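(* Let $\nu\ge1$ and fix $0<\varrho_0\le\frac14<\frac12\le\varrho_1<1$. Let $$\mathscr{C}:=\big\{\mathbf{1}_S: S\in\mathrm{STAR}^2(\nu;\varrho_0,\varrho_1)\big\},$$ considered as a subset of $\mathbb{X}=L^2(\mathbb{R}^2)$. Then the power-exponential Minkowski dimension of $\mathscr{C}$ exists and $\dim_{\mathrm{M},\exp}(\mathscr{C})=1$, and there exists a Borel probability measure on $\mathbb{X}$ that is critical for $\mathscr{C}$. Moreover, there exist a cone-adapted shearlet system, an enumeration $\mathcal{G}=(g_n)_{n\in\mathbb{N}}$ of this system, and a polynomial $P$ such that the family $(\mathcal{A}_n)_{n\in\mathbb{N}}=(\Sigma_n(\mathcal{G},P))_{n\in\mathbb{N}}$ is optimal for $\mathscr{C}$ in the class of families of controlled complexity in $L^2(\mathbb{R}^2)$. In particular, the following phase transition occurs. For every $0\le t<1$ there is $C(t)>0$ with $\sup_{f\in\mathscr{C}}\operatorname{dist}(f,\Sigma_n(\mathcal{G},P))\le C(t)n^{-t}$ for all $n\in\mathbb{N}$. Conversely, for every Borel probability measure $\mu$ on $L^2(\mathbb{R}^2)$ that is critical for $\mathscr{C}$ and every family $(\mathcal{B}_n)_{n\in\mathbb{N}}$ of controlled complexity in $L^2(\mathbb{R}^2)$, $$\mu^{\ast}\Big(\bigcup_{t>1}\big\{f\in\mathscr{C}:\sup_{n\in\mathbb{N}}\,n^t\operatorname{dist}(f,\mathcal{B}_n)<\infty\big\}\Big)=0.$$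
   Context: Star-shaped sets. $C^2_{2\pi}(\mathbb{R})$ is the set of $2\pi$-periodic $C^2$ functions $\mathbb{R}\to\mathbb{R}$. For non-negative $\varrho\in C^2_{2\pi}(\mathbb{R})$ put $S_\varrho:=\{r(\cos\phi,\sin\phi)^T:\phi\in[0,2\pi],\,0\le r\le\varrho(\phi)\}\subseteq\mathbb{R}^2$. $\mathrm{STAR}^2(\nu;\varrho_0,\varrho_1)$ is the set of all $x_0+S_\varrho$ with $x_0\in\mathbb{R}^2$, $\varrho\in C^2_{2\pi}(\mathbb{R})$, $\|\varrho''\|_{L^\infty}\le\nu$, $\varrho_0\le\varrho\le\varrho_1$ and $x_0+S_\varrho\subseteq[0,1]^2$. Cone-adapted shearlet system. For generators $\varphi,\psi\in L^2(\mathbb{R}^2)$ and a sampling density $\delta>0$, it consists of the functions $\varphi(\cdot-\delta k)$, $k\in\mathbb{Z}^2$, together with $x\mapsto 2^{3j/4}\,\psi\big(S_m D_j R^{\iota}x-\delta k\big)$ for $j\in\mathbb{N}_0$, $m\in\mathbb{Z}$ with $|m|\le\lceil2^{j/2}\rceil$, $\iota\in\{0,1\}$, $k\in\mathbb{Z}^2$, where $D_j=\operatorname{diag}(2^j,2^{j/2})$, $S_m=\begin{pmatrix}1&m\\0&1\end{pmatrix}$, $R=\begin{pmatrix}0&1\\1&0\end{pmatrix}$. Non-linear approximation sets. $\Sigma_n(\mathcal{G},P)$ is the union of $\operatorname{span}\{g_k:k\in I_0\}$ over all $I_0\subseteq\{k\in\mathbb{N}:k\le P(n)\}$ with $\#I_0\le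 n$ ($\operatorname{span}\emptyset=\{0\}$). General notions in a (quasi-)metric space $(\mathbb{X},d)$. $B(x,r)=\{y:d(x,y)\le r\}$; $\operatorname{dist}(x,\mathcal{A})=\inf_{a\in\mathcal{A}}d(x,a)$. $\mathcal{N}(S,\varepsilon)$ is the least number of closed $\varepsilon$-balls with centers in $S$ covering $S\ne\emptyset$ ($\infty$ if there is no finite one); $\mathcal{N}(\emptyset,\varepsilon)=0$. For totally bounded $\mathscr{C}$ with at least two elements, $\underline{\dim}_{\mathrm{M},\exp}(\mathscr{C})$ and $\overline{\dim}_{\mathrm{M},\exp}(\mathscr{C})$ are the $\liminf$ and $\limsup$ as $\varepsilon\downarrow0$ of $\frac{\log_2\log_2\mathcal{N}(\mathscr{C},\varepsilon)}{\log_2(1/\varepsilon)}$ (both are $\infty$ if $\mathscr{C}$ is not totally bounded). If they coincide, the power-exponential Minkowski dimension $\dim_{\mathrm{M},\exp}(\mathscr{C})$ is said to exist and is the common value. For a measure $\mu$, $\mu^{\ast}(M)=\inf\{\mu(A):A\supseteq M\text{ measurable}\}$. $\mu$ is critical for $\mathscr{C}$ if $\mu^{\ast}(\mathscr{C})>0$ and for every $0<s<\underline{\dim}_{\mathrm{M},\exp}(\mathscr{C})$ there are $c,r_0>0$ with $\mu^{\ast}(B(x,\rho))\le\exp(-c(1/\rho)^s)$ for all $x\in\mathbb{X}$, $0<\rho<r_0$. A family $(\mathcal{A}_n)_{n\in\mathbb{N}}$ of sets $\emptyset\ne\mathcal{A}_n\subseteq\mathbb{X}$ is of controlled complexity in $\mathbb{X}$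 if for every $a>0$, $x\in\mathbb{X}$, $R>0$ there are $n_0\in\mathbb{N}$ and $\eta:\mathbb{N}\to[0,\infty)$ with $\sup_n\eta(n)/n^{1+\delta}<\infty$ for every $\delta>0$ and $\mathcal{N}(B(x,R)\cap\mathcal{A}_n,n^{-a})\le\exp(\eta(n))$ for all $n\ge n_0$. For bounded $\mathscr{C}\ne\emptyset$, a family $(\mathcal{A}_n)$ of controlled complexity is optimal for $\mathscr{C}$ in the class of families of controlled complexity in $\mathbb{X}$ if for every $0\le t<(\overline{\dim}_{\mathrm{M},\exp}(\mathscr{C}))^{-1}$ there is $C(t)>0$ with $\sup_{x\in\mathscr{C}}\operatorname{dist}(x,\mathcal{A}_n)\le C(t)n^{-t}$ for all $n\in\mathbb{N}$. *)

theory Defs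
  imports
    "HOL-Probability.Probability_Measure"
    "HOL-Computational_Algebra.Polynomial"
begin

section \<open>The complex Hilbert space of square-integrable functions on the plane\<close>

definition square_integrable :: "(real^2 \<Rightarrow> complex) \<Rightarrow> bool" where
  "square_integrable f \<longleftrightarrow>
     f \<in> borel_measurable lborel \<and> integrable lborel (\<lambda>x. (norm (f x))\<^sup>2)"

definition l2_rel :: "(real^2 \<Rightarrow> complex) \<Rightarrow> (real^2 \<Rightarrow> complex) \<Rightarrow> bool" where
  "l2_rel f g \<longleftrightarrow>
     square_integrable f \<and> square_integrable g \<and> (AE x in lborel. f x = g x)"

lemma square_integrable_zero [simp]: "square_integrable (\<lambda>x. 0)"
  by (simp add: square_integrable_def)

lemma square_integrable_add:
  assumes "square_integrable f" "square_integrable g"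
  shows "square_integrable (\<lambda>x. f x + g x)"
proof -
  have [measurable]: "f \<in> borel_measurable lborel" "g \<in> borel_measurable lborel"
    using assms by (auto simp: square_integrable_def)
  have "integrable lborel (\<lambda>x. 2 * (norm (f x))\<^sup>2 + 2 * (norm (g x))\<^sup>2)"
    using assms by (auto simp: square_integrable_def)
  moreover have "(norm (f x + g x))\<^sup>2 \<le> 2 * (norm (f x))\<^sup>2 + 2 * (norm (g x))\<^sup>2" for x
  proof -
    have "(norm (f x + g x))\<^sup>2 \<le> (norm (f x) + norm (g x))\<^sup>2"
      by (intro power_mono norm_triangle_ineq) auto
    also have "\<dots> \<le> 2 * (norm (f x))\<^sup>2 + 2 * (norm (g x))\<^sup>2"
      using zero_le_power2[of "norm (f x) - norm (g x)"]
      by (simp add: power2_eq_square algebra_simps)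
    finally show ?thesis .
  qed
  ultimately have "integrable lborel (\<lambda>x. (norm (f x + g x))\<^sup>2)"
    by (intro Bochner_Integration.integrable_bound[where g = "\<lambda>x. (norm (f x + g x))\<^sup>2"])
      (auto intro!: AE_I2 intro: order_trans[OF _ abs_ge_self])
  then show ?thesis
    by (simp add: square_integrable_def)
qed

lemma square_integrable_cmult:
  assumes "square_integrable f"
  shows "square_integrable (\<lambda>x. c * f x)"
  using assms by (auto simp: square_integrable_def norm_mult power_mult_distrib)

lemma integrable_inner_square_integrable:
  assumes "square_integrable f" "square_integrable g"
  shows "integrable lborel (\<lambda>x. f x \<bullet> g x)"
proof -
  have [measurable]: "f \<in> borel_measurable lborel" "g \<in> borel_measurable lborel"
    using assms by (auto simp: square_integrable_def)
  have "integrable lborel (\<lambda>x. (norm (f x))\<^sup>2 + (norm (g x))\<^sup>2)"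
    using assms by (auto simp: square_integrable_def)
  moreover have "\<bar>f x \<bullet> g x\<bar> \<le> (norm (f x))\<^sup>2 + (norm (g x))\<^sup>2" for x
  proof -
    have "\<bar>f x \<bullet> g x\<bar> \<le> norm (f x) * norm (g x)"
      by (rule Cauchy_Schwarz_ineq2)
    also have "\<dots> \<le> (norm (f x))\<^sup>2 + (norm (g x))\<^sup>2"
      using zero_le_power2[of "norm (f x) - norm (g x)"]
        zero_le_power2[of "norm (f x)"] zero_le_power2[of "norm (g x)"]
      unfolding power2_diff by linarith
    finally show ?thesis .
  qed
  ultimately show ?thesis
    by (intro Bochner_Integration.integrable_bound[where g = "\<lambda>x. f x \<bullet> g x"])
      (auto intro!: AE_I2 intro: order_trans[OF _ abs_ge_self])
qed

text \<open>The relation is partial, so \<open>l2_of f\<close> is meaningful only if \<open>f\<close> is square integrable.\<close>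

quotient_type l2 = "real^2 \<Rightarrow> complex" / partial: l2_rel
  morphisms rep_l2 l2_of
proof (rule part_equivpI)
  show "\<exists>f. l2_rel f f"
    by (rule exI[of _ "\<lambda>x. 0"]) (simp add: l2_rel_def)
  show "symp l2_rel"
    by (auto simp: symp_def l2_rel_def)
  show "transp l2_rel"
  proof (rule transpI)
    fix f g h
    assume fg: "l2_rel f g" and gh: "l2_rel g h"
    then have "AE x in lborel. f x = g x" "AE x in lborel. g x = h x"
      by (simp_all add: l2_rel_def)
    then have "AE x in lborel. f x = h x"
      by eventually_elim simp
    with fg gh show "l2_rel f h"
      by (simp add: l2_rel_def)
  qed
qed

lift_definition l2_cscale :: "complex \<Rightarrow> l2 \<Rightarrow> l2" is "\<lambda>c f x. c * f x"
  by (auto simp: l2_rel_def intro: square_integrable_cmult)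

instantiation l2 :: real_vector
begin

lift_definition zero_l2 :: l2 is "\<lambda>x. 0"
  by (simp add: l2_rel_def)

lift_definition plus_l2 :: "l2 \<Rightarrow> l2 \<Rightarrow> l2" is "\<lambda>f g x. f x + g x"
  by (auto simp: l2_rel_def intro: square_integrable_add)

lift_definition uminus_l2 :: "l2 \<Rightarrow> l2" is "\<lambda>f x. - f x"
  by (auto simp: l2_rel_def square_integrable_def)

definition minus_l2 :: "l2 \<Rightarrow> l2 \<Rightarrow> l2" where
  "minus_l2 f g = f + (- g)"

definition scaleR_l2 :: "real \<Rightarrow> l2 \<Rightarrow> l2" where
  "scaleR_l2 r f = l2_cscale (complex_of_real r) f"

instance
proof
  fix f g h :: l2 and a b :: real
  show "f + g + h = f + (g + h)"
    by transfer (auto simp: l2_rel_def add.assoc intro!: square_integrable_add)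
  show "f + g = g + f"
    by transfer (auto simp: l2_rel_def add.commute intro!: square_integrable_add)
  show "0 + f = f"
    by transfer (auto simp: l2_rel_def)
  show "- f + f = 0"
    by transfer (auto simp: l2_rel_def)
  show "f - g = f + - g"
    by (simp add: minus_l2_def)
  show "a *\<^sub>R (f + g) = a *\<^sub>R f + a *\<^sub>R g"
    unfolding scaleR_l2_def
    by transfer (auto simp: l2_rel_def distrib_left
        intro!: square_integrable_add square_integrable_cmult)
  show "(a + b) *\<^sub>R f = a *\<^sub>R f + b *\<^sub>R f"
    unfolding scaleR_l2_def of_real_add
    by transfer (auto simp: l2_rel_def distrib_right
        intro!: square_integrable_add square_integrable_cmult)
  show "a *\<^sub>R b *\<^sub>R f = (a * b) *\<^sub>R f"
    unfolding scaleR_l2_def of_real_mult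
    by transfer (auto simp: l2_rel_def mult.assoc intro!: square_integrable_cmult)
  show "1 *\<^sub>R f = f"
    unfolding scaleR_l2_def of_real_1 by transfer (auto simp: l2_rel_def)
qed

end

instantiation l2 :: real_inner
begin

text \<open>The inner product on \<open>complex\<close> is the real part of the Hermitian one, so this is the real
  part of the usual inner product; it induces the usual norm.\<close>

lift_definition inner_l2 :: "l2 \<Rightarrow> l2 \<Rightarrow> real" is "\<lambda>f g. LINT x|lborel. f x \<bullet> g x"
proof -
  fix f f' g g' :: "real^2 \<Rightarrow> complex"
  assume "l2_rel f f'" "l2_rel g g'"
  then have [measurable]: "f \<in> borel_measurable lborel" "g \<in> borel_measurable lborel"
      "f' \<in> borel_measurable lborel" "g' \<in> borel_measurable lborel"
    and "AE x in lborel. f x \<bullet> g x = f' x \<bullet> g' x"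
    by (auto simp: l2_rel_def square_integrable_def)
  then show "(LINT x|lborel. f x \<bullet> g x) = (LINT x|lborel. f' x \<bullet> g' x)"
    by (intro integral_cong_AE) auto
qed

definition norm_l2 :: "l2 \<Rightarrow> real" where
  "norm_l2 f = sqrt (f \<bullet> f)"

definition sgn_l2 :: "l2 \<Rightarrow> l2" where
  "sgn_l2 f = f /\<^sub>R norm f"

definition dist_l2 :: "l2 \<Rightarrow> l2 \<Rightarrow> real" where
  "dist_l2 f g = norm (f - g)"

definition uniformity_l2 :: "(l2 \<times> l2) filter" where
  "uniformity_l2 = (INF e\<in>{0<..}. principal {(x, y). dist x y < e})"

definition open_l2 :: "l2 set \<Rightarrow> bool" where
  "open_l2 U \<longleftrightarrow> (\<forall>x\<in>U. eventually (\<lambda>(x', y). x' = x \<longrightarrow> y \<in> U) uniformity)"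

instance
proof
  fix f g h :: l2 and a :: real
  show "sgn f = f /\<^sub>R norm f"
    by (rule sgn_l2_def)
  show "dist f g = norm (f - g)"
    by (rule dist_l2_def)
  show "uniformity = (INF e\<in>{0<..}. principal {(x, y :: l2). dist x y < e})"
    by (rule uniformity_l2_def)
  show "open U \<longleftrightarrow> (\<forall>x\<in>U. eventually (\<lambda>(x', y). x' = x \<longrightarrow> y \<in> U) uniformity)"
    for U :: "l2 set"
    by (rule open_l2_def)
  show "f \<bullet> g = g \<bullet> f"
    by transfer (simp add: inner_commute)
  show "(f + g) \<bullet> h = f \<bullet> h + g \<bullet> h"
    by transfer
      (auto simp: l2_rel_def inner_add_left integrable_inner_square_integrable)
  show "a *\<^sub>R f \<bullet> g = a * (f \<bullet> g)"
    unfolding scaleR_l2_def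
    by transfer (auto simp: scaleR_conv_of_real[symmetric])
  show "0 \<le> f \<bullet> f"
    by transfer simp
  show "f \<bullet> f = 0 \<longleftrightarrow> f = 0"
  proof transfer
    fix f :: "real^2 \<Rightarrow> complex"
    assume "l2_rel f f"
    then have f: "square_integrable f"
      by (simp add: l2_rel_def)
    have "(LINT x|lborel. f x \<bullet> f x) = 0 \<longleftrightarrow> (AE x in lborel. f x \<bullet> f x = 0)"
      by (rule integral_nonneg_eq_0_iff_AE)
        (use f in \<open>auto intro: integrable_inner_square_integrable\<close>)
    then show "(LINT x|lborel. f x \<bullet> f x) = 0 \<longleftrightarrow> l2_rel f (\<lambda>x. 0)"
      using f by (simp add: l2_rel_def)
  qed
  show "norm f = sqrt (f \<bullet> f)"
    by (rule norm_l2_def)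
qed

end

lemma norm_l2_of:
  assumes "square_integrable f"
  shows "norm (l2_of f) = sqrt (LINT x|lborel. (norm (f x))\<^sup>2)"
proof -
  have "l2_rel f f"
    using assms by (simp add: l2_rel_def)
  then have "l2_of f \<bullet> l2_of f = (LINT x|lborel. f x \<bullet> f x)"
    by (simp add: inner_l2.abs_eq)
  then show ?thesis
    by (simp add: norm_l2_def power2_norm_eq_inner)
qed

global_interpretation l2: vector_space l2_cscale
proof
  fix f g :: l2 and a b :: complex
  show "l2_cscale a (f + g) = l2_cscale a f + l2_cscale a g"
    by transfer (auto simp: l2_rel_def distrib_left
        intro!: square_integrable_add square_integrable_cmult)
  show "l2_cscale (a + b) f = l2_cscale a f + l2_cscale b f"
    by transfer (auto simp: l2_rel_def distrib_right
        intro!: square_integrable_add square_integrable_cmult)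
  show "l2_cscale a (l2_cscale b f) = l2_cscale (a * b) f"
    by transfer (auto simp: l2_rel_def mult.assoc intro!: square_integrable_cmult)
  show "l2_cscale 1 f = f"
    by transfer (auto simp: l2_rel_def)
qed


section \<open>Power-exponential Minkowski dimension\<close>

text \<open>The infimum of the empty set of extended naturals is \<open>\<infinity>\<close>.\<close>

definition covering_number :: "'a::metric_space set \<Rightarrow> real \<Rightarrow> enat" where
  "covering_number S \<epsilon> =
     (INF T \<in> {T. finite T \<and> T \<subseteq> S \<and> S \<subseteq> (\<Union>x\<in>T. cball x \<epsilon>)}. enat (card T))"

text \<open>Only limits at \<open>0\<close> for totally bounded sets with at least two elements matter; there the
  covering number is finite and eventually at least \<open>2\<close>, so neither \<open>the_enat \<infinity>\<close> nor \<open>log 2 0\<close>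
  occurs. A set with at most one element gets the dimension \<open>0\<close>.\<close>

definition pe_quotient :: "'a::metric_space set \<Rightarrow> real \<Rightarrow> ereal" where
  "pe_quotient C \<epsilon> =
     ereal (log 2 (log 2 (real (the_enat (covering_number C \<epsilon>)))) / log 2 (1 / \<epsilon>))"

definition lower_pe_dim :: "'a::metric_space set \<Rightarrow> ereal" where
  "lower_pe_dim C =
     (if totally_bounded C then Liminf (at_right 0) (pe_quotient C) else \<infinity>)"

definition upper_pe_dim :: "'a::metric_space set \<Rightarrow> ereal" where
  "upper_pe_dim C =
     (if totally_bounded C then Limsup (at_right 0) (pe_quotient C) else \<infinity>)"

text \<open>The dimension exists and equals \<open>d\<close>.\<close>

definition has_pe_dim :: "'a::metric_space set \<Rightarrow> ereal \<Rightarrow> bool" where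
  "has_pe_dim C d \<longleftrightarrow> lower_pe_dim C = d \<and> upper_pe_dim C = d"


section \<open>Critical measures\<close>

definition borel_prob_measure :: "'a::topological_space measure \<Rightarrow> bool" where
  "borel_prob_measure \<mu> \<longleftrightarrow> prob_space \<mu> \<and> sets \<mu> = sets borel"

definition critical_measure :: "'a::metric_space measure \<Rightarrow> 'a set \<Rightarrow> bool" where
  "critical_measure \<mu> C \<longleftrightarrow>
     outer_measure_of \<mu> C > 0 \<and>
     (\<forall>s::real. 0 < s \<and> ereal s < lower_pe_dim C \<longrightarrow>
        (\<exists>c>0. \<exists>r\<^sub>0>0. \<forall>x. \<forall>\<rho>::real. 0 < \<rho> \<and> \<rho> < r\<^sub>0 \<longrightarrow>
           outer_measure_of \<mu> (cball x \<rho>) \<le> ennreal (exp (- c * (1 / \<rho>) powr s))))"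


section \<open>Families of controlled complexity\<close>

text \<open>Families indexed by the positive integers are functions on \<open>nat\<close> whose value at \<open>0\<close> is
  never used.\<close>

definition controlled_complexity :: "(nat \<Rightarrow> 'a::metric_space set) \<Rightarrow> bool" where
  "controlled_complexity A \<longleftrightarrow>
     (\<forall>n\<ge>1. A n \<noteq> {}) \<and>
     (\<forall>a::real. \<forall>x. \<forall>R::real. a > 0 \<and> R > 0 \<longrightarrow>
        (\<exists>n\<^sub>0\<ge>1. \<exists>\<eta>::nat \<Rightarrow> real. (\<forall>n. \<eta> n \<ge> 0) \<and>
           (\<forall>\<delta>>0. bdd_above ((\<lambda>n. \<eta> n / real n powr (1 + \<delta>)) ` {1..})) \<and>
           (\<forall>n\<ge>n\<^sub>0. ereal_of_enat (covering_number (cball x R \<inter> A n) (real n powr - a))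
                     \<le> ereal (exp (\<eta> n)))))"

definition optimal_controlled :: "(nat \<Rightarrow> 'a::metric_space set) \<Rightarrow> 'a set \<Rightarrow> bool" where
  "optimal_controlled A C \<longleftrightarrow>
     bounded C \<and> C \<noteq> {} \<and> controlled_complexity A \<and>
     (\<forall>t::real. 0 \<le> t \<and> ereal t < inverse (upper_pe_dim C) \<longrightarrow>
        (\<exists>K>0. \<forall>n\<ge>1. \<forall>x\<in>C. infdist x (A n) \<le> K * real n powr - t))"


section \<open>Star-shaped sets\<close>

text \<open>\<open>f C1_differentiable_on UNIV\<close> includes the continuity of the derivative.\<close>

definition C2_2pi :: "(real \<Rightarrow> real) set" where
  "C2_2pi = {\<rho>. (\<forall>x. \<rho> (x + 2 * pi) = \<rho> x) \<and>
     \<rho> C1_differentiable_on UNIV \<and> deriv \<rho> C1_differentiable_on UNIV}"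

definition star_region :: "(real \<Rightarrow> real) \<Rightarrow> (real^2) set" where
  "star_region \<rho> =
     {r *\<^sub>R vector [cos \<phi>, sin \<phi>] | r \<phi>. \<phi> \<in> {0..2 * pi} \<and> 0 \<le> r \<and> r \<le> \<rho> \<phi>}"

definition STAR :: "real \<Rightarrow> real \<Rightarrow> real \<Rightarrow> (real^2) set set" where
  "STAR \<nu> \<rho>\<^sub>0 \<rho>\<^sub>1 =
     {(+) x\<^sub>0 ` star_region \<rho> | x\<^sub>0 \<rho>.
        \<rho> \<in> C2_2pi \<and> (\<forall>\<phi>. 0 \<le> \<rho> \<phi>) \<and>
        (AE \<phi> in lborel. \<bar>deriv (deriv \<rho>) \<phi>\<bar> \<le> \<nu>) \<and>
        (\<forall>\<phi>. \<rho>\<^sub>0 \<le> \<rho> \<phi> \<and> \<rho> \<phi> \<le> \<rho>\<^sub>1) \<and>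
        (+) x\<^sub>0 ` star_region \<rho> \<subseteq> {x. \<forall>i. 0 \<le> x $ i \<and> x $ i \<le> 1}}"

definition star_indicators :: "real \<Rightarrow> real \<Rightarrow> real \<Rightarrow> l2 set" where
  "star_indicators \<nu> \<rho>\<^sub>0 \<rho>\<^sub>1 = (\<lambda>S. l2_of (indicator S)) ` STAR \<nu> \<rho>\<^sub>0 \<rho>\<^sub>1"


section \<open>Cone-adapted shearlet systems\<close>

definition int_vec :: "int^2 \<Rightarrow> real^2" where
  "int_vec k = (\<chi> i. of_int (k $ i))"

definition shear_matrix :: "int \<Rightarrow> real^2^2" where
  "shear_matrix m = vector [vector [1, of_int m], vector [0, 1]]"

definition dilation_matrix :: "nat \<Rightarrow> real^2^2" where
  "dilation_matrix j = vector [vector [2 ^ j, 0], vector [0, 2 powr (real j / 2)]]"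

definition swap_matrix :: "real^2^2" where
  "swap_matrix = vector [vector [0, 1], vector [1, 0]]"

text \<open>Powers of the swap are powers of the map it induces, because \<open>^\<close> on \<open>real^2^2\<close> is the
  entrywise power.\<close>

definition shearlet ::
  "(real^2 \<Rightarrow> complex) \<Rightarrow> real \<Rightarrow> nat \<Rightarrow> int \<Rightarrow> nat \<Rightarrow> int^2 \<Rightarrow> real^2 \<Rightarrow> complex" where
  "shearlet \<psi> \<delta> j m \<iota> k x =
     complex_of_real (2 powr (3 * real j / 4)) *
     \<psi> (shear_matrix m *v (dilation_matrix j *v (((*v) swap_matrix ^^ \<iota>) x)) - \<delta> *\<^sub>R int_vec k)"

definition shearlet_system ::
  "(real^2 \<Rightarrow> complex) \<Rightarrow> (real^2 \<Rightarrow> complex) \<Rightarrow> real \<Rightarrow> l2 set" where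
  "shearlet_system \<phi> \<psi> \<delta> =
     {l2_of (\<lambda>x. \<phi> (x - \<delta> *\<^sub>R int_vec k)) | k. True} \<union>
     {l2_of (shearlet \<psi> \<delta> j m \<iota> k) | j m \<iota> k.
        \<bar>m\<bar> \<le> \<lceil>2 powr (real j / 2)\<rceil> \<and> \<iota> \<in> {0, 1}}"


section \<open>Non-linear approximation sets\<close>

definition nonlinear_approx :: "(nat \<Rightarrow> l2) \<Rightarrow> real poly \<Rightarrow> nat \<Rightarrow> l2 set" where
  "nonlinear_approx g P n =
     (\<Union>I \<in> {I. I \<subseteq> {k. 1 \<le> k \<and> real k \<le> poly P (real n)} \<and> card I \<le> n}. l2.span (g ` I))"

end

theory Submission
  imports Defs "HOL-Probability.Probability"
begin

text \<open>Both generators of the shearlet system are one compactly supported, piecewise quadratic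
  function \<open>\<kappa>(x\<^sub>1) \<kappa>(x\<^sub>2)\<close>, where \<open>\<kappa>\<close> is the cardinal function of quadratic interpolation on the
  integers. At scale \<open>2 ^ -l\<close> the boundary of a star-shaped set is replaced, in the squares of a grid,
  by its tangent lines, with a smooth transition across a strip of width \<open>4 ^ -l\<close>. The difference
  of two consecutive scales is a sum of \<open>O(2 ^ l)\<close> pieces, each a smooth function of an affine
  coordinate at scale \<open>4 ^ -l\<close> times a smooth function at scale \<open>2 ^ -l\<close>. Interpolating a piece on
  the sheared grid of level \<open>l + s\<close> takes \<open>O(8 ^ s)\<close> shearlets and has error \<open>O(8 ^ -s)\<close>, because
  the interpolation is exact on quadratic polynomials. With \<open>8 ^ s \<approx> 2 ^ (I - l)\<close> a total of
  \<open>O(I 2 ^ I)\<close> shearlets yields the \<open>L\<^sup>2\<close> error \<open>O(I 2 ^ -I)\<close>, hence all rates below \<open>1\<close>.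

  The spans of at most \<open>n\<close> elements out of polynomially many have metric entropy \<open>O(n log n)\<close>, so
  that the dimension is at most \<open>1\<close>. The critical measure is the law of a star whose radius is a
  constant plus a series of \<open>4 ^ -i\<close>-small ripples, one for each of \<open>2 ^ i\<close> sectors, switched on
  by independent fair bits. Given the bits of all other levels, two stars in one ball of a radius
  slightly below \<open>2 ^ -i\<close> differ in at most a sixteenth of the bits of level \<open>i\<close>; counting Hamming
  balls bounds the measure of the ball by \<open>exp (- 2 ^ i / 16)\<close>. This gives the lower bound for the
  dimension, and a union bound over coverings gives the converse.\<close>

section \<open>Splines and quadratic interpolation\<close>

text \<open>The exponents come from a budget. At scale \<open>2 ^ -l\<close> the errors of about
  \<open>2 ^ l\<close> pieces live in strips of area of order \<open>8 ^ -l\<close>, so a uniform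
  error \<open>8 ^ -s\<close> amounts to \<open>8 ^ -s * 2 ^ -l\<close> in the mean. Keeping
  \<open>8 ^ s * 2 ^ l\<close> constant makes both the error and the cost equal at all scales; the
  number of scales is the only loss. The cost is cubic in \<open>T = 2 ^ s\<close> because parabolic
  refinement puts \<open>T^2\<close> grid points across a strip and \<open>T\<close> along it. The
  generators may be chosen freely, and a spline makes the coefficients point values of the piece.
  The obstacle is alignment: the grid must follow the boundary with slope error of order
  \<open>1 / N\<close> in squares of side of order \<open>1 / N\<close>, and the tangents of
  neighbouring squares differ by just this amount. For the lower bound, \<open>4 ^ -i\<close> is the
  largest ripple that a bounded second derivative permits in a sector of width
  \<open>2 ^ -i\<close>. One bit then moves an area of order \<open>8 ^ -i\<close>, a fixed share of
  \<open>2 ^ i\<close> bits an area \<open>4 ^ -i\<close>. Summability over the levels costs a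
  factor of order \<open>i^2\<close>, invisible in the exponent.\<close>

definition tcube :: "real \<Rightarrow> real" where
  "tcube t = (max 0 t) ^ 3"

text \<open>The truncated cube has second derivative \<open>6 * max 0 t\<close>, which is Lipschitz
  with constant 6, so the cubic remainder is bounded even across the kink at 0. The sign patterns of
  \<open>t\<close> and \<open>t + d\<close> replace the calculus.\<close>

lemma tcube_taylor:
  "\<bar>tcube (t + d) - tcube t - 3 * (max 0 t)^2 * d - 3 * max 0 t * d^2\<bar> \<le> \<bar>d\<bar>^3"
proof -
  consider "t \<ge> 0" "t + d \<ge> 0" | "t \<ge> 0" "t + d < 0" | "t < 0" "t + d < 0" | "t < 0" "t + d \<ge> 0"
    by linarith
  then show ?thesis
  proof cases
    case 1
    then have "tcube (t + d) - tcube t - 3 * (max 0 t)^2 * d - 3 * max 0 t * d^2 = d^3"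
      by (simp add: tcube_def max_def power2_eq_square power3_eq_cube algebra_simps)
    then show ?thesis by (simp add: power_abs)
  next
    case 2
    then have eq: "tcube (t + d) - tcube t - 3 * (max 0 t)^2 * d - 3 * max 0 t * d^2
        = (- (t + d))^3 - (- d)^3"
      by (simp add: tcube_def max_def power2_eq_square power3_eq_cube algebra_simps)
    have "0 \<le> (- (t + d))^3" by (rule zero_le_power) (use 2 in linarith)
    moreover have "(- (t + d))^3 \<le> (- d)^3" by (rule power_mono) (use 2 in linarith)+
    moreover have "\<bar>d\<bar> = - d" using 2 by linarith
    ultimately have "0 \<le> (- (t + d))^3" "(- (t + d))^3 \<le> (- d)^3" "\<bar>d\<bar> = - d" by blast+
    then show ?thesis unfolding eq by simp
  next
    case 3
    then show ?thesis by (simp add: tcube_def max_def)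
  next
    case 4
    then have eq: "tcube (t + d) - tcube t - 3 * (max 0 t)^2 * d - 3 * max 0 t * d^2 = (t + d)^3"
      by (simp add: tcube_def max_def)
    have "0 \<le> (t + d)^3" "(t + d)^3 \<le> d^3" "\<bar>d\<bar> = d"
      using 4 by (auto intro!: power_mono zero_le_power)
    then show ?thesis unfolding eq by simp
  qed
qed

text \<open>One minus the antiderivative of the quadratic B-spline with knots 0, 1, 2, 3, compressed
  to the unit interval: a twice continuously differentiable descent from 1 to 0, written as a third
  difference of truncated cubes.\<close>

definition smooth_step :: "real \<Rightarrow> real" where
  "smooth_step t =
     1 - (tcube (3*t) - 3 * tcube (3*t - 1) + 3 * tcube (3*t - 2) - tcube (3*t - 3)) / 6"

lemma smooth_step_le0: "t \<le> 0 \<Longrightarrow> smooth_step t = 1"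
  by (simp add: smooth_step_def tcube_def max_def)

lemma smooth_step_ge1: "t \<ge> 1 \<Longrightarrow> smooth_step t = 0"
  by (simp add: smooth_step_def tcube_def max_def power3_eq_cube algebra_simps)

lemma smooth_step_bound: "\<bar>smooth_step t\<bar> \<le> 100"
proof -
  consider "t \<le> 0" | "t \<ge> 1" | "0 < t" "t < 1" by linarith
  then show ?thesis
  proof cases
    case 3
    have c: "0 \<le> tcube (3*t-x)" "tcube (3*t-x) \<le> 27" if "x \<ge> 0" for x
      using power_mono[of "max 0 (3*t-x)" 3 3] that 3 unfolding tcube_def by simp_all
    show ?thesis
      using c[of 0, unfolded diff_zero, OF order_refl] c[OF zero_le_one] c[of 2] c[of 3]
      unfolding smooth_step_def abs_le_iff by (intro conjI) (simp_all add: field_simps)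
  qed (simp_all add: smooth_step_le0 smooth_step_ge1)
qed

lemma third_difference_bound:
  assumes "0 \<le> A" "A \<le> r" "0 \<le> B" "B \<le> r" "0 \<le> C" "C \<le> r" "0 \<le> D" "D \<le> (r::real)"
  shows "\<bar>A - 3 * B + 3 * C - D\<bar> \<le> 4 * r"
  using assms by (intro abs_leI) linarith+

text \<open>The coefficients are the same third difference applied to the Taylor coefficients of
  \<open>tcube\<close>; the inner scaling by 3 turns up in 3/2 and 9/2. For \<open>t \<le> 0\<close>
  every term is zero, and for \<open>t \<ge> 1\<close> a third difference of a polynomial of degree
  at most two vanishes. The value 100 is one generous bound for everything.\<close>

lemma smooth_step_taylor:
  "\<exists>a b. \<bar>a\<bar> \<le> 100 \<and> \<bar>b\<bar> \<le> 100 \<and>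
     (\<forall>d. \<bar>smooth_step (t + d) - smooth_step t - a * d - b * d^2\<bar> \<le> 100 * \<bar>d\<bar>^3)"
proof -
  define m where "m x = max 0 (x::real)" for x
  define a where "a = - (3/2) * ((m (3*t))^2 - 3 * (m (3*t-1))^2 + 3 * (m (3*t-2))^2 - (m (3*t-3))^2)"
  define b where "b = - (9/2) * (m (3*t) - 3 * m (3*t-1) + 3 * m (3*t-2) - m (3*t-3))"
  have ab: "\<bar>a\<bar> \<le> 100 \<and> \<bar>b\<bar> \<le> 100"
  proof -
    consider "t \<le> 0" | "t \<ge> 1" | "0 < t" "t < 1" by linarith
    then show ?thesis
    proof cases
      case 1
      then have "a = 0" "b = 0" by (simp_all add: a_def b_def m_def)
      then show ?thesis by simp
    next
      case 2
      then have "a = 0" "b = 0"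
        by (simp_all add: a_def b_def m_def max_def power2_eq_square algebra_simps)
      then show ?thesis by simp
    next
      case 3
      have sq: "0 \<le> (m (3*t-x))^2" "(m (3*t-x))^2 \<le> 9" "0 \<le> m (3*t-x)" "m (3*t-x) \<le> 3" if "x \<ge> 0" for x
        using power_mono[of "max 0 (3*t-x)" 3 2] that 3 unfolding m_def by simp_all
      note sq' = sq[of 0, unfolded diff_zero, OF order_refl] sq[OF zero_le_one]
          sq[OF zero_le_numeral, of "num.Bit0 num.One"] sq[OF zero_le_numeral, of "num.Bit1 num.One"]
      have "\<bar>(m (3*t))^2 - 3 * (m (3*t-1))^2 + 3 * (m (3*t-2))^2 - (m (3*t-3))^2\<bar> \<le> 4 * 9"
        by (intro third_difference_bound sq')
      moreover have "\<bar>m (3*t) - 3 * m (3*t-1) + 3 * m (3*t-2) - m (3*t-3)\<bar> \<le> 4 * 3"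
        by (intro third_difference_bound sq')
      ultimately show ?thesis unfolding a_def b_def abs_mult by simp
    qed
  qed
  have "\<bar>smooth_step (t + d) - smooth_step t - a * d - b * d^2\<bar> \<le> 100 * \<bar>d\<bar>^3" for d
  proof -
    define r where "r x = tcube (x + 3*d) - tcube x - 3 * (m x)^2 * (3*d) - 3 * m x * (3*d)^2" for x
    have r: "\<bar>r x\<bar> \<le> 27 * \<bar>d\<bar>^3" for x
      using tcube_taylor[of x "3*d"] unfolding r_def m_def by (simp add: abs_mult power_mult_distrib)
    have e: "3 * (t + d) = 3*t + 3*d" "3 * (t + d) - c = (3*t - c) + 3*d" for c by auto
    have "smooth_step (t + d) - smooth_step t - a * d - b * d^2
       = - (r (3*t) - 3 * r (3*t-1) + 3 * r (3*t-2) - r (3*t-3)) / 6"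
      unfolding smooth_step_def r_def a_def b_def e
      by (simp add: field_simps power2_eq_square)
    moreover have "\<bar>- (r (3*t) - 3 * r (3*t-1) + 3 * r (3*t-2) - r (3*t-3)) / 6\<bar> \<le> 100 * \<bar>d\<bar>^3"
      using abs_le_D1[OF r[of "3*t"]] abs_le_D1[OF r[of "3*t-1"]] abs_le_D1[OF r[of "3*t-2"]]
        abs_le_D1[OF r[of "3*t-3"]] abs_le_D2[OF r[of "3*t"]] abs_le_D2[OF r[of "3*t-1"]]
        abs_le_D2[OF r[of "3*t-2"]] abs_le_D2[OF r[of "3*t-3"]]
      by (intro abs_leI) (simp_all add: field_simps)
    ultimately show ?thesis by simp
  qed
  with ab show ?thesis by blast
qed

text \<open>A difference of a step and its shift, so that the integer translates telescope to 1 and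
  at most two of them are nonzero at any point.\<close>

definition bump :: "real \<Rightarrow> real" where
  "bump t = smooth_step t - smooth_step (t + 1)"

lemma bump_eq_0: "\<bar>t\<bar> \<ge> 1 \<Longrightarrow> bump t = 0"
  by (cases "t \<ge> 1") (auto simp: bump_def smooth_step_le0 smooth_step_ge1 abs_if split: if_splits)

lemma bump_partition: "bump (t - of_int \<lfloor>t\<rfloor>) + bump (t - of_int (\<lfloor>t\<rfloor> + 1)) = 1"
proof -
  have "smooth_step (t - of_int \<lfloor>t\<rfloor> + 1) = 0" by (rule smooth_step_ge1) linarith
  moreover have "smooth_step (t - of_int (\<lfloor>t\<rfloor> + 1)) = 1" by (rule smooth_step_le0) linarith
  moreover have "t - of_int (\<lfloor>t\<rfloor> + 1) + 1 = t - of_int \<lfloor>t\<rfloor>" by simp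
  ultimately show ?thesis unfolding bump_def by simp
qed

lemma bump_bound: "\<bar>bump t\<bar> \<le> 200"
  using smooth_step_bound[of t] smooth_step_bound[of "t + 1"] by (simp add: bump_def)

lemma bump_active:
  assumes "bump (t - of_int q) \<noteq> 0"
  shows "q \<in> {\<lfloor>t\<rfloor>, \<lfloor>t\<rfloor> + 1}" "\<bar>t - of_int q\<bar> < 1"
proof -
  show *: "\<bar>t - of_int q\<bar> < 1" using assms bump_eq_0[of "t - of_int q"] by force
  then have "q = \<lfloor>t\<rfloor> \<or> q = \<lfloor>t\<rfloor> + 1" by linarith
  then show "q \<in> {\<lfloor>t\<rfloor>, \<lfloor>t\<rfloor> + 1}" by simp
qed

text \<open>Quadratic Taylor expansions at scale \<open>\<epsilon>\<close>, with bounds that are uniform in the base point.\<close>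

definition jet :: "real \<Rightarrow> real \<Rightarrow> (real \<Rightarrow> real) \<Rightarrow> bool" where
  "jet \<epsilon> B g \<longleftrightarrow> (\<forall>t. \<bar>g t\<bar> \<le> B \<and> (\<exists>a b. \<bar>a\<bar> \<le> B * \<epsilon> \<and> \<bar>b\<bar> \<le> B * \<epsilon>^2 \<and>
     (\<forall>d. \<bar>d\<bar> \<le> 2 \<longrightarrow> \<bar>g (t + d) - g t - a * d - b * d^2\<bar> \<le> B * \<epsilon>^3 * \<bar>d\<bar>^3)))"

lemma jet_bound: "jet \<epsilon> B g \<Longrightarrow> \<bar>g t\<bar> \<le> B"
  by (simp add: jet_def)

lemma jet_nonneg: "jet \<epsilon> B g \<Longrightarrow> 0 \<le> B"
  using jet_bound[of \<epsilon> B g 0] by linarith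

lemma jet_diff:
  assumes "jet \<epsilon> B g" "jet \<epsilon> B' h"
  shows "jet \<epsilon> (B + B') (\<lambda>t. g t - h t)"
  unfolding jet_def
proof (intro allI conjI)
  fix t
  show "\<bar>g t - h t\<bar> \<le> B + B'"
    using jet_bound[OF assms(1), of t] jet_bound[OF assms(2), of t] by linarith
  obtain a b where ab: "\<bar>a\<bar> \<le> B * \<epsilon>" "\<bar>b\<bar> \<le> B * \<epsilon>^2"
    "\<And>d. \<bar>d\<bar> \<le> 2 \<Longrightarrow> \<bar>g (t + d) - g t - a * d - b * d^2\<bar> \<le> B * \<epsilon>^3 * \<bar>d\<bar>^3"
    using assms(1) unfolding jet_def by meson
  obtain a' b' where ab': "\<bar>a'\<bar> \<le> B' * \<epsilon>" "\<bar>b'\<bar> \<le> B' * \<epsilon>^2"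
    "\<And>d. \<bar>d\<bar> \<le> 2 \<Longrightarrow> \<bar>h (t + d) - h t - a' * d - b' * d^2\<bar> \<le> B' * \<epsilon>^3 * \<bar>d\<bar>^3"
    using assms(2) unfolding jet_def by meson
  show "\<exists>a b. \<bar>a\<bar> \<le> (B + B') * \<epsilon> \<and> \<bar>b\<bar> \<le> (B + B') * \<epsilon>^2 \<and>
     (\<forall>d. \<bar>d\<bar> \<le> 2 \<longrightarrow> \<bar>g (t + d) - h (t + d) - (g t - h t) - a * d - b * d^2\<bar>
        \<le> (B + B') * \<epsilon>^3 * \<bar>d\<bar>^3)"
  proof (rule exI[of _ "a - a'"], rule exI[of _ "b - b'"], intro conjI allI impI)
    show "\<bar>a - a'\<bar> \<le> (B + B') * \<epsilon>" "\<bar>b - b'\<bar> \<le> (B + B') * \<epsilon>\<^sup>2"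
      using ab(1,2) ab'(1,2) by (auto simp: distrib_right)
    fix d :: real assume "\<bar>d\<bar> \<le> 2"
    from ab(3)[OF this] ab'(3)[OF this]
    show "\<bar>g (t + d) - h (t + d) - (g t - h t) - (a - a') * d - (b - b') * d^2\<bar>
        \<le> (B + B') * \<epsilon>^3 * \<bar>d\<bar>^3"
      by (simp add: algebra_simps)
  qed
qed

text \<open>The product of two expansions is truncated after degree two. The 12 is 2 + 2 + 1 + 7:
  the mixed cubic terms, the quartic term (absorbed by \<open>\<bar>d\<bar> \<le> 2\<close> and
  \<open>\<epsilon> \<le> 1\<close>), and the two remainders times the respective other
  factor.\<close>

lemma jet_mult:
  assumes "jet \<epsilon> B g" "jet \<epsilon> B' h" and eps: "0 \<le> \<epsilon>" "\<epsilon> \<le> 1"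
  shows "jet \<epsilon> (12 * B * B') (\<lambda>t. g t * h t)"
  unfolding jet_def
proof (intro allI conjI)
  fix t
  have B: "0 \<le> B" "0 \<le> B'" using assms jet_nonneg by blast+
  have bg: "\<bar>g t\<bar> \<le> B" and bh: "\<And>t. \<bar>h t\<bar> \<le> B'"
    using assms jet_bound by blast+
  have "\<bar>g t * h t\<bar> \<le> B * B'" unfolding abs_mult using bg bh B by (intro mult_mono) auto
  also have "\<dots> \<le> 12 * B * B'" using B by simp
  finally show "\<bar>g t * h t\<bar> \<le> 12 * B * B'" .
  obtain a b where ab: "\<bar>a\<bar> \<le> B * \<epsilon>" "\<bar>b\<bar> \<le> B * \<epsilon>^2"
    "\<And>d. \<bar>d\<bar> \<le> 2 \<Longrightarrow> \<bar>g (t + d) - g t - a * d - b * d^2\<bar> \<le> B * \<epsilon>^3 * \<bar>d\<bar>^3"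
    using assms(1) unfolding jet_def by meson
  obtain a' b' where ab': "\<bar>a'\<bar> \<le> B' * \<epsilon>" "\<bar>b'\<bar> \<le> B' * \<epsilon>^2"
    "\<And>d. \<bar>d\<bar> \<le> 2 \<Longrightarrow> \<bar>h (t + d) - h t - a' * d - b' * d^2\<bar> \<le> B' * \<epsilon>^3 * \<bar>d\<bar>^3"
    using assms(2) unfolding jet_def by meson
  define A where "A = g t * a' + a * h t"
  define D where "D = g t * b' + a * a' + b * h t"
  have m: "\<bar>x * y\<bar> \<le> X * Y" if "\<bar>x\<bar> \<le> X" "\<bar>y\<bar> \<le> Y" for x y X Y :: real
    unfolding abs_mult using that by (intro mult_mono) auto
  show "\<exists>a b. \<bar>a\<bar> \<le> 12 * B * B' * \<epsilon> \<and> \<bar>b\<bar> \<le> 12 * B * B' * \<epsilon>^2 \<and>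
     (\<forall>d. \<bar>d\<bar> \<le> 2 \<longrightarrow> \<bar>g (t + d) * h (t + d) - g t * h t - a * d - b * d^2\<bar>
        \<le> 12 * B * B' * \<epsilon>^3 * \<bar>d\<bar>^3)"
  proof (rule exI[of _ A], rule exI[of _ D], intro conjI allI impI)
    have "\<bar>g t * a'\<bar> \<le> B * (B' * \<epsilon>)" "\<bar>a * h t\<bar> \<le> (B * \<epsilon>) * B'" using bg bh ab ab' m by blast+
    moreover have "0 \<le> B * B' * \<epsilon>" using B eps by auto
    ultimately show "\<bar>A\<bar> \<le> 12 * B * B' * \<epsilon>" unfolding A_def by (simp add: algebra_simps)
    have "\<bar>g t * b'\<bar> \<le> B * (B' * \<epsilon>^2)" "\<bar>a * a'\<bar> \<le> (B * \<epsilon>) * (B' * \<epsilon>)" "\<bar>b * h t\<bar> \<le> (B * \<epsilon>^2) * B'"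
      using bg bh ab ab' m by blast+
    moreover have "0 \<le> B * B' * \<epsilon>^2" using B eps by auto
    ultimately show "\<bar>D\<bar> \<le> 12 * B * B' * \<epsilon>^2" unfolding D_def
      by (simp add: algebra_simps power2_eq_square)
    fix d :: real assume d: "\<bar>d\<bar> \<le> 2"
    define r where "r = g (t + d) - g t - a * d - b * d^2"
    define r' where "r' = h (t + d) - h t - a' * d - b' * d^2"
    have r: "\<bar>r\<bar> \<le> B * \<epsilon>^3 * \<bar>d\<bar>^3" and r': "\<bar>r'\<bar> \<le> B' * \<epsilon>^3 * \<bar>d\<bar>^3"
      using ab(3)[OF d] ab'(3)[OF d] by (simp_all add: r_def r'_def)
    have eq: "g (t + d) * h (t + d) - g t * h t - A * d - D * d^2
       = (a * b' + b * a') * d^3 + (b * b' * d) * d^3 + r * h (t + d) + r' * (g t + a * d + b * d^2)"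
      unfolding A_def D_def r_def r'_def by (simp add: algebra_simps power2_eq_square power3_eq_cube)
    define E where "E = B * B' * \<epsilon>^3 * \<bar>d\<bar>^3"
    have E0: "0 \<le> E" unfolding E_def using B eps by auto
    have "\<bar>a * b'\<bar> \<le> (B * \<epsilon>) * (B' * \<epsilon>^2)" "\<bar>b * a'\<bar> \<le> (B * \<epsilon>^2) * (B' * \<epsilon>)"
      using ab ab' m by blast+
    then have "\<bar>a * b' + b * a'\<bar> \<le> 2 * B * B' * \<epsilon>^3" by (simp add: algebra_simps power2_eq_square power3_eq_cube)
    then have t1: "\<bar>(a * b' + b * a') * d^3\<bar> \<le> 2 * E"
      using m[of "a * b' + b * a'" "2 * B * B' * \<epsilon>^3" "d^3" "\<bar>d\<bar>^3"] by (simp add: E_def power_abs algebra_simps)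
    have "\<bar>b * b'\<bar> \<le> (B * \<epsilon>^2) * (B' * \<epsilon>^2)" using ab ab' m by blast
    also have "\<dots> = B * B' * \<epsilon>^3 * \<epsilon>" by (simp add: algebra_simps power2_eq_square power3_eq_cube)
    also have "\<dots> \<le> B * B' * \<epsilon>^3 * 1" using B eps by (intro mult_left_mono) auto
    finally have "\<bar>b * b' * d\<bar> \<le> (B * B' * \<epsilon>^3) * 2" using m[OF _ d] by simp
    then have t2: "\<bar>(b * b' * d) * d^3\<bar> \<le> 2 * E"
      using m[of "b * b' * d" "(B * B' * \<epsilon>^3) * 2" "d^3" "\<bar>d\<bar>^3"] by (simp add: E_def power_abs algebra_simps)
    have t3: "\<bar>r * h (t + d)\<bar> \<le> E" using m[OF r bh[of "t + d"]] by (simp add: E_def algebra_simps)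
    have e1: "B * \<epsilon> \<le> B * 1" "B * \<epsilon>^2 \<le> B * 1"
      using B eps by (intro mult_left_mono power_le_one; simp)+
    have "\<bar>a * d\<bar> \<le> B * 2" using ab(1) e1 m[OF _ d, of a B] by simp
    moreover have "\<bar>b * d^2\<bar> \<le> B * 2^2"
    proof (rule m)
      show "\<bar>b\<bar> \<le> B" using ab(2) e1 by simp
      show "\<bar>d\<^sup>2\<bar> \<le> 2^2" using power_mono[OF d, of 2] by simp
    qed
    ultimately have "\<bar>g t + a * d + b * d^2\<bar> \<le> 7 * B"
      using bg abs_triangle_ineq[of "g t + a * d" "b * d^2"] abs_triangle_ineq[of "g t" "a * d"] by simp
    then have t4: "\<bar>r' * (g t + a * d + b * d^2)\<bar> \<le> 7 * E"
      using m[OF r', of "g t + a * d + b * d^2" "7 * B"] by (simp add: E_def algebra_simps)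
    show "\<bar>g (t + d) * h (t + d) - g t * h t - A * d - D * d^2\<bar> \<le> 12 * B * B' * \<epsilon>^3 * \<bar>d\<bar>^3"
      unfolding eq using t1 t2 t3 t4 E_def by linarith
  qed
qed

lemma jet_smooth_step:
  assumes \<mu>: "\<bar>\<mu>\<bar> \<le> C * \<epsilon>" and C: "1 \<le> C" and \<epsilon>: "0 \<le> \<epsilon>"
  shows "jet \<epsilon> (100 * C^3) (\<lambda>t. smooth_step (\<mu> * t + \<nu>))"
  unfolding jet_def
proof (intro allI conjI)
  fix t
  have C1: "C \<le> C^3" "C^2 \<le> C^3" "1 \<le> C^3" using C by (auto simp: self_le_power power_increasing)
  show "\<bar>smooth_step (\<mu> * t + \<nu>)\<bar> \<le> 100 * C^3"
    using smooth_step_bound[of "\<mu> * t + \<nu>"] C1 by linarith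
  obtain a b where ab: "\<bar>a\<bar> \<le> 100" "\<bar>b\<bar> \<le> 100"
    "\<And>d. \<bar>smooth_step (\<mu> * t + \<nu> + d) - smooth_step (\<mu> * t + \<nu>) - a * d - b * d^2\<bar> \<le> 100 * \<bar>d\<bar>^3"
    using smooth_step_taylor[of "\<mu> * t + \<nu>"] by blast
  have pw: "\<bar>\<mu>\<bar>^n \<le> C^n * \<epsilon>^n" for n
    using power_mono[OF \<mu>, of n] by (simp add: power_mult_distrib)
  show "\<exists>a b. \<bar>a\<bar> \<le> 100 * C^3 * \<epsilon> \<and> \<bar>b\<bar> \<le> 100 * C^3 * \<epsilon>^2 \<and>
     (\<forall>d. \<bar>d\<bar> \<le> 2 \<longrightarrow> \<bar>smooth_step (\<mu> * (t + d) + \<nu>) - smooth_step (\<mu> * t + \<nu>) - a * d - b * d^2\<bar>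
        \<le> 100 * C^3 * \<epsilon>^3 * \<bar>d\<bar>^3)"
  proof (rule exI[of _ "a * \<mu>"], rule exI[of _ "b * \<mu>^2"], intro conjI allI impI)
    have "\<bar>a * \<mu>\<bar> \<le> 100 * (C * \<epsilon>)" unfolding abs_mult using ab \<mu> by (intro mult_mono) auto
    also have "\<dots> \<le> 100 * (C^3 * \<epsilon>)" using C1 \<epsilon> by (intro mult_left_mono mult_right_mono) auto
    finally show "\<bar>a * \<mu>\<bar> \<le> 100 * C^3 * \<epsilon>" by simp
    have "\<bar>b * \<mu>^2\<bar> \<le> 100 * (C^2 * \<epsilon>^2)" unfolding abs_mult power_abs[symmetric]
      using ab pw[of 2] by (intro mult_mono) (auto simp: power_abs)
    also have "\<dots> \<le> 100 * (C^3 * \<epsilon>^2)" using C1 \<epsilon> by (intro mult_left_mono mult_right_mono) auto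
    finally show "\<bar>b * \<mu>^2\<bar> \<le> 100 * C^3 * \<epsilon>^2" by simp
    fix d :: real
    have "\<bar>smooth_step (\<mu> * t + \<nu> + \<mu> * d) - smooth_step (\<mu> * t + \<nu>) - a * (\<mu> * d) - b * (\<mu> * d)^2\<bar>
      \<le> 100 * (\<bar>\<mu>\<bar>^3 * \<bar>d\<bar>^3)"
      using ab(3)[of "\<mu> * d"] by (simp add: abs_mult power_mult_distrib)
    also have "\<dots> \<le> 100 * ((C^3 * \<epsilon>^3) * \<bar>d\<bar>^3)" using pw[of 3]
      by (intro mult_left_mono mult_right_mono) auto
    finally show "\<bar>smooth_step (\<mu> * (t + d) + \<nu>) - smooth_step (\<mu> * t + \<nu>) - a * \<mu> * d - b * \<mu>\<^sup>2 * d^2\<bar>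
        \<le> 100 * C^3 * \<epsilon>^3 * \<bar>d\<bar>^3"
      by (simp add: algebra_simps power_mult_distrib)
  qed
qed

lemma jet_bump:
  assumes \<mu>: "\<bar>\<mu>\<bar> \<le> C * \<epsilon>" and C: "1 \<le> C" and \<epsilon>: "0 \<le> \<epsilon>"
  shows "jet \<epsilon> (200 * C^3) (\<lambda>t. bump (\<mu> * t + \<nu>))"
  using jet_diff[OF jet_smooth_step[OF assms, of \<nu>] jet_smooth_step[OF assms, of "\<nu> + 1"]]
  by (simp add: bump_def algebra_simps)

text \<open>The cardinal function of quadratic Lagrange interpolation at \<open>\<lfloor>t\<rfloor>\<close>, \<open>\<lfloor>t\<rfloor> + 1\<close>, \<open>\<lfloor>t\<rfloor> + 2\<close>.\<close>

definition kernel :: "real \<Rightarrow> real" where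
  "kernel u = (if u < -2 then 0 else if u < -1 then (u + 1) * (u + 2) / 2
     else if u < 0 then 1 - u^2 else if u < 1 then (1 - u) * (2 - u) / 2 else 0)"

lemma kernel_measurable [measurable]: "kernel \<in> borel_measurable borel"
  unfolding kernel_def by measurable

lemma kernel_abs_le: "\<bar>kernel u\<bar> \<le> 1"
proof -
  have "0 \<le> (-1 - u) * (u + 2) \<and> (-1 - u) * (u + 2) \<le> 1 * 1" if "-2 \<le> u" "u < -1"
    using that by (intro conjI mult_mono mult_nonneg_nonneg) auto
  moreover have "u^2 \<le> 1" "0 \<le> u^2" if "-1 \<le> u" "u < 0"
    using that by (auto simp: power2_le_iff_abs_le intro!: abs_square_le_1[THEN iffD2])
  moreover have "0 \<le> (1 - u) * (2 - u) \<and> (1 - u) * (2 - u) \<le> 1 * 2" if "0 \<le> u" "u < 1"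
    using that by (intro conjI mult_mono mult_nonneg_nonneg) auto
  ultimately show ?thesis
    unfolding kernel_def by (auto simp: abs_le_iff algebra_simps)
qed

lemma kernel_nonzero:
  assumes "kernel (t - of_int k) \<noteq> 0"
  shows "k \<in> {\<lfloor>t\<rfloor>, \<lfloor>t\<rfloor> + 1, \<lfloor>t\<rfloor> + 2}" "\<bar>t - of_int k\<bar> \<le> 2"
proof -
  have *: "-2 \<le> t - of_int k" "t - of_int k < 1" using assms by (auto simp: kernel_def split: if_splits)
  then have "k = \<lfloor>t\<rfloor> \<or> k = \<lfloor>t\<rfloor> + 1 \<or> k = \<lfloor>t\<rfloor> + 2" by linarith
  then show "k \<in> {\<lfloor>t\<rfloor>, \<lfloor>t\<rfloor> + 1, \<lfloor>t\<rfloor> + 2}" by blast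
  show "\<bar>t - of_int k\<bar> \<le> 2" using * by linarith
qed

definition interp :: "(int \<Rightarrow> real) \<Rightarrow> real \<Rightarrow> real" where
  "interp g t = (\<Sum>k\<in>{\<lfloor>t\<rfloor>, \<lfloor>t\<rfloor> + 1, \<lfloor>t\<rfloor> + 2}. g k * kernel (t - of_int k))"

lemma quadratic_combination:
  fixes x :: real
  shows "g1 * k0 + g2 * k1 + g3 * k2 = g0 * (k0 + k1 + k2) + a * (x * k0 + y * k1 + z * k2)
    + b * (p * k0 + q * k1 + w * k2) + (g1 - g0 - a * x - b * p) * k0
    + (g2 - g0 - a * y - b * q) * k1 + (g3 - g0 - a * z - b * w) * k2"
  by (simp add: algebra_simps)

text \<open>The kernel reproduces polynomials of degree at most two (the three moment identities
  \<open>k3\<close>), so only Taylor remainders survive. All three nodes lie within distance 2 of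
  \<open>t\<close>, which is the radius in \<open>jet\<close>; 24 is three nodes times
  \<open>2 ^ 3\<close>.\<close>

lemma interp_error:
  assumes g: "jet \<epsilon> B g" and \<epsilon>: "0 \<le> \<epsilon>"
  shows "\<bar>g t - interp (\<lambda>k. g (of_int k)) t\<bar> \<le> 24 * B * \<epsilon>^3"
proof -
  define u where "u = t - of_int \<lfloor>t\<rfloor>"
  have u: "0 \<le> u" "u < 1" unfolding u_def by linarith+
  obtain a b where ab:
    "\<And>d. \<bar>d\<bar> \<le> 2 \<Longrightarrow> \<bar>g (t + d) - g t - a * d - b * d^2\<bar> \<le> B * \<epsilon>^3 * \<bar>d\<bar>^3"
    using g unfolding jet_def by meson
  define r where "r d = g (t + d) - g t - a * d - b * d^2" for d
  have B: "0 \<le> B" using g jet_nonneg by blast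
  have r: "\<bar>r d\<bar> \<le> 8 * B * \<epsilon>^3" if "\<bar>d\<bar> \<le> 2" for d
  proof -
    have "\<bar>r d\<bar> \<le> B * \<epsilon>^3 * \<bar>d\<bar>^3" using ab[OF that] by (simp add: r_def)
    also have "\<dots> \<le> B * \<epsilon>^3 * 2^3" using B \<epsilon> that by (intro mult_left_mono power_mono) auto
    finally show ?thesis by simp
  qed
  have k: "kernel u = (1 - u) * (2 - u) / 2" "kernel (u - 1) = 1 - (u - 1)^2" "kernel (u - 2) = (u - 1) * u / 2"
    using u by (auto simp: kernel_def)
  have e: "of_int \<lfloor>t\<rfloor> = t + - u" "of_int (\<lfloor>t\<rfloor> + 1) = t + (1 - u)" "of_int (\<lfloor>t\<rfloor> + 2) = t + (2 - u)"
    by (auto simp: u_def)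
  have k3: "kernel u + kernel (u - 1) + kernel (u - 2) = 1"
    "- u * kernel u + (1 - u) * kernel (u - 1) + (2 - u) * kernel (u - 2) = 0"
    "u^2 * kernel u + (1 - u)^2 * kernel (u - 1) + (2 - u)^2 * kernel (u - 2) = 0"
    unfolding k by (simp_all add: field_simps power2_eq_square)
  have "interp (\<lambda>k. g (of_int k)) t = g (t + - u) * kernel u + g (t + (1 - u)) * kernel (u - 1)
     + g (t + (2 - u)) * kernel (u - 2)"
  proof -
    have tt: "t - of_int \<lfloor>t\<rfloor> = u" "t - of_int (\<lfloor>t\<rfloor> + 1) = u - 1" "t - of_int (\<lfloor>t\<rfloor> + 2) = u - 2"
      by (simp_all add: u_def)
    have s3: "sum f {\<lfloor>t\<rfloor>, \<lfloor>t\<rfloor> + 1, \<lfloor>t\<rfloor> + 2} = f \<lfloor>t\<rfloor> + f (\<lfloor>t\<rfloor> + 1) + f (\<lfloor>t\<rfloor> + 2)"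
      for f :: "int \<Rightarrow> real" by simp
    show ?thesis unfolding interp_def s3 tt e[symmetric] by (rule refl)
  qed
  also have "\<dots> = g t * (kernel u + kernel (u - 1) + kernel (u - 2))
      + a * (- u * kernel u + (1 - u) * kernel (u - 1) + (2 - u) * kernel (u - 2))
      + b * (u^2 * kernel u + (1 - u)^2 * kernel (u - 1) + (2 - u)^2 * kernel (u - 2))
      + r (- u) * kernel u + r (1 - u) * kernel (u - 1) + r (2 - u) * kernel (u - 2)"
    unfolding r_def power2_minus by (rule quadratic_combination)
  also have "\<dots> = g t + r (- u) * kernel u + r (1 - u) * kernel (u - 1) + r (2 - u) * kernel (u - 2)"
    by (simp only: k3 mult_1_right mult_zero_right add_0_right)
  finally have eq: "g t - interp (\<lambda>k. g (of_int k)) t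
     = - (r (- u) * kernel u) - r (1 - u) * kernel (u - 1) - r (2 - u) * kernel (u - 2)" by simp
  have p: "\<bar>r d * kernel v\<bar> \<le> 8 * B * \<epsilon>^3 * 1" if "\<bar>d\<bar> \<le> 2" for d v
    unfolding abs_mult using r[OF that] kernel_abs_le[of v] B \<epsilon> by (intro mult_mono) auto
  show ?thesis unfolding eq
    using p[of "- u" u] p[of "1 - u" "u - 1"] p[of "2 - u" "u - 2"] u by (simp add: abs_le_iff)
qed

definition interp2 :: "(int \<Rightarrow> int \<Rightarrow> real) \<Rightarrow> real \<Rightarrow> real \<Rightarrow> real" where
  "interp2 g U V = interp (\<lambda>k2. interp (\<lambda>k1. g k1 k2) U) V"

text \<open>One variable after the other: 24 for the error in \<open>V\<close> at exact values, plus
  three times 24 because the errors in \<open>U\<close> pass through three kernel values of modulus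
  at most 1.\<close>

lemma interp2_error:
  assumes g1: "\<And>V. jet \<epsilon> B (\<lambda>U. g U V)" and g2: "\<And>U. jet \<epsilon> B (\<lambda>V. g U V)" and \<epsilon>: "0 \<le> \<epsilon>"
  shows "\<bar>g U V - interp2 (\<lambda>k1 k2. g (of_int k1) (of_int k2)) U V\<bar> \<le> 96 * B * \<epsilon>^3"
proof -
  have B: "0 \<le> B" using g1 jet_nonneg by blast
  define K where "K = {\<lfloor>V\<rfloor>, \<lfloor>V\<rfloor> + 1, \<lfloor>V\<rfloor> + 2}"
  have "\<bar>interp (\<lambda>k2. g U (of_int k2)) V - interp2 (\<lambda>k1 k2. g (of_int k1) (of_int k2)) U V\<bar>
    = \<bar>\<Sum>k\<in>K. (g U (of_int k) - interp (\<lambda>k1. g (of_int k1) (of_int k)) U) * kernel (V - of_int k)\<bar>"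
    unfolding interp2_def interp_def[of _ V] K_def[symmetric]
    by (simp add: sum_subtractf algebra_simps)
  also have "\<dots> \<le> (\<Sum>k\<in>K. 24 * B * \<epsilon>^3 * 1)"
    unfolding abs_mult using interp_error[OF g1 \<epsilon>] kernel_abs_le B \<epsilon>
    by (intro order.trans[OF sum_abs] sum_mono) (auto simp: abs_mult intro!: mult_mono[of _ _ _ "1::real", simplified])
  also have "\<dots> = 72 * B * \<epsilon>^3" by (simp add: K_def)
  finally show ?thesis using interp_error[OF g2 \<epsilon>, of U V] by linarith
qed

text \<open>The nine nodes in use depend on the point. A sum over the fixed finite set of nonzero
  samples does not, and is therefore a linear combination of translates of one generator.\<close>

lemma interp2_eq_sum:
  assumes N: "finite N" "\<And>k1 k2. g k1 k2 \<noteq> 0 \<Longrightarrow> (k1, k2) \<in> N"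
  shows "interp2 g U V = (\<Sum>(k1, k2)\<in>N. g k1 k2 * kernel (U - of_int k1) * kernel (V - of_int k2))"
proof -
  define A where "A = {\<lfloor>U\<rfloor>, \<lfloor>U\<rfloor> + 1, \<lfloor>U\<rfloor> + 2} \<times> {\<lfloor>V\<rfloor>, \<lfloor>V\<rfloor> + 1, \<lfloor>V\<rfloor> + 2}"
  define f where "f = (\<lambda>(k1, k2). g k1 k2 * kernel (U - of_int k1) * kernel (V - of_int k2))"
  have "interp2 g U V = (\<Sum>k2\<in>{\<lfloor>V\<rfloor>, \<lfloor>V\<rfloor> + 1, \<lfloor>V\<rfloor> + 2}. \<Sum>k1\<in>{\<lfloor>U\<rfloor>, \<lfloor>U\<rfloor> + 1, \<lfloor>U\<rfloor> + 2}. f (k1, k2))"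
    unfolding interp2_def interp_def f_def by (simp only: sum_distrib_right prod.case)
  also have "\<dots> = sum f A"
    unfolding A_def sum.cartesian_product' by (rule sum.swap)
  also have "\<dots> = sum f (A \<inter> N)"
    by (rule sum.mono_neutral_right) (use N in \<open>auto simp: A_def f_def\<close>)
  also have "\<dots> = sum f N"
  proof (rule sum.mono_neutral_left)
    show "\<forall>i\<in>N - A \<inter> N. f i = 0"
    proof
      fix i assume i: "i \<in> N - A \<inter> N"
      obtain k1 k2 where ik: "i = (k1, k2)" by fastforce
      show "f i = 0"
      proof (rule ccontr)
        assume "f i \<noteq> 0"
        then have "kernel (U - of_int k1) \<noteq> 0" "kernel (V - of_int k2) \<noteq> 0"
          by (auto simp: f_def ik)
        from kernel_nonzero(1)[OF this(1)] kernel_nonzero(1)[OF this(2)] i ik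
        show False by (auto simp: A_def)
      qed
    qed
  qed (use N in auto)
  finally show ?thesis by (simp add: f_def)
qed

section \<open>Pieces and their approximation by sheared kernels\<close>

lemma card_int_near:
  fixes z r :: real
  assumes "0 \<le> r"
  shows "finite {k::int. \<bar>of_int k - z\<bar> \<le> r}" "real (card {k::int. \<bar>of_int k - z\<bar> \<le> r}) \<le> 2 * r + 1"
proof -
  have sub: "{k::int. \<bar>of_int k - z\<bar> \<le> r} \<subseteq> {\<lceil>z - r\<rceil>..\<lfloor>z + r\<rfloor>}"
    by (auto simp: abs_le_iff ceiling_le_iff le_floor_iff)
  then show "finite {k::int. \<bar>of_int k - z\<bar> \<le> r}" by (rule finite_subset) simp
  have "card {k::int. \<bar>of_int k - z\<bar> \<le> r} \<le> card {\<lceil>z - r\<rceil>..\<lfloor>z + r\<rfloor>}"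
    by (rule card_mono[OF _ sub]) simp
  also have "\<dots> = nat (\<lfloor>z + r\<rfloor> - \<lceil>z - r\<rceil> + 1)" by simp
  finally have "real (card {k::int. \<bar>of_int k - z\<bar> \<le> r}) \<le> real (nat (\<lfloor>z + r\<rfloor> - \<lceil>z - r\<rceil> + 1))" by simp
  also have "\<dots> \<le> 2 * r + 1"
  proof (cases "\<lfloor>z + r\<rfloor> - \<lceil>z - r\<rceil> + 1 \<ge> 0")
    case True
    then have "real (nat (\<lfloor>z + r\<rfloor> - \<lceil>z - r\<rceil> + 1)) = of_int (\<lfloor>z + r\<rfloor>) - of_int (\<lceil>z - r\<rceil>) + 1" by simp
    then show ?thesis by linarith
  qed (use assms in auto)
  finally show "real (card {k::int. \<bar>of_int k - z\<bar> \<le> r}) \<le> 2 * r + 1" .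
qed

definition aff :: "real \<times> real \<times> real \<Rightarrow> real \<Rightarrow> real \<Rightarrow> real" where
  "aff \<alpha> x y = fst \<alpha> * x + fst (snd \<alpha>) * y + snd (snd \<alpha>)"

definition window :: "real \<Rightarrow> int \<times> int \<Rightarrow> real \<Rightarrow> real \<Rightarrow> real" where
  "window N q x y = bump (N * x - of_int (fst q)) * bump (N * y - of_int (snd q))"

text \<open>One summand of the difference of two layers after multiplication by both partitions of
  unity. The factor \<open>N^2\<close> gives the transition a width of order \<open>N^-2\<close>.
  The switch \<open>e\<close> is 1 for consecutive scales and 0 for the coarsest layer, where
  nothing is subtracted.\<close>

definition piece :: "real \<Rightarrow> int \<times> int \<Rightarrow> int \<times> int \<Rightarrow> real \<times> real \<times> real \<Rightarrow> real \<times> real \<times> real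
    \<Rightarrow> real \<Rightarrow> real \<Rightarrow> real \<Rightarrow> real" where
  "piece N q q' \<alpha> \<alpha>' e x y = window N q x y * window (N/2) q' x y *
     (smooth_step (N^2 * aff \<alpha> x y) - e * smooth_step ((N/2)^2 * aff \<alpha>' x y))"

lemma window_active:
  assumes "window N q x y \<noteq> 0"
  shows "\<bar>N * x - of_int (fst q)\<bar> < 1" "\<bar>N * y - of_int (snd q)\<bar> < 1"
    "q \<in> {\<lfloor>N * x\<rfloor>, \<lfloor>N * x\<rfloor> + 1} \<times> {\<lfloor>N * y\<rfloor>, \<lfloor>N * y\<rfloor> + 1}"
  using assms bump_active[of "N * x" "fst q"] bump_active[of "N * y" "snd q"]
  unfolding window_def mem_Times_iff by auto

definition piece_const :: "real \<Rightarrow> real" where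
  "piece_const C = 12 * (12 * (12 * (200 * C^3) * (200 * C^3)) * (12 * (200 * C^3) * (200 * C^3))) * (200 * C^3)"

text \<open>Along a line the windows vary at speed \<open>N\<close>, the steps at speed
  \<open>N^2\<close> times the change of the affine coordinate. For the steps this is a condition on
  the direction: across the strip it is met by shortness of the grid step, along the strip by near
  tangency.\<close>

lemma piece_jet:
  assumes C: "1 \<le> C" and \<epsilon>: "0 \<le> \<epsilon>" "\<epsilon> \<le> 1" and N: "0 \<le> N" and e: "e = 0 \<or> e = 1"
    and u: "N * \<bar>u\<bar> \<le> C * \<epsilon>" and v: "N * \<bar>v\<bar> \<le> C * \<epsilon>"
    and l1: "N^2 * \<bar>fst \<alpha> * u + fst (snd \<alpha>) * v\<bar> \<le> C * \<epsilon>"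
    and l2: "N^2 * \<bar>fst \<alpha>' * u + fst (snd \<alpha>') * v\<bar> \<le> C * \<epsilon>"
  shows "jet \<epsilon> (piece_const C) (\<lambda>t. piece N q q' \<alpha> \<alpha>' e (x0 + t * u) (y0 + t * v))"
proof -
  have w: "jet \<epsilon> (12 * (200 * C^3) * (200 * C^3)) (\<lambda>t. window M p (x0 + t * u) (y0 + t * v))"
    if M: "0 \<le> M" "M \<le> N" for M p
  proof -
    have "M * \<bar>u\<bar> \<le> N * \<bar>u\<bar>" "M * \<bar>v\<bar> \<le> N * \<bar>v\<bar>" using M by (auto intro: mult_right_mono)
    then have uv: "\<bar>M * u\<bar> \<le> C * \<epsilon>" "\<bar>M * v\<bar> \<le> C * \<epsilon>" using u v M by (auto simp: abs_mult)
    have "jet \<epsilon> (12 * (200 * C^3) * (200 * C^3))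
      (\<lambda>t. bump ((M * u) * t + (M * x0 - of_int (fst p))) * bump ((M * v) * t + (M * y0 - of_int (snd p))))"
      by (intro jet_mult jet_bump uv C \<epsilon>)
    then show ?thesis by (simp add: window_def algebra_simps)
  qed
  have s: "jet \<epsilon> (100 * C^3) (\<lambda>t. smooth_step (c * aff l (x0 + t * u) (y0 + t * v)))"
    if c: "0 \<le> c" "c \<le> N^2" and l: "N^2 * \<bar>fst l * u + fst (snd l) * v\<bar> \<le> C * \<epsilon>" for c l
  proof -
    have "\<bar>c * (fst l * u + fst (snd l) * v)\<bar> \<le> N^2 * \<bar>fst l * u + fst (snd l) * v\<bar>"
      unfolding abs_mult using c by (intro mult_right_mono) auto
    then have a: "\<bar>c * (fst l * u + fst (snd l) * v)\<bar> \<le> C * \<epsilon>" using l by linarith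
    have "jet \<epsilon> (100 * C^3) (\<lambda>t. smooth_step ((c * (fst l * u + fst (snd l) * v)) * t
        + c * (fst l * x0 + fst (snd l) * y0 + snd (snd l))))"
      by (rule jet_smooth_step[OF a C \<epsilon>(1)])
    then show ?thesis by (simp add: aff_def algebra_simps)
  qed
  have half: "0 \<le> N/2" "N/2 \<le> N" "(N/2)^2 \<le> N^2" using N by (auto simp: power_divide)
  have zero: "jet \<epsilon> (100 * C^3) (\<lambda>t. 0)" using C \<epsilon> by (auto simp: jet_def intro!: exI[of _ 0])
  have "jet \<epsilon> (100 * C^3) (\<lambda>t. e * smooth_step ((N/2)^2 * aff \<alpha>' (x0 + t * u) (y0 + t * v)))"
    using e zero s[OF _ half(3) l2] by auto
  with s[OF _ order_refl l1] have "jet \<epsilon> (100 * C^3 + 100 * C^3) (\<lambda>t.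
     smooth_step (N^2 * aff \<alpha> (x0 + t * u) (y0 + t * v)) - e * smooth_step ((N/2)^2 * aff \<alpha>' (x0 + t * u) (y0 + t * v)))"
    by (intro jet_diff) auto
  then have d: "jet \<epsilon> (200 * C^3) (\<lambda>t.
     smooth_step (N^2 * aff \<alpha> (x0 + t * u) (y0 + t * v)) - e * smooth_step ((N/2)^2 * aff \<alpha>' (x0 + t * u) (y0 + t * v)))"
    by simp
  show ?thesis
    unfolding piece_def piece_const_def
    by (intro jet_mult d w[OF N order_refl] w[OF half(1,2)] \<epsilon>)
qed

text \<open>In the coordinates \<open>U = M^2 x + m M y\<close>, \<open>V = M y\<close> the piece
  has a jet at scale \<open>1 / T\<close>: a unit step in \<open>U\<close> has length
  \<open>M^-2\<close>, and a unit step in \<open>V\<close> runs almost along the strip because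
  \<open>m\<close> matches its slope. The strip meets of order \<open>T^2\<close> values of
  \<open>k1\<close> and \<open>T\<close> values of \<open>k2\<close>.\<close>

lemma piece_approx_sheared:
  fixes C N T :: real and m :: int
  defines "M \<equiv> N * T"
  assumes C: "1 \<le> C" and N: "1 \<le> N" and T: "1 \<le> T" and e: "e = 0 \<or> e = 1"
    and m: "\<bar>of_int m\<bar> \<le> M"
    and a: "\<bar>fst \<alpha>\<bar> \<le> C" "\<bar>fst \<alpha>'\<bar> \<le> C"
    and b: "\<bar>fst (snd \<alpha>) - fst \<alpha> * of_int m / M\<bar> \<le> C / N" "\<bar>fst (snd \<alpha>') - fst \<alpha>' * of_int m / M\<bar> \<le> C / N"
    and supp: "\<And>x y. piece N q q' \<alpha> \<alpha>' e x y \<noteq> 0 \<Longrightarrow> \<bar>x - \<xi> - \<mu> * y\<bar> \<le> C / N^2"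
    and \<mu>: "\<bar>\<mu> + of_int m / M\<bar> \<le> C / N"
  shows "\<exists>K coef. finite K \<and> real (card K) \<le> 15 * C * T^3 \<and>
    (\<forall>(k1, k2)\<in>K. \<bar>N * (of_int k2 / M) - of_int (snd q)\<bar> \<le> 1 \<and>
        \<bar>N * ((of_int k1 - of_int m * of_int k2) / M^2) - of_int (fst q)\<bar> \<le> 1) \<and>
    (\<forall>x y. let E = piece N q q' \<alpha> \<alpha>' e x y - (\<Sum>(k1, k2)\<in>K. coef k1 k2 *
          kernel (M^2 * x + of_int m * (M * y) - of_int k1) * kernel (M * y - of_int k2)) in
       \<bar>E\<bar> \<le> 96 * piece_const C / T^3 \<and>
       (E \<noteq> 0 \<longrightarrow> \<bar>N * x - of_int (fst q)\<bar> \<le> 6 \<and> \<bar>N * y - of_int (snd q)\<bar> \<le> 6 \<and>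
          \<bar>x - \<xi> - \<mu> * y\<bar> \<le> 5 * C / N^2))"
proof -
  let ?p = "piece N q q' \<alpha> \<alpha>' e"
  define \<epsilon> where "\<epsilon> = 1 / T"
  have M0: "0 < M" "1 \<le> M" "N \<le> M" "T \<le> M"
    using N T mult_mono[of 1 N 1 T] mult_mono[of N N 1 T] mult_mono[of 1 N T T] by (auto simp: M_def)
  have \<epsilon>: "0 \<le> \<epsilon>" "\<epsilon> \<le> 1" using T by (auto simp: \<epsilon>_def)
  have C\<epsilon>: "\<epsilon> \<le> C * \<epsilon>" using C \<epsilon> by (simp add: mult_le_cancel_right1)
  have NM: "N / M = \<epsilon>" using N by (simp add: M_def \<epsilon>_def)
  define g where "g U V = ?p ((U - of_int m * V) / M^2) (V / M)" for U V
  have g_eq: "?p x y = g (M^2 * x + of_int m * (M * y)) (M * y)" for x y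
    using M0 unfolding g_def by simp
  have NM2: "N / M^2 \<le> \<epsilon>" "N^2 / M^2 \<le> \<epsilon>"
  proof -
    have "N / M^2 = \<epsilon> / M" unfolding NM[symmetric] by (simp add: power2_eq_square)
    also have "\<dots> \<le> \<epsilon>" using \<epsilon> M0 by (simp add: divide_le_eq mult_le_cancel_left1)
    finally show "N / M^2 \<le> \<epsilon>" .
    have "N^2 / M^2 = \<epsilon>^2" using NM by (simp add: power_divide[symmetric])
    also have "\<dots> \<le> \<epsilon>" using \<epsilon> by (simp add: power2_eq_square mult_left_le)
    finally show "N^2 / M^2 \<le> \<epsilon>" .
  qed
  have jU: "jet \<epsilon> (piece_const C) (\<lambda>U. g U V)" for V
  proof -
    have "N^2 * \<bar>fst l * (1 / M^2) + fst (snd l) * 0\<bar> \<le> C * \<epsilon>" if "\<bar>fst l\<bar> \<le> C" for l :: "real \<times> real \<times> real"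
    proof -
      have "N^2 * \<bar>fst l * (1 / M^2) + fst (snd l) * 0\<bar> = \<bar>fst l\<bar> * (N^2 / M^2)" by (simp add: abs_mult)
      also have "\<dots> \<le> C * \<epsilon>" using that NM2(2) C by (intro mult_mono) auto
      finally show ?thesis .
    qed
    from piece_jet[OF C \<epsilon> _ e _ _ this[OF a(1)] this[OF a(2)], of q q' "- of_int m * V / M^2" "V / M"]
    show ?thesis unfolding g_def using N NM2(1) C\<epsilon> C \<epsilon>
      by (simp add: diff_divide_distrib)
  qed
  have jV: "jet \<epsilon> (piece_const C) (\<lambda>V. g U V)" for U
  proof -
    \<comment> \<open>Here the alignment pays: the change along the sheared direction is
      \<open>N^2 / M\<close> times a slope mismatch of at most \<open>C / N\<close>, which leaves
      \<open>C / T\<close>.\<close>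
    have "N^2 * \<bar>fst l * (- of_int m / M^2) + fst (snd l) * (1 / M)\<bar> \<le> C * \<epsilon>"
      if "\<bar>fst (snd l) - fst l * of_int m / M\<bar> \<le> C / N" for l :: "real \<times> real \<times> real"
    proof -
      have "fst l * (- of_int m / M^2) + fst (snd l) * (1 / M) = (fst (snd l) - fst l * of_int m / M) / M"
        using M0 by (simp add: field_simps power2_eq_square)
      then have "N^2 * \<bar>fst l * (- of_int m / M^2) + fst (snd l) * (1 / M)\<bar>
         = N * (N / M) * \<bar>fst (snd l) - fst l * of_int m / M\<bar>"
        using M0 by (simp add: power2_eq_square)
      also have "\<dots> \<le> N * (N / M) * (C / N)" using that N M0 by (intro mult_left_mono) auto
      also have "\<dots> = C * \<epsilon>" using N NM by simp
      finally show ?thesis .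
    qed
    note l = this[OF b(1)] this[OF b(2)]
    have u: "N * \<bar>- of_int m / M^2\<bar> \<le> C * \<epsilon>"
    proof -
      have "N * \<bar>- of_int m / M^2\<bar> = (N / M) * (\<bar>of_int m\<bar> / M)" using M0 by (simp add: power2_eq_square)
      also have "\<dots> \<le> \<epsilon> * 1" unfolding NM using m M0 \<epsilon> by (intro mult_left_mono) auto
      finally show ?thesis using C\<epsilon> by simp
    qed
    have v: "N * \<bar>1 / M\<bar> \<le> C * \<epsilon>" using NM C\<epsilon> M0 by simp
    from piece_jet[OF C \<epsilon> _ e u v l, of q q' "U / M^2" 0]
    show ?thesis unfolding g_def using N by (simp add: diff_divide_distrib mult.commute)
  qed
  define K where "K = {(k1, k2). g (of_int k1) (of_int k2) \<noteq> 0}"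
  \<comment> \<open>Centre of the relevant \<open>k1\<close>, taken at the row
    \<open>k2 = T * snd q\<close>. Relative to the sheared grid the strip drifts by at most
    \<open>M * C / N = C * T\<close> per row, hence by \<open>C * T^2\<close> within
    \<open>T\<close> rows.\<close>
  define Z where "Z = M^2 * \<xi> + M * (of_int m / M + \<mu>) * (T * of_int (snd q))"
  have Kb: "\<bar>N * (of_int k2 / M) - of_int (snd q)\<bar> < 1"
     "\<bar>N * ((of_int k1 - of_int m * of_int k2) / M^2) - of_int (fst q)\<bar> < 1"
     "\<bar>of_int k2 - T * of_int (snd q)\<bar> \<le> T" "\<bar>of_int k1 - Z\<bar> \<le> 2 * C * T^2"
    if k: "(k1, k2) \<in> K" for k1 k2
  proof -
    let ?x = "(of_int k1 - of_int m * of_int k2) / M^2" and ?y = "of_int k2 / M"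
    have p0: "?p ?x ?y \<noteq> 0" using k by (simp add: K_def g_def)
    then have w: "window N q ?x ?y \<noteq> 0" by (auto simp: piece_def)
    from window_active[OF w] show k2: "\<bar>N * ?y - of_int (snd q)\<bar> < 1" and "\<bar>N * ?x - of_int (fst q)\<bar> < 1" by auto
    have y: "N * ?y = of_int k2 / T" using N T by (simp add: M_def)
    have "of_int k2 - T * of_int (snd q) = T * (N * ?y - of_int (snd q))" unfolding y using T by (simp add: right_diff_distrib)
    then have "\<bar>of_int k2 - T * of_int (snd q)\<bar> = T * \<bar>N * ?y - of_int (snd q)\<bar>" using T by (simp add: abs_mult)
    also have "\<dots> \<le> T * 1" using k2 T by (intro mult_left_mono) auto
    finally show k2': "\<bar>of_int k2 - T * of_int (snd q)\<bar> \<le> T" by simp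
    have "\<bar>?x - \<xi> - \<mu> * ?y\<bar> \<le> C / N^2" by (rule supp[OF p0])
    then have "M^2 * \<bar>?x - \<xi> - \<mu> * ?y\<bar> \<le> M^2 * (C / N^2)" by (rule mult_left_mono) simp
    also have "\<dots> = C * T^2" using N by (simp add: M_def power_mult_distrib)
    finally have "\<bar>M^2 * (?x - \<xi> - \<mu> * ?y)\<bar> \<le> C * T^2" by (simp add: abs_mult)
    also have "M^2 * (?x - \<xi> - \<mu> * ?y) = of_int k1 - M^2 * \<xi> - M * (of_int m / M + \<mu>) * of_int k2"
      using M0 by (simp add: field_simps power2_eq_square)
    also have "\<dots> = (of_int k1 - Z) - M * (of_int m / M + \<mu>) * (of_int k2 - T * of_int (snd q))"
      unfolding Z_def by (simp add: algebra_simps)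
    finally have 1: "\<bar>(of_int k1 - Z) - M * (of_int m / M + \<mu>) * (of_int k2 - T * of_int (snd q))\<bar> \<le> C * T^2" .
    have "\<bar>M * (of_int m / M + \<mu>) * (of_int k2 - T * of_int (snd q))\<bar>
        = M * \<bar>\<mu> + of_int m / M\<bar> * \<bar>of_int k2 - T * of_int (snd q)\<bar>" using M0 by (simp add: abs_mult add.commute)
    also have "\<dots> \<le> M * (C / N) * T" using \<mu> k2' M0 C N by (intro mult_mono) auto
    also have "\<dots> = C * T^2" using N by (simp add: M_def power2_eq_square)
    finally have 2: "\<bar>M * (of_int m / M + \<mu>) * (of_int k2 - T * of_int (snd q))\<bar> \<le> C * T^2" .
    have "\<bar>a\<bar> \<le> 2 * C * T^2" if "\<bar>a - b\<bar> \<le> C * T^2" "\<bar>b\<bar> \<le> C * T^2" for a b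
      using that by linarith
    from this[OF 1 2] show "\<bar>of_int k1 - Z\<bar> \<le> 2 * C * T^2" .
  qed
  define K1 where "K1 = {k::int. \<bar>of_int k - Z\<bar> \<le> 2 * C * T^2}"
  define K2 where "K2 = {k::int. \<bar>of_int k - T * of_int (snd q)\<bar> \<le> T}"
  have T2: "1 \<le> T^2" "1 \<le> C * T^2" using T C mult_mono[of 1 C 1 "T^2"] by (auto simp: one_le_power)
  have K1: "finite K1" "real (card K1) \<le> 5 * C * T^2" and K2: "finite K2" "real (card K2) \<le> 3 * T"
    unfolding K1_def K2_def
    using card_int_near[of "2 * C * T^2" Z] card_int_near[of T "T * of_int (snd q)"] T2 T by auto
  have KK: "K \<subseteq> K1 \<times> K2" using Kb(3,4) by (auto simp: K1_def K2_def)
  have finK: "finite K" using finite_subset[OF KK] K1 K2 by simp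
  have "card K \<le> card K1 * card K2" using card_mono[OF _ KK] K1 K2 by (simp add: card_cartesian_product)
  then have "real (card K) \<le> real (card K1) * real (card K2)" by (metis of_nat_le_iff of_nat_mult)
  also have "\<dots> \<le> (5 * C * T^2) * (3 * T)" using K1 K2 C by (intro mult_mono) auto
  finally have cardK: "real (card K) \<le> 15 * C * T^3" by (simp add: power2_eq_square power3_eq_cube algebra_simps)
  define coef where "coef k1 k2 = g (of_int k1) (of_int k2)" for k1 k2 :: int
  have main: "\<bar>?p x y - (\<Sum>(k1, k2)\<in>K. coef k1 k2 *
          kernel (M^2 * x + of_int m * (M * y) - of_int k1) * kernel (M * y - of_int k2))\<bar> \<le> 96 * piece_const C / T^3"
    for x y
  proof -
    have "interp2 coef (M^2 * x + of_int m * (M * y)) (M * y) = (\<Sum>(k1, k2)\<in>K. coef k1 k2 *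
          kernel (M^2 * x + of_int m * (M * y) - of_int k1) * kernel (M * y - of_int k2))"
      by (rule interp2_eq_sum[OF finK]) (auto simp: K_def coef_def)
    moreover have "\<bar>g (M^2 * x + of_int m * (M * y)) (M * y) - interp2 coef (M^2 * x + of_int m * (M * y)) (M * y)\<bar>
        \<le> 96 * piece_const C * \<epsilon>^3"
      unfolding coef_def by (rule interp2_error[OF jU jV \<epsilon>(1)])
    ultimately show ?thesis unfolding g_eq by (simp add: \<epsilon>_def power_divide)
  qed
  \<comment> \<open>The error can be nonzero where the piece vanishes, but then a node with nonzero
    sample is within reach of the kernel. Two grid units change \<open>N * x\<close> by at most 4,
    \<open>N * y\<close> by at most 2 and the strip coordinate by at most
    \<open>4 * C / N^2\<close>.\<close>
  have supp': "\<bar>N * x - of_int (fst q)\<bar> \<le> 6 \<and> \<bar>N * y - of_int (snd q)\<bar> \<le> 6 \<and>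
          \<bar>x - \<xi> - \<mu> * y\<bar> \<le> 5 * C / N^2"
    if E: "?p x y - (\<Sum>(k1, k2)\<in>K. coef k1 k2 *
          kernel (M^2 * x + of_int m * (M * y) - of_int k1) * kernel (M * y - of_int k2)) \<noteq> 0" for x y
  proof (cases "?p x y = 0")
    case False
    then have "window N q x y \<noteq> 0" by (auto simp: piece_def)
    moreover have "C / N^2 \<le> 5 * C / N^2" using C by (intro divide_right_mono) auto
    ultimately show ?thesis using window_active[of N q x y] supp[OF False] by auto
  next
    case True
    with E obtain k1 k2 where k: "(k1, k2) \<in> K"
      and ker: "kernel (M^2 * x + of_int m * (M * y) - of_int k1) \<noteq> 0" "kernel (M * y - of_int k2) \<noteq> 0"
      by (force elim!: sum.not_neutral_contains_not_neutral)
    define dU where "dU = M^2 * x + of_int m * (M * y) - of_int k1"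
    define dV where "dV = M * y - of_int k2"
    let ?x = "(of_int k1 - of_int m * of_int k2) / M^2" and ?y = "of_int k2 / M"
    have d: "\<bar>dU\<bar> \<le> 2" "\<bar>dV\<bar> \<le> 2" using ker kernel_nonzero(2) unfolding dU_def dV_def by blast+
    have ey: "y = ?y + dV / M" using M0 by (simp add: dV_def field_simps)
    have ex: "x = ?x + (dU - of_int m * dV) / M^2" using M0 by (simp add: dU_def dV_def field_simps power2_eq_square)
    have "N * \<bar>dV / M\<bar> = \<epsilon> * \<bar>dV\<bar>" unfolding NM[symmetric] using M0 by simp
    also have "\<dots> \<le> 1 * 2" using d \<epsilon> by (intro mult_mono) auto
    finally have y2: "N * \<bar>dV / M\<bar> \<le> 2" by simp
    have "\<bar>dU - of_int m * dV\<bar> \<le> 2 + M * 2"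
    proof -
      have "\<bar>of_int m * dV\<bar> \<le> M * 2" unfolding abs_mult using m d M0 by (intro mult_mono) auto
      then show ?thesis using d by linarith
    qed
    also have "\<dots> \<le> 4 * M" using M0 by simp
    finally have "N * \<bar>(dU - of_int m * dV) / M^2\<bar> \<le> N * (4 * M / M^2)" using N M0
      by (intro mult_left_mono) (auto simp: abs_mult divide_right_mono)
    also have "\<dots> = 4 * \<epsilon>" unfolding NM[symmetric] using M0 by (simp add: power2_eq_square)
    finally have x2: "N * \<bar>(dU - of_int m * dV) / M^2\<bar> \<le> 4" using \<epsilon> by linarith
    have "N * y - of_int (snd q) = (N * ?y - of_int (snd q)) + N * (dV / M)"
      by (subst ey) (simp only: ring_distribs)
    moreover have "\<bar>N * (dV / M)\<bar> \<le> 2" using y2 N by (simp add: abs_mult)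
    ultimately have b2: "\<bar>N * y - of_int (snd q)\<bar> \<le> 6" using Kb(1)[OF k] by linarith
    have "N * x - of_int (fst q) = (N * ?x - of_int (fst q)) + N * ((dU - of_int m * dV) / M^2)"
      by (subst ex) (simp only: ring_distribs)
    moreover have "\<bar>N * ((dU - of_int m * dV) / M^2)\<bar> \<le> 4" using x2 N by (simp add: abs_mult)
    ultimately have b1: "\<bar>N * x - of_int (fst q)\<bar> \<le> 6" using Kb(2)[OF k] by linarith
    have "?p ?x ?y \<noteq> 0" using k by (simp add: K_def g_def)
    then have s: "\<bar>?x - \<xi> - \<mu> * ?y\<bar> \<le> C / N^2" by (rule supp)
    have "x - \<xi> - \<mu> * y = (?x - \<xi> - \<mu> * ?y) + (dU / M^2 - (\<mu> + of_int m / M) * (dV / M))"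
      using M0 by (subst ex, subst ey) (simp add: field_simps power2_eq_square)
    moreover have "\<bar>dU / M^2\<bar> \<le> 2 * C / N^2"
    proof -
      have "\<bar>dU / M^2\<bar> \<le> 2 / M^2" using d by (simp add: divide_right_mono)
      also have "\<dots> \<le> (2 * C) / N^2" using C M0 N by (intro frac_le power_mono) auto
      finally show ?thesis .
    qed
    moreover have "\<bar>(\<mu> + of_int m / M) * (dV / M)\<bar> \<le> 2 * C / N^2"
    proof -
      have "\<bar>dV / M\<bar> \<le> 2 / N" using d N M0 by (simp add: abs_mult) (intro frac_le, auto)
      then have "\<bar>(\<mu> + of_int m / M) * (dV / M)\<bar> \<le> (C / N) * (2 / N)"
        unfolding abs_mult using \<mu> C N by (intro mult_mono) auto
      then show ?thesis by (simp add: power2_eq_square algebra_simps)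
    qed
    moreover have "C / N^2 + 2 * C / N^2 + 2 * C / N^2 = 5 * C / N^2" by (simp add: field_simps)
    ultimately have "\<bar>x - \<xi> - \<mu> * y\<bar> \<le> 5 * C / N^2" using s by linarith
    with b1 b2 show ?thesis by blast
  qed
  show ?thesis
    apply (rule exI[of _ K], rule exI[of _ coef])
    using finK cardK Kb(1,2) main supp' unfolding Let_def by (fastforce intro: less_imp_le)
qed

text \<open>For \<open>M = 2 ^ L\<close> this is the shearlet of level \<open>j = 2 * L\<close>
  without its normalising factor; \<open>i = 1\<close> exchanges the coordinates.\<close>

definition elem :: "real \<Rightarrow> int \<Rightarrow> nat \<Rightarrow> int \<times> int \<Rightarrow> real \<Rightarrow> real \<Rightarrow> real" where
  "elem M m i k x y = (if i = 0
     then kernel (M^2 * x + of_int m * (M * y) - of_int (fst k)) * kernel (M * y - of_int (snd k))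
     else kernel (M^2 * y + of_int m * (M * x) - of_int (fst k)) * kernel (M * x - of_int (snd k)))"

text \<open>The bounds on the indices \<open>k\<close> serve the polynomial in the selection rule.
  The affine form \<open>\<beta>\<close> describes the strip that carries the error, and the lower
  bound on one of its coefficients controls the area of that strip.\<close>

definition approx_data where
  "approx_data D N T q f i m K coef \<beta> \<longleftrightarrow> (i \<in> {0, 1} \<and> \<bar>of_int m\<bar> \<le> N * T \<and>
     finite K \<and> real (card K) \<le> D * T^3 \<and>
     (\<forall>k\<in>K. \<bar>of_int (fst k)\<bar> \<le> N * T^2 * (\<bar>of_int (fst q)\<bar> + \<bar>of_int (snd q)\<bar> + 2) \<and>
             \<bar>of_int (snd k)\<bar> \<le> N * T^2 * (\<bar>of_int (fst q)\<bar> + \<bar>of_int (snd q)\<bar> + 2)) \<and>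
     (1/2 \<le> \<bar>fst \<beta>\<bar> \<or> 1/2 \<le> \<bar>fst (snd \<beta>)\<bar>) \<and>
     (\<forall>x y. \<bar>f x y - (\<Sum>k\<in>K. coef k * elem (N * T) m i k x y)\<bar> \<le> D / T^3 \<and>
       (f x y - (\<Sum>k\<in>K. coef k * elem (N * T) m i k x y) \<noteq> 0 \<longrightarrow>
          \<bar>N * x - of_int (fst q)\<bar> \<le> 6 \<and> \<bar>N * y - of_int (snd q)\<bar> \<le> 6 \<and> \<bar>aff \<beta> x y\<bar> \<le> D / N^2)))"

definition approximable :: "real \<Rightarrow> real \<Rightarrow> real \<Rightarrow> int \<times> int \<Rightarrow> (real \<Rightarrow> real \<Rightarrow> real) \<Rightarrow> bool" where
  "approximable D N T q f \<longleftrightarrow> (\<exists>i m K coef \<beta>. approx_data D N T q f i m K coef \<beta>)"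

lemma approximable_swap:
  assumes "approximable D N T (prod.swap q) (\<lambda>x y. f y x)"
  shows "approximable D N T q f"
proof -
  from assms obtain i m K coef \<beta> where "approx_data D N T (prod.swap q) (\<lambda>x y. f y x) i m K coef \<beta>"
    unfolding approximable_def by blast
  note h = this[unfolded approx_data_def fst_swap snd_swap]
  have e: "elem (N * T) m (1 - i) k x y = elem (N * T) m i k y x" for k x y
    using h by (auto simp: elem_def)
  have a: "aff (fst (snd \<beta>), fst \<beta>, snd (snd \<beta>)) x y = aff \<beta> y x" for x y by (simp add: aff_def)
  show ?thesis unfolding approximable_def approx_data_def
  proof (rule exI[of _ "1 - i"], rule exI[of _ m], rule exI[of _ K], rule exI[of _ coef],
      rule exI[of _ "(fst (snd \<beta>), fst \<beta>, snd (snd \<beta>))"], intro conjI)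
    show "\<forall>x y. \<bar>f x y - (\<Sum>k\<in>K. coef k * elem (N * T) m (1 - i) k x y)\<bar> \<le> D / T^3 \<and>
       (f x y - (\<Sum>k\<in>K. coef k * elem (N * T) m (1 - i) k x y) \<noteq> 0 \<longrightarrow>
          \<bar>N * x - of_int (fst q)\<bar> \<le> 6 \<and> \<bar>N * y - of_int (snd q)\<bar> \<le> 6 \<and>
          \<bar>aff (fst (snd \<beta>), fst \<beta>, snd (snd \<beta>)) x y\<bar> \<le> D / N^2)"
      unfolding e a
    proof (intro allI)
      fix x y
      note h[THEN conjunct2, THEN conjunct2, THEN conjunct2, THEN conjunct2, THEN conjunct2, THEN conjunct2,
        THEN spec[of _ y], THEN spec[of _ x]]
      then show "\<bar>f x y - (\<Sum>k\<in>K. coef k * elem (N * T) m i k y x)\<bar> \<le> D / T^3 \<and>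
       (f x y - (\<Sum>k\<in>K. coef k * elem (N * T) m i k y x) \<noteq> 0 \<longrightarrow>
          \<bar>N * x - of_int (fst q)\<bar> \<le> 6 \<and> \<bar>N * y - of_int (snd q)\<bar> \<le> 6 \<and>
          \<bar>aff \<beta> y x\<bar> \<le> D / N^2)" by (simp only: conj_ac) (elim conjE, intro conjI TrueI)
    qed
    show "\<forall>k\<in>K. \<bar>of_int (fst k)\<bar> \<le> N * T^2 * (\<bar>of_int (fst q)\<bar> + \<bar>of_int (snd q)\<bar> + 2) \<and>
             \<bar>of_int (snd k)\<bar> \<le> N * T^2 * (\<bar>of_int (fst q)\<bar> + \<bar>of_int (snd q)\<bar> + 2)"
      using h by (simp only: add.commute[of "\<bar>of_int (fst q)\<bar>"]) blast
  qed (use h in auto)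
qed

definition approx_const :: "real \<Rightarrow> real" where
  "approx_const C = 96 * piece_const C + 15 * C"

lemma piece_const_nonneg: "0 \<le> C \<Longrightarrow> 0 \<le> piece_const C"
  by (simp add: piece_const_def)

lemma piece_approximable_sheared:
  fixes C N T :: real and m :: int
  assumes C: "1 \<le> C" and N: "1 \<le> N" and T: "1 \<le> T" and e: "e = 0 \<or> e = 1"
    and m: "\<bar>of_int m\<bar> \<le> N * T"
    and a: "\<bar>fst \<alpha>\<bar> \<le> C" "\<bar>fst \<alpha>'\<bar> \<le> C"
    and b: "\<bar>fst (snd \<alpha>) - fst \<alpha> * of_int m / (N * T)\<bar> \<le> C / N"
      "\<bar>fst (snd \<alpha>') - fst \<alpha>' * of_int m / (N * T)\<bar> \<le> C / N"
    and supp: "\<And>x y. piece N q q' \<alpha> \<alpha>' e x y \<noteq> 0 \<Longrightarrow> \<bar>x - \<xi> - \<mu> * y\<bar> \<le> C / N^2"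
    and \<mu>: "\<bar>\<mu> + of_int m / (N * T)\<bar> \<le> C / N"
  shows "approximable (approx_const C) N T q (piece N q q' \<alpha> \<alpha>' e)"
proof -
  let ?M = "N * T"
  obtain K coef where fin: "finite K" and card: "real (card K) \<le> 15 * C * T^3"
    and Kb: "\<And>k1 k2. (k1, k2)\<in>K \<Longrightarrow> \<bar>N * (of_int k2 / ?M) - of_int (snd q)\<bar> \<le> 1 \<and>
        \<bar>N * ((of_int k1 - of_int m * of_int k2) / ?M^2) - of_int (fst q)\<bar> \<le> 1"
    and E: "\<And>x y. let E = piece N q q' \<alpha> \<alpha>' e x y - (\<Sum>(k1, k2)\<in>K. coef k1 k2 *
          kernel (?M^2 * x + of_int m * (?M * y) - of_int k1) * kernel (?M * y - of_int k2)) in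
       \<bar>E\<bar> \<le> 96 * piece_const C / T^3 \<and>
       (E \<noteq> 0 \<longrightarrow> \<bar>N * x - of_int (fst q)\<bar> \<le> 6 \<and> \<bar>N * y - of_int (snd q)\<bar> \<le> 6 \<and>
          \<bar>x - \<xi> - \<mu> * y\<bar> \<le> 5 * C / N^2)"
  proof -
    obtain K coef where K: "finite K \<and> real (card K) \<le> 15 * C * T^3 \<and>
    (\<forall>(k1, k2)\<in>K. \<bar>N * (of_int k2 / ?M) - of_int (snd q)\<bar> \<le> 1 \<and>
        \<bar>N * ((of_int k1 - of_int m * of_int k2) / ?M^2) - of_int (fst q)\<bar> \<le> 1) \<and>
    (\<forall>x y. let E = piece N q q' \<alpha> \<alpha>' e x y - (\<Sum>(k1, k2)\<in>K. coef k1 k2 *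
          kernel (?M^2 * x + of_int m * (?M * y) - of_int k1) * kernel (?M * y - of_int k2)) in
       \<bar>E\<bar> \<le> 96 * piece_const C / T^3 \<and>
       (E \<noteq> 0 \<longrightarrow> \<bar>N * x - of_int (fst q)\<bar> \<le> 6 \<and> \<bar>N * y - of_int (snd q)\<bar> \<le> 6 \<and>
          \<bar>x - \<xi> - \<mu> * y\<bar> \<le> 5 * C / N^2))"
      by atomize_elim (rule piece_approx_sheared[OF C N T e m a b _ \<mu>], erule supp)
    show ?thesis
      by (rule that[OF K[THEN conjunct1] K[THEN conjunct2, THEN conjunct1]])
        (use K[THEN conjunct2, THEN conjunct2, THEN conjunct1] in fast,
         rule K[THEN conjunct2, THEN conjunct2, THEN conjunct2, THEN spec, THEN spec])
  qed
  have P: "0 \<le> piece_const C" using C piece_const_nonneg by simp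
  have sums: "(\<Sum>(k1, k2)\<in>K. coef k1 k2 *
          kernel (?M^2 * x + of_int m * (?M * y) - of_int k1) * kernel (?M * y - of_int k2))
     = (\<Sum>k\<in>K. (case k of (k1, k2) \<Rightarrow> coef k1 k2) * elem ?M m 0 k x y)" for x y
    by (intro sum.cong) (auto simp: elem_def)
  have M: "0 < ?M" "N \<le> ?M" "1 \<le> ?M" "T \<le> N * T^2" "N * T * T = N * T^2"
    using N T mult_mono[of 1 N 1 T] mult_mono[of N N 1 T] mult_mono[of 1 "N * T" T T]
    by (auto simp: power2_eq_square)
  let ?q = "\<bar>of_int (fst q)\<bar> + \<bar>of_int (snd q)\<bar> + (2::real)"
  have kb: "\<bar>of_int k1\<bar> \<le> N * T^2 * ?q \<and> \<bar>of_int k2\<bar> \<le> N * T^2 * ?q" if k: "(k1, k2) \<in> K" for k1 k2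
  proof -
    have 2: "\<bar>of_int k2 / T - of_int (snd q)\<bar> \<le> 1" using Kb[OF k] N T by simp
    then have "\<bar>of_int k2 / T\<bar> \<le> \<bar>of_int (snd q)\<bar> + 1" by linarith
    then have k2: "\<bar>of_int k2\<bar> \<le> T * (\<bar>of_int (snd q)\<bar> + 1)" using T by (simp add: field_simps)
    also have "\<dots> \<le> N * T^2 * ?q" using M T by (intro mult_mono) auto
    finally have k2': "\<bar>of_int k2\<bar> \<le> N * T^2 * ?q" .
    have NM: "N / ?M^2 = 1 / (N * T^2)" using N T by (simp add: field_simps power2_eq_square)
    have "\<bar>(of_int k1 - of_int m * of_int k2) * (N / ?M^2) - of_int (fst q)\<bar> \<le> 1"
      using Kb[OF k] by (simp add: mult.commute)
    then have "\<bar>(of_int k1 - of_int m * of_int k2) * (N / ?M^2)\<bar> \<le> \<bar>of_int (fst q)\<bar> + 1" by linarith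
    then have "\<bar>of_int k1 - of_int m * of_int k2\<bar> \<le> N * T^2 * (\<bar>of_int (fst q)\<bar> + 1)"
      unfolding NM using N T by (simp add: field_simps abs_mult)
    moreover have "\<bar>of_int m * of_int k2\<bar> \<le> (N * T) * (T * (\<bar>of_int (snd q)\<bar> + 1))"
      unfolding abs_mult using m k2 M by (intro mult_mono) auto
    ultimately have "\<bar>of_int k1\<bar> \<le> N * T^2 * (\<bar>of_int (fst q)\<bar> + 1) + N * T^2 * (\<bar>of_int (snd q)\<bar> + 1)"
      by (simp add: power2_eq_square mult.assoc)
    also have "\<dots> = N * T^2 * ?q" by (simp add: algebra_simps)
    finally show ?thesis using k2' by simp
  qed
  show ?thesis unfolding approximable_def approx_data_def
  proof (rule exI[of _ 0], rule exI[of _ m], rule exI[of _ K], rule exI[of _ "\<lambda>k. case k of (k1, k2) \<Rightarrow> coef k1 k2"],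
      rule exI[of _ "(1, - \<mu>, - \<xi>)"], intro conjI)
    have "15 * C * T^3 \<le> approx_const C * T^3" using P T by (intro mult_right_mono) (auto simp: approx_const_def)
    then show "real (card K) \<le> approx_const C * T^3" using card by linarith
    have c1: "96 * piece_const C / T^3 \<le> approx_const C / T^3" and c2: "5 * C / N^2 \<le> approx_const C / N^2"
      using P C T by (auto intro!: divide_right_mono simp: approx_const_def)
    have af: "aff (1, - \<mu>, - \<xi>) x y = x - \<xi> - \<mu> * y" for x y by (simp add: aff_def)
    show "\<forall>x y. \<bar>piece N q q' \<alpha> \<alpha>' e x y - (\<Sum>k\<in>K. (case k of (k1, k2) \<Rightarrow> coef k1 k2) * elem (N * T) m 0 k x y)\<bar>
        \<le> approx_const C / T^3 \<and>
       (piece N q q' \<alpha> \<alpha>' e x y - (\<Sum>k\<in>K. (case k of (k1, k2) \<Rightarrow> coef k1 k2) * elem (N * T) m 0 k x y) \<noteq> 0 \<longrightarrow>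
          \<bar>N * x - of_int (fst q)\<bar> \<le> 6 \<and> \<bar>N * y - of_int (snd q)\<bar> \<le> 6 \<and>
          \<bar>aff (1, - \<mu>, - \<xi>) x y\<bar> \<le> approx_const C / N^2)"
      using E c1 c2 unfolding sums Let_def af by (meson order_trans)
  qed (use m fin kb in auto)
qed

lemma round_abs_le:
  fixes z :: real
  assumes "\<bar>z\<bar> \<le> of_int n"
  shows "\<bar>round z\<bar> \<le> n"
proof -
  have "round z \<le> round (of_int n :: real)" "round (of_int (- n) :: real) \<le> round z"
    using assms by (intro round_mono; simp)+
  then show ?thesis by (simp only: round_of_int)
qed

text \<open>The shear is the rounded slope \<open>M * b / a\<close> of the coarse line; since the
  slope is at most 1 and \<open>M\<close> is an integer, rounding keeps
  \<open>\<bar>m\<bar> \<le> M\<close>. The fine line is constant or within \<open>C / N\<close> of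
  the coarse one, so the same shear fits both; three errors of size \<open>C / N\<close> give the
  factor 3.\<close>

lemma piece_approximable_steep:
  fixes C N T :: real
  assumes C: "1 \<le> C" and N: "1 \<le> N" and T: "1 \<le> T" and e: "e = 0 \<or> e = 1"
    and M: "N * T = of_int Mi"
    and a: "\<bar>fst \<alpha>\<bar> \<le> C" "\<bar>fst \<alpha>'\<bar> \<le> C"
    and d: "1/2 \<le> \<bar>fst \<alpha>'\<bar>" "\<bar>fst (snd \<alpha>')\<bar> \<le> \<bar>fst \<alpha>'\<bar>"
    and near: "(fst \<alpha> = 0 \<and> fst (snd \<alpha>) = 0) \<or>
       (\<bar>fst \<alpha> - fst \<alpha>'\<bar> \<le> C / N \<and> \<bar>fst (snd \<alpha>) - fst (snd \<alpha>')\<bar> \<le> C / N)"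
    and supp: "\<And>x y. piece N q q' \<alpha> \<alpha>' e x y \<noteq> 0 \<Longrightarrow> \<bar>aff \<alpha>' x y\<bar> \<le> C / N^2"
  shows "approximable (approx_const (3 * C)) N T q (piece N q q' \<alpha> \<alpha>' e)"
proof -
  let ?M = "N * T" and ?a = "fst \<alpha>'" and ?b = "fst (snd \<alpha>')"
  define m where "m = round (?M * ?b / ?a)"
  have a0: "?a \<noteq> 0" using d by auto
  have M0: "0 < ?M" "N \<le> ?M" using N T mult_mono[of 1 N 1 T] mult_mono[of N N 1 T] by auto
  have "\<bar>?b / ?a\<bar> \<le> 1" using d a0 by (simp add: divide_le_eq)
  then have "?M * \<bar>?b / ?a\<bar> \<le> ?M * 1" using M0 by (intro mult_left_mono) auto
  then have "\<bar>?M * ?b / ?a\<bar> \<le> of_int Mi" using M M0 by (simp add: abs_mult)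
  from round_abs_le[OF this] have m: "\<bar>of_int m\<bar> \<le> ?M" unfolding M m_def by linarith
  have r: "\<bar>of_int m - ?M * ?b / ?a\<bar> \<le> 1/2" unfolding m_def by (rule of_int_round_abs_le)
  have "\<bar>?b / ?a - of_int m / ?M\<bar> = \<bar>of_int m - ?M * ?b / ?a\<bar> / ?M"
  proof -
    have "?b / ?a - of_int m / ?M = - (of_int m - ?M * ?b / ?a) / ?M"
      using M0 N T by (simp add: diff_divide_distrib)
    then show ?thesis using M0 by (simp only: abs_divide abs_minus_cancel abs_of_pos)
  qed
  also have "\<dots> \<le> (1/2) / N" using r M0 N by (intro frac_le) auto
  finally have mu: "\<bar>?b / ?a - of_int m / ?M\<bar> \<le> (1/2) / N" .
  have C3: "1 / 2 / N \<le> (3 * C) / N" using C N by (intro divide_right_mono) auto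
  have "?b - ?a * of_int m / ?M = ?a * (?b / ?a - of_int m / ?M)" using a0 by (simp add: field_simps)
  then have "\<bar>?b - ?a * of_int m / ?M\<bar> \<le> C * ((1/2) / N)"
    unfolding abs_mult[symmetric] using mult_mono[OF a(2) mu] C by (simp add: abs_mult)
  then have b': "\<bar>?b - ?a * of_int m / ?M\<bar> \<le> C / N" using C N by (simp add: field_simps)
  have CN: "0 \<le> C / N" "3 * C / N = C / N + C / N + C / N" using C N by auto
  have b: "\<bar>fst (snd \<alpha>) - fst \<alpha> * of_int m / ?M\<bar> \<le> 3 * C / N"
    using near
  proof
    assume n: "\<bar>fst \<alpha> - fst \<alpha>'\<bar> \<le> C / N \<and> \<bar>fst (snd \<alpha>) - fst (snd \<alpha>')\<bar> \<le> C / N"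
    have "\<bar>of_int m / ?M\<bar> \<le> 1" using m M0 by (simp add: divide_le_eq)
    then have "\<bar>(fst \<alpha> - ?a) * (of_int m / ?M)\<bar> \<le> C / N * 1"
      unfolding abs_mult using n CN by (intro mult_mono) auto
    moreover have "fst (snd \<alpha>) - fst \<alpha> * of_int m / ?M = (?b - ?a * of_int m / ?M)
        + (fst (snd \<alpha>) - ?b) - (fst \<alpha> - ?a) * (of_int m / ?M)"
    proof -
      have "b - a * r = (b' - a' * r) + (b - b') - (a - a') * r" for a a' b b' r :: real
        by (simp add: algebra_simps)
      then show ?thesis unfolding times_divide_eq_right[symmetric] .
    qed
    ultimately show ?thesis using n b' CN by linarith
  qed (use CN in auto)
  show ?thesis
  proof (rule piece_approximable_sheared[OF _ N T e m, where \<xi> = "- snd (snd \<alpha>') / ?a" and \<mu> = "- ?b / ?a"])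
    show "\<bar>?b - ?a * of_int m / ?M\<bar> \<le> 3 * C / N" using b' CN by linarith
    show "\<bar>- ?b / ?a + of_int m / ?M\<bar> \<le> 3 * C / N" using mu C3 by (simp add: abs_minus_commute)
    fix x y assume p: "piece N q q' \<alpha> \<alpha>' e x y \<noteq> 0"
    have "x - - snd (snd \<alpha>') / ?a - - ?b / ?a * y = aff \<alpha>' x y / ?a" using a0 by (simp add: aff_def field_simps)
    then have "\<bar>x - - snd (snd \<alpha>') / ?a - - ?b / ?a * y\<bar> = \<bar>aff \<alpha>' x y\<bar> / \<bar>?a\<bar>" by (simp add: abs_divide)
    also have "\<dots> \<le> (C / N^2) / (1/2)" using supp[OF p] d C by (intro frac_le) auto
    also have "\<dots> \<le> 3 * C / N^2" using C by (simp add: divide_right_mono)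
    finally show "\<bar>x - - snd (snd \<alpha>') / ?a - - ?b / ?a * y\<bar> \<le> 3 * C / N^2" .
  qed (use a b C in auto)
qed

text \<open>Of the two coefficients of a normal of length at least 1 the larger is at least 1/2. If
  it belongs to \<open>y\<close>, the axes are exchanged, which is the second cone.\<close>

lemma piece_approximable:
  fixes C N T :: real
  assumes C: "1 \<le> C" and N: "1 \<le> N" and T: "1 \<le> T" and e: "e = 0 \<or> e = 1"
    and M: "N * T = of_int Mi"
    and a: "\<bar>fst \<alpha>\<bar> \<le> C" "\<bar>fst \<alpha>'\<bar> \<le> C" "\<bar>fst (snd \<alpha>)\<bar> \<le> C" "\<bar>fst (snd \<alpha>')\<bar> \<le> C"
    and d: "1 \<le> (fst \<alpha>')^2 + (fst (snd \<alpha>'))^2"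
    and near: "(fst \<alpha> = 0 \<and> fst (snd \<alpha>) = 0) \<or>
       (\<bar>fst \<alpha> - fst \<alpha>'\<bar> \<le> C / N \<and> \<bar>fst (snd \<alpha>) - fst (snd \<alpha>')\<bar> \<le> C / N)"
    and supp: "\<And>x y. piece N q q' \<alpha> \<alpha>' e x y \<noteq> 0 \<Longrightarrow> \<bar>aff \<alpha>' x y\<bar> \<le> C / N^2"
  shows "approximable (approx_const (3 * C)) N T q (piece N q q' \<alpha> \<alpha>' e)"
proof -
  have half: "1/2 \<le> \<bar>x\<bar>" if "1 \<le> x^2 + y^2" "\<bar>y\<bar> \<le> \<bar>x\<bar>" for x y :: real
  proof (rule ccontr)
    assume "\<not> 1/2 \<le> \<bar>x\<bar>"
    then have "x^2 \<le> (1/2)^2" "y^2 \<le> (1/2)^2" using that by (auto simp: abs_le_square_iff[symmetric])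
    then show False using that by (simp add: power2_eq_square)
  qed
  show ?thesis
  proof (cases "\<bar>fst (snd \<alpha>')\<bar> \<le> \<bar>fst \<alpha>'\<bar>")
    case True
    show ?thesis by (rule piece_approximable_steep[OF C N T e M a(1,2) half[OF d True] True near supp])
  next
    case False
    define sw where "sw l = (fst (snd l), fst l, snd (snd l))" for l :: "real \<times> real \<times> real"
    have p: "piece N q q' \<alpha> \<alpha>' e y x = piece N (prod.swap q) (prod.swap q') (sw \<alpha>) (sw \<alpha>') e x y" for x y
      by (simp add: piece_def window_def aff_def sw_def mult.commute add.commute)
    have af: "aff (sw l) x y = aff l y x" for l x y by (simp add: aff_def sw_def)
    have h: "1/2 \<le> \<bar>fst (snd \<alpha>')\<bar>" by (rule half[of _ "fst \<alpha>'"]) (use d False in auto)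
    show ?thesis
    proof (rule approximable_swap, unfold p, rule piece_approximable_steep[OF C N T e M])
      fix x y assume "piece N (prod.swap q) (prod.swap q') (sw \<alpha>) (sw \<alpha>') e x y \<noteq> 0"
      then show "\<bar>aff (sw \<alpha>') x y\<bar> \<le> C / N^2" unfolding af p[symmetric] by (rule supp)
    qed (use a near False h in \<open>auto simp: sw_def\<close>)
  qed
qed

text \<open>At \<open>N = 1\<close> the tolerance \<open>C / N\<close> does not restrict the
  direction: the shear 0 serves every line, and the window itself plays the role of the
  strip.\<close>

lemma coarse_piece_approximable:
  assumes C: "1 \<le> C" and T: "1 \<le> T"
    and a: "\<bar>fst \<alpha>\<bar> \<le> C" "\<bar>fst (snd \<alpha>)\<bar> \<le> C"
  shows "approximable (approx_const C) 1 T q (piece 1 q q' \<alpha> \<alpha>' 0)"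
proof -
  have e: "piece 1 q q' \<alpha> \<alpha>' 0 = piece 1 q q' \<alpha> (0, 0, 0) 0" by (simp add: piece_def fun_eq_iff)
  show ?thesis unfolding e
  proof (rule piece_approximable_sheared[where m = 0 and \<xi> = "of_int (fst q)" and \<mu> = 0])
    fix x y assume "piece 1 q q' \<alpha> (0, 0, 0) 0 x y \<noteq> 0"
    then have "window 1 q x y \<noteq> 0" by (auto simp: piece_def)
    from window_active(1)[OF this] show "\<bar>x - of_int (fst q) - 0 * y\<bar> \<le> C / 1^2" using C by simp
  qed (use assms in auto)
qed

section \<open>Sets with flat boundary\<close>

text \<open>What the approximation uses of a star. \<open>G\<close> is a defining function that
  agrees to second order with an affine function at each boundary point, with one constant for the
  whole plane. \<open>cross\<close> says that membership changes only near the boundary,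
  \<open>sample\<close> that the boundary has finite length at every scale.\<close>

locale flat_set =
  fixes K :: real and S :: "real \<Rightarrow> real \<Rightarrow> bool" and G :: "real \<Rightarrow> real \<Rightarrow> real"
    and p1 p2 A1 A2 :: "real \<Rightarrow> real"
  assumes K: "2 \<le> K"
    and mem: "S x y \<longleftrightarrow> G x y \<le> 0"
    and flat: "\<bar>A1 \<phi> * (x - p1 \<phi>) + A2 \<phi> * (y - p2 \<phi>) - G x y\<bar> \<le> K * ((x - p1 \<phi>)^2 + (y - p2 \<phi>)^2)"
    and normal: "1 \<le> (A1 \<phi>)^2 + (A2 \<phi>)^2" "\<bar>A1 \<phi>\<bar> \<le> K" "\<bar>A2 \<phi>\<bar> \<le> K"
    and cross: "\<lbrakk>S x y; \<not> S x' y'; \<bar>x - x'\<bar> \<le> r; \<bar>y - y'\<bar> \<le> r\<rbrakk>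
       \<Longrightarrow> \<exists>\<phi>. \<bar>x' - p1 \<phi>\<bar> \<le> K * r \<and> \<bar>y' - p2 \<phi>\<bar> \<le> K * r"
    and sample: "\<lbrakk>0 < r; r \<le> 1\<rbrakk> \<Longrightarrow> \<exists>F. finite F \<and> real (card F) \<le> K / r \<and>
       (\<forall>\<phi>. \<exists>\<phi>'\<in>F. \<bar>p1 \<phi> - p1 \<phi>'\<bar> \<le> K * r \<and> \<bar>p2 \<phi> - p2 \<phi>'\<bar> \<le> K * r)"
    and box: "S x y \<Longrightarrow> 0 \<le> x \<and> x \<le> 1 \<and> 0 \<le> y \<and> y \<le> 1"

section \<open>Polar geometry of star-shaped sets\<close>

lemma periodic_int:
  fixes f :: "real \<Rightarrow> real"
  assumes "\<And>t. f (t + 2 * pi) = f t"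
  shows "f (t + of_int n * (2 * pi)) = f t"
proof -
  have nat: "f (t + real k * (2 * pi)) = f t" for k t
  proof (induction k arbitrary: t)
    case (Suc k)
    have "f (t + real (Suc k) * (2 * pi)) = f ((t + real k * (2 * pi)) + 2 * pi)" by (simp add: algebra_simps)
    then show ?case using assms Suc by simp
  qed simp
  show ?thesis
  proof (cases "n \<ge> 0")
    case True then show ?thesis using nat[of t "nat n"] by simp
  next
    case False
    then have "f (t + of_int n * (2 * pi)) = f ((t + of_int n * (2 * pi)) + real (nat (- n)) * (2 * pi))" by (simp only: nat)
    also have "(t + of_int n * (2 * pi)) + real (nat (- n)) * (2 * pi) = t" using False by (simp add: algebra_simps)
    finally show ?thesis .
  qed
qed

lemma abs_cos_diff_le: "\<bar>cos x - cos y\<bar> \<le> \<bar>x - y :: real\<bar>"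
proof -
  have "\<bar>cos x - cos y\<bar> = 2 * \<bar>sin ((x + y) / 2)\<bar> * \<bar>sin ((y - x) / 2)\<bar>"
    by (simp add: cos_diff_cos abs_mult)
  also have "\<dots> \<le> 2 * 1 * \<bar>(y - x) / 2\<bar>"
    using abs_sin_x_le_abs_x[of "(y - x) / 2"] by (intro mult_mono) auto
  finally show ?thesis by simp
qed

lemma abs_sin_diff_le: "\<bar>sin x - sin y\<bar> \<le> \<bar>x - y :: real\<bar>"
  using abs_cos_diff_le[of "pi/2 - x" "pi/2 - y"] by (simp add: cos_diff)

lemma sin_minus_self: "\<bar>sin x - x\<bar> \<le> x^2 / (2::real)"
  using Maclaurin_sin_bound[of x 2] by (simp add: numeral_2_eq_2 sin_coeff_def)

lemma one_minus_cos_le: "1 - cos x \<le> x^2 / (2::real)"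
proof -
  have "1 - cos x = 2 * (sin (x/2))^2" using cos_double_sin[of "x/2"] by simp
  also have "(sin (x/2))^2 \<le> (x/2)^2"
    using abs_sin_x_le_abs_x[of "x/2"] by (simp only: abs_le_square_iff)
  finally show ?thesis by (simp add: power_divide)
qed

lemma polar_dist:
  fixes r R \<theta> \<phi> :: real
  shows "(r * cos \<theta> - R * cos \<phi>)^2 + (r * sin \<theta> - R * sin \<phi>)^2
     = (r - R * cos (\<theta> - \<phi>))^2 + (R * sin (\<theta> - \<phi>))^2" (is "?l = ?r")
    and "(r * cos \<theta> - R * cos \<phi>)^2 + (r * sin \<theta> - R * sin \<phi>)^2
     = (r - R)^2 + 2 * r * R * (1 - cos (\<theta> - \<phi>))"
proof -
  have "(r * c - R * C)^2 + (r * s - R * S)^2 = r^2 * (s^2 + c^2) + R^2 * (S^2 + C^2) - 2 * r * R * (c * C + s * S)"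
    for c C s S :: real by (simp add: power2_eq_square algebra_simps)
  then have "?l = r^2 * ((sin \<theta>)^2 + (cos \<theta>)^2) + R^2 * ((sin \<phi>)^2 + (cos \<phi>)^2) - 2 * r * R * (cos \<theta> * cos \<phi> + sin \<theta> * sin \<phi>)" .
  then have l: "?l = r^2 + R^2 - 2 * r * R * cos (\<theta> - \<phi>)" by (simp add: cos_diff)
  have "(r - R * c)^2 + (R * s)^2 = r^2 - 2 * r * R * c + R^2 * (s^2 + c^2)" for c s :: real
    by (simp add: power2_eq_square algebra_simps)
  then have "?r = r^2 - 2 * r * R * cos (\<theta> - \<phi>) + R^2 * ((sin (\<theta> - \<phi>))^2 + (cos (\<theta> - \<phi>))^2)" .
  with l show "?l = ?r" by simp
  show "?l = (r - R)^2 + 2 * r * R * (1 - cos (\<theta> - \<phi>))" unfolding l by (simp add: power2_eq_square algebra_simps)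
qed

text \<open>If the cosine is nonpositive, the distance is at least \<open>R \<ge> a\<close>, and 5
  exceeds \<open>pi\<close>. Otherwise \<open>\<bar>x\<bar> \<le> 8/5\<close>, and
  \<open>\<bar>sin x\<bar> \<ge> \<bar>x\<bar> - x^2 / 2\<close> yields
  \<open>\<bar>sin x\<bar> \<ge> \<bar>x\<bar> / 5\<close>.\<close>

lemma angle_le_dist:
  fixes r R \<theta> \<phi> d :: real
  assumes a: "0 < a" "a \<le> R" and r: "0 \<le> r" and \<Delta>: "\<bar>\<theta> - \<phi>\<bar> \<le> pi"
    and d: "0 \<le> d" "(r * cos \<theta> - R * cos \<phi>)^2 + (r * sin \<theta> - R * sin \<phi>)^2 \<le> d^2"
  shows "\<bar>\<theta> - \<phi>\<bar> \<le> 5 / a * d"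
proof (cases "cos (\<theta> - \<phi>) \<le> 0")
  case True
  have "r * R * cos (\<theta> - \<phi>) \<le> 0" using True r a by (simp add: mult_nonneg_nonpos)
  moreover have e: "(r - R)^2 + 2 * r * R * (1 - c) = r^2 + R^2 - 2 * (r * R * c)" for c
    by (simp add: power2_eq_square algebra_simps)
  ultimately have "R^2 \<le> d^2" using d(2) zero_le_power2[of r] unfolding polar_dist(2) e by linarith
  then have "R \<le> d" using d(1) power2_le_imp_le by blast
  then have "5 \<le> 5 / a * d" using a by (simp add: field_simps)
  then show ?thesis using \<Delta> pi_less_4 by linarith
next
  case False
  let ?x = "\<theta> - \<phi>"
  have x: "\<bar>?x\<bar> < pi / 2"
  proof (rule ccontr)
    assume "\<not> \<bar>?x\<bar> < pi / 2"
    then have "cos \<bar>?x\<bar> \<le> cos (pi/2)" using \<Delta> by (intro cos_monotone_0_pi_le) auto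
    then show False using False by simp
  qed
  have pi: "pi / 2 \<le> 8/5" using pi_approx by simp
  have "\<bar>?x\<bar> - ?x^2 / 2 \<le> \<bar>sin ?x\<bar>" using sin_minus_self[of ?x] by linarith
  moreover have "?x^2 \<le> \<bar>?x\<bar> * (8/5)"
    using mult_left_mono[of "\<bar>?x\<bar>" "8/5" "\<bar>?x\<bar>"] x pi by (simp add: power2_eq_square)
  ultimately have s: "\<bar>?x\<bar> / 5 \<le> \<bar>sin ?x\<bar>" by simp
  have "(R * sin ?x)^2 \<le> d^2" using d(2) zero_le_power2[of "r - R * cos ?x"] unfolding polar_dist(1) by linarith
  then have "\<bar>R * sin ?x\<bar> \<le> d" using d(1) by (simp add: abs_le_square_iff[symmetric])
  moreover have "a * (\<bar>?x\<bar> / 5) \<le> \<bar>R * sin ?x\<bar>" unfolding abs_mult using s a by (intro mult_mono) auto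
  ultimately have "a * (\<bar>?x\<bar> / 5) \<le> d" by linarith
  then show ?thesis using a by (simp add: field_simps)
qed

text \<open>The second derivative is represented by the quadratic Taylor remainder with the uniform
  constant \<open>B\<close>, so the geometry below involves no differentiation.\<close>

locale star_profile =
  fixes \<rho> \<rho>' :: "real \<Rightarrow> real" and a B :: real and x1 x2 :: real
  assumes a: "0 < a" and \<rho>: "a \<le> \<rho> t" "\<rho> t \<le> 1" and per: "\<rho> (t + 2 * pi) = \<rho> t"
    and B: "1 \<le> B" and lip: "\<bar>\<rho> s - \<rho> t\<bar> \<le> B * \<bar>s - t\<bar>" and d1: "\<bar>\<rho>' t\<bar> \<le> B"
    and taylor: "\<bar>\<rho> (t + h) - \<rho> t - \<rho>' t * h\<bar> \<le> B * h^2"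
begin

lemma angle_shift:
  obtains \<theta>' where "\<bar>\<theta>' - \<phi>\<bar> \<le> pi" "\<rho> \<theta>' = \<rho> \<theta>" "cos \<theta>' = cos \<theta>" "sin \<theta>' = sin \<theta>"
proof
  define n where "n = - round ((\<theta> - \<phi>) / (2 * pi))"
  let ?t = "\<theta> + of_int n * (2 * pi)"
  have "\<bar>of_int (round ((\<theta> - \<phi>) / (2 * pi))) - (\<theta> - \<phi>) / (2 * pi)\<bar> \<le> 1/2" by (rule of_int_round_abs_le)
  then have "2 * pi * \<bar>of_int (round ((\<theta> - \<phi>) / (2 * pi))) - (\<theta> - \<phi>) / (2 * pi)\<bar> \<le> 2 * pi * (1/2)"
    by (intro mult_left_mono) auto
  then have "\<bar>2 * pi * (of_int (round ((\<theta> - \<phi>) / (2 * pi))) - (\<theta> - \<phi>) / (2 * pi))\<bar> \<le> pi"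
    by (simp add: abs_mult)
  also have "2 * pi * (of_int (round ((\<theta> - \<phi>) / (2 * pi))) - (\<theta> - \<phi>) / (2 * pi)) = - (?t - \<phi>)"
    by (simp add: n_def field_simps)
  finally show "\<bar>?t - \<phi>\<bar> \<le> pi" by (simp only: abs_minus_cancel)
  show "\<rho> ?t = \<rho> \<theta>" "cos ?t = cos \<theta>" "sin ?t = sin \<theta>" by (intro periodic_int per cos_periodic sin_periodic)+
qed

definition inside :: "real \<Rightarrow> real \<Rightarrow> bool" where
  "inside x y \<longleftrightarrow> (\<exists>r \<theta>. 0 \<le> r \<and> r \<le> \<rho> \<theta> \<and> x - x1 = r * cos \<theta> \<and> y - x2 = r * sin \<theta>)"

lemma polar_obtain:
  obtains r \<theta> where "0 \<le> r" "x - x1 = r * cos \<theta>" "y - x2 = r * sin \<theta>"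
proof -
  obtain r \<theta> where h: "x - x1 = r * cos \<theta>" "y - x2 = r * sin \<theta>" using polar_Ex by metis
  show ?thesis
  proof (cases "0 \<le> r")
    case False
    then show ?thesis using h that[of "- r" "\<theta> + pi"] by simp
  qed (use h that in blast)
qed

text \<open>Some choice of polar coordinates. At the centre the angle is arbitrary, which is
  harmless because \<open>gauge\<close> is negative there for every angle.\<close>

definition ang :: "real \<Rightarrow> real \<Rightarrow> real \<times> real" where
  "ang x y = (SOME z. 0 \<le> fst z \<and> x - x1 = fst z * cos (snd z) \<and> y - x2 = fst z * sin (snd z))"

definition gauge :: "real \<Rightarrow> real \<Rightarrow> real" where
  "gauge x y = fst (ang x y) - \<rho> (snd (ang x y))"

lemma ang: "0 \<le> fst (ang x y)" "x - x1 = fst (ang x y) * cos (snd (ang x y))" "y - x2 = fst (ang x y) * sin (snd (ang x y))"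
proof -
  obtain r \<theta> where "0 \<le> r" "x - x1 = r * cos \<theta>" "y - x2 = r * sin \<theta>" by (rule polar_obtain)
  then have "\<exists>z. 0 \<le> fst z \<and> x - x1 = fst z * cos (snd z) \<and> y - x2 = fst z * sin (snd z)" by (intro exI[of _ "(r, \<theta>)"]) auto
  from someI_ex[OF this, folded ang_def]
  show "0 \<le> fst (ang x y)" "x - x1 = fst (ang x y) * cos (snd (ang x y))" "y - x2 = fst (ang x y) * sin (snd (ang x y))"
    by blast+
qed

lemma inside_gauge: "inside x y \<longleftrightarrow> gauge x y \<le> 0"
proof
  assume "gauge x y \<le> 0"
  then show "inside x y" unfolding inside_def gauge_def
    using ang[where x = x and y = y] by (intro exI[of _ "fst (ang x y)"] exI[of _ "snd (ang x y)"]) auto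
next
  assume "inside x y"
  then obtain r \<theta> where r: "0 \<le> r" "r \<le> \<rho> \<theta>" and xy: "x - x1 = r * cos \<theta>" "y - x2 = r * sin \<theta>"
    unfolding inside_def by blast
  obtain R \<phi> where R: "fst (ang x y) = R" "snd (ang x y) = \<phi>" by blast
  have R0: "0 \<le> R" and e: "r * cos \<theta> - R * cos \<phi> = 0" "r * sin \<theta> - R * sin \<phi> = 0"
    using ang[where x = x and y = y] xy R by auto
  obtain \<theta>' where t: "\<bar>\<theta>' - \<phi>\<bar> \<le> pi" "\<rho> \<theta>' = \<rho> \<theta>" "cos \<theta>' = cos \<theta>" "sin \<theta>' = sin \<theta>" by (rule angle_shift)
  show "gauge x y \<le> 0"
  proof (cases "R = 0")
    case True
    then show ?thesis unfolding gauge_def R using \<rho>(1)[of \<phi>] a by simp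
  next
    case False
    have "\<bar>\<theta>' - \<phi>\<bar> \<le> 5 / R * 0"
      by (rule angle_le_dist[of R R r]) (use False R0 r t e in auto)
    then have "\<theta>' = \<phi>" by simp
    moreover have "(r - R)^2 + 2 * r * R * (1 - cos (\<theta>' - \<phi>)) = 0"
      using polar_dist(2)[of r \<theta>' R \<phi>] e t by simp
    ultimately have "r = R" by simp
    with r t \<open>\<theta>' = \<phi>\<close> show ?thesis unfolding gauge_def R by simp
  qed
qed

text \<open>\<open>c0\<close> is the constant of \<open>angle_le_dist\<close>; \<open>c1\<close>,
  \<open>c2\<close>, \<open>c3\<close> bound the three parts of the tangent defect, and
  \<open>c4\<close> the excess radius in the proof of \<open>cross\<close>.\<close>

definition "c0 = 5 / a"
definition "c1 = c0^2 + 4 * c0"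
definition "c2 = B * c0^2"
definition "c3 = (B / a) * (c1 + c0)"
definition "c4 = B * c0 + 1"

definition flat_const :: real where
  "flat_const = c1 + c2 + c3 + 2 * c4 + 2 * B + 10 + B / a"

lemma flat_const_ge:
  "0 < c0" "c1 + c2 + c3 \<le> flat_const" "2 \<le> flat_const" "2 * c4 \<le> flat_const" "B + 1 \<le> flat_const"
  "10 \<le> flat_const" "1 + B / a \<le> flat_const"
proof -
  show c0: "0 < c0" using a by (simp add: c0_def)
  have c1: "0 \<le> c1" using c0 by (simp add: c1_def)
  have c2: "0 \<le> c2" using B by (simp add: c2_def)
  have Ba: "0 < B / a" using B a by simp
  have c3: "0 \<le> c3" unfolding c3_def using Ba c1 c0 by (intro mult_nonneg_nonneg) auto
  have c4: "0 \<le> c4" using B c0 by (simp add: c4_def)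
  show "c1 + c2 + c3 \<le> flat_const" "2 \<le> flat_const" "2 * c4 \<le> flat_const" "B + 1 \<le> flat_const"
    "10 \<le> flat_const" "1 + B / a \<le> flat_const"
    unfolding flat_const_def using c1 c2 c3 c4 Ba B by linarith+
qed

text \<open>The affine form is the gradient of \<open>r - \<rho> \<theta>\<close> at the boundary
  point: the radial unit vector minus \<open>\<rho>' / \<rho>\<close> times the angular one. The
  defect consists of terms with \<open>1 - cos D\<close>, \<open>sin D - D\<close>,
  \<open>(r - R) * D\<close> and the Taylor remainder of \<open>\<rho>\<close>, each quadratic in
  the distance \<open>d\<close>.\<close>

lemma tangent_gauge:
  fixes \<phi>
  defines "\<eta> \<equiv> \<rho>' \<phi> / \<rho> \<phi>"
  shows "\<bar>(cos \<phi> + \<eta> * sin \<phi>) * (x - (x1 + \<rho> \<phi> * cos \<phi>)) + (sin \<phi> - \<eta> * cos \<phi>) * (y - (x2 + \<rho> \<phi> * sin \<phi>)) - gauge x y\<bar>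
    \<le> flat_const * ((x - (x1 + \<rho> \<phi> * cos \<phi>))^2 + (y - (x2 + \<rho> \<phi> * sin \<phi>))^2)"
proof -
  define R where "R = \<rho> \<phi>"
  define k where "k = c0"
  obtain r \<theta>0 where r0: "fst (ang x y) = r" "snd (ang x y) = \<theta>0" by blast
  obtain \<theta> where t: "\<bar>\<theta> - \<phi>\<bar> \<le> pi" "\<rho> \<theta> = \<rho> \<theta>0" "cos \<theta> = cos \<theta>0" "sin \<theta> = sin \<theta>0" by (rule angle_shift)
  have r: "0 \<le> r" and xy: "x = x1 + r * cos \<theta>" "y = x2 + r * sin \<theta>" using ang[where x = x and y = y] r0 t by auto
  have g: "gauge x y = r - \<rho> \<theta>" using r0 t by (simp add: gauge_def)
  define D where "D = \<theta> - \<phi>"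
  define d where "d = sqrt ((r * cos \<theta> - R * cos \<phi>)^2 + (r * sin \<theta> - R * sin \<phi>)^2)"
  have d: "0 \<le> d" "d^2 = (r * cos \<theta> - R * cos \<phi>)^2 + (r * sin \<theta> - R * sin \<phi>)^2" by (auto simp: d_def)
  have R: "a \<le> R" "R \<le> 1" using \<rho> by (auto simp: R_def)
  have k: "0 < k" using flat_const_ge by (simp add: k_def)
  have D: "\<bar>D\<bar> \<le> pi" "\<bar>D\<bar> \<le> k * d" unfolding D_def k_def c0_def
    using t angle_le_dist[OF a R(1) r, of \<theta> \<phi> d] d by auto
  have "(r - R)^2 \<le> d^2" unfolding d(2) polar_dist(2) using r R a by simp
  then have rR: "\<bar>r - R\<bar> \<le> d" using d(1) by (simp add: abs_le_square_iff[symmetric])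
  have D2: "D^2 \<le> k^2 * d^2" using power_mono[OF D(2), of 2] by (simp add: power_mult_distrib)
  have "D^2 = \<bar>D\<bar> * \<bar>D\<bar>" by (simp add: power2_eq_square)
  also have "\<dots> \<le> 4 * (k * d)" using D pi_less_4 k d by (intro mult_mono) auto
  finally have D3: "D^2 \<le> 4 * k * d" by simp
  \<comment> \<open>The radius \<open>r\<close> is unbounded, but at most \<open>1 + d\<close>. The
    surplus \<open>d\<close> meets the bound \<open>D^2 \<le> 4 * k * d\<close>, which is linear in
    \<open>d\<close> and stems from \<open>\<bar>D\<bar> \<le> pi < 4\<close>.\<close>
  have "r * D^2 \<le> (1 + d) * D^2" using rR R by (intro mult_right_mono) auto
  also have "\<dots> = D^2 + d * D^2" by (simp add: algebra_simps)
  also have "\<dots> \<le> k^2 * d^2 + d * (4 * k * d)" using D2 D3 d by (intro add_mono mult_left_mono) auto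
  finally have rD: "r * D^2 \<le> (k^2 + 4 * k) * d^2" by (simp add: power2_eq_square algebra_simps)
  have alg: "(C + e * S) * (r * c - R * C) + (S - e * C) * (r * s - R * S)
      = r * (c * C + s * S) - R * (S^2 + C^2) - e * r * (s * C - c * S)" for C c S s e :: real
    by (simp add: power2_eq_square algebra_simps)
  have eq: "(cos \<phi> + \<eta> * sin \<phi>) * (r * cos \<theta> - R * cos \<phi>) + (sin \<phi> - \<eta> * cos \<phi>) * (r * sin \<theta> - R * sin \<phi>)
      = r * cos D - R - \<eta> * r * sin D"
  proof -
    have "(cos \<phi> + \<eta> * sin \<phi>) * (r * cos \<theta> - R * cos \<phi>) + (sin \<phi> - \<eta> * cos \<phi>) * (r * sin \<theta> - R * sin \<phi>)
      = r * (cos \<theta> * cos \<phi> + sin \<theta> * sin \<phi>) - R * ((sin \<phi>)^2 + (cos \<phi>)^2) - \<eta> * r * (sin \<theta> * cos \<phi> - cos \<theta> * sin \<phi>)"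
      by (rule alg)
    then show ?thesis by (simp add: D_def cos_diff sin_diff)
  qed
  have \<eta>R: "\<eta> * R = \<rho>' \<phi>" using R a by (simp add: \<eta>_def R_def)
  have main: "r * cos D - R - \<eta> * r * sin D - (r - \<rho> \<theta>)
     = - (r * (1 - cos D)) + (\<rho> \<theta> - R - \<rho>' \<phi> * D) - \<eta> * (r * (sin D - D) + (r - R) * D)"
    unfolding \<eta>R[symmetric] by (simp add: algebra_simps)
  have "\<bar>r * (1 - cos D)\<bar> \<le> r * (D^2 / 2)" unfolding abs_mult using r one_minus_cos_le[of D] cos_le_one[of D]
    by (intro mult_mono) auto
  moreover have half: "r * (D^2 / 2) \<le> (k^2 + 4 * k) * d^2"
    using rD mult_nonneg_nonneg[OF r zero_le_power2[of D]] by linarith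
  ultimately have m1: "\<bar>r * (1 - cos D)\<bar> \<le> (k^2 + 4 * k) * d^2" by linarith
  have "\<bar>\<rho> \<theta> - R - \<rho>' \<phi> * D\<bar> \<le> B * D^2" using taylor[of \<phi> D] by (simp add: R_def D_def)
  also have "\<dots> \<le> B * (k^2 * d^2)" using B D2 by (intro mult_left_mono) auto
  finally have m2: "\<bar>\<rho> \<theta> - R - \<rho>' \<phi> * D\<bar> \<le> B * k^2 * d^2" by simp
  have "\<bar>r * (sin D - D)\<bar> \<le> r * (D^2 / 2)" unfolding abs_mult using r sin_minus_self[of D] by (intro mult_mono) auto
  then have "\<bar>r * (sin D - D)\<bar> \<le> (k^2 + 4 * k) * d^2" using half by linarith
  moreover have "\<bar>(r - R) * D\<bar> \<le> d * (k * d)" unfolding abs_mult using rR D d by (intro mult_mono) auto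
  ultimately have m3: "\<bar>r * (sin D - D) + (r - R) * D\<bar> \<le> ((k^2 + 4 * k) + k) * d^2"
    by (simp add: power2_eq_square algebra_simps)
  have \<eta>: "\<bar>\<eta>\<bar> \<le> B / a" unfolding \<eta>_def abs_divide using d1 B \<rho>[of \<phi>] a by (intro frac_le) auto
  have m4: "\<bar>\<eta> * (r * (sin D - D) + (r - R) * D)\<bar> \<le> (B / a) * (((k^2 + 4 * k) + k) * d^2)"
    unfolding abs_mult using \<eta> m3 B a by (intro mult_mono) auto
  have "\<bar>r * cos D - R - \<eta> * r * sin D - (r - \<rho> \<theta>)\<bar>
      \<le> (k^2 + 4 * k) * d^2 + B * k^2 * d^2 + (B / a) * (((k^2 + 4 * k) + k) * d^2)"
    unfolding main using m1 m2 m4 by linarith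
  also have "\<dots> = ((k^2 + 4 * k) + B * k^2 + (B / a) * ((k^2 + 4 * k) + k)) * d^2" by (simp add: algebra_simps)
  also have "\<dots> \<le> flat_const * d^2"
    using flat_const_ge(2) unfolding c3_def c2_def c1_def k_def by (intro mult_right_mono) auto
  finally show ?thesis unfolding g d(2) using eq by (simp add: xy R_def)
qed

text \<open>For \<open>cross\<close> the boundary point is taken in the direction of the outer
  point, whose excess radius is controlled by the Lipschitz bound. For \<open>sample\<close> the
  angles are the multiples of \<open>r\<close> within one turn.\<close>

lemma flat_set_inside:
  assumes box: "\<And>x y. inside x y \<Longrightarrow> 0 \<le> x \<and> x \<le> 1 \<and> 0 \<le> y \<and> y \<le> 1"
  shows "flat_set flat_const inside gauge (\<lambda>\<phi>. x1 + \<rho> \<phi> * cos \<phi>) (\<lambda>\<phi>. x2 + \<rho> \<phi> * sin \<phi>)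
     (\<lambda>\<phi>. cos \<phi> + \<rho>' \<phi> / \<rho> \<phi> * sin \<phi>) (\<lambda>\<phi>. sin \<phi> - \<rho>' \<phi> / \<rho> \<phi> * cos \<phi>)"
proof
  note fc = flat_const_ge(3-7)
  have Ba: "0 < B / a" using B a by simp
  show "2 \<le> flat_const" by (rule fc(1))
  show "inside x y \<longleftrightarrow> gauge x y \<le> 0" for x y by (rule inside_gauge)
  show "inside x y \<Longrightarrow> 0 \<le> x \<and> x \<le> 1 \<and> 0 \<le> y \<and> y \<le> 1" for x y by (rule box)
  fix \<phi>
  define \<eta> where "\<eta> = \<rho>' \<phi> / \<rho> \<phi>"
  have \<eta>: "\<bar>\<eta>\<bar> \<le> B / a" unfolding \<eta>_def abs_divide using d1 B \<rho>[of \<phi>] a by (intro frac_le) auto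
  show "\<bar>(cos \<phi> + \<rho>' \<phi> / \<rho> \<phi> * sin \<phi>) * (x - (x1 + \<rho> \<phi> * cos \<phi>)) + (sin \<phi> - \<rho>' \<phi> / \<rho> \<phi> * cos \<phi>) * (y - (x2 + \<rho> \<phi> * sin \<phi>)) - gauge x y\<bar>
    \<le> flat_const * ((x - (x1 + \<rho> \<phi> * cos \<phi>))^2 + (y - (x2 + \<rho> \<phi> * sin \<phi>))^2)" for x y
    by (rule tangent_gauge)
  have "(cos \<phi> + \<eta> * sin \<phi>)^2 + (sin \<phi> - \<eta> * cos \<phi>)^2 = (1 + \<eta>^2) * ((sin \<phi>)^2 + (cos \<phi>)^2)"
  proof -
    have "(C + \<eta> * S)^2 + (S - \<eta> * C)^2 = (1 + \<eta>^2) * (S^2 + C^2)" for C S :: real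
      by (simp add: power2_eq_square algebra_simps)
    then show ?thesis .
  qed
  then show "1 \<le> (cos \<phi> + \<rho>' \<phi> / \<rho> \<phi> * sin \<phi>)^2 + (sin \<phi> - \<rho>' \<phi> / \<rho> \<phi> * cos \<phi>)^2" unfolding \<eta>_def[symmetric] by simp
  have s: "\<bar>\<eta> * sin \<phi>\<bar> \<le> B / a * 1" "\<bar>\<eta> * cos \<phi>\<bar> \<le> B / a * 1"
    unfolding abs_mult using \<eta> Ba by (intro mult_mono; simp)+
  show "\<bar>cos \<phi> + \<rho>' \<phi> / \<rho> \<phi> * sin \<phi>\<bar> \<le> flat_const" "\<bar>sin \<phi> - \<rho>' \<phi> / \<rho> \<phi> * cos \<phi>\<bar> \<le> flat_const"
    unfolding \<eta>_def[symmetric] using s abs_cos_le_one[of \<phi>] abs_sin_le_one[of \<phi>] fc by linarith+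
next
  fix x y x' y' r assume S: "inside x y" "\<not> inside x' y'" and r: "\<bar>x - x'\<bar> \<le> r" "\<bar>y - y'\<bar> \<le> r"
  define k where "k = c0"
  obtain s \<theta>0 where s: "0 \<le> s" "s \<le> \<rho> \<theta>0" "x - x1 = s * cos \<theta>0" "y - x2 = s * sin \<theta>0" using S(1) unfolding inside_def by blast
  obtain R \<phi> where R: "0 \<le> R" "x' - x1 = R * cos \<phi>" "y' - x2 = R * sin \<phi>" by (rule polar_obtain)
  have R\<rho>: "\<rho> \<phi> < R" using S(2) R unfolding inside_def by force
  obtain \<theta> where t: "\<bar>\<theta> - \<phi>\<bar> \<le> pi" "\<rho> \<theta> = \<rho> \<theta>0" "cos \<theta> = cos \<theta>0" "sin \<theta> = sin \<theta>0" by (rule angle_shift)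
  have r0: "0 \<le> r" using r by linarith
  have e: "s * cos \<theta> - R * cos \<phi> = x - x'" "s * sin \<theta> - R * sin \<phi> = y - y'" using s R t by auto
  have "\<bar>x - x'\<bar>^2 \<le> r^2" "\<bar>y - y'\<bar>^2 \<le> r^2" using r by (intro power_mono; simp)+
  then have "(x - x')^2 + (y - y')^2 \<le> r^2 + r^2" by simp
  also have "\<dots> \<le> (2 * r)^2" by (simp add: power_mult_distrib)
  finally have d: "(s * cos \<theta> - R * cos \<phi>)^2 + (s * sin \<theta> - R * sin \<phi>)^2 \<le> (2 * r)^2" unfolding e .
  have "a \<le> R" using R\<rho> \<rho>(1)[of \<phi>] by linarith
  from angle_le_dist[OF a this s(1) t(1) _ d] r0 have D: "\<bar>\<theta> - \<phi>\<bar> \<le> k * (2 * r)" by (simp add: k_def c0_def)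
  have "(s - R)^2 \<le> (2 * r)^2" using d unfolding polar_dist(2) using s(1) R(1) cos_le_one[of "\<theta> - \<phi>"]
    by (smt (verit) mult_nonneg_nonneg)
  then have "\<bar>s - R\<bar> \<le> \<bar>2 * r\<bar>" by (simp only: abs_le_square_iff)
  then have "\<bar>s - R\<bar> \<le> 2 * r" using r0 by simp
  moreover have "\<bar>\<rho> \<theta> - \<rho> \<phi>\<bar> \<le> B * (k * (2 * r))"
    by (rule order.trans[OF lip]) (use D B in \<open>intro mult_left_mono; simp\<close>)
  ultimately have "R - \<rho> \<phi> \<le> 2 * r + B * (k * (2 * r))" using s t by linarith
  also have "\<dots> = 2 * (B * k + 1) * r" by (simp add: algebra_simps)
  also have "\<dots> \<le> flat_const * r"
    using flat_const_ge(4) r0 unfolding c4_def k_def by (intro mult_right_mono) auto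
  finally have Rf: "\<bar>R - \<rho> \<phi>\<bar> \<le> flat_const * r" using R\<rho> by simp
  have "\<bar>(R - \<rho> \<phi>) * cos \<phi>\<bar> \<le> (flat_const * r) * 1" "\<bar>(R - \<rho> \<phi>) * sin \<phi>\<bar> \<le> (flat_const * r) * 1"
    unfolding abs_mult using Rf by (intro mult_mono; simp)+
  moreover have "x' - (x1 + \<rho> \<phi> * cos \<phi>) = (R - \<rho> \<phi>) * cos \<phi>" "y' - (x2 + \<rho> \<phi> * sin \<phi>) = (R - \<rho> \<phi>) * sin \<phi>"
    using R by (auto simp: algebra_simps)
  ultimately show "\<exists>\<phi>. \<bar>x' - (x1 + \<rho> \<phi> * cos \<phi>)\<bar> \<le> flat_const * r \<and> \<bar>y' - (x2 + \<rho> \<phi> * sin \<phi>)\<bar> \<le> flat_const * r"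
    by (intro exI[of _ \<phi>]) simp
next
  fix r :: real assume r: "0 < r" "r \<le> 1"
  note fc = flat_const_ge(6) flat_const_ge(5)
  define F where "F = (\<lambda>j::nat. real j * r) ` {..nat \<lfloor>2 * pi / r\<rfloor>}"
  have "card F \<le> card {..nat \<lfloor>2 * pi / r\<rfloor>}" unfolding F_def by (rule card_image_le) simp
  then have "real (card F) \<le> real (nat \<lfloor>2 * pi / r\<rfloor>) + 1" by simp
  also have "\<dots> \<le> 2 * pi / r + 1 / r"
  proof -
    have "0 \<le> \<lfloor>2 * pi / r\<rfloor>" using r by simp
    then have "real (nat \<lfloor>2 * pi / r\<rfloor>) = of_int \<lfloor>2 * pi / r\<rfloor>" by simp
    moreover have "1 \<le> 1 / r" using r by simp
    ultimately show ?thesis by linarith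
  qed
  also have "\<dots> \<le> 10 / r" using r pi_less_4 pi_approx by (simp add: add_divide_distrib[symmetric] divide_right_mono)
  also have "\<dots> \<le> flat_const / r" using fc r by (intro divide_right_mono) auto
  finally have card: "real (card F) \<le> flat_const / r" .
  have lipc: "\<bar>(z + \<rho> s * c s) - (z + \<rho> t * c t)\<bar> \<le> flat_const * r"
    if "\<bar>s - t\<bar> \<le> r" "\<bar>c s - c t\<bar> \<le> \<bar>s - t\<bar>" "\<bar>c s\<bar> \<le> 1" for z s t :: real and c
  proof -
    have "(z + \<rho> s * c s) - (z + \<rho> t * c t) = (\<rho> s - \<rho> t) * c s + \<rho> t * (c s - c t)" by (simp add: algebra_simps)
    moreover have "\<bar>(\<rho> s - \<rho> t) * c s\<bar> \<le> (B * r) * 1" unfolding abs_mult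
      using that B by (intro mult_mono order.trans[OF lip] mult_left_mono) auto
    moreover have "\<bar>\<rho> t * (c s - c t)\<bar> \<le> 1 * r" unfolding abs_mult
      using that \<rho>[of t] a by (intro mult_mono) auto
    moreover have "B * r + r \<le> flat_const * r" using mult_right_mono[OF fc(2), of r] r by (simp add: algebra_simps)
    ultimately show ?thesis by linarith
  qed
  show "\<exists>F. finite F \<and> real (card F) \<le> flat_const / r \<and>
       (\<forall>\<phi>. \<exists>\<phi>'\<in>F. \<bar>x1 + \<rho> \<phi> * cos \<phi> - (x1 + \<rho> \<phi>' * cos \<phi>')\<bar> \<le> flat_const * r
          \<and> \<bar>x2 + \<rho> \<phi> * sin \<phi> - (x2 + \<rho> \<phi>' * sin \<phi>')\<bar> \<le> flat_const * r)"
  proof (rule exI[of _ F], intro conjI allI)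
    show "finite F" by (simp add: F_def)
    show "real (card F) \<le> flat_const / r" by (rule card)
    fix \<phi>
    define s where "s = \<phi> + of_int (- \<lfloor>\<phi> / (2 * pi)\<rfloor>) * (2 * pi)"
    have ps: "\<rho> s = \<rho> \<phi>" "cos s = cos \<phi>" "sin s = sin \<phi>" unfolding s_def by (intro periodic_int per cos_periodic sin_periodic)+
    have s: "0 \<le> s" "s < 2 * pi"
    proof -
      have "s = 2 * pi * (\<phi> / (2 * pi) - of_int \<lfloor>\<phi> / (2 * pi)\<rfloor>)" by (simp add: s_def field_simps)
      moreover have "0 \<le> \<phi> / (2 * pi) - of_int \<lfloor>\<phi> / (2 * pi)\<rfloor>" "\<phi> / (2 * pi) - of_int \<lfloor>\<phi> / (2 * pi)\<rfloor> < 1" by linarith+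
      ultimately show "0 \<le> s" "s < 2 * pi"
        using mult_strict_left_mono[of "\<phi> / (2 * pi) - of_int \<lfloor>\<phi> / (2 * pi)\<rfloor>" 1 "2 * pi"] by auto
    qed
    define j where "j = nat \<lfloor>s / r\<rfloor>"
    have "0 \<le> \<lfloor>s / r\<rfloor>" using s r by simp
    then have "real j = of_int \<lfloor>s / r\<rfloor>" by (simp add: j_def)
    then have "\<bar>s / r - real j\<bar> \<le> 1" by linarith
    then have "r * \<bar>s / r - real j\<bar> \<le> r * 1" using r by (intro mult_left_mono) auto
    moreover have "r * \<bar>s / r - real j\<bar> = \<bar>r * (s / r - real j)\<bar>" using r by (simp add: abs_mult)
    moreover have "r * (s / r - real j) = s - real j * r" using r by (simp add: field_simps)
    ultimately have sj: "\<bar>s - real j * r\<bar> \<le> r" by simp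
    have "j \<le> nat \<lfloor>2 * pi / r\<rfloor>" unfolding j_def using s r by (intro nat_mono floor_mono divide_right_mono) auto
    then have jF: "real j * r \<in> F" by (auto simp: F_def)
    have "\<bar>(x1 + \<rho> s * cos s) - (x1 + \<rho> (real j * r) * cos (real j * r))\<bar> \<le> flat_const * r"
      "\<bar>(x2 + \<rho> s * sin s) - (x2 + \<rho> (real j * r) * sin (real j * r))\<bar> \<le> flat_const * r"
      by (intro lipc sj abs_cos_diff_le abs_sin_diff_le abs_cos_le_one abs_sin_le_one)+
    with jF show "\<exists>\<phi>'\<in>F. \<bar>x1 + \<rho> \<phi> * cos \<phi> - (x1 + \<rho> \<phi>' * cos \<phi>')\<bar> \<le> flat_const * r
          \<and> \<bar>x2 + \<rho> \<phi> * sin \<phi> - (x2 + \<rho> \<phi>' * sin \<phi>')\<bar> \<le> flat_const * r"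
      unfolding ps by blast
  qed
qed

end

section \<open>Members of the given class as flat sets with a uniform constant\<close>

lemma C2_2pi_derivs:
  assumes "\<rho> \<in> C2_2pi"
  shows "(\<rho> has_real_derivative deriv \<rho> t) (at t)"
    "(deriv \<rho> has_real_derivative deriv (deriv \<rho>) t) (at t)"
    "continuous_on UNIV (deriv (deriv \<rho>))" "\<rho> (t + 2 * pi) = \<rho> t"
proof -
  have *: "(\<forall>t. (f has_real_derivative deriv f t) (at t)) \<and> continuous_on UNIV (deriv f)"
    if f: "f C1_differentiable_on UNIV" for f :: "real \<Rightarrow> real"
  proof -
    obtain D where D: "\<And>x. (f has_real_derivative D x) (at x)" "continuous_on UNIV D"
      using f unfolding C1_differentiable_on_def has_real_derivative_iff_has_vector_derivative by auto
    then have "deriv f = D" by (auto intro: DERIV_imp_deriv)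
    with D show ?thesis by simp
  qed
  show "(\<rho> has_real_derivative deriv \<rho> t) (at t)" "(deriv \<rho> has_real_derivative deriv (deriv \<rho>) t) (at t)"
    "continuous_on UNIV (deriv (deriv \<rho>))" "\<rho> (t + 2 * pi) = \<rho> t"
    using assms * unfolding C2_2pi_def by blast+
qed

text \<open>A violation would persist on a nonempty open set, which is not null. Thus the essential
  bound on the second derivative holds everywhere.\<close>

lemma continuous_AE_le:
  fixes f :: "real \<Rightarrow> real"
  assumes c: "continuous_on UNIV f" and AE: "AE x in lborel. f x \<le> c"
  shows "f x \<le> c"
proof (rule ccontr)
  assume "\<not> f x \<le> c"
  then have ne: "{x. f x > c} \<noteq> {}" by (auto simp: not_le)
  have op: "open {x. f x > c}" using c by (intro open_Collect_less) auto
  have "{x. f x > c} \<in> null_sets lborel"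
    using AE op AE_iff_null[of lborel "\<lambda>x. f x \<le> c"] by (simp add: not_le borel_open)
  then have "negligible {x. f x > c}"
    by (simp only: negligible_iff_null_sets null_sets_completionI)
  with open_not_negligible[OF op ne] show False by blast
qed

lemma abs_diff_le_of_deriv:
  fixes f :: "real \<Rightarrow> real"
  assumes "\<And>t. (f has_real_derivative f' t) (at t)" "\<And>t. \<bar>f' t\<bar> \<le> B"
  shows "\<bar>f s - f t\<bar> \<le> B * \<bar>s - t\<bar>"
proof -
  have "norm (f s - f t) \<le> B * norm (s - t)"
    by (rule field_differentiable_bound[of UNIV f f' B]) (use assms in auto)
  then show ?thesis by simp
qed

lemma taylor_of_deriv:
  fixes f :: "real \<Rightarrow> real"
  assumes f: "\<And>t. (f has_real_derivative f' t) (at t)" and f': "\<And>s t. \<bar>f' s - f' t\<bar> \<le> B * \<bar>s - t\<bar>"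
  shows "\<bar>f (t + h) - f t - f' t * h\<bar> \<le> B * h^2"
proof -
  have "norm ((\<lambda>x. f x - f' t * x) (t + h) - (\<lambda>x. f x - f' t * x) t) \<le> (B * \<bar>h\<bar>) * norm ((t + h) - t)"
  proof (rule field_differentiable_bound[of "closed_segment t (t + h)" _ "\<lambda>x. f' x - f' t"])
    fix x assume x: "x \<in> closed_segment t (t + h)"
    have B: "0 \<le> B" using f'[of 0 1] by simp
    show "((\<lambda>x. f x - f' t * x) has_field_derivative f' x - f' t) (at x within closed_segment t (t + h))"
      by (auto intro!: derivative_eq_intros has_field_derivative_at_within[OF f])
    have "\<bar>x - t\<bar> \<le> \<bar>h\<bar>" using x by (auto simp: closed_segment_eq_real_ivl split: if_splits)
    then show "norm (f' x - f' t) \<le> B * \<bar>h\<bar>" using order.trans[OF f' mult_left_mono[OF _ B]] by simp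
  qed auto
  then show ?thesis by (simp add: algebra_simps power2_eq_square)
qed

lemma star_profile_of_C2:
  assumes \<rho>: "\<rho> \<in> C2_2pi" and \<nu>: "AE \<phi> in lborel. \<bar>deriv (deriv \<rho>) \<phi>\<bar> \<le> \<nu>" "1 \<le> \<nu>"
    and a: "0 < a" "\<And>\<phi>. a \<le> \<rho> \<phi>" "\<And>\<phi>. \<rho> \<phi> \<le> 1"
  shows "star_profile \<rho> (deriv \<rho>) a (1 + \<nu>)"
proof -
  note d = C2_2pi_derivs[OF \<rho>]
  have dd: "\<bar>deriv (deriv \<rho>) t\<bar> \<le> \<nu>" for t
    by (rule continuous_AE_le[OF _ \<nu>(1)]) (use d(3) in \<open>auto intro: continuous_intros\<close>)
  have lip': "\<bar>deriv \<rho> s - deriv \<rho> t\<bar> \<le> \<nu> * \<bar>s - t\<bar>" for s t by (rule abs_diff_le_of_deriv[OF d(2) dd])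
  have tay: "\<bar>\<rho> (t + h) - \<rho> t - deriv \<rho> t * h\<bar> \<le> \<nu> * h^2" for t h by (rule taylor_of_deriv[OF d(1) lip'])
  \<comment> \<open>Values at distance 1 differ by at most 1, and the Taylor remainder over that
    distance is at most \<open>\<nu>\<close>.\<close>
  have d1: "\<bar>deriv \<rho> t\<bar> \<le> 1 + \<nu>" for t
    using tay[of t 1] a(1) a(2)[of t] a(3)[of t] a(2)[of "t + 1"] a(3)[of "t + 1"] by simp
  show ?thesis
  proof
    show "\<bar>\<rho> s - \<rho> t\<bar> \<le> (1 + \<nu>) * \<bar>s - t\<bar>" for s t by (rule abs_diff_le_of_deriv[OF d(1) d1])
    show "\<bar>\<rho> (t + h) - \<rho> t - deriv \<rho> t * h\<bar> \<le> (1 + \<nu>) * h\<^sup>2" for t h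
      unfolding distrib_right using tay[of t h] zero_le_power2[of h] by linarith
  qed (use a d d1 \<nu> in auto)
qed

text \<open>Taken out of the locale to make visible that the constant depends only on
  \<open>\<nu>\<close> and the lower bound of the radius, hence is uniform over the class.\<close>

definition star_const :: "real \<Rightarrow> real \<Rightarrow> real" where
  "star_const \<nu> a = star_profile.flat_const a (1 + \<nu>)"

lemma (in star_profile) inside_iff:
  "inside (x $ 1) (x $ 2) \<longleftrightarrow> x \<in> (+) (vector [x1, x2]) ` star_region \<rho>" for x :: "real^2"
proof
  assume "inside (x $ 1) (x $ 2)"
  then obtain r \<theta> where r: "0 \<le> r" "r \<le> \<rho> \<theta>" "x $ 1 - x1 = r * cos \<theta>" "x $ 2 - x2 = r * sin \<theta>"
    unfolding inside_def by blast
  define s where "s = \<theta> + of_int (- \<lfloor>\<theta> / (2 * pi)\<rfloor>) * (2 * pi)"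
  have ps: "\<rho> s = \<rho> \<theta>" "cos s = cos \<theta>" "sin s = sin \<theta>" unfolding s_def by (intro periodic_int per cos_periodic sin_periodic)+
  have s: "s \<in> {0..2 * pi}"
  proof -
    have "s = 2 * pi * (\<theta> / (2 * pi) - of_int \<lfloor>\<theta> / (2 * pi)\<rfloor>)" by (simp add: s_def field_simps)
    moreover have "0 \<le> \<theta> / (2 * pi) - of_int \<lfloor>\<theta> / (2 * pi)\<rfloor>" "\<theta> / (2 * pi) - of_int \<lfloor>\<theta> / (2 * pi)\<rfloor> \<le> 1" by linarith+
    ultimately show ?thesis
      using mult_left_mono[of "\<theta> / (2 * pi) - of_int \<lfloor>\<theta> / (2 * pi)\<rfloor>" 1 "2 * pi"] by auto
  qed
  have "r *\<^sub>R vector [cos s, sin s] \<in> star_region \<rho>" unfolding star_region_def mem_Collect_eq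
    using r s ps by (intro exI[of _ r] exI[of _ s]) (simp del: atLeastAtMost_iff)
  moreover have "x = vector [x1, x2] + r *\<^sub>R vector [cos s, sin s]"
    using r ps by (simp add: vec_eq_iff forall_2 vector_2 algebra_simps)
  ultimately show "x \<in> (+) (vector [x1, x2]) ` star_region \<rho>" by blast
next
  assume "x \<in> (+) (vector [x1, x2]) ` star_region \<rho>"
  then obtain r \<theta> where "0 \<le> r" "r \<le> \<rho> \<theta>" "x = vector [x1, x2] + r *\<^sub>R vector [cos \<theta>, sin \<theta>]"
    unfolding star_region_def by auto
  then show "inside (x $ 1) (x $ 2)" unfolding inside_def
    by (intro exI[of _ r] exI[of _ \<theta>]) (simp add: vector_2)
qed

lemma STAR_flat:
  assumes "1 \<le> \<nu>" "0 < \<rho>\<^sub>0" "\<rho>\<^sub>1 < 1" and S: "S \<in> STAR \<nu> \<rho>\<^sub>0 \<rho>\<^sub>1"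
  shows "\<exists>G p1 p2 A1 A2. flat_set (star_const \<nu> \<rho>\<^sub>0) (\<lambda>x y. vector [x, y] \<in> S) G p1 p2 A1 A2"
proof -
  from S obtain x\<^sub>0 \<rho> where S_eq: "S = (+) x\<^sub>0 ` star_region \<rho>" and \<rho>: "\<rho> \<in> C2_2pi"
    and \<nu>: "AE \<phi> in lborel. \<bar>deriv (deriv \<rho>) \<phi>\<bar> \<le> \<nu>" and b: "\<And>\<phi>. \<rho>\<^sub>0 \<le> \<rho> \<phi> \<and> \<rho> \<phi> \<le> \<rho>\<^sub>1"
    and box: "(+) x\<^sub>0 ` star_region \<rho> \<subseteq> {x. \<forall>i. 0 \<le> x $ i \<and> x $ i \<le> 1}"
    unfolding STAR_def by blast
  interpret star_profile \<rho> "deriv \<rho>" "\<rho>\<^sub>0" "1 + \<nu>" "x\<^sub>0 $ 1" "x\<^sub>0 $ 2"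
    by (rule star_profile_of_C2) (use assms \<rho> \<nu> b in \<open>auto intro: order_trans less_imp_le\<close>)
  have x0: "vector [x\<^sub>0 $ 1, x\<^sub>0 $ 2] = x\<^sub>0" by (simp add: vec_eq_iff forall_2 vector_2)
  have i: "inside x y \<longleftrightarrow> vector [x, y] \<in> S" for x y
    using inside_iff[of "vector [x, y]"] by (simp add: vector_2 x0 S_eq)
  have "0 \<le> x \<and> x \<le> 1 \<and> 0 \<le> y \<and> y \<le> 1" if "inside x y" for x y
  proof -
    have "vector [x, y] \<in> {x :: real^2. \<forall>i. 0 \<le> x $ i \<and> x $ i \<le> 1}" using that box unfolding i S_eq by blast
    then show ?thesis by (simp add: forall_2 vector_2)
  qed
  from flat_set_inside[OF this] show ?thesis unfolding star_const_def i[abs_def] by blast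
qed

section \<open>Smooth approximations of a set with flat boundary\<close>

lemma sum_same_support:
  fixes f :: "'a \<Rightarrow> real"
  assumes "finite A" "finite B" "\<And>z. f z \<noteq> 0 \<Longrightarrow> z \<in> A \<and> z \<in> B"
  shows "sum f A = sum f B"
proof -
  have "sum f A = sum f (A \<inter> B)" by (rule sum.mono_neutral_right) (use assms in auto)
  also have "\<dots> = sum f B" by (rule sum.mono_neutral_left) (use assms in auto)
  finally show ?thesis .
qed

definition active :: "real \<Rightarrow> real \<Rightarrow> real \<Rightarrow> (int \<times> int) set" where
  "active N x y = {\<lfloor>N * x\<rfloor>, \<lfloor>N * x\<rfloor> + 1} \<times> {\<lfloor>N * y\<rfloor>, \<lfloor>N * y\<rfloor> + 1}"

lemma finite_active [simp]: "finite (active N x y)"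
  by (simp add: active_def)

lemma window_partition: "(\<Sum>q\<in>active N x y. window N q x y) = 1"
proof -
  have b: "(\<Sum>k\<in>{\<lfloor>t\<rfloor>, \<lfloor>t\<rfloor> + 1}. bump (t - of_int k)) = 1" for t
    using bump_partition[of t] by simp
  have "(\<Sum>q\<in>active N x y. window N q x y)
    = (\<Sum>k1\<in>{\<lfloor>N * x\<rfloor>, \<lfloor>N * x\<rfloor> + 1}. bump (N * x - of_int k1)) * (\<Sum>k2\<in>{\<lfloor>N * y\<rfloor>, \<lfloor>N * y\<rfloor> + 1}. bump (N * y - of_int k2))"
    unfolding active_def window_def sum_product sum.cartesian_product by (intro sum.cong) auto
  then show ?thesis unfolding b by simp
qed

lemma card_pairs_near:
  fixes a b r :: real
  assumes "0 \<le> r"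
  shows "finite {q::int\<times>int. \<bar>a - of_int (fst q)\<bar> \<le> r \<and> \<bar>b - of_int (snd q)\<bar> \<le> r}"
    "real (card {q::int\<times>int. \<bar>a - of_int (fst q)\<bar> \<le> r \<and> \<bar>b - of_int (snd q)\<bar> \<le> r}) \<le> (2 * r + 1)^2"
proof -
  have e: "{q::int\<times>int. \<bar>a - of_int (fst q)\<bar> \<le> r \<and> \<bar>b - of_int (snd q)\<bar> \<le> r}
    = {k. \<bar>of_int k - a\<bar> \<le> r} \<times> {k. \<bar>of_int k - b\<bar> \<le> r}" by (auto simp: abs_minus_commute)
  show "finite {q::int\<times>int. \<bar>a - of_int (fst q)\<bar> \<le> r \<and> \<bar>b - of_int (snd q)\<bar> \<le> r}"
    unfolding e using card_int_near[OF assms] by auto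
  have "real (card {k::int. \<bar>of_int k - a\<bar> \<le> r}) * real (card {k::int. \<bar>of_int k - b\<bar> \<le> r}) \<le> (2 * r + 1) * (2 * r + 1)"
    using card_int_near[OF assms] assms by (intro mult_mono) auto
  then show "real (card {q::int\<times>int. \<bar>a - of_int (fst q)\<bar> \<le> r \<and> \<bar>b - of_int (snd q)\<bar> \<le> r}) \<le> (2 * r + 1)^2"
    unfolding e by (simp add: card_cartesian_product power2_eq_square)
qed

context flat_set
begin

text \<open>In grid units, the margin \<open>K + 1\<close> is the reach \<open>K\<close> of
  \<open>cross\<close> at radius \<open>1 / N\<close> plus the half-width 1 of a window.\<close>

definition near :: "real \<Rightarrow> int \<times> int \<Rightarrow> bool" where
  "near N q \<longleftrightarrow> (\<exists>\<phi>. \<bar>N * p1 \<phi> - of_int (fst q)\<bar> \<le> K + 1 \<and> \<bar>N * p2 \<phi> - of_int (snd q)\<bar> \<le> K + 1)"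

definition foot :: "real \<Rightarrow> int \<times> int \<Rightarrow> real" where
  "foot N q = (SOME \<phi>. \<bar>N * p1 \<phi> - of_int (fst q)\<bar> \<le> K + 1 \<and> \<bar>N * p2 \<phi> - of_int (snd q)\<bar> \<le> K + 1)"

text \<open>Away from the boundary the constants -1 and 1, scaled by \<open>N^2 \<ge> 1\<close>,
  make the step exactly 1 or 0. One formula thus serves all squares, and such lines have zero
  gradient, which fits any shear.\<close>

definition line :: "real \<Rightarrow> int \<times> int \<Rightarrow> real \<times> real \<times> real" where
  "line N q = (if near N q then (A1 (foot N q), A2 (foot N q), - A1 (foot N q) * p1 (foot N q) - A2 (foot N q) * p2 (foot N q))
     else if S (of_int (fst q) / N) (of_int (snd q) / N) then (0, 0, -1) else (0, 0, 1))"

definition layer :: "real \<Rightarrow> real \<Rightarrow> real \<Rightarrow> real" where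
  "layer N x y = (\<Sum>q\<in>active N x y. window N q x y * smooth_step (N^2 * aff (line N q) x y))"

definition ind :: "real \<Rightarrow> real \<Rightarrow> real" where
  "ind x y = (if S x y then 1 else 0)"

lemma foot:
  assumes "near N q"
  shows "\<bar>N * p1 (foot N q) - of_int (fst q)\<bar> \<le> K + 1" "\<bar>N * p2 (foot N q) - of_int (snd q)\<bar> \<le> K + 1"
  using someI_ex[OF assms[unfolded near_def]] unfolding foot_def by blast+

lemma line_near:
  "near N q \<Longrightarrow> aff (line N q) x y = A1 (foot N q) * (x - p1 (foot N q)) + A2 (foot N q) * (y - p2 (foot N q))"
  by (simp add: line_def aff_def algebra_simps)

lemma boundary: "S (p1 \<phi>) (p2 \<phi>)"
  using flat[of \<phi> "p1 \<phi>" "p2 \<phi>"] by (simp add: mem)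

lemma far_const:
  assumes N: "1 \<le> N" and q: "\<not> near N q"
    and x: "\<bar>N * x - of_int (fst q)\<bar> \<le> 1" and y: "\<bar>N * y - of_int (snd q)\<bar> \<le> 1"
  shows "smooth_step (N^2 * aff (line N q) x y) = ind x y"
proof -
  let ?a = "of_int (fst q) / N" and ?b = "of_int (snd q) / N"
  have d: "\<bar>x - ?a\<bar> \<le> 1 / N" "\<bar>y - ?b\<bar> \<le> 1 / N"
  proof -
    have "x - ?a = (N * x - of_int (fst q)) / N" "y - ?b = (N * y - of_int (snd q)) / N" using N by (auto simp: field_simps)
    then show "\<bar>x - ?a\<bar> \<le> 1 / N" "\<bar>y - ?b\<bar> \<le> 1 / N" using x y N by (auto simp: divide_right_mono)
  qed
  have nearI: "near N q" if "\<bar>x' - p1 \<phi>\<bar> \<le> K * (1 / N)" "\<bar>y' - p2 \<phi>\<bar> \<le> K * (1 / N)"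
      "\<bar>N * x' - of_int (fst q)\<bar> \<le> 1" "\<bar>N * y' - of_int (snd q)\<bar> \<le> 1" for x' y' \<phi>
  proof -
    have "N * \<bar>x' - p1 \<phi>\<bar> \<le> N * (K * (1 / N))" "N * \<bar>y' - p2 \<phi>\<bar> \<le> N * (K * (1 / N))"
      using that N by (intro mult_left_mono; simp)+
    then have "\<bar>N * (x' - p1 \<phi>)\<bar> \<le> K" "\<bar>N * (y' - p2 \<phi>)\<bar> \<le> K" using N by (auto simp: abs_mult)
    then show ?thesis unfolding near_def using that(3,4)
      by (intro exI[of _ \<phi>]) (auto simp: right_diff_distrib abs_le_iff)
  qed
  have S: "S x y \<longleftrightarrow> S ?a ?b"
  proof (rule ccontr)
    assume neq: "S x y \<noteq> S ?a ?b"
    show False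
    proof (cases "S x y")
      case True
      with neq cross[of x y ?a ?b "1 / N"] d obtain \<phi> where "\<bar>?a - p1 \<phi>\<bar> \<le> K * (1 / N)" "\<bar>?b - p2 \<phi>\<bar> \<le> K * (1 / N)" by blast
      from nearI[OF this] q N show False by simp
    next
      case False
      with neq cross[of ?a ?b x y "1 / N"] d obtain \<phi> where "\<bar>x - p1 \<phi>\<bar> \<le> K * (1 / N)" "\<bar>y - p2 \<phi>\<bar> \<le> K * (1 / N)"
        by (auto simp: abs_minus_commute)
      from nearI[OF this x y] q show False by simp
    qed
  qed
  have N2: "1 \<le> N^2" using N by (simp add: one_le_power)
  show ?thesis unfolding line_def using q S N2
    by (simp add: aff_def ind_def smooth_step_le0 smooth_step_ge1)
qed

lemma near_flat:
  assumes N: "0 < N" and q: "near N q" and R: "0 \<le> R"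
    and x: "\<bar>N * x - of_int (fst q)\<bar> \<le> R" and y: "\<bar>N * y - of_int (snd q)\<bar> \<le> R"
  shows "\<bar>aff (line N q) x y - G x y\<bar> \<le> 2 * K * (K + 1 + R)^2 / N^2"
proof -
  let ?f = "foot N q"
  have K0: "0 \<le> K" using K by simp
  have "\<bar>N * (x - p1 ?f)\<bar> \<le> K + 1 + R" "\<bar>N * (y - p2 ?f)\<bar> \<le> K + 1 + R"
    using foot[OF q] x y by (auto simp: right_diff_distrib abs_le_iff)
  then have "(N * (x - p1 ?f))^2 \<le> (K + 1 + R)^2" "(N * (y - p2 ?f))^2 \<le> (K + 1 + R)^2"
    using power_mono[of "\<bar>N * (x - p1 ?f)\<bar>" "K + 1 + R" 2] power_mono[of "\<bar>N * (y - p2 ?f)\<bar>" "K + 1 + R" 2] by auto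
  then have "N^2 * ((x - p1 ?f)^2 + (y - p2 ?f)^2) \<le> 2 * (K + 1 + R)^2"
    by (simp add: power_mult_distrib distrib_left)
  then have "(x - p1 ?f)^2 + (y - p2 ?f)^2 \<le> 2 * (K + 1 + R)^2 / N^2" using N by (simp add: field_simps)
  then have "K * ((x - p1 ?f)^2 + (y - p2 ?f)^2) \<le> K * (2 * (K + 1 + R)^2 / N^2)" using K0 by (rule mult_left_mono)
  then show ?thesis using flat[of ?f x y] line_near[OF q, of x y] by (simp add: mult.assoc mult.left_commute)
qed

definition E1 :: real where "E1 = 2 * K * (K + 2)^2"
text \<open>Five times the bound of \<open>near_flat\<close> with \<open>R = 2\<close>: one share
  for the line at scale \<open>N\<close> and four for the line at scale \<open>N / 2\<close>, where
  the error is quadrupled.\<close>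

definition E2 :: real where "E2 = 10 * K * (K + 3)^2"

lemma E12: "1 \<le> E1" "E1 \<le> E2" "K \<le> E2" "2 * K * (K + 3)^2 \<le> E2 / 5"
proof -
  have 1: "1 \<le> (K + 2)^2" "(K + 2)^2 \<le> (K + 3)^2" using K by (auto intro!: one_le_power power_mono)
  have "1 * 1 \<le> (2 * K) * (K + 2)^2" using K 1 by (intro mult_mono) auto
  then show "1 \<le> E1" by (simp add: E1_def)
  show "E1 \<le> E2" unfolding E1_def E2_def using K 1 by (intro mult_mono) auto
  have "K * 1 \<le> (10 * K) * (K + 3)^2" using K 1 by (intro mult_mono) auto
  then show "K \<le> E2" by (simp add: E2_def)
  show "2 * K * (K + 3)^2 \<le> E2 / 5" by (simp add: E2_def)
qed

lemma near_flat_active: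
  assumes N: "0 < N" and q: "near N q"
    and x: "\<bar>N * x - of_int (fst q)\<bar> \<le> 1" and y: "\<bar>N * y - of_int (snd q)\<bar> \<le> 1"
  shows "\<bar>aff (line N q) x y - G x y\<bar> \<le> E1 / N^2"
  using near_flat[OF N q _ x y] by (simp add: E1_def add.commute)

text \<open>Beyond \<open>E1 / N^2\<close> the affine coordinate has the sign of \<open>G\<close>,
  and on the positive side \<open>E1 \<ge> 1\<close> ensures that the step has already run
  out.\<close>

lemma near_sharp:
  assumes N: "0 < N" and q: "near N q"
    and x: "\<bar>N * x - of_int (fst q)\<bar> \<le> 1" and y: "\<bar>N * y - of_int (snd q)\<bar> \<le> 1"
    and far: "\<bar>aff (line N q) x y\<bar> > E1 / N^2"
  shows "smooth_step (N^2 * aff (line N q) x y) = ind x y"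
proof (cases "aff (line N q) x y > 0")
  case True
  then have "G x y > 0" using near_flat_active[OF N q x y] far by linarith
  then have "ind x y = 0" by (simp add: ind_def mem)
  moreover have "1 \<le> N^2 * aff (line N q) x y"
  proof -
    have "N^2 * (E1 / N^2) \<le> N^2 * aff (line N q) x y" using True far by (intro mult_left_mono) auto
    then show ?thesis using E12 N by simp
  qed
  ultimately show ?thesis by (simp add: smooth_step_ge1)
next
  case False
  have "0 < E1 / N^2" using E12 N by (intro divide_pos_pos) auto
  then have "G x y < 0" using near_flat_active[OF N q x y] far False by linarith
  then have "ind x y = 1" by (simp add: ind_def mem)
  moreover have "N^2 * aff (line N q) x y \<le> 0" using False by (intro mult_nonneg_nonpos) auto
  ultimately show ?thesis by (simp add: smooth_step_le0)
qed

text \<open>If the two steps differ, one of them differs from the indicator. Either the coarse one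
  does, and the point lies in the coarse strip; or the fine one does, and comparison with the common
  \<open>G\<close> transfers its strip to the coarse line, with 6 = 1 + 1 + 4.\<close>

lemma piece_support:
  assumes N: "2 \<le> N" and p: "piece N q q' (line N q) (line (N/2) q') 1 x y \<noteq> 0"
  shows "near (N/2) q'" "\<bar>aff (line (N/2) q') x y\<bar> \<le> 6 * E2 / N^2"
    "\<bar>of_int (fst q) - 2 * of_int (fst q')\<bar> \<le> (3::real)" "\<bar>of_int (snd q) - 2 * of_int (snd q')\<bar> \<le> (3::real)"
proof -
  let ?s = "smooth_step (N^2 * aff (line N q) x y)" and ?s' = "smooth_step ((N/2)^2 * aff (line (N/2) q') x y)"
  have w: "window N q x y \<noteq> 0" "window (N/2) q' x y \<noteq> 0" and s: "?s \<noteq> ?s'" using p by (auto simp: piece_def)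
  note a = window_active(1,2)[OF w(1)] and a' = window_active(1,2)[OF w(2)]
  have hx: "\<bar>N * x - 2 * of_int (fst q')\<bar> \<le> 2" "\<bar>N * y - 2 * of_int (snd q')\<bar> \<le> 2" using a' by (auto simp: field_simps abs_le_iff abs_less_iff)
  show "\<bar>of_int (fst q) - 2 * of_int (fst q')\<bar> \<le> (3::real)" "\<bar>of_int (snd q) - 2 * of_int (snd q')\<bar> \<le> (3::real)"
    using a hx by linarith+
  have nn: "near (N/2) q'" if n: "near N q"
  proof -
    have "\<bar>N * p1 (foot N q) - 2 * of_int (fst q')\<bar> \<le> K + 4" "\<bar>N * p2 (foot N q) - 2 * of_int (snd q')\<bar> \<le> K + 4"
      using foot[OF n] a hx by linarith+
    \<comment> \<open>\<open>(K + 4) / 2 \<le> K + 1\<close> is where \<open>2 \<le> K\<close>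
      enters.\<close>
    then show ?thesis unfolding near_def using K by (intro exI[of _ "foot N q"]) (auto simp: field_simps abs_le_iff)
  qed
  have nq: "?s = ind x y" if "\<not> near N q" using far_const[OF _ that, of x y] a N by auto
  have nq': "?s' = ind x y" if "\<not> near (N/2) q'" using far_const[OF _ that, of x y] a' N by auto
  show n': "near (N/2) q'" using nn nq nq' s by metis
  have N0: "0 < N" "0 < N / 2" using N by auto
  have fl': "\<bar>aff (line (N/2) q') x y - G x y\<bar> \<le> 4 * (E1 / N^2)"
  proof -
    have "E1 / (N/2)^2 = 4 * (E1 / N^2)" by (simp add: power_divide)
    then show ?thesis using near_flat_active[OF N0(2) n', of x y] a' by simp
  qed
  have E0: "0 \<le> E1 / N^2" using E12 N by (intro divide_nonneg_nonneg) auto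
  have "\<bar>aff (line (N/2) q') x y\<bar> \<le> 6 * (E1 / N^2)"
  proof (rule ccontr)
    assume c: "\<not> ?thesis"
    have "\<bar>aff (line (N/2) q') x y\<bar> > E1 / (N/2)^2" using c E0 by (simp add: power_divide)
    then have "?s' = ind x y" using near_sharp[OF N0(2) n', of x y] a' by auto
    then have n: "near N q" "?s \<noteq> ind x y" using nq s by auto
    then have "\<bar>aff (line N q) x y\<bar> \<le> E1 / N^2" using near_sharp[OF N0(1) n(1), of x y] a by force
    then show False using near_flat_active[OF N0(1) n(1), of x y] a fl' c by linarith
  qed
  also have "\<dots> \<le> 6 * (E2 / N^2)" using E12 by (intro mult_left_mono divide_right_mono) auto
  finally show "\<bar>aff (line (N/2) q') x y\<bar> \<le> 6 * E2 / N^2" by simp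
qed

text \<open>Both lines approximate the same \<open>G\<close> around the square of \<open>q\<close>.
  Comparing them at three points with spacing \<open>1 / N\<close> turns a difference of order
  \<open>N^-2\<close> into a difference of coefficients of order \<open>1 / N\<close>.\<close>

lemma line_close:
  assumes N: "1 \<le> N" and n: "near N q" "near (N/2) q'"
    and d: "\<bar>of_int (fst q) - 2 * of_int (fst q')\<bar> \<le> (3::real)" "\<bar>of_int (snd q) - 2 * of_int (snd q')\<bar> \<le> (3::real)"
  shows "\<bar>fst (line N q) - fst (line (N/2) q')\<bar> \<le> 6 * E2 / N"
    "\<bar>fst (snd (line N q)) - fst (snd (line (N/2) q'))\<bar> \<le> 6 * E2 / N"
proof -
  have diff: "\<bar>aff (line N q) x y - aff (line (N/2) q') x y\<bar> \<le> E2 / N^2"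
    if x: "0 \<le> N * x - of_int (fst q)" "N * x - of_int (fst q) \<le> 1" and y: "0 \<le> N * y - of_int (snd q)" "N * y - of_int (snd q) \<le> 1" for x y
  proof -
    have xx: "N * x = 2 * ((N / 2) * x)" "N * y = 2 * ((N / 2) * y)" by auto
    have "\<bar>N / 2 * x - of_int (fst q')\<bar> \<le> 2" "\<bar>N / 2 * y - of_int (snd q')\<bar> \<le> 2" using x y d xx by linarith+
    then have 1: "\<bar>aff (line (N/2) q') x y - G x y\<bar> \<le> 2 * K * (K + 1 + 2)^2 / (N/2)^2" using N n by (intro near_flat) auto
    have 2: "\<bar>aff (line N q) x y - G x y\<bar> \<le> 2 * K * (K + 1 + 1)^2 / N^2" using N n x y by (intro near_flat) auto
    have m: "2 * K * (K + 1 + 1)^2 / N^2 \<le> 2 * K * (K + 3)^2 / N^2"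
      using K by (intro divide_right_mono mult_left_mono power_mono) auto
    have "K + 1 + 2 = K + 3" by simp
    then have "2 * K * (K + 1 + 2)^2 / (N/2)^2 = 4 * (2 * K * (K + 3)^2 / N^2)"
      by (simp only: power_divide) simp
    moreover have "2 * K * (K + 3)^2 / N^2 + 4 * (2 * K * (K + 3)^2 / N^2) = E2 / N^2"
    proof -
      have e: "E2 = 5 * (2 * K * (K + 3)^2)" unfolding E2_def mult.assoc[symmetric] by simp
      show ?thesis unfolding e times_divide_eq_right[of 5, symmetric] by linarith
    qed
    ultimately show ?thesis using 1 2 m by linarith
  qed
  let ?a = "of_int (fst q) / N" and ?b = "of_int (snd q) / N"
  have h0: "\<bar>aff (line N q) ?a ?b - aff (line (N/2) q') ?a ?b\<bar> \<le> E2 / N^2"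
    and h1: "\<bar>aff (line N q) (?a + 1/N) ?b - aff (line (N/2) q') (?a + 1/N) ?b\<bar> \<le> E2 / N^2"
    and h2: "\<bar>aff (line N q) ?a (?b + 1/N) - aff (line (N/2) q') ?a (?b + 1/N)\<bar> \<le> E2 / N^2"
    using N by (intro diff; simp add: field_simps)+
  have step: "aff l (x + 1/N) y = aff l x y + fst l / N" "aff l x (y + 1/N) = aff l x y + fst (snd l) / N" for l x y
    by (simp_all add: aff_def distrib_left)
  have 3: "2 * (E2 / N^2) * N \<le> 6 * E2 / N" using N E12 K by (simp add: power2_eq_square divide_right_mono)
  have "\<bar>(fst (line N q) - fst (line (N/2) q')) / N\<bar> \<le> 2 * (E2 / N^2)"
    using h0 h1 unfolding step diff_divide_distrib by linarith
  then have "\<bar>(fst (line N q) - fst (line (N/2) q')) / N\<bar> * N \<le> 2 * (E2 / N^2) * N" using N by (intro mult_right_mono) auto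
  then show "\<bar>fst (line N q) - fst (line (N/2) q')\<bar> \<le> 6 * E2 / N" using N 3 by (simp add: abs_divide)
  have "\<bar>(fst (snd (line N q)) - fst (snd (line (N/2) q'))) / N\<bar> \<le> 2 * (E2 / N^2)"
    using h0 h2 unfolding step diff_divide_distrib by linarith
  then have "\<bar>(fst (snd (line N q)) - fst (snd (line (N/2) q'))) / N\<bar> * N \<le> 2 * (E2 / N^2) * N" using N by (intro mult_right_mono) auto
  then show "\<bar>fst (snd (line N q)) - fst (snd (line (N/2) q'))\<bar> \<le> 6 * E2 / N" using N 3 by (simp add: abs_divide)
qed

lemma line_bounds:
  "\<bar>fst (line N q)\<bar> \<le> K" "\<bar>fst (snd (line N q))\<bar> \<le> K"
  "near N q \<Longrightarrow> 1 \<le> (fst (line N q))^2 + (fst (snd (line N q)))^2"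
  "\<not> near N q \<Longrightarrow> fst (line N q) = 0 \<and> fst (snd (line N q)) = 0"
  using K normal by (auto simp: line_def)

text \<open>Linear in \<open>N\<close> because the boundary is a curve: around each point of a
  \<open>sample\<close> at scale \<open>1 / N\<close> there is a bounded number of squares.\<close>

lemma card_near:
  assumes N: "1 \<le> N"
  shows "finite {q. near N q}" "real (card {q. near N q}) \<le> K * (4 * K + 3)^2 * N"
proof -
  obtain F where F: "finite F" "real (card F) \<le> K / (1 / N)"
    and s: "\<And>\<phi>. \<exists>\<phi>'\<in>F. \<bar>p1 \<phi> - p1 \<phi>'\<bar> \<le> K * (1 / N) \<and> \<bar>p2 \<phi> - p2 \<phi>'\<bar> \<le> K * (1 / N)"
    using sample[of "1 / N"] N by auto
  define Q where "Q \<phi> = {q::int\<times>int. \<bar>N * p1 \<phi> - of_int (fst q)\<bar> \<le> 2 * K + 1 \<and> \<bar>N * p2 \<phi> - of_int (snd q)\<bar> \<le> 2 * K + 1}" for \<phi>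
  have Q: "finite (Q \<phi>)" "real (card (Q \<phi>)) \<le> (4 * K + 3)^2" for \<phi>
    unfolding Q_def using card_pairs_near[of "2 * K + 1" "N * p1 \<phi>" "N * p2 \<phi>"] K by (auto simp: algebra_simps)
  have sub: "{q. near N q} \<subseteq> (\<Union>\<phi>\<in>F. Q \<phi>)"
  proof safe
    fix q1 q2 assume n: "near N (q1, q2)"
    obtain \<phi> where \<phi>: "\<phi> \<in> F" "\<bar>p1 (foot N (q1, q2)) - p1 \<phi>\<bar> \<le> K * (1 / N)" "\<bar>p2 (foot N (q1, q2)) - p2 \<phi>\<bar> \<le> K * (1 / N)"
      using s by blast
    have "N * \<bar>p1 (foot N (q1, q2)) - p1 \<phi>\<bar> \<le> N * (K * (1 / N))" "N * \<bar>p2 (foot N (q1, q2)) - p2 \<phi>\<bar> \<le> N * (K * (1 / N))"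
      using \<phi> N by (intro mult_left_mono; simp)+
    then have "\<bar>N * (p1 (foot N (q1, q2)) - p1 \<phi>)\<bar> \<le> K" "\<bar>N * (p2 (foot N (q1, q2)) - p2 \<phi>)\<bar> \<le> K" using N by (auto simp: abs_mult)
    then have "\<bar>N * p1 \<phi> - of_int q1\<bar> \<le> 2 * K + 1" "\<bar>N * p2 \<phi> - of_int q2\<bar> \<le> 2 * K + 1"
      using foot[OF n] unfolding right_diff_distrib fst_conv snd_conv by linarith+
    then show "(q1, q2) \<in> (\<Union>\<phi>\<in>F. Q \<phi>)" using \<phi> by (auto simp: Q_def)
  qed
  have fin: "finite (\<Union>\<phi>\<in>F. Q \<phi>)" using F Q by auto
  then show "finite {q. near N q}" using sub finite_subset by blast
  have "card {q. near N q} \<le> card (\<Union>\<phi>\<in>F. Q \<phi>)" by (rule card_mono[OF fin sub])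
  also have "\<dots> \<le> (\<Sum>\<phi>\<in>F. card (Q \<phi>))" by (rule card_UN_le[OF F(1)])
  finally have "real (card {q. near N q}) \<le> (\<Sum>\<phi>\<in>F. real (card (Q \<phi>)))" by (simp flip: of_nat_sum)
  also have "\<dots> \<le> (\<Sum>\<phi>\<in>F. (4 * K + 3)^2)" by (intro sum_mono Q)
  also have "\<dots> = real (card F) * (4 * K + 3)^2" by simp
  also have "\<dots> \<le> (K * N) * (4 * K + 3)^2" using F by (intro mult_right_mono) auto
  finally show "real (card {q. near N q}) \<le> K * (4 * K + 3)^2 * N" by (simp add: algebra_simps)
qed

end

lemma piece_measurable: "(\<lambda>z::real^2. piece N q q' \<alpha> \<alpha>' e (z $ 1) (z $ 2)) \<in> borel_measurable borel"
  unfolding piece_def window_def aff_def bump_def smooth_step_def tcube_def by measurable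

context flat_set
begin

text \<open>Each layer is multiplied by the partition of unity of the other scale, so that every
  summand contains one fine and one coarse line and the cancellation takes place inside a single
  piece.\<close>

lemma layer_diff:
  "layer N x y - layer (N/2) x y = (\<Sum>\<pi>\<in>active N x y \<times> active (N/2) x y.
     piece N (fst \<pi>) (snd \<pi>) (line N (fst \<pi>)) (line (N/2) (snd \<pi>)) 1 x y)"
proof -
  have "layer N x y - layer (N/2) x y
    = layer N x y * (\<Sum>q\<in>active (N/2) x y. window (N/2) q x y) - (\<Sum>q\<in>active N x y. window N q x y) * layer (N/2) x y"
    by (simp add: window_partition)
  also have "\<dots> = (\<Sum>\<pi>\<in>active N x y \<times> active (N/2) x y.
     piece N (fst \<pi>) (snd \<pi>) (line N (fst \<pi>)) (line (N/2) (snd \<pi>)) 1 x y)"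
    unfolding layer_def sum_product sum.cartesian_product sum_subtractf[symmetric]
    by (intro sum.cong) (auto simp: piece_def algebra_simps)
  finally show ?thesis .
qed

lemma layer_eq_pieces:
  "layer N x y = (\<Sum>\<pi>\<in>active N x y \<times> active (N/2) x y.
     piece N (fst \<pi>) (snd \<pi>) (line N (fst \<pi>)) \<alpha>' 0 x y)"
proof -
  have "layer N x y = layer N x y * (\<Sum>q\<in>active (N/2) x y. window (N/2) q x y)"
    by (simp add: window_partition)
  also have "\<dots> = (\<Sum>\<pi>\<in>active N x y \<times> active (N/2) x y.
     piece N (fst \<pi>) (snd \<pi>) (line N (fst \<pi>)) \<alpha>' 0 x y)"
    unfolding layer_def sum_product sum.cartesian_product
    by (intro sum.cong) (auto simp: piece_def algebra_simps)
  finally show ?thesis .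
qed

lemma piece_active:
  assumes "piece N q q' \<alpha> \<alpha>' e x y \<noteq> 0"
  shows "(q, q') \<in> active N x y \<times> active (N/2) x y"
proof -
  have "window N q x y \<noteq> 0" "window (N/2) q' x y \<noteq> 0" using assms by (auto simp: piece_def)
  from window_active(3)[OF this(1)] window_active(3)[OF this(2)] show ?thesis
    unfolding active_def by blast
qed

text \<open>At most 49 = \<open>7^2\<close> fine squares can be paired with a given coarse one; the
  second term counts the pairs at the coarsest scale, where every square around the unit square is
  kept.\<close>

definition pair_const :: real where
  "pair_const = 49 * (K * (4 * K + 3)^2) + ((2 * K + 7)^2)^2"

definition piece_bound :: real where
  "piece_bound = approx_const (3 * (6 * E2))"

lemma foot_box: "0 \<le> p1 \<phi>" "p1 \<phi> \<le> 1" "0 \<le> p2 \<phi>" "p2 \<phi> \<le> 1"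
  using box[OF boundary[of \<phi>]] by auto

lemma pair_const_ge: "2 * K + 7 \<le> pair_const" "0 \<le> pair_const" "((2 * K + 7)^2)^2 \<le> pair_const"
    "49 * (K * (4 * K + 3)^2) \<le> pair_const"
proof -
  have 1: "1 \<le> 2 * K + 7" using K by simp
  then have 2: "2 * K + 7 \<le> (2 * K + 7)^2" by (intro self_le_power) auto
  then have "(2 * K + 7)^2 \<le> ((2 * K + 7)^2)^2" using 1 by (intro self_le_power) (auto intro: order_trans)
  moreover have "0 \<le> 49 * (K * (4 * K + 3)^2)" using K by auto
  ultimately show "2 * K + 7 \<le> pair_const" "0 \<le> pair_const" "((2 * K + 7)^2)^2 \<le> pair_const"
    "49 * (K * (4 * K + 3)^2) \<le> pair_const"
    using 1 2 unfolding pair_const_def by linarith+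
qed

lemma coarse_pieces:
  "\<exists>P f. (\<forall>\<pi>. (\<lambda>z::real^2. f \<pi> (z $ 1) (z $ 2)) \<in> borel_measurable borel) \<and> finite P \<and> real (card P) \<le> pair_const \<and>
    (\<forall>\<pi>\<in>P. \<bar>of_int (fst (fst \<pi>))\<bar> \<le> pair_const \<and> \<bar>of_int (snd (fst \<pi>))\<bar> \<le> pair_const \<and>
       \<bar>of_int (fst (fst \<pi>)) - 2 * of_int (fst (snd \<pi>))\<bar> \<le> (3::real) \<and>
       \<bar>of_int (snd (fst \<pi>)) - 2 * of_int (snd (snd \<pi>))\<bar> \<le> (3::real)) \<and>
    (\<forall>x y. layer 1 x y = (\<Sum>\<pi>\<in>P. f \<pi> x y)) \<and>
    (\<forall>\<pi>\<in>P. \<forall>T\<ge>1. approximable piece_bound 1 T (fst \<pi>) (f \<pi>))"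
proof -
  define f where "f \<pi> = piece 1 (fst \<pi>) (snd \<pi>) (line 1 (fst \<pi>)) (0, 0, 0) 0" for \<pi>
  define B where "B = {q::int\<times>int. \<bar>0 - of_int (fst q)\<bar> \<le> K + 3 \<and> \<bar>0 - of_int (snd q)\<bar> \<le> K + 3}"
  define P where "P = {\<pi>. fst \<pi> \<in> B \<and>
       \<bar>of_int (fst (fst \<pi>)) - 2 * of_int (fst (snd \<pi>))\<bar> \<le> (3::real) \<and>
       \<bar>of_int (snd (fst \<pi>)) - 2 * of_int (snd (snd \<pi>))\<bar> \<le> (3::real)}"
  have B: "finite B" "real (card B) \<le> (2 * K + 7)^2"
    unfolding B_def using card_pairs_near[of "K + 3" 0 0] K by (simp_all add: algebra_simps)
  have sub: "P \<subseteq> B \<times> B"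
  proof
    fix \<pi> assume p: "\<pi> \<in> P"
    then have "snd \<pi> \<in> B" using K unfolding P_def B_def mem_Collect_eq by (auto simp: abs_le_iff)
    with p show "\<pi> \<in> B \<times> B" by (auto simp: P_def mem_Times_iff)
  qed
  have finP: "finite P" using sub B finite_subset by blast
  have "card P \<le> card B * card B" using card_mono[OF _ sub] B by (simp add: card_cartesian_product)
  then have "real (card P) \<le> real (card B) * real (card B)" by (metis of_nat_le_iff of_nat_mult)
  also have "\<dots> \<le> (2 * K + 7)^2 * (2 * K + 7)^2" using B by (intro mult_mono) auto
  also have "\<dots> \<le> pair_const" using pair_const_ge(3) by (simp only: power2_eq_square)
  finally have card: "real (card P) \<le> pair_const" .
  have supp: "\<pi> \<in> P" if nz: "f \<pi> x y \<noteq> 0" for \<pi> x y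
  proof -
    have w: "window 1 (fst \<pi>) x y \<noteq> 0" "window (1/2) (snd \<pi>) x y \<noteq> 0"
      and s: "smooth_step (1^2 * aff (line 1 (fst \<pi>)) x y) \<noteq> 0" using nz by (auto simp: f_def piece_def)
    note a = window_active(1,2)[OF w(1)] and a' = window_active(1,2)[OF w(2)]
    have b: "\<bar>of_int (fst (fst \<pi>))\<bar> \<le> K + 3" "\<bar>of_int (snd (fst \<pi>))\<bar> \<le> K + 3"
    proof -
      have "\<bar>of_int (fst (fst \<pi>))\<bar> \<le> K + 3 \<and> \<bar>of_int (snd (fst \<pi>))\<bar> \<le> K + 3"
      proof (cases "near 1 (fst \<pi>)")
        case True
        show ?thesis using foot[OF True] foot_box[of "foot 1 (fst \<pi>)"] by (auto simp: abs_le_iff)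
      next
        case False
        have "ind x y \<noteq> 0" using far_const[OF _ False, of x y] a s by auto
        then have "S x y" by (auto simp: ind_def split: if_splits)
        then show ?thesis using box[of x y] a K by (auto simp: abs_le_iff abs_less_iff)
      qed
      then show "\<bar>of_int (fst (fst \<pi>))\<bar> \<le> K + 3" "\<bar>of_int (snd (fst \<pi>))\<bar> \<le> K + 3" by auto
    qed
    show ?thesis unfolding P_def B_def mem_Collect_eq using a a' b by (auto simp: abs_le_iff abs_less_iff)
  qed
  have "layer 1 x y = (\<Sum>\<pi>\<in>P. f \<pi> x y)" for x y
    unfolding layer_eq_pieces[of 1 x y "(0, 0, 0)"] f_def[symmetric]
  proof (rule sum_same_support)
    fix \<pi> assume nz: "f \<pi> x y \<noteq> 0"
    then show "\<pi> \<in> active 1 x y \<times> active (1 / 2) x y \<and> \<pi> \<in> P"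
      using supp[OF nz] piece_active[of 1 "fst \<pi>" "snd \<pi>"] by (auto simp: f_def)
  qed (use finP in auto)
  moreover have "approximable piece_bound 1 T (fst \<pi>) (f \<pi>)" if "1 \<le> T" for T \<pi>
    unfolding piece_bound_def f_def using E12 K line_bounds[of 1 "fst \<pi>"] that by (intro coarse_piece_approximable) auto
  moreover have "\<bar>of_int (fst (fst \<pi>))\<bar> \<le> pair_const \<and> \<bar>of_int (snd (fst \<pi>))\<bar> \<le> pair_const" if "\<pi> \<in> P" for \<pi>
    using that pair_const_ge(1) K unfolding P_def B_def by auto
  moreover have "(\<lambda>z::real^2. f \<pi> (z $ 1) (z $ 2)) \<in> borel_measurable borel" for \<pi>
    unfolding f_def by (rule piece_measurable)
  ultimately show ?thesis using finP card by (intro exI[of _ P] exI[of _ f]) (auto simp: P_def)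
qed

text \<open>Only pairs whose coarse square is near the boundary contribute, at most 49 for each of
  them. The index set \<open>P\<close> depends neither on the point nor on the later refinement
  \<open>s\<close>.\<close>

lemma fine_pieces:
  assumes N: "N = 2 ^ Suc l"
  shows "\<exists>P f. (\<forall>\<pi>. (\<lambda>z::real^2. f \<pi> (z $ 1) (z $ 2)) \<in> borel_measurable borel) \<and> finite P \<and> real (card P) \<le> pair_const * N \<and>
    (\<forall>\<pi>\<in>P. \<bar>of_int (fst (fst \<pi>))\<bar> \<le> pair_const * N \<and> \<bar>of_int (snd (fst \<pi>))\<bar> \<le> pair_const * N \<and>
       \<bar>of_int (fst (fst \<pi>)) - 2 * of_int (fst (snd \<pi>))\<bar> \<le> (3::real) \<and>
       \<bar>of_int (snd (fst \<pi>)) - 2 * of_int (snd (snd \<pi>))\<bar> \<le> (3::real)) \<and>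
    (\<forall>x y. layer N x y - layer (N/2) x y = (\<Sum>\<pi>\<in>P. f \<pi> x y)) \<and>
    (\<forall>\<pi>\<in>P. \<forall>s. approximable piece_bound N (2 ^ s) (fst \<pi>) (f \<pi>))"
proof -
  have N2: "2 \<le> N" using N by simp
  then have N1: "1 \<le> N" "1 \<le> N / 2" by auto
  define f where "f \<pi> = piece N (fst \<pi>) (snd \<pi>) (line N (fst \<pi>)) (line (N/2) (snd \<pi>)) 1" for \<pi>
  define P where "P = {\<pi>. near (N/2) (snd \<pi>) \<and>
       \<bar>of_int (fst (fst \<pi>)) - 2 * of_int (fst (snd \<pi>))\<bar> \<le> (3::real) \<and>
       \<bar>of_int (snd (fst \<pi>)) - 2 * of_int (snd (snd \<pi>))\<bar> \<le> (3::real)}"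
  define Q where "Q = {q. near (N/2) q}"
  define B where "B q' = {q::int\<times>int. \<bar>2 * of_int (fst q') - of_int (fst q)\<bar> \<le> (3::real) \<and> \<bar>2 * of_int (snd q') - of_int (snd q)\<bar> \<le> (3::real)}"
    for q' :: "int \<times> int"
  have B: "finite (B q')" "real (card (B q')) \<le> 49" for q'
    unfolding B_def using card_pairs_near[of 3 "2 * of_int (fst q')" "2 * of_int (snd q')"] by simp_all
  have Q: "finite Q" "real (card Q) \<le> K * (4 * K + 3)^2 * (N/2)"
    unfolding Q_def using card_near[OF N1(2)] by auto
  have P_eq: "P = prod.swap ` (SIGMA q':Q. B q')"
  proof
    show "P \<subseteq> prod.swap ` (SIGMA q':Q. B q')"
    proof
      fix \<pi> assume "\<pi> \<in> P"
      then have "prod.swap \<pi> \<in> (SIGMA q':Q. B q')" by (cases \<pi>) (auto simp: P_def Q_def B_def abs_minus_commute)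
      then show "\<pi> \<in> prod.swap ` (SIGMA q':Q. B q')" by (metis image_eqI swap_swap)
    qed
    show "prod.swap ` (SIGMA q':Q. B q') \<subseteq> P" by (auto simp: P_def Q_def B_def abs_minus_commute)
  qed
  have finP: "finite P" unfolding P_eq using Q B by auto
  have "card P \<le> card (SIGMA q':Q. B q')" unfolding P_eq using Q B by (intro card_image_le) auto
  also have "\<dots> = (\<Sum>q'\<in>Q. card (B q'))" using Q B by (intro card_SigmaI) auto
  finally have "real (card P) \<le> (\<Sum>q'\<in>Q. real (card (B q')))" by (simp flip: of_nat_sum)
  also have "\<dots> \<le> (\<Sum>q'\<in>Q. 49)" by (intro sum_mono B)
  also have "\<dots> = 49 * real (card Q)" by simp
  also have "\<dots> \<le> 49 * (K * (4 * K + 3)^2 * (N/2))" using Q by (intro mult_left_mono) auto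
  also have "\<dots> \<le> 49 * (K * (4 * K + 3)^2) * N" using K N1 by simp
  also have "\<dots> \<le> pair_const * N" using pair_const_ge(4) N1 by (intro mult_right_mono) auto
  finally have card: "real (card P) \<le> pair_const * N" .
  have bound: "\<bar>of_int (fst (fst \<pi>))\<bar> \<le> pair_const * N \<and> \<bar>of_int (snd (fst \<pi>))\<bar> \<le> pair_const * N" if p: "\<pi> \<in> P" for \<pi>
  proof -
    have n: "near (N/2) (snd \<pi>)" and d: "\<bar>of_int (fst (fst \<pi>)) - 2 * of_int (fst (snd \<pi>))\<bar> \<le> (3::real)"
       "\<bar>of_int (snd (fst \<pi>)) - 2 * of_int (snd (snd \<pi>))\<bar> \<le> (3::real)" using p by (auto simp: P_def)
    let ?f = "foot (N/2) (snd \<pi>)"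
    have "0 \<le> N / 2 * p1 ?f" "N / 2 * p1 ?f \<le> N / 2 * 1" "0 \<le> N / 2 * p2 ?f" "N / 2 * p2 ?f \<le> N / 2 * 1"
      using foot_box[of ?f] N1 by (auto intro!: mult_left_mono mult_nonneg_nonneg)
    then have "\<bar>of_int (fst (fst \<pi>))\<bar> \<le> N + 2 * K + 5" "\<bar>of_int (snd (fst \<pi>))\<bar> \<le> N + 2 * K + 5"
      using foot[OF n] d by (auto simp: abs_le_iff)
    moreover have "N + 2 * K + 5 \<le> (2 * K + 7) * N"
      using mult_left_mono[OF N1(1), of "2 * K + 6"] K by (simp add: algebra_simps)
    moreover have "\<dots> \<le> pair_const * N" using pair_const_ge(1) N1 by (intro mult_right_mono) auto
    ultimately show ?thesis by linarith
  qed
  have supp: "\<pi> \<in> P" if nz: "f \<pi> x y \<noteq> 0" for \<pi> x y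
    using piece_support[OF N2, of "fst \<pi>" "snd \<pi>" x y] nz unfolding f_def P_def by auto
  have eq: "layer N x y - layer (N/2) x y = (\<Sum>\<pi>\<in>P. f \<pi> x y)" for x y
    unfolding layer_diff f_def[symmetric]
  proof (rule sum_same_support)
    fix \<pi> assume nz: "f \<pi> x y \<noteq> 0"
    then show "\<pi> \<in> active N x y \<times> active (N / 2) x y \<and> \<pi> \<in> P"
      using supp[OF nz] piece_active[of N "fst \<pi>" "snd \<pi>"] by (auto simp: f_def)
  qed (use finP in auto)
  have app: "approximable piece_bound N (2 ^ s) (fst \<pi>) (f \<pi>)" if p: "\<pi> \<in> P" for \<pi> s
    unfolding piece_bound_def f_def
  proof (rule piece_approximable[where Mi = "2 ^ (Suc l + s)"])
    have n: "near (N/2) (snd \<pi>)" and d: "\<bar>of_int (fst (fst \<pi>)) - 2 * of_int (fst (snd \<pi>))\<bar> \<le> (3::real)"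
       "\<bar>of_int (snd (fst \<pi>)) - 2 * of_int (snd (snd \<pi>))\<bar> \<le> (3::real)" using p by (auto simp: P_def)
    show "1 \<le> 6 * E2" using E12 by linarith
    show "N * 2 ^ s = real_of_int (2 ^ (Suc l + s))" unfolding N by (simp add: power_add)
    have KE: "K \<le> 6 * E2" using E12 K by linarith
    show "\<bar>fst (line N (fst \<pi>))\<bar> \<le> 6 * E2" "\<bar>fst (line (N/2) (snd \<pi>))\<bar> \<le> 6 * E2"
      "\<bar>fst (snd (line N (fst \<pi>)))\<bar> \<le> 6 * E2" "\<bar>fst (snd (line (N/2) (snd \<pi>)))\<bar> \<le> 6 * E2"
      using line_bounds(1,2) KE by (meson order_trans)+
    show "1 \<le> (fst (line (N/2) (snd \<pi>)))^2 + (fst (snd (line (N/2) (snd \<pi>))))^2" by (rule line_bounds(3)[OF n])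
    show "fst (line N (fst \<pi>)) = 0 \<and> fst (snd (line N (fst \<pi>))) = 0 \<or>
      \<bar>fst (line N (fst \<pi>)) - fst (line (N/2) (snd \<pi>))\<bar> \<le> 6 * E2 / N \<and>
      \<bar>fst (snd (line N (fst \<pi>))) - fst (snd (line (N/2) (snd \<pi>)))\<bar> \<le> 6 * E2 / N"
      using line_close[OF N1(1) _ n d] line_bounds(4)[of N "fst \<pi>"] by blast
    show "\<bar>aff (line (N/2) (snd \<pi>)) x y\<bar> \<le> 6 * E2 / N^2"
      if "piece N (fst \<pi>) (snd \<pi>) (line N (fst \<pi>)) (line (N/2) (snd \<pi>)) 1 x y \<noteq> 0" for x y
      using piece_support(2)[OF N2 that] .
  qed (use N1 in auto)
  have "(\<lambda>z::real^2. f \<pi> (z $ 1) (z $ 2)) \<in> borel_measurable borel" for \<pi>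
    unfolding f_def by (rule piece_measurable)
  then show ?thesis using finP card bound eq app
    by (intro exI[of _ P] exI[of _ f]) (auto simp: P_def)
qed

text \<open>4040000 is \<open>200 * 200 * 101\<close>: two bump bounds and the bound for a step
  minus the indicator. Active squares whose strip does not contain the point contribute
  nothing.\<close>

lemma layer_error:
  assumes N: "1 \<le> N"
  shows "\<bar>layer N x y - ind x y\<bar> \<le> 4040000 * real (card {q. near N q \<and> \<bar>N * x - of_int (fst q)\<bar> \<le> 6 \<and>
     \<bar>N * y - of_int (snd q)\<bar> \<le> 6 \<and> \<bar>aff (line N q) x y\<bar> \<le> E2 / N^2})"
proof -
  define R where "R = {q. near N q \<and> \<bar>N * x - of_int (fst q)\<bar> \<le> 6 \<and>
     \<bar>N * y - of_int (snd q)\<bar> \<le> 6 \<and> \<bar>aff (line N q) x y\<bar> \<le> E2 / N^2}"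
  define t where "t q = window N q x y * (smooth_step (N^2 * aff (line N q) x y) - ind x y)" for q
  have finR: "finite R" by (rule finite_subset[OF _ card_near(1)[OF N]]) (auto simp: R_def)
  have "layer N x y - ind x y = layer N x y - ind x y * (\<Sum>q\<in>active N x y. window N q x y)" by (simp add: window_partition)
  also have "\<dots> = (\<Sum>q\<in>active N x y. t q)"
    unfolding layer_def t_def sum_distrib_left sum_subtractf[symmetric] by (simp add: algebra_simps)
  also have "\<dots> = (\<Sum>q\<in>active N x y \<inter> R. t q)"
  proof (rule sum.mono_neutral_right)
    show "\<forall>q\<in>active N x y - active N x y \<inter> R. t q = 0"
    proof
      fix q assume q: "q \<in> active N x y - active N x y \<inter> R"
      show "t q = 0"
      proof (rule ccontr)
        assume nz: "t q \<noteq> 0"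
        then have w: "window N q x y \<noteq> 0" and s: "smooth_step (N^2 * aff (line N q) x y) \<noteq> ind x y" by (auto simp: t_def)
        note a = window_active(1,2)[OF w]
        have n: "near N q" using far_const[OF N, of q x y] a s by force
        have "\<bar>aff (line N q) x y\<bar> \<le> E1 / N^2" using near_sharp[OF _ n, of x y] a s N by force
        also have "\<dots> \<le> E2 / N^2" using E12 by (intro divide_right_mono) auto
        finally have "q \<in> R" using n a by (auto simp: R_def)
        with q show False by auto
      qed
    qed
  qed auto
  also have "\<bar>\<dots>\<bar> \<le> (\<Sum>q\<in>active N x y \<inter> R. \<bar>t q\<bar>)" by (rule sum_abs)
  also have "\<dots> \<le> (\<Sum>q\<in>active N x y \<inter> R. 4040000)"
  proof (rule sum_mono)
    fix q
    have "\<bar>window N q x y\<bar> \<le> 200 * 200" unfolding window_def abs_mult by (intro mult_mono bump_bound) auto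
    moreover have "\<bar>smooth_step (N^2 * aff (line N q) x y) - ind x y\<bar> \<le> 101"
      using smooth_step_bound[of "N^2 * aff (line N q) x y"] by (auto simp: ind_def abs_le_iff)
    ultimately have "\<bar>t q\<bar> \<le> (200 * 200) * 101" unfolding t_def abs_mult by (intro mult_mono) auto
    then show "\<bar>t q\<bar> \<le> 4040000" by simp
  qed
  also have "\<dots> = 4040000 * real (card (active N x y \<inter> R))" by simp
  also have "\<dots> \<le> 4040000 * real (card R)" using finR by (intro mult_left_mono) (auto intro: card_mono)
  finally show ?thesis unfolding R_def by simp
qed

end

section \<open>Estimates in the mean\<close>

definition strip :: "real \<Rightarrow> real \<Rightarrow> int \<times> int \<Rightarrow> real \<times> real \<times> real \<Rightarrow> (real^2) set" where
  "strip D N q \<beta> = {z. \<bar>N * z $ 1 - of_int (fst q)\<bar> \<le> 6 \<and> \<bar>N * z $ 2 - of_int (snd q)\<bar> \<le> 6 \<and>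
     \<bar>aff \<beta> (z $ 1) (z $ 2)\<bar> \<le> D / N^2}"

lemma strip_measurable [measurable]: "strip D N q \<beta> \<in> sets borel"
  unfolding strip_def aff_def by measurable

lemma shear_box_measure:
  fixes f :: "real^2 \<Rightarrow> real^2"
  assumes f: "linear f" and det: "\<bar>det (matrix f)\<bar> = 1"
    and ab: "\<And>i. a $ i \<le> b $ i" and A: "A \<in> sets borel" "A \<subseteq> f ` cbox a b"
  shows "emeasure lborel A \<le> ennreal ((b $ 1 - a $ 1) * (b $ 2 - a $ 2))"
proof -
  have "measure lebesgue (f ` cbox a b) = measure lebesgue (cbox a b)"
    using measure_linear_image[OF f lmeasurable_cbox] det by simp
  also have "\<dots> = (\<Prod>i\<in>UNIV. b $ i - a $ i)"
    using ab by (simp add: content_cbox_cart interval_eq_empty_cart not_less)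
  also have "\<dots> = (b $ 1 - a $ 1) * (b $ 2 - a $ 2)" by (simp add: UNIV_2)
  finally have m: "measure lebesgue (f ` cbox a b) = (b $ 1 - a $ 1) * (b $ 2 - a $ 2)" .
  have fm: "f ` cbox a b \<in> lmeasurable" using measurable_linear_image[OF f lmeasurable_cbox] .
  have "emeasure lborel A = emeasure lebesgue A" using A(1) by simp
  also have "\<dots> \<le> emeasure lebesgue (f ` cbox a b)" using fm A(2) by (intro emeasure_mono) auto
  also have "\<dots> = ennreal ((b $ 1 - a $ 1) * (b $ 2 - a $ 2))" using fm m by (simp add: emeasure_eq_measure2)
  finally show ?thesis .
qed

text \<open>Dividing by the coefficient of modulus at least 1/2 and undoing the slope by a shear of
  determinant 1 leaves a box with sides \<open>4 * D / N^2\<close> and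
  \<open>12 / N\<close>.\<close>

lemma strip_area:
  assumes D: "0 \<le> D" and N: "0 < N" and \<beta>: "1/2 \<le> \<bar>fst \<beta>\<bar> \<or> 1/2 \<le> \<bar>fst (snd \<beta>)\<bar>"
  shows "emeasure lborel (strip D N q \<beta>) \<le> ennreal (48 * D / N^3)"
proof -
  have lin: "linear (\<lambda>z::real^2. vector [z $ 1 - c * z $ 2, z $ 2] :: real^2)"
    "linear (\<lambda>z::real^2. vector [z $ 1, z $ 2 - c * z $ 1] :: real^2)" for c
    by (auto intro!: linearI simp: vec_eq_iff forall_2 vector_2 algebra_simps)
  have det: "\<bar>det (matrix (\<lambda>z::real^2. vector [z $ 1 - c * z $ 2, z $ 2] :: real^2))\<bar> = 1"
    "\<bar>det (matrix (\<lambda>z::real^2. vector [z $ 1, z $ 2 - c * z $ 1] :: real^2))\<bar> = 1" for c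
    by (simp_all add: det_2 matrix_def vector_2 axis_def)
  have D0: "0 \<le> D / N^2" using D by simp
  have N3: "(4 * D / N^2) * (12 / N) = 48 * D / N^3" using N by (simp add: power2_eq_square power3_eq_cube)
  have *: "\<bar>u\<bar> \<le> 6 / N \<and> \<bar>v\<bar> \<le> 2 * D / N^2" if "\<bar>N * u\<bar> \<le> 6" "1/2 \<le> \<bar>r\<bar>" "\<bar>r * v\<bar> \<le> D / N^2" for u v r
  proof -
    have "\<bar>u\<bar> \<le> 6 / N" using that(1) N by (simp add: abs_mult field_simps)
    moreover have "(1/2) * \<bar>v\<bar> \<le> \<bar>r\<bar> * \<bar>v\<bar>" using that(2) by (intro mult_right_mono) auto
    then have "\<bar>v\<bar> \<le> 2 * (D / N^2)" using that(3) by (simp add: abs_mult)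
    ultimately show ?thesis by simp
  qed
  show ?thesis
  proof (cases "1/2 \<le> \<bar>fst \<beta>\<bar>")
    case True
    define c where "c = fst (snd \<beta>) / fst \<beta>"
    define d where "d = snd (snd \<beta>) / fst \<beta>"
    let ?q = "of_int (snd q) / N"
    have "emeasure lborel (strip D N q \<beta>)
      \<le> ennreal (((vector [- d + 2 * D / N^2, ?q + 6 / N] :: real^2) $ 1 - (vector [- d - 2 * D / N^2, ?q - 6 / N] :: real^2) $ 1)
         * ((vector [- d + 2 * D / N^2, ?q + 6 / N] :: real^2) $ 2 - (vector [- d - 2 * D / N^2, ?q - 6 / N] :: real^2) $ 2))"
    proof (rule shear_box_measure[OF lin(1) det(1)[of c]])
      show "(vector [- d - 2 * D / N^2, ?q - 6 / N] :: real^2) $ i \<le> (vector [- d + 2 * D / N^2, ?q + 6 / N] :: real^2) $ i" for i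
        using D0 N exhaust_2[of i] by (auto simp: vector_2)
      show "strip D N q \<beta> \<subseteq> (\<lambda>z::real^2. vector [z $ 1 - c * z $ 2, z $ 2] :: real^2) ` cbox (vector [- d - 2 * D / N^2, ?q - 6 / N]) (vector [- d + 2 * D / N^2, ?q + 6 / N])"
      proof
        fix z assume z: "z \<in> strip D N q \<beta>"
        define w :: "real^2" where "w = vector [z $ 1 + c * z $ 2, z $ 2]"
        have "N * (z $ 2 - ?q) = N * z $ 2 - of_int (snd q)" using N by (simp add: right_diff_distrib)
        moreover have "fst \<beta> * (z $ 1 + c * z $ 2 + d) = aff \<beta> (z $ 1) (z $ 2)" using True
          unfolding c_def d_def aff_def by (auto simp: field_simps)
        ultimately have "\<bar>z $ 2 - ?q\<bar> \<le> 6 / N \<and> \<bar>z $ 1 + c * z $ 2 + d\<bar> \<le> 2 * D / N^2"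
          using z True by (intro *[of _ "fst \<beta>"]) (auto simp: strip_def)
        then have "w \<in> cbox (vector [- d - 2 * D / N^2, ?q - 6 / N]) (vector [- d + 2 * D / N^2, ?q + 6 / N])"
          by (auto simp: mem_box_cart forall_2 vector_2 w_def abs_le_iff)
        moreover have "z = vector [w $ 1 - c * w $ 2, w $ 2]" by (simp add: vec_eq_iff forall_2 vector_2 w_def)
        ultimately show "z \<in> (\<lambda>z::real^2. vector [z $ 1 - c * z $ 2, z $ 2] :: real^2) ` cbox (vector [- d - 2 * D / N^2, ?q - 6 / N]) (vector [- d + 2 * D / N^2, ?q + 6 / N])" by blast
      qed
    qed simp
    then show ?thesis by (simp add: vector_2 N3[symmetric])
  next
    case False
    then have s: "1/2 \<le> \<bar>fst (snd \<beta>)\<bar>" using \<beta> by simp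
    define c where "c = fst \<beta> / fst (snd \<beta>)"
    define d where "d = snd (snd \<beta>) / fst (snd \<beta>)"
    let ?q = "of_int (fst q) / N"
    have "emeasure lborel (strip D N q \<beta>)
      \<le> ennreal (((vector [?q + 6 / N, - d + 2 * D / N^2] :: real^2) $ 1 - (vector [?q - 6 / N, - d - 2 * D / N^2] :: real^2) $ 1)
         * ((vector [?q + 6 / N, - d + 2 * D / N^2] :: real^2) $ 2 - (vector [?q - 6 / N, - d - 2 * D / N^2] :: real^2) $ 2))"
    proof (rule shear_box_measure[OF lin(2) det(2)[of c]])
      show "(vector [?q - 6 / N, - d - 2 * D / N^2] :: real^2) $ i \<le> (vector [?q + 6 / N, - d + 2 * D / N^2] :: real^2) $ i" for i
        using D0 N exhaust_2[of i] by (auto simp: vector_2)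
      show "strip D N q \<beta> \<subseteq> (\<lambda>z::real^2. vector [z $ 1, z $ 2 - c * z $ 1] :: real^2) ` cbox (vector [?q - 6 / N, - d - 2 * D / N^2]) (vector [?q + 6 / N, - d + 2 * D / N^2])"
      proof
        fix z assume z: "z \<in> strip D N q \<beta>"
        define w :: "real^2" where "w = vector [z $ 1, z $ 2 + c * z $ 1]"
        have "N * (z $ 1 - ?q) = N * z $ 1 - of_int (fst q)" using N by (simp add: right_diff_distrib)
        moreover have "fst (snd \<beta>) * (z $ 2 + c * z $ 1 + d) = aff \<beta> (z $ 1) (z $ 2)" using s
          unfolding c_def d_def aff_def by (auto simp: field_simps)
        ultimately have "\<bar>z $ 1 - ?q\<bar> \<le> 6 / N \<and> \<bar>z $ 2 + c * z $ 1 + d\<bar> \<le> 2 * D / N^2"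
          using z s by (intro *[of _ "fst (snd \<beta>)"]) (auto simp: strip_def)
        then have "w \<in> cbox (vector [?q - 6 / N, - d - 2 * D / N^2]) (vector [?q + 6 / N, - d + 2 * D / N^2])"
          by (auto simp: mem_box_cart forall_2 vector_2 w_def abs_le_iff)
        moreover have "z = vector [w $ 1, w $ 2 - c * w $ 1]" by (simp add: vec_eq_iff forall_2 vector_2 w_def)
        ultimately show "z \<in> (\<lambda>z::real^2. vector [z $ 1, z $ 2 - c * z $ 1] :: real^2) ` cbox (vector [?q - 6 / N, - d - 2 * D / N^2]) (vector [?q + 6 / N, - d + 2 * D / N^2])" by blast
      qed
    qed simp
    then show ?thesis unfolding N3[symmetric] by (simp add: vector_2 mult.commute)
  qed
qed

definition l2_le :: "(real^2 \<Rightarrow> real) \<Rightarrow> real \<Rightarrow> bool" where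
  "l2_le e c \<longleftrightarrow> square_integrable (\<lambda>z. complex_of_real (e z)) \<and> norm (l2_of (\<lambda>z. complex_of_real (e z))) \<le> c"

text \<open>If at most \<open>M\<close> sets overlap at a point, the squared overlap count is at
  most \<open>M\<close> times the count, whose integral is the sum of the areas. The mean square of
  the error thus grows only linearly in the number of sets.\<close>

lemma l2_le_overlap:
  fixes e :: "real^2 \<Rightarrow> real"
  assumes e: "e \<in> borel_measurable borel" and P: "finite P" and R: "\<And>\<pi>. \<pi> \<in> P \<Longrightarrow> R \<pi> \<in> sets borel"
    and A: "\<And>\<pi>. \<pi> \<in> P \<Longrightarrow> emeasure lborel (R \<pi>) \<le> ennreal A" "0 \<le> A"
    and b: "0 \<le> b" "\<And>z. \<bar>e z\<bar> \<le> b * real (card {\<pi>\<in>P. z \<in> R \<pi>})"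
    and M: "0 \<le> M" "\<And>z. real (card {\<pi>\<in>P. z \<in> R \<pi>}) \<le> M"
  shows "l2_le e (b * sqrt (M * real (card P) * A))"
proof -
  define h where "h z = b^2 * M * (\<Sum>\<pi>\<in>P. indicator (R \<pi>) z)" for z :: "real^2"
  have int1: "integrable lborel (\<lambda>z. indicator (R \<pi>) z :: real)" and mu: "measure lborel (R \<pi>) \<le> A" if "\<pi> \<in> P" for \<pi>
  proof -
    have "emeasure lborel (R \<pi>) < \<infinity>" using A(1)[OF that] by (auto simp: less_top[symmetric] top_unique)
    then show "integrable lborel (\<lambda>z. indicator (R \<pi>) z :: real)" using R[OF that] by simp
    show "measure lborel (R \<pi>) \<le> A" unfolding measure_def using A that by (simp add: enn2real_leI)
  qed
  have inth: "integrable lborel h" unfolding h_def by (intro integrable_mult_right Bochner_Integration.integrable_sum int1)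
  have "integral\<^sup>L lborel h = b^2 * M * (\<Sum>\<pi>\<in>P. measure lborel (R \<pi>))"
  proof -
    have "integral\<^sup>L lborel h = b^2 * M * integral\<^sup>L lborel (\<lambda>z. \<Sum>\<pi>\<in>P. indicator (R \<pi>) z)"
      unfolding h_def by simp
    also have "integral\<^sup>L lborel (\<lambda>z. \<Sum>\<pi>\<in>P. indicator (R \<pi>) z :: real)
       = (\<Sum>\<pi>\<in>P. integral\<^sup>L lborel (\<lambda>z. indicator (R \<pi>) z))"
      by (rule Bochner_Integration.integral_sum[OF int1])
    finally show ?thesis by simp
  qed
  also have "\<dots> \<le> b^2 * M * (\<Sum>\<pi>\<in>P. A)" using mu M b by (intro mult_left_mono sum_mono) auto
  also have "\<dots> = b^2 * (M * real (card P) * A)" by simp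
  finally have Ih: "integral\<^sup>L lborel h \<le> b^2 * (M * real (card P) * A)" .
  have le: "(e z)^2 \<le> h z" for z
  proof -
    let ?c = "real (card {\<pi>\<in>P. z \<in> R \<pi>})"
    have c: "?c = (\<Sum>\<pi>\<in>P. indicator (R \<pi>) z)"
      using P by (simp add: indicator_def of_bool_def sum.If_cases Collect_conj_eq Int_commute)
    have "(e z)^2 \<le> (b * ?c)^2" using power_mono[OF b(2)[of z], of 2] by simp
    also have "\<dots> = b^2 * (?c * ?c)" by (simp add: power2_eq_square)
    also have "\<dots> \<le> b^2 * (M * ?c)" using M by (intro mult_left_mono mult_right_mono) auto
    finally show ?thesis unfolding h_def c[symmetric] by simp
  qed
  have inte: "integrable lborel (\<lambda>z. (e z)^2)"
    by (rule Bochner_Integration.integrable_bound[OF inth]) (use e le in \<open>auto intro: order_trans[OF _ abs_ge_self]\<close>)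
  have sq: "square_integrable (\<lambda>z. complex_of_real (e z))"
    unfolding square_integrable_def using e inte by auto
  have "integral\<^sup>L lborel (\<lambda>z. (e z)^2) \<le> integral\<^sup>L lborel h" by (intro integral_mono inte inth le)
  then have "sqrt (integral\<^sup>L lborel (\<lambda>z. (e z)^2)) \<le> sqrt (b^2 * (M * real (card P) * A))" using Ih by simp
  also have "\<dots> = b * sqrt (M * real (card P) * A)" using b by (simp add: real_sqrt_mult)
  finally show ?thesis using sq by (simp add: l2_le_def norm_l2_of)
qed

section \<open>Shearlets generated by the interpolation kernel\<close>

definition gen_wave :: "real^2 \<Rightarrow> complex" where
  "gen_wave z = complex_of_real (kernel (z $ 1) * kernel (z $ 2))"

text \<open>Only even levels \<open>j = 2 * L\<close> occur: then \<open>2 ^ (j / 2)\<close> is the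
  integer \<open>2 ^ L\<close>, and so is the bound on the shear.\<close>

definition shear_index :: "(nat \<times> int \<times> nat \<times> int \<times> int) set" where
  "shear_index = {(L, m, i, k1, k2). i \<in> {0, 1} \<and> \<bar>of_int m\<bar> \<le> (2::real) ^ L}"

definition welem :: "nat \<times> int \<times> nat \<times> int \<times> int \<Rightarrow> l2" where
  "welem = (\<lambda>(L, m, i, k1, k2). l2_of (shearlet gen_wave 1 (2 * L) m i (vector [k1, k2])))"

lemma shearlet_gen_wave:
  assumes "i \<in> {0, 1}"
  shows "shearlet gen_wave 1 (2 * L) m i (vector [fst k, snd k]) z
     = complex_of_real (2 powr (3 * real (2 * L) / 4) * elem (2 ^ L) m i k (z $ 1) (z $ 2))"
proof -
  have sw: "swap_matrix *v z = vector [z $ 2, z $ 1]"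
    by (simp add: vec_eq_iff forall_2 swap_matrix_def matrix_vector_mult_def sum_2 vector_2)
  have p: "2 powr (real (2 * L) / 2) = (2::real) ^ L" by (simp add: powr_realpow)
  have D: "shear_matrix m *v (dilation_matrix (2 * L) *v w)
     = vector [(2 ^ L)^2 * w $ 1 + of_int m * (2 ^ L * w $ 2), 2 ^ L * w $ 2]" for w :: "real^2"
    by (simp only: dilation_matrix_def p)
      (simp add: vec_eq_iff forall_2 shear_matrix_def matrix_vector_mult_def sum_2 vector_2 power_mult power_even_eq mult.commute)
  show ?thesis
    using assms by (auto simp: shearlet_def D sw gen_wave_def elem_def vector_2 int_vec_def)
qed

lemma elem_measurable [measurable]: "(\<lambda>z::real^2. elem M m i k (z $ 1) (z $ 2)) \<in> borel_measurable borel"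
  unfolding elem_def by measurable

lemma square_integrable_bounded_support:
  fixes e :: "real^2 \<Rightarrow> real"
  assumes e: "e \<in> borel_measurable borel" and B: "\<And>z. \<bar>e z\<bar> \<le> B" and r: "\<And>z. e z \<noteq> 0 \<Longrightarrow> norm z \<le> r"
  shows "square_integrable (\<lambda>z. complex_of_real (e z))"
proof -
  have i: "integrable lborel (\<lambda>z::real^2. B^2 * indicator (cball 0 r) z)"
    by (intro integrable_mult_right integrable_real_indicator emeasure_bounded_finite) auto
  have "(e z)^2 \<le> B^2 * indicator (cball 0 r) z" for z
    using power_mono[OF B[of z], of 2] r[of z] by (cases "e z = 0") auto
  then have "integrable lborel (\<lambda>z. (e z)^2)"
    by (intro Bochner_Integration.integrable_bound[OF i]) (use e in \<open>auto intro: order_trans[OF _ abs_ge_self]\<close>)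
  then show ?thesis unfolding square_integrable_def using e by auto
qed

lemma norm_le_sum2: "norm (z::real^2) \<le> \<bar>z $ 1\<bar> + \<bar>z $ 2\<bar>"
  using norm_le_l1_cart[of z] by (simp add: sum_2)

lemma l2_rel_refl: "square_integrable f \<Longrightarrow> l2_rel f f"
  by (simp add: l2_rel_def)

lemma l2_of_add: "square_integrable f \<Longrightarrow> square_integrable g \<Longrightarrow> l2_of (\<lambda>x. f x + g x) = l2_of f + l2_of g"
  by (simp add: plus_l2.abs_eq l2_rel_refl)

lemma l2_of_uminus: "square_integrable f \<Longrightarrow> l2_of (\<lambda>x. - f x) = - l2_of f"
  by (simp add: uminus_l2.abs_eq l2_rel_refl)

lemma l2_of_cscale: "square_integrable f \<Longrightarrow> l2_of (\<lambda>x. c * f x) = l2_cscale c (l2_of f)"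
  by (simp add: l2_cscale.abs_eq l2_rel_refl)

lemma square_integrable_uminus: "square_integrable f \<Longrightarrow> square_integrable (\<lambda>x. - f x)"
  by (auto simp: square_integrable_def)

lemma square_integrable_sub: "square_integrable f \<Longrightarrow> square_integrable g \<Longrightarrow> square_integrable (\<lambda>x. f x - g x)"
  using square_integrable_add[of f "\<lambda>x. - g x"] square_integrable_uminus[of g] by simp

lemma l2_of_diff: "square_integrable f \<Longrightarrow> square_integrable g \<Longrightarrow> l2_of (\<lambda>x. f x - g x) = l2_of f - l2_of g"
  using l2_of_add[of f "\<lambda>x. - g x"] square_integrable_uminus[of g] by (simp add: l2_of_uminus)

lemma square_integrable_sum:
  "finite A \<Longrightarrow> (\<And>a. a \<in> A \<Longrightarrow> square_integrable (f a)) \<Longrightarrow> square_integrable (\<lambda>x. \<Sum>a\<in>A. f a x)"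
  by (induction A rule: finite_induct) (auto intro: square_integrable_add)

lemma l2_of_sum:
  "finite A \<Longrightarrow> (\<And>a. a \<in> A \<Longrightarrow> square_integrable (f a)) \<Longrightarrow> l2_of (\<lambda>x. \<Sum>a\<in>A. f a x) = (\<Sum>a\<in>A. l2_of (f a))"
proof (induction A rule: finite_induct)
  case empty
  then show ?case by (simp add: zero_l2.abs_eq)
next
  case (insert a A)
  then show ?case by (simp add: l2_of_add square_integrable_sum)
qed

lemma elem_l2:
  assumes M: "1 \<le> M"
  shows "square_integrable (\<lambda>z. complex_of_real (elem M m i k (z $ 1) (z $ 2)))"
proof (rule square_integrable_bounded_support[OF elem_measurable])
  show "\<bar>elem M m i k (z $ 1) (z $ 2)\<bar> \<le> 1 * 1" for z :: "real^2"
  proof -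
    have "\<bar>kernel a * kernel b\<bar> \<le> 1 * 1" for a b
      unfolding abs_mult by (intro mult_mono kernel_abs_le) auto
    then show ?thesis unfolding elem_def by simp
  qed
  fix z :: "real^2" assume nz: "elem M m i k (z $ 1) (z $ 2) \<noteq> 0"
  let ?r = "(2 + \<bar>of_int (snd k)\<bar>) + (2 + \<bar>of_int (fst k)\<bar> + \<bar>of_int m\<bar> * (2 + \<bar>of_int (snd k)\<bar>))"
  have *: "\<bar>x\<bar> + \<bar>y\<bar> \<le> ?r"
    if k: "kernel (M^2 * x + of_int m * (M * y) - of_int (fst k)) \<noteq> 0" "kernel (M * y - of_int (snd k)) \<noteq> 0" for x y
  proof -
    have 1: "\<bar>M * y\<bar> \<le> 2 + \<bar>of_int (snd k)\<bar>" using kernel_nonzero(2)[OF k(2)] by linarith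
    have y: "1 * \<bar>y\<bar> \<le> M * \<bar>y\<bar>" using M by (intro mult_right_mono) auto
    have "\<bar>of_int m * (M * y)\<bar> \<le> \<bar>of_int m\<bar> * (2 + \<bar>of_int (snd k)\<bar>)"
      unfolding abs_mult[of "of_int m"] using 1 by (intro mult_left_mono) auto
    then have 2: "\<bar>M^2 * x\<bar> \<le> 2 + \<bar>of_int (fst k)\<bar> + \<bar>of_int m\<bar> * (2 + \<bar>of_int (snd k)\<bar>)"
      using kernel_nonzero(2)[OF k(1)] by linarith
    have x: "1 * \<bar>x\<bar> \<le> M^2 * \<bar>x\<bar>" using M by (intro mult_right_mono) (auto simp: one_le_power)
    show ?thesis using 1 2 x y M by (simp add: abs_mult)
  qed
  have "\<bar>z $ 1\<bar> + \<bar>z $ 2\<bar> \<le> ?r"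
  proof (cases "i = 0")
    case True
    then show ?thesis using nz by (intro *) (auto simp: elem_def)
  next
    case False
    then have "\<bar>z $ 2\<bar> + \<bar>z $ 1\<bar> \<le> ?r" using nz by (intro *) (auto simp: elem_def)
    then show ?thesis by simp
  qed
  then show "norm z \<le> ?r" using norm_le_sum2[of z] by linarith
qed

lemma welem_eq:
  assumes i: "i \<in> {0, 1}"
  shows "l2_of (\<lambda>z. complex_of_real (elem (2 ^ L) m i k (z $ 1) (z $ 2)))
    = l2_cscale (complex_of_real (1 / 2 powr (3 * real (2 * L) / 4))) (welem (L, m, i, fst k, snd k))"
proof -
  let ?c = "2 powr (3 * real (2 * L) / 4)"
  have "shearlet gen_wave 1 (2 * L) m i (vector [fst k, snd k])
     = (\<lambda>z. complex_of_real ?c * complex_of_real (elem (2 ^ L) m i k (z $ 1) (z $ 2)))"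
    by (simp add: fun_eq_iff shearlet_gen_wave[OF i])
  then have "welem (L, m, i, fst k, snd k) = l2_cscale (complex_of_real ?c) (l2_of (\<lambda>z. complex_of_real (elem (2 ^ L) m i k (z $ 1) (z $ 2))))"
    unfolding welem_def by (simp add: l2_of_cscale elem_l2 case_prod_beta)
  then show ?thesis by (simp flip: of_real_mult)
qed

lemma sum_l2_le:
  assumes "finite A" "\<And>a. a \<in> A \<Longrightarrow> l2_le (f a) (c a)"
  shows "l2_le (\<lambda>z. \<Sum>a\<in>A. f a z) (\<Sum>a\<in>A. c a)"
proof -
  have sq: "square_integrable (\<lambda>z. complex_of_real (f a z))" if "a \<in> A" for a using assms(2)[OF that] by (simp add: l2_le_def)
  have "l2_of (\<lambda>z. complex_of_real (\<Sum>a\<in>A. f a z)) = (\<Sum>a\<in>A. l2_of (\<lambda>z. complex_of_real (f a z)))"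
    unfolding of_real_sum using assms(1) sq by (rule l2_of_sum)
  also have "norm \<dots> \<le> (\<Sum>a\<in>A. c a)"
    using assms(2) by (intro sum_norm_le) (auto simp: l2_le_def)
  finally show ?thesis unfolding l2_le_def of_real_sum using square_integrable_sum[OF assms(1) sq] by simp
qed

lemma add_l2_le:
  assumes "l2_le f c" "l2_le g d"
  shows "l2_le (\<lambda>z. f z + g z) (c + d)"
  using assms norm_triangle_mono[of "l2_of (\<lambda>z. complex_of_real (f z))" c "l2_of (\<lambda>z. complex_of_real (g z))" d]
  by (auto simp: l2_le_def l2_of_add square_integrable_add)

lemma l2_le_uminus: "l2_le (\<lambda>z. f z - g z) c \<Longrightarrow> l2_le (\<lambda>z. g z - f z) c"
  using l2_of_uminus[of "\<lambda>z. complex_of_real (f z - g z)"] square_integrable_uminus[of "\<lambda>z. complex_of_real (f z - g z)"]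
  by (auto simp: l2_le_def norm_minus_commute simp del: of_real_diff) (simp_all add: )

section \<open>Approximation of the layer differences by shearlets in the mean\<close>

context flat_set
begin

definition detail :: "nat \<Rightarrow> real^2 \<Rightarrow> real" where
  "detail l z = layer (2 ^ l) (z $ 1) (z $ 2) - (if l = 0 then 0 else layer (2 ^ (l - 1)) (z $ 1) (z $ 2))"

definition detail_data where
  "detail_data l P f \<longleftrightarrow> (\<forall>\<pi>. (\<lambda>z::real^2. f \<pi> (z $ 1) (z $ 2)) \<in> borel_measurable borel) \<and> finite P \<and> real (card P) \<le> pair_const * 2 ^ l \<and>
    (\<forall>\<pi>\<in>P. \<bar>of_int (fst (fst \<pi>))\<bar> \<le> pair_const * 2 ^ l \<and> \<bar>of_int (snd (fst \<pi>))\<bar> \<le> pair_const * 2 ^ l \<and>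
       \<bar>of_int (fst (fst \<pi>)) - 2 * of_int (fst (snd \<pi>))\<bar> \<le> (3::real) \<and>
       \<bar>of_int (snd (fst \<pi>)) - 2 * of_int (snd (snd \<pi>))\<bar> \<le> (3::real)) \<and>
    (\<forall>z. detail l z = (\<Sum>\<pi>\<in>P. f \<pi> (z $ 1) (z $ 2))) \<and>
    (\<forall>\<pi>\<in>P. \<forall>s. approximable piece_bound (2 ^ l) (2 ^ s) (fst \<pi>) (f \<pi>))"

lemma detail_pieces: "\<exists>P f. detail_data l P f"
proof (cases l)
  case 0
  from coarse_pieces show ?thesis unfolding detail_data_def 0 detail_def
    by (elim exE conjE, intro exI conjI) (assumption | simp)+
next
  case (Suc l')
  have e: "(2::real) ^ Suc l' / 2 = 2 ^ l'" by simp
  from fine_pieces[OF refl, of l'] show ?thesis unfolding detail_data_def Suc detail_def e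
    by (elim exE conjE, intro exI conjI) (assumption | simp)+
qed

lemma piece_bound_nonneg: "0 \<le> piece_bound"
  using E12 piece_const_nonneg[of "18 * E2"] by (simp add: piece_bound_def approx_const_def)

lemma detail_measurable: "detail l \<in> borel_measurable borel"
proof -
  obtain P f where "detail_data l P f" using detail_pieces by blast
  then have "detail l = (\<lambda>z. \<Sum>\<pi>\<in>P. f \<pi> (z $ 1) (z $ 2))" "\<And>\<pi>. (\<lambda>z::real^2. f \<pi> (z $ 1) (z $ 2)) \<in> borel_measurable borel"
    unfolding detail_data_def by auto
  then show ?thesis by simp
qed

definition detail_const :: real where
  "detail_const = piece_bound * sqrt (2704 * pair_const * (48 * piece_bound))"

text \<open>Of order \<open>2 ^ l\<close> pieces with \<open>T ^ 3 = 8 ^ s\<close> elements each.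
  The uniform error of order \<open>8 ^ -s\<close> lives on \<open>2 ^ l\<close> strips of area of
  order \<open>8 ^ -l\<close> with bounded overlap, so the mean error is of order
  \<open>8 ^ -s * 2 ^ -l\<close>.\<close>

lemma detail_approx:
  "\<exists>J h. finite J \<and> J \<subseteq> shear_index \<and> real (card J) \<le> pair_const * piece_bound * (2 ^ l * 8 ^ s) \<and>
     (\<forall>(L, m, i, k1, k2)\<in>J. L = l + s \<and> \<bar>of_int k1\<bar> \<le> (2 * pair_const + 2) * 4 ^ (l + s) \<and>
         \<bar>of_int k2\<bar> \<le> (2 * pair_const + 2) * 4 ^ (l + s)) \<and>
     square_integrable (\<lambda>z. complex_of_real (h z)) \<and>
     l2_of (\<lambda>z. complex_of_real (h z)) \<in> l2.span (welem ` J) \<and>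
     l2_le (\<lambda>z. detail l z - h z) (detail_const / (8 ^ s * 2 ^ l))"
proof -
  let ?D = piece_bound and ?N = "2 ^ l :: real" and ?T = "2 ^ s :: real"
  note D0 = piece_bound_nonneg
  obtain P f where "detail_data l P f" using detail_pieces by blast
  note dd = this[unfolded detail_data_def]
  have finP: "finite P" and cardP: "real (card P) \<le> pair_const * 2 ^ l"
    and Pb: "\<And>\<pi>. \<pi> \<in> P \<Longrightarrow> \<bar>of_int (fst (fst \<pi>))\<bar> \<le> pair_const * 2 ^ l \<and> \<bar>of_int (snd (fst \<pi>))\<bar> \<le> pair_const * 2 ^ l \<and>
       \<bar>of_int (fst (fst \<pi>)) - 2 * of_int (fst (snd \<pi>))\<bar> \<le> (3::real) \<and>
       \<bar>of_int (snd (fst \<pi>)) - 2 * of_int (snd (snd \<pi>))\<bar> \<le> (3::real)"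
    and det: "\<And>z. detail l z = (\<Sum>\<pi>\<in>P. f \<pi> (z $ 1) (z $ 2))"
    and app: "\<And>\<pi>. \<pi> \<in> P \<Longrightarrow> \<exists>i m K coef \<beta>. approx_data ?D ?N ?T (fst \<pi>) (f \<pi>) i m K coef \<beta>"
    using dd unfolding approximable_def by blast+
  from app obtain i m K coef \<beta> where data: "\<And>\<pi>. \<pi> \<in> P \<Longrightarrow> approx_data ?D ?N ?T (fst \<pi>) (f \<pi>) (i \<pi>) (m \<pi>) (K \<pi>) (coef \<pi>) (\<beta> \<pi>)"
    by metis
  note data' = data[unfolded approx_data_def]
  have NT: "?N * ?T = 2 ^ (l + s)" by (simp add: power_add)
  define a where "a \<pi> z = (\<Sum>k\<in>K \<pi>. coef \<pi> k * elem (?N * ?T) (m \<pi>) (i \<pi>) k (z $ 1) (z $ 2))" for \<pi> and z :: "real^2"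
  define h where "h z = (\<Sum>\<pi>\<in>P. a \<pi> z)" for z
  define g where "g \<pi> k = (l + s, m \<pi>, i \<pi>, fst k, snd k)" for \<pi> and k :: "int \<times> int"
  define J where "J = (\<Union>\<pi>\<in>P. g \<pi> ` K \<pi>)"
  have finK: "finite (K \<pi>)" "real (card (K \<pi>)) \<le> ?D * 8 ^ s" "i \<pi> \<in> {0, 1}" if "\<pi> \<in> P" for \<pi>
  proof -
    have "?T ^ 3 = 8 ^ s" by (simp add: power_mult[symmetric] mult.commute[of s 3]) (simp add: power_mult)
    then show "finite (K \<pi>)" "real (card (K \<pi>)) \<le> ?D * 8 ^ s" "i \<pi> \<in> {0, 1}" using data'[OF that] by auto
  qed
  have finJ: "finite J" unfolding J_def using finP finK by auto
  have "card J \<le> (\<Sum>\<pi>\<in>P. card (g \<pi> ` K \<pi>))" unfolding J_def by (rule card_UN_le[OF finP])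
  also have "\<dots> \<le> (\<Sum>\<pi>\<in>P. card (K \<pi>))" by (intro sum_mono card_image_le finK)
  finally have "real (card J) \<le> (\<Sum>\<pi>\<in>P. real (card (K \<pi>)))" by (simp flip: of_nat_sum)
  also have "\<dots> \<le> (\<Sum>\<pi>\<in>P. ?D * 8 ^ s)" by (intro sum_mono finK)
  also have "\<dots> = real (card P) * (?D * 8 ^ s)" by simp
  also have "\<dots> \<le> (pair_const * 2 ^ l) * (?D * 8 ^ s)" using cardP D0 by (intro mult_right_mono) auto
  finally have cardJ: "real (card J) \<le> pair_const * ?D * (2 ^ l * 8 ^ s)" by (simp add: algebra_simps)
  have kb: "\<bar>of_int (fst k)\<bar> \<le> (2 * pair_const + 2) * 4 ^ (l + s) \<and> \<bar>of_int (snd k)\<bar> \<le> (2 * pair_const + 2) * 4 ^ (l + s)"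
    if p: "\<pi> \<in> P" and k: "k \<in> K \<pi>" for \<pi> k
  proof -
    have "?N * ?T^2 * (\<bar>of_int (fst (fst \<pi>))\<bar> + \<bar>of_int (snd (fst \<pi>))\<bar> + 2)
        \<le> ?N * ?T^2 * (pair_const * ?N + pair_const * ?N + 2 * ?N)"
      using Pb[OF p] by (intro mult_left_mono add_mono) auto
    also have "\<dots> = (2 * pair_const + 2) * ((?N * ?N) * ?T^2)" by (simp add: algebra_simps)
    also have "(?N * ?N) * ?T^2 = 4 ^ (l + s)" by (simp add: power_add power2_eq_square power_mult_distrib[symmetric])
    finally show ?thesis using data'[OF p] k by (meson order_trans)
  qed
  have J_bounds: "\<forall>(L, m, i, k1, k2)\<in>J. L = l + s \<and> \<bar>of_int k1\<bar> \<le> (2 * pair_const + 2) * 4 ^ (l + s) \<and>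
         \<bar>of_int k2\<bar> \<le> (2 * pair_const + 2) * 4 ^ (l + s)"
    unfolding J_def g_def using kb by auto
  have J_index: "J \<subseteq> shear_index"
  proof
    fix t assume "t \<in> J"
    then obtain \<pi> k where p: "\<pi> \<in> P" "k \<in> K \<pi>" "t = g \<pi> k" by (auto simp: J_def)
    then show "t \<in> shear_index" using data'[OF p(1)] unfolding NT by (simp add: g_def shear_index_def)
  qed
  have sqe: "square_integrable (\<lambda>z. complex_of_real (elem (?N * ?T) m' i' k (z $ 1) (z $ 2)))" for m' i' k
    by (rule elem_l2) (simp add: NT)
  have sqt: "square_integrable (\<lambda>z. complex_of_real (coef \<pi> k * elem (?N * ?T) (m \<pi>) (i \<pi>) k (z $ 1) (z $ 2)))" for \<pi> k
    using square_integrable_cmult[OF sqe] by simp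
  have sqa: "square_integrable (\<lambda>z. complex_of_real (a \<pi> z))" if "\<pi> \<in> P" for \<pi>
    unfolding a_def of_real_sum by (rule square_integrable_sum[OF finK(1)[OF that] sqt])
  have sqh: "square_integrable (\<lambda>z. complex_of_real (h z))"
    unfolding h_def of_real_sum by (rule square_integrable_sum[OF finP sqa])
  have span_a: "l2_of (\<lambda>z. complex_of_real (a \<pi> z)) \<in> l2.span (welem ` J)" if p: "\<pi> \<in> P" for \<pi>
  proof -
    have "l2_of (\<lambda>z. complex_of_real (a \<pi> z)) = (\<Sum>k\<in>K \<pi>. l2_of (\<lambda>z. complex_of_real (coef \<pi> k * elem (?N * ?T) (m \<pi>) (i \<pi>) k (z $ 1) (z $ 2))))"
      unfolding a_def of_real_sum by (rule l2_of_sum[OF finK(1)[OF p] sqt])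
    also have "\<dots> \<in> l2.span (welem ` J)"
    proof (rule l2.span_sum)
      fix k assume k: "k \<in> K \<pi>"
      have "l2_of (\<lambda>z. complex_of_real (coef \<pi> k * elem (?N * ?T) (m \<pi>) (i \<pi>) k (z $ 1) (z $ 2)))
        = l2_cscale (complex_of_real (coef \<pi> k)) (l2_of (\<lambda>z. complex_of_real (elem (2 ^ (l + s)) (m \<pi>) (i \<pi>) k (z $ 1) (z $ 2))))"
        using l2_of_cscale[OF sqe, of "complex_of_real (coef \<pi> k)"] by (simp add: NT)
      also have "\<dots> \<in> l2.span (welem ` J)"
        unfolding welem_eq[OF finK(3)[OF p]]
        by (intro l2.span_scale l2.span_base) (use p k in \<open>auto simp: J_def g_def\<close>)
      finally show "l2_of (\<lambda>z. complex_of_real (coef \<pi> k * elem (?N * ?T) (m \<pi>) (i \<pi>) k (z $ 1) (z $ 2))) \<in> l2.span (welem ` J)" .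
    qed
    finally show ?thesis .
  qed
  have span_h: "l2_of (\<lambda>z. complex_of_real (h z)) \<in> l2.span (welem ` J)"
  proof -
    have "l2_of (\<lambda>z. complex_of_real (h z)) = (\<Sum>\<pi>\<in>P. l2_of (\<lambda>z. complex_of_real (a \<pi> z)))"
      unfolding h_def of_real_sum by (rule l2_of_sum[OF finP sqa])
    then show ?thesis by (simp only:) (intro l2.span_sum span_a)
  qed
  have T3: "?T ^ 3 = 8 ^ s" by (simp add: power_mult[symmetric] mult.commute[of s 3]) (simp add: power_mult)
  have am: "a \<pi> \<in> borel_measurable borel" for \<pi> unfolding a_def[abs_def] by measurable
  have err: "l2_le (\<lambda>z. detail l z - h z) (?D / 8 ^ s * sqrt (2704 * real (card P) * (48 * ?D / ?N^3)))"
  proof (rule l2_le_overlap[where R = "\<lambda>\<pi>. strip ?D ?N (fst \<pi>) (\<beta> \<pi>)"])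
    show "(\<lambda>z. detail l z - h z) \<in> borel_measurable borel"
      using detail_measurable am unfolding h_def[abs_def] by measurable
    show "emeasure lborel (strip ?D ?N (fst \<pi>) (\<beta> \<pi>)) \<le> ennreal (48 * ?D / ?N^3)" if "\<pi> \<in> P" for \<pi>
      by (rule strip_area[OF D0]) (use data'[OF that] in auto)
    show "\<bar>detail l z - h z\<bar> \<le> ?D / 8 ^ s * real (card {\<pi> \<in> P. z \<in> strip ?D ?N (fst \<pi>) (\<beta> \<pi>)})" for z
    proof -
      have "\<bar>detail l z - h z\<bar> \<le> (\<Sum>\<pi>\<in>P. \<bar>f \<pi> (z $ 1) (z $ 2) - a \<pi> z\<bar>)"
        unfolding det h_def sum_subtractf[symmetric] by (rule sum_abs)
      also have "\<dots> \<le> (\<Sum>\<pi>\<in>P. if z \<in> strip ?D ?N (fst \<pi>) (\<beta> \<pi>) then ?D / 8 ^ s else 0)"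
      proof (rule sum_mono)
        fix \<pi> assume p: "\<pi> \<in> P"
        have "\<bar>f \<pi> (z $ 1) (z $ 2) - a \<pi> z\<bar> \<le> ?D / ?T ^ 3 \<and>
         (f \<pi> (z $ 1) (z $ 2) - a \<pi> z \<noteq> 0 \<longrightarrow> \<bar>?N * z $ 1 - of_int (fst (fst \<pi>))\<bar> \<le> 6 \<and>
            \<bar>?N * z $ 2 - of_int (snd (fst \<pi>))\<bar> \<le> 6 \<and> \<bar>aff (\<beta> \<pi>) (z $ 1) (z $ 2)\<bar> \<le> ?D / ?N^2)"
          using data'[OF p, THEN conjunct2, THEN conjunct2, THEN conjunct2, THEN conjunct2, THEN conjunct2, THEN conjunct2] unfolding a_def by blast
        then show "\<bar>f \<pi> (z $ 1) (z $ 2) - a \<pi> z\<bar> \<le> (if z \<in> strip ?D ?N (fst \<pi>) (\<beta> \<pi>) then ?D / 8 ^ s else 0)"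
          unfolding strip_def T3 by auto
      qed
      also have "\<dots> = ?D / 8 ^ s * real (card {\<pi> \<in> P. z \<in> strip ?D ?N (fst \<pi>) (\<beta> \<pi>)})"
        using finP by (simp add: sum.If_cases Collect_conj_eq Int_commute)
      finally show ?thesis .
    qed
    \<comment> \<open>There are at most 169 = \<open>13^2\<close> fine squares within 6 grid units
      of the point and, for each of them, at most 16 = \<open>4^2\<close> coarse partners.\<close>
    show "real (card {\<pi> \<in> P. z \<in> strip ?D ?N (fst \<pi>) (\<beta> \<pi>)}) \<le> 2704" for z
    proof -
      define A where "A = {q::int\<times>int. \<bar>?N * z $ 1 - of_int (fst q)\<bar> \<le> 6 \<and> \<bar>?N * z $ 2 - of_int (snd q)\<bar> \<le> 6}"
      define B where "B q = {q'::int\<times>int. \<bar>of_int (fst q) / 2 - of_int (fst q')\<bar> \<le> (3/2::real) \<and> \<bar>of_int (snd q) / 2 - of_int (snd q')\<bar> \<le> (3/2::real)}"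
        for q :: "int \<times> int"
      have A: "finite A" "real (card A) \<le> 169" unfolding A_def using card_pairs_near[of 6 "?N * z $ 1" "?N * z $ 2"] by simp_all
      have B: "finite (B q)" "real (card (B q)) \<le> 16" for q
        unfolding B_def using card_pairs_near[of "3/2" "of_int (fst q) / 2" "of_int (snd q) / 2"] by simp_all
      have sub: "{\<pi> \<in> P. z \<in> strip ?D ?N (fst \<pi>) (\<beta> \<pi>)} \<subseteq> (SIGMA q:A. B q)"
      proof
        fix \<pi> assume p: "\<pi> \<in> {\<pi> \<in> P. z \<in> strip ?D ?N (fst \<pi>) (\<beta> \<pi>)}"
        then have "fst \<pi> \<in> A" by (simp add: strip_def A_def)
        moreover have "snd \<pi> \<in> B (fst \<pi>)"
        proof -
          have half: "\<bar>a / 2 - b\<bar> \<le> 3/2" if "\<bar>a - 2 * b\<bar> \<le> 3" for a b :: real using that by linarith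
          show ?thesis unfolding B_def mem_Collect_eq by (intro conjI half) (use p Pb[of \<pi>] in blast)+
        qed
        ultimately show "\<pi> \<in> (SIGMA q:A. B q)" by (metis SigmaI prod.collapse)
      qed
      have "card {\<pi> \<in> P. z \<in> strip ?D ?N (fst \<pi>) (\<beta> \<pi>)} \<le> card (SIGMA q:A. B q)"
        using A B by (intro card_mono sub) auto
      also have "\<dots> = (\<Sum>q\<in>A. card (B q))" using A B by (intro card_SigmaI) auto
      finally have "real (card {\<pi> \<in> P. z \<in> strip ?D ?N (fst \<pi>) (\<beta> \<pi>)}) \<le> (\<Sum>q\<in>A. real (card (B q)))" by (simp flip: of_nat_sum)
      also have "\<dots> \<le> (\<Sum>q\<in>A. 16)" by (intro sum_mono B)
      also have "\<dots> \<le> 2704" using A by simp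
      finally show ?thesis .
    qed
  qed (use finP D0 in auto)
  have "2704 * real (card P) * (48 * ?D / ?N^3) \<le> 2704 * (pair_const * ?N) * (48 * ?D / ?N^3)"
    using cardP D0 by (intro mult_right_mono mult_left_mono divide_nonneg_nonneg) auto
  also have "\<dots> = (2704 * pair_const * (48 * ?D)) / ?N^2" by (simp add: power2_eq_square power3_eq_cube)
  finally have "sqrt (2704 * real (card P) * (48 * ?D / ?N^3)) \<le> sqrt ((2704 * pair_const * (48 * ?D)) / ?N^2)" by simp
  also have "\<dots> = sqrt (2704 * pair_const * (48 * ?D)) / ?N" by (simp add: real_sqrt_divide)
  finally have "?D / 8 ^ s * sqrt (2704 * real (card P) * (48 * ?D / ?N^3)) \<le> ?D / 8 ^ s * (sqrt (2704 * pair_const * (48 * ?D)) / ?N)"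
    using D0 by (intro mult_left_mono) auto
  also have "\<dots> = detail_const / (8 ^ s * 2 ^ l)" by (simp add: detail_const_def)
  finally have "l2_le (\<lambda>z. detail l z - h z) (detail_const / (8 ^ s * 2 ^ l))"
    using err by (auto simp: l2_le_def)
  then show ?thesis using finJ J_index cardJ J_bounds sqh span_h by (intro exI[of _ J] exI[of _ h]) blast
qed

end

text \<open>\<open>s\<close> is \<open>(I - l) / 3\<close> rounded up, the least refinement that
  brings scale \<open>l\<close> to the accuracy \<open>2 ^ -I\<close>. The rounding costs the factor
  4, and the level \<open>l + s\<close> stays within \<open>I\<close>.\<close>

lemma eight_pow_bounds:
  fixes I l :: nat
  assumes "l \<le> I"
  defines "s \<equiv> (I - l + 2) div 3"
  shows "(2::real) ^ I \<le> 8 ^ s * 2 ^ l" "2 ^ l * 8 ^ s \<le> (4::real) * 2 ^ I" "l + s \<le> I"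
proof -
  have e8: "(8::real) ^ s = 2 ^ (3 * s)" by (simp add: power_mult)
  have 1: "I \<le> 3 * s + l" and 2: "l + 3 * s \<le> I + 2" and 3: "l + s \<le> I" using assms unfolding s_def by linarith+
  show "(2::real) ^ I \<le> 8 ^ s * 2 ^ l" unfolding e8 power_add[symmetric] using 1 by (intro power_increasing) auto
  have "(2::real) ^ (l + 3 * s) \<le> 2 ^ (I + 2)" using 2 by (intro power_increasing) auto
  then show "2 ^ l * 8 ^ s \<le> (4::real) * 2 ^ I" unfolding e8 by (simp add: power_add)
  show "l + s \<le> I" by (rule 3)
qed

context flat_set
begin

lemma sum_detail: "(\<Sum>l\<le>I. detail l z) = layer (2 ^ I) (z $ 1) (z $ 2)"
  by (induction I) (simp_all add: detail_def)

definition layer_const :: real where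
  "layer_const = 4040000 * sqrt (169 * (K * (4 * K + 3)^2) * (48 * E2))"

lemma layer_l2:
  assumes meas: "(\<lambda>z::real^2. ind (z $ 1) (z $ 2)) \<in> borel_measurable borel"
  shows "l2_le (\<lambda>z. layer (2 ^ I) (z $ 1) (z $ 2) - ind (z $ 1) (z $ 2)) (layer_const / 2 ^ I)"
proof -
  let ?N = "2 ^ I :: real"
  define P where "P = {q. near ?N q}"
  have P: "finite P" "real (card P) \<le> K * (4 * K + 3)^2 * ?N" unfolding P_def using card_near[of ?N] by auto
  have E: "0 \<le> E2" using E12 K by linarith
  have set_eq: "{q \<in> P. z \<in> strip E2 ?N q (line ?N q)} = {q. near ?N q \<and> \<bar>?N * z $ 1 - of_int (fst q)\<bar> \<le> 6 \<and>
     \<bar>?N * z $ 2 - of_int (snd q)\<bar> \<le> 6 \<and> \<bar>aff (line ?N q) (z $ 1) (z $ 2)\<bar> \<le> E2 / ?N^2}" for z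
    by (auto simp: P_def strip_def)
  have err: "l2_le (\<lambda>z. layer ?N (z $ 1) (z $ 2) - ind (z $ 1) (z $ 2))
      (4040000 * sqrt (169 * real (card P) * (48 * E2 / ?N^3)))"
  proof (rule l2_le_overlap[where R = "\<lambda>q. strip E2 ?N q (line ?N q)"])
    show "(\<lambda>z::real^2. layer ?N (z $ 1) (z $ 2) - ind (z $ 1) (z $ 2)) \<in> borel_measurable borel"
      unfolding sum_detail[symmetric] using meas detail_measurable by measurable
    show "emeasure lborel (strip E2 ?N q (line ?N q)) \<le> ennreal (48 * E2 / ?N^3)" if q: "q \<in> P" for q
    proof (rule strip_area[OF E])
      have n: "1 \<le> (fst (line ?N q))^2 + (fst (snd (line ?N q)))^2" using q line_bounds(3) by (simp add: P_def)
      show "1/2 \<le> \<bar>fst (line ?N q)\<bar> \<or> 1/2 \<le> \<bar>fst (snd (line ?N q))\<bar>"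
      proof (rule ccontr)
        assume "\<not> ?thesis"
        then have "\<bar>fst (line ?N q)\<bar>^2 \<le> (1/2)^2" "\<bar>fst (snd (line ?N q))\<bar>^2 \<le> (1/2)^2"
          by (intro power_mono; simp)+
        then show False using n by (simp add: power2_eq_square)
      qed
    qed simp
    show "\<bar>layer ?N (z $ 1) (z $ 2) - ind (z $ 1) (z $ 2)\<bar> \<le> 4040000 * real (card {q \<in> P. z \<in> strip E2 ?N q (line ?N q)})" for z
      unfolding set_eq by (rule layer_error) simp
    show "real (card {q \<in> P. z \<in> strip E2 ?N q (line ?N q)}) \<le> 169" for z
    proof -
      have c: "finite {q::int\<times>int. \<bar>?N * z $ 1 - of_int (fst q)\<bar> \<le> 6 \<and> \<bar>?N * z $ 2 - of_int (snd q)\<bar> \<le> 6}"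
        "real (card {q::int\<times>int. \<bar>?N * z $ 1 - of_int (fst q)\<bar> \<le> 6 \<and> \<bar>?N * z $ 2 - of_int (snd q)\<bar> \<le> 6}) \<le> 169"
        using card_pairs_near[of 6 "?N * z $ 1" "?N * z $ 2"] by simp_all
      have "card {q \<in> P. z \<in> strip E2 ?N q (line ?N q)} \<le> card {q::int\<times>int. \<bar>?N * z $ 1 - of_int (fst q)\<bar> \<le> 6 \<and> \<bar>?N * z $ 2 - of_int (snd q)\<bar> \<le> 6}"
        by (rule card_mono[OF c(1)]) (auto simp: strip_def)
      then show ?thesis using c(2) by linarith
    qed
  qed (use P E in auto)
  have "169 * real (card P) * (48 * E2 / ?N^3) \<le> 169 * (K * (4 * K + 3)^2 * ?N) * (48 * E2 / ?N^3)"
    using P E by (intro mult_right_mono mult_left_mono divide_nonneg_nonneg) auto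
  also have "\<dots> = (169 * (K * (4 * K + 3)^2) * (48 * E2)) / ?N^2" by (simp add: power2_eq_square power3_eq_cube)
  finally have "sqrt (169 * real (card P) * (48 * E2 / ?N^3)) \<le> sqrt ((169 * (K * (4 * K + 3)^2) * (48 * E2)) / ?N^2)" by simp
  also have "\<dots> = sqrt (169 * (K * (4 * K + 3)^2) * (48 * E2)) / ?N" by (simp add: real_sqrt_divide)
  finally have "4040000 * sqrt (169 * real (card P) * (48 * E2 / ?N^3)) \<le> layer_const / ?N" unfolding layer_const_def by simp
  then show ?thesis using err by (auto simp: l2_le_def)
qed

lemma indicator_approx:
  assumes meas: "(\<lambda>z::real^2. ind (z $ 1) (z $ 2)) \<in> borel_measurable borel"
  shows "\<exists>J f. finite J \<and> J \<subseteq> shear_index \<and> real (card J) \<le> (4 * pair_const * piece_bound) * (real (I + 1) * 2 ^ I) \<and>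
     (\<forall>(L, m, i, k1, k2)\<in>J. L \<le> I \<and> \<bar>of_int k1\<bar> \<le> (2 * pair_const + 2) * 4 ^ I \<and> \<bar>of_int k2\<bar> \<le> (2 * pair_const + 2) * 4 ^ I) \<and>
     f \<in> l2.span (welem ` J) \<and>
     norm (l2_of (\<lambda>z. complex_of_real (ind (z $ 1) (z $ 2))) - f) \<le> (layer_const + detail_const) * (real (I + 1) / 2 ^ I)"
proof -
  define s where "s l = (I - l + 2) div 3" for l
  have "\<forall>l. \<exists>Jh. finite (fst Jh) \<and> fst Jh \<subseteq> shear_index \<and> real (card (fst Jh)) \<le> pair_const * piece_bound * (2 ^ l * 8 ^ s l) \<and>
     (\<forall>(L, m, i, k1, k2)\<in>fst Jh. L = l + s l \<and> \<bar>of_int k1\<bar> \<le> (2 * pair_const + 2) * 4 ^ (l + s l) \<and>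
         \<bar>of_int k2\<bar> \<le> (2 * pair_const + 2) * 4 ^ (l + s l)) \<and>
     square_integrable (\<lambda>z. complex_of_real (snd Jh z)) \<and>
     l2_of (\<lambda>z. complex_of_real (snd Jh z)) \<in> l2.span (welem ` fst Jh) \<and>
     l2_le (\<lambda>z. detail l z - snd Jh z) (detail_const / (8 ^ s l * 2 ^ l))"
    using detail_approx[where s = "s _"] by (simp add: split_paired_Ex)
  from choice[OF this] obtain Jh where Jh: "\<And>l. finite (fst (Jh l)) \<and> fst (Jh l) \<subseteq> shear_index \<and> real (card (fst (Jh l))) \<le> pair_const * piece_bound * (2 ^ l * 8 ^ s l) \<and>
     (\<forall>(L, m, i, k1, k2)\<in>fst (Jh l). L = l + s l \<and> \<bar>of_int k1\<bar> \<le> (2 * pair_const + 2) * 4 ^ (l + s l) \<and>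
         \<bar>of_int k2\<bar> \<le> (2 * pair_const + 2) * 4 ^ (l + s l)) \<and>
     square_integrable (\<lambda>z. complex_of_real (snd (Jh l) z)) \<and>
     l2_of (\<lambda>z. complex_of_real (snd (Jh l) z)) \<in> l2.span (welem ` fst (Jh l)) \<and>
     l2_le (\<lambda>z. detail l z - snd (Jh l) z) (detail_const / (8 ^ s l * 2 ^ l))"
    by blast
  define J where "J = (\<Union>l\<le>I. fst (Jh l))"
  define h where "h l = snd (Jh l)" for l
  define f where "f = (\<Sum>l\<le>I. l2_of (\<lambda>z. complex_of_real (h l z)))"
  have pc: "0 \<le> pair_const * piece_bound" "0 \<le> 2 * pair_const + 2" "0 \<le> detail_const" "0 \<le> layer_const"
    using pair_const_ge(2) piece_bound_nonneg E12 K by (auto simp: detail_const_def layer_const_def)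
  have finJ: "finite J" using Jh by (auto simp: J_def)
  have "card J \<le> (\<Sum>l\<le>I. card (fst (Jh l)))" unfolding J_def by (rule card_UN_le) simp
  then have "real (card J) \<le> (\<Sum>l\<le>I. real (card (fst (Jh l))))" by (simp flip: of_nat_sum)
  also have "\<dots> \<le> (\<Sum>l\<le>I. pair_const * piece_bound * (4 * 2 ^ I))"
  proof (rule sum_mono)
    fix l assume "l \<in> {..I}"
    then have "real (card (fst (Jh l))) \<le> pair_const * piece_bound * (2 ^ l * 8 ^ s l)" "2 ^ l * 8 ^ s l \<le> (4::real) * 2 ^ I"
      using Jh eight_pow_bounds(2)[of l I] by (auto simp: s_def)
    then show "real (card (fst (Jh l))) \<le> pair_const * piece_bound * (4 * 2 ^ I)"
      using mult_left_mono[OF _ pc(1)] order_trans by blast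
  qed
  also have "\<dots> = (4 * pair_const * piece_bound) * (real (I + 1) * 2 ^ I)" by (simp add: algebra_simps)
  finally have cardJ: "real (card J) \<le> (4 * pair_const * piece_bound) * (real (I + 1) * 2 ^ I)" .
  have bJ: "\<forall>(L, m, i, k1, k2)\<in>J. L \<le> I \<and> \<bar>of_int k1\<bar> \<le> (2 * pair_const + 2) * 4 ^ I \<and> \<bar>of_int k2\<bar> \<le> (2 * pair_const + 2) * 4 ^ I"
  proof (clarify)
    fix L m i k1 k2 assume "(L, m, i, k1, k2) \<in> J"
    then obtain l where l: "l \<le> I" "(L, m, i, k1, k2) \<in> fst (Jh l)" by (auto simp: J_def)
    have b: "L = l + s l" "\<bar>of_int k1\<bar> \<le> (2 * pair_const + 2) * 4 ^ (l + s l)" "\<bar>of_int k2\<bar> \<le> (2 * pair_const + 2) * 4 ^ (l + s l)"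
      using Jh[of l] l(2) by auto
    have ls: "l + s l \<le> I" using eight_pow_bounds(3)[OF l(1)] by (simp add: s_def)
    have "(2 * pair_const + 2) * 4 ^ (l + s l) \<le> (2 * pair_const + 2) * 4 ^ I"
      using pc ls by (intro mult_left_mono power_increasing) auto
    then show "L \<le> I \<and> \<bar>of_int k1\<bar> \<le> (2 * pair_const + 2) * 4 ^ I \<and> \<bar>of_int k2\<bar> \<le> (2 * pair_const + 2) * 4 ^ I"
      using b ls by linarith
  qed
  have span: "f \<in> l2.span (welem ` J)" unfolding f_def
  proof (rule l2.span_sum)
    fix l assume "l \<in> {..I}"
    then have "welem ` fst (Jh l) \<subseteq> welem ` J" by (auto simp: J_def)
    then show "l2_of (\<lambda>z. complex_of_real (h l z)) \<in> l2.span (welem ` J)"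
      using Jh[of l] l2.span_mono unfolding h_def by blast
  qed
  have hsq: "square_integrable (\<lambda>z. complex_of_real (h l z))" for l using Jh by (simp add: h_def)
  have dsq: "l2_le (\<lambda>z. detail l z - h l z) (detail_const / 2 ^ I)" if "l \<le> I" for l
  proof -
    have "(2::real) ^ I \<le> 8 ^ s l * 2 ^ l" using eight_pow_bounds(1)[OF that] by (simp add: s_def)
    then have "detail_const / (8 ^ s l * 2 ^ l) \<le> detail_const / 2 ^ I" using pc by (intro divide_left_mono) auto
    then show ?thesis using Jh[of l] unfolding h_def l2_le_def by linarith
  qed
  have L: "l2_le (\<lambda>z. layer (2 ^ I) (z $ 1) (z $ 2) - (\<Sum>l\<le>I. h l z)) (\<Sum>l\<le>I. detail_const / 2 ^ I)"
    unfolding sum_detail[symmetric] sum_subtractf[symmetric] by (rule sum_l2_le) (use dsq in auto)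
  have "l2_le (\<lambda>z. (ind (z $ 1) (z $ 2) - layer (2 ^ I) (z $ 1) (z $ 2)) + (layer (2 ^ I) (z $ 1) (z $ 2) - (\<Sum>l\<le>I. h l z)))
    (layer_const / 2 ^ I + (\<Sum>l\<le>I. detail_const / 2 ^ I))"
    by (rule add_l2_le[OF l2_le_uminus[OF layer_l2[OF meas]] L])
  then have tot: "l2_le (\<lambda>z. ind (z $ 1) (z $ 2) - (\<Sum>l\<le>I. h l z)) (layer_const / 2 ^ I + (\<Sum>l\<le>I. detail_const / 2 ^ I))"
    by simp
  have hs: "square_integrable (\<lambda>z. complex_of_real (\<Sum>l\<le>I. h l z))"
    unfolding of_real_sum by (rule square_integrable_sum) (use hsq in auto)
  have fs: "l2_of (\<lambda>z. complex_of_real (\<Sum>l\<le>I. h l z)) = f"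
    unfolding of_real_sum f_def by (rule l2_of_sum) (use hsq in auto)
  have isq: "square_integrable (\<lambda>z. complex_of_real (ind (z $ 1) (z $ 2)))"
    using square_integrable_add[OF tot[unfolded l2_le_def, THEN conjunct1] hs] by simp
  have "norm (l2_of (\<lambda>z. complex_of_real (ind (z $ 1) (z $ 2))) - f) \<le> layer_const / 2 ^ I + (\<Sum>l\<le>I. detail_const / 2 ^ I)"
    using tot unfolding l2_le_def of_real_diff l2_of_diff[OF isq hs] fs by blast
  also have "\<dots> = (layer_const + real (I + 1) * detail_const) / 2 ^ I" by (simp add: add_divide_distrib)
  also have "\<dots> \<le> (real (I + 1) * layer_const + real (I + 1) * detail_const) / 2 ^ I"
    using pc by (intro divide_right_mono add_mono) (auto simp: mult_le_cancel_right1)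
  also have "\<dots> = (layer_const + detail_const) * (real (I + 1) / 2 ^ I)" by (simp add: algebra_simps)
  finally have fin: "norm (l2_of (\<lambda>z. complex_of_real (ind (z $ 1) (z $ 2))) - f) \<le> (layer_const + detail_const) * (real (I + 1) / 2 ^ I)" .
  have "J \<subseteq> shear_index" unfolding J_def using Jh by blast
  then show ?thesis using finJ cardJ bJ span fin by blast
qed

end

text \<open>The constants exported from the locale depend on \<open>K\<close> alone, so this sum
  bounds all of them simultaneously for every star of the class.\<close>

definition star_count :: "real \<Rightarrow> real" where
  "star_count K = 4 * flat_set.pair_const K * flat_set.piece_bound K + (2 * flat_set.pair_const K + 2)
     + (flat_set.layer_const K + flat_set.detail_const K) + 1"

lemma star_region_compact:
  assumes c: "continuous_on UNIV \<rho>"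
  shows "compact (star_region \<rho>)"
proof -
  obtain m where "\<And>\<phi>. \<phi> \<in> {0..2 * pi} \<Longrightarrow> \<rho> \<phi> \<le> \<rho> m"
    using continuous_attains_sup[OF compact_Icc _ continuous_on_subset[OF c], of 0 "2 * pi"] by force
  then obtain B where B: "\<And>\<phi>. \<phi> \<in> {0..2 * pi} \<Longrightarrow> \<rho> \<phi> \<le> B" by blast
  define X where "X = {x :: real \<times> real. fst x \<in> {0..2 * pi} \<and> 0 \<le> snd x \<and> snd x \<le> \<rho> (fst x)}"
  have "X \<subseteq> {0..2 * pi} \<times> {0..B}" using B by (auto simp: X_def) (meson order_trans)
  then have "bounded X" by (rule bounded_subset[rotated]) (intro bounded_Times; simp)
  moreover have "closed X"
  proof -
    have e: "X = {x. 0 \<le> fst x} \<inter> {x. fst x \<le> 2 * pi} \<inter> {x. 0 \<le> snd x} \<inter> {x. snd x \<le> \<rho> (fst x)}" by (auto simp: X_def)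
    have "continuous_on UNIV (\<lambda>x :: real \<times> real. \<rho> (fst x))"
      by (rule continuous_on_compose2[OF c]) (auto intro: continuous_intros)
    then show ?thesis unfolding e by (intro closed_Int closed_Collect_le continuous_intros) auto
  qed
  ultimately have "compact X" by (simp add: compact_eq_bounded_closed)
  moreover have "star_region \<rho> = (\<lambda>x. snd x *\<^sub>R vector [cos (fst x), sin (fst x)]) ` X"
    unfolding star_region_def X_def by (auto simp: image_iff) force+
  moreover have "continuous_on X (\<lambda>x. snd x *\<^sub>R vector [cos (fst x), sin (fst x)] :: real^2)"
  proof -
    have e: "(\<lambda>x. snd x *\<^sub>R vector [cos (fst x), sin (fst x)] :: real^2)
       = (\<lambda>x. \<chi> i. snd x * (if i = 1 then cos (fst x) else sin (fst x)))"
      by (auto simp: fun_eq_iff vec_eq_iff forall_2 vector_2)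
    have "continuous_on X (\<lambda>x. snd x * (if i = 1 then cos (fst x) else sin (fst x)))" for i :: 2
      by (cases "i = 1") (auto intro!: continuous_intros)
    then show ?thesis unfolding e by (rule continuous_on_vec_lambda)
  qed
  ultimately show ?thesis by (simp add: compact_continuous_image)
qed

lemma STAR_borel:
  assumes "S \<in> STAR \<nu> \<rho>\<^sub>0 \<rho>\<^sub>1"
  shows "S \<in> sets borel"
proof -
  obtain x\<^sub>0 \<rho> where S: "S = (+) x\<^sub>0 ` star_region \<rho>" "\<rho> \<in> C2_2pi" using assms unfolding STAR_def by blast
  have "continuous_on UNIV \<rho>"
    using C2_2pi_derivs(1)[OF S(2)] by (meson DERIV_isCont continuous_at_imp_continuous_on)
  then have "compact S" unfolding S(1) by (intro compact_translation star_region_compact)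
  then show ?thesis by (simp add: borel_compact)
qed

theorem star_approximation:
  assumes par: "1 \<le> \<nu>" "0 < \<rho>\<^sub>0" "\<rho>\<^sub>1 < 1"
  shows "\<exists>C\<ge>1. \<forall>S\<in>STAR \<nu> \<rho>\<^sub>0 \<rho>\<^sub>1. \<forall>I::nat. \<exists>J f. finite J \<and> J \<subseteq> shear_index \<and>
     real (card J) \<le> C * (real (I + 1) * 2 ^ I) \<and>
     (\<forall>(L, m, i, k1, k2)\<in>J. L \<le> I \<and> \<bar>of_int k1\<bar> \<le> C * 4 ^ I \<and> \<bar>of_int k2\<bar> \<le> C * 4 ^ I) \<and>
     f \<in> l2.span (welem ` J) \<and> norm (l2_of (indicator S) - f) \<le> C * (real (I + 1) / 2 ^ I)"
proof -
  define C where "C = max 1 (star_count (star_const \<nu> \<rho>\<^sub>0))"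
  show ?thesis
  proof (rule exI[of _ C], intro conjI ballI allI)
    show "1 \<le> C" by (simp add: C_def)
    fix S and I :: nat assume S: "S \<in> STAR \<nu> \<rho>\<^sub>0 \<rho>\<^sub>1"
    obtain G p1 p2 A1 A2 where "flat_set (star_const \<nu> \<rho>\<^sub>0) (\<lambda>x y. vector [x, y] \<in> S) G p1 p2 A1 A2"
      using STAR_flat[OF par S] by blast
    then interpret flat_set "star_const \<nu> \<rho>\<^sub>0" "\<lambda>x y. vector [x, y] \<in> S" G p1 p2 A1 A2 .
    have v: "vector [z $ 1, z $ 2] = z" for z :: "real^2" by (simp add: vec_eq_iff forall_2 vector_2)
    have ind: "(\<lambda>z. ind (z $ 1) (z $ 2)) = indicator S" by (auto simp: ind_def fun_eq_iff v indicator_def)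
    have meas: "(\<lambda>z::real^2. ind (z $ 1) (z $ 2)) \<in> borel_measurable borel" unfolding ind using STAR_borel[OF S] by simp
    have indc: "(\<lambda>z. complex_of_real (ind (z $ 1) (z $ 2))) = indicator S" by (auto simp: ind_def fun_eq_iff v indicator_def)
    have nn: "0 \<le> 4 * pair_const * piece_bound" "0 \<le> 2 * pair_const + 2" "0 \<le> layer_const + detail_const"
      using pair_const_ge(2) piece_bound_nonneg E12 K by (auto simp: detail_const_def layer_const_def)
    have C: "4 * pair_const * piece_bound \<le> C" "2 * pair_const + 2 \<le> C" "layer_const + detail_const \<le> C"
      using nn unfolding C_def star_count_def by linarith+
    obtain J f where J: "finite J" "J \<subseteq> shear_index" "real (card J) \<le> (4 * pair_const * piece_bound) * (real (I + 1) * 2 ^ I)"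
      "\<forall>(L, m, i, k1, k2)\<in>J. L \<le> I \<and> \<bar>of_int k1\<bar> \<le> (2 * pair_const + 2) * 4 ^ I \<and> \<bar>of_int k2\<bar> \<le> (2 * pair_const + 2) * 4 ^ I"
      "f \<in> l2.span (welem ` J)"
      "norm (l2_of (indicator S) - f) \<le> (layer_const + detail_const) * (real (I + 1) / 2 ^ I)"
      using indicator_approx[OF meas, of I] unfolding indc by (elim exE conjE)
    have m: "(4 * pair_const * piece_bound) * (real (I + 1) * 2 ^ I) \<le> C * (real (I + 1) * 2 ^ I)"
      "(2 * pair_const + 2) * 4 ^ I \<le> C * 4 ^ I"
      "(layer_const + detail_const) * (real (I + 1) / 2 ^ I) \<le> C * (real (I + 1) / 2 ^ I)"
      by (intro mult_right_mono C; simp)+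
    have "\<forall>(L, m, i, k1, k2)\<in>J. L \<le> I \<and> \<bar>of_int k1\<bar> \<le> C * 4 ^ I \<and> \<bar>of_int k2\<bar> \<le> C * 4 ^ I"
      using J(4) m(2) by (fastforce intro: order_trans)
    moreover have "real (card J) \<le> C * (real (I + 1) * 2 ^ I)" "norm (l2_of (indicator S) - f) \<le> C * (real (I + 1) / 2 ^ I)"
      using J m by linarith+
    ultimately show "\<exists>J f. finite J \<and> J \<subseteq> shear_index \<and>
     real (card J) \<le> C * (real (I + 1) * 2 ^ I) \<and>
     (\<forall>(L, m, i, k1, k2)\<in>J. L \<le> I \<and> \<bar>of_int k1\<bar> \<le> C * 4 ^ I \<and> \<bar>of_int k2\<bar> \<le> C * 4 ^ I) \<and>
     f \<in> l2.span (welem ` J) \<and> norm (l2_of (indicator S) - f) \<le> C * (real (I + 1) / 2 ^ I)"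
      using J by blast
  qed
qed

section \<open>Covering numbers\<close>

definition covered :: "'a::metric_space set \<Rightarrow> real \<Rightarrow> nat \<Rightarrow> bool" where
  "covered S \<epsilon> m \<longleftrightarrow> (\<exists>T. finite T \<and> T \<subseteq> S \<and> S \<subseteq> (\<Union>x\<in>T. cball x \<epsilon>) \<and> card T \<le> m)"

lemma covering_number_le: "covered S \<epsilon> m \<Longrightarrow> covering_number S \<epsilon> \<le> enat m"
  unfolding covered_def covering_number_def by (elim exE conjE) (rule INF_lower2, auto)

lemma covered_of_covering_number:
  assumes "covering_number S \<epsilon> = enat k"
  shows "covered S \<epsilon> k"
proof -
  let ?A = "(\<lambda>T. enat (card T)) ` {T. finite T \<and> T \<subseteq> S \<and> S \<subseteq> (\<Union>x\<in>T. cball x \<epsilon>)}"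
  have "?A \<noteq> {}"
  proof
    assume A: "?A = {}"
    have "covering_number S \<epsilon> = \<infinity>" unfolding covering_number_def A by (simp add: Inf_enat_def)
    with assms show False by simp
  qed
  then obtain y where "y \<in> ?A" by blast
  then have "Inf ?A \<in> ?A" by (rule wellorder_InfI)
  then have "enat k \<in> ?A" using assms unfolding covering_number_def by simp
  then show ?thesis unfolding covered_def by auto
qed

text \<open>Entropy bounds by quantisation: one representative of each code word lies in
  \<open>S\<close> and serves as a centre, while the code itself may take values anywhere.\<close>

lemma covered_code:
  assumes "finite K" "code ` S \<subseteq> K" "\<And>x y. x \<in> S \<Longrightarrow> y \<in> S \<Longrightarrow> code x = code y \<Longrightarrow> dist x y \<le> \<epsilon>"
  shows "covered S \<epsilon> (card K)"
proof -
  define r where "r c = (SOME x. x \<in> S \<and> code x = c)" for c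
  have r: "r (code x) \<in> S \<and> code (r (code x)) = code x" if "x \<in> S" for x
    unfolding r_def by (rule someI[of _ x]) (use that in simp)
  have fin: "finite (code ` S)" using assms finite_subset by blast
  show ?thesis unfolding covered_def
  proof (rule exI[of _ "r ` code ` S"], intro conjI)
    show "S \<subseteq> (\<Union>x\<in>r ` code ` S. cball x \<epsilon>)"
      using r assms(3) by fastforce
    have "card (r ` code ` S) \<le> card (code ` S)" by (rule card_image_le[OF fin])
    also have "\<dots> \<le> card K" by (rule card_mono[OF assms(1,2)])
    finally show "card (r ` code ` S) \<le> card K" .
  qed (use r fin in auto)
qed

lemma covered_mono: "covered S \<epsilon> m \<Longrightarrow> m \<le> m' \<Longrightarrow> covered S \<epsilon> m'"
  unfolding covered_def by (meson order_trans)

lemma covered_UN: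
  assumes "finite I" "\<And>i. i \<in> I \<Longrightarrow> covered (S i) \<epsilon> m"
  shows "covered (\<Union>i\<in>I. S i) \<epsilon> (card I * m)"
proof -
  have "\<forall>i\<in>I. \<exists>T. finite T \<and> T \<subseteq> S i \<and> S i \<subseteq> (\<Union>x\<in>T. cball x \<epsilon>) \<and> card T \<le> m"
    using assms(2) unfolding covered_def by blast
  from bchoice[OF this] obtain T where T: "\<forall>i\<in>I. finite (T i) \<and> T i \<subseteq> S i \<and> S i \<subseteq> (\<Union>x\<in>T i. cball x \<epsilon>) \<and> card (T i) \<le> m"
    by (elim exE)
  show ?thesis unfolding covered_def
  proof (rule exI[of _ "\<Union>i\<in>I. T i"], intro conjI)
    show "finite (\<Union>i\<in>I. T i)" "(\<Union>i\<in>I. T i) \<subseteq> (\<Union>i\<in>I. S i)" using assms(1) T by auto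
    show "(\<Union>i\<in>I. S i) \<subseteq> (\<Union>x\<in>\<Union>i\<in>I. T i. cball x \<epsilon>)" using T by blast
    have "card (\<Union>i\<in>I. T i) \<le> (\<Sum>i\<in>I. card (T i))" by (rule card_UN_le[OF assms(1)])
    also have "\<dots> \<le> (\<Sum>i\<in>I. m)" using T by (intro sum_mono) auto
    finally show "card (\<Union>i\<in>I. T i) \<le> card I * m" by simp
  qed
qed

section \<open>Entropy of balls in finite-dimensional subspaces and of sparse spans\<close>

lemma orthonormal_exists:
  fixes B :: "'a::real_inner set"
  assumes "finite B"
  shows "\<exists>E. finite E \<and> card E \<le> card B \<and> (\<forall>e\<in>E. \<forall>e'\<in>E. e \<bullet> e' = (if e = e' then 1 else 0)) \<and> B \<subseteq> span E"
  using assms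
proof (induction B rule: finite_induct)
  case empty
  show ?case by (intro exI[of _ "{}"]) auto
next
  case (insert b B)
  then obtain E where E: "finite E" "card E \<le> card B" "\<And>e e'. e \<in> E \<Longrightarrow> e' \<in> E \<Longrightarrow> e \<bullet> e' = (if e = e' then 1 else 0)"
    "B \<subseteq> span E" by auto
  define p where "p = (\<Sum>e\<in>E. (b \<bullet> e) *\<^sub>R e)"
  define r where "r = b - p"
  have pE: "p \<in> span E" unfolding p_def by (intro span_sum span_scale span_base)
  have orth: "r \<bullet> e = 0" if "e \<in> E" for e
  proof -
    have "p \<bullet> e = (\<Sum>e'\<in>E. (b \<bullet> e') * (e' \<bullet> e))" unfolding p_def by (simp add: inner_sum_left)
    also have "\<dots> = (\<Sum>e'\<in>E. if e' = e then b \<bullet> e' else 0)" using E(3) that by (intro sum.cong) auto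
    also have "\<dots> = b \<bullet> e" using E(1) that by simp
    finally show ?thesis by (simp add: r_def inner_diff_left)
  qed
  show ?case
  proof (cases "r = 0")
    case True
    then have "b \<in> span E" using pE by (simp add: r_def)
    then show ?thesis using E insert.hyps by (intro exI[of _ E]) (auto simp: card_insert_if)
  next
    case False
    define u where "u = r /\<^sub>R norm r"
    have uu: "u \<bullet> u = 1" using False by (simp add: u_def dot_square_norm power2_eq_square)
    have ue: "u \<bullet> e = 0" "e \<bullet> u = 0" if "e \<in> E" for e using orth[OF that] by (auto simp: u_def inner_commute)
    have uE: "u \<notin> E" using ue uu by force
    have "b = p + norm r *\<^sub>R u" using False by (simp add: u_def r_def)
    also have "\<dots> \<in> span (insert u E)"
    proof (rule span_add)
      show "p \<in> span (insert u E)" using pE span_mono[of E "insert u E"] by blast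
      show "norm r *\<^sub>R u \<in> span (insert u E)" by (intro span_scale span_base) simp
    qed
    finally have "b \<in> span (insert u E)" .
    moreover have "B \<subseteq> span (insert u E)" using E(4) span_mono[of E "insert u E"] by blast
    ultimately show ?thesis using E insert.hyps uu ue uE
      by (intro exI[of _ "insert u E"]) (auto simp: card_insert_if)
  qed
qed

text \<open>The coordinates of \<open>x - x0\<close> in an orthonormal system whose span contains
  \<open>B\<close> are rounded down to multiples of \<open>\<epsilon> / d\<close>, with
  \<open>2 * k + 2\<close> possible values each. \<open>x0\<close> may lie outside the span because
  only differences of two points of the span are reconstructed.\<close>

lemma covered_span_ball:
  fixes B :: "'a::real_inner set"
  assumes B: "finite B" and d: "card B \<le> d" "1 \<le> d" and \<epsilon>: "0 < \<epsilon>" and R: "0 \<le> R"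
  shows "covered (cball x0 R \<inter> span B) \<epsilon> ((2 * nat \<lceil>R * real d / \<epsilon>\<rceil> + 2) ^ d)"
proof -
  obtain E where E: "finite E" "card E \<le> card B" "\<And>e e'. e \<in> E \<Longrightarrow> e' \<in> E \<Longrightarrow> e \<bullet> e' = (if e = e' then 1 else 0)"
    "B \<subseteq> span E" using orthonormal_exists[OF B] by auto
  have ex: "x = (\<Sum>e\<in>E. (x \<bullet> e) *\<^sub>R e)" if "x \<in> span B" for x
  proof -
    have "x \<in> span E" using that E(4) by (metis span_mono span_span subset_iff)
    then obtain c where c: "x = (\<Sum>e\<in>E. c e *\<^sub>R e)" using span_finite[OF E(1)] by auto
    have "x \<bullet> e = c e" if "e \<in> E" for e
    proof -
      have "x \<bullet> e = (\<Sum>e'\<in>E. c e' * (e' \<bullet> e))" unfolding c by (simp add: inner_sum_left)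
      also have "\<dots> = (\<Sum>e'\<in>E. if e' = e then c e' else 0)" using E(3) that by (intro sum.cong) auto
      finally show ?thesis using E(1) that by simp
    qed
    then show ?thesis using c by simp
  qed
  have n1: "norm e = 1" if "e \<in> E" for e using E(3)[OF that that] by (simp add: norm_eq_1)
  define h where "h = \<epsilon> / real d"
  have h: "0 < h" using \<epsilon> d by (simp add: h_def)
  define k where "k = \<lceil>R * real d / \<epsilon>\<rceil>"
  have "0 \<le> R * real d / \<epsilon>" using R \<epsilon> by simp
  then have k0: "0 \<le> k" unfolding k_def by linarith
  define code where "code x = (\<lambda>e\<in>E. \<lfloor>((x - x0) \<bullet> e) / h\<rfloor>)" for x
  let ?K = "PiE E (\<lambda>_. {- k - 1..k})"
  have fin: "finite ?K" using E by (intro finite_PiE) auto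
  have cK: "card ?K = (2 * nat k + 2) ^ card E" using E k0 by (simp add: card_PiE nat_add_distrib nat_mult_distrib)
  have "covered (cball x0 R \<inter> span B) \<epsilon> (card ?K)"
  proof (rule covered_code[OF fin])
    show "code ` (cball x0 R \<inter> span B) \<subseteq> ?K"
    proof (rule image_subsetI)
      fix x assume x: "x \<in> cball x0 R \<inter> span B"
      show "code x \<in> ?K" unfolding code_def
      proof (rule restrict_PiE_iff[THEN iffD2], rule ballI)
        fix e assume e: "e \<in> E"
        have "\<bar>(x - x0) \<bullet> e\<bar> \<le> norm (x - x0) * norm e" by (rule Cauchy_Schwarz_ineq2)
        also have "\<dots> \<le> R" using x n1[OF e] by (simp add: dist_norm norm_minus_commute)
        finally have "\<bar>((x - x0) \<bullet> e) / h\<bar> \<le> R / h" using h by (simp add: divide_right_mono)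
        also have "R / h \<le> of_int k" using \<epsilon> unfolding h_def k_def by simp
        finally have "- of_int k \<le> ((x - x0) \<bullet> e) / h" "((x - x0) \<bullet> e) / h \<le> of_int k" by linarith+
        then show "\<lfloor>((x - x0) \<bullet> e) / h\<rfloor> \<in> {- k - 1..k}" by (simp add: le_floor_iff floor_le_iff)
      qed
    qed
    fix x y assume x: "x \<in> cball x0 R \<inter> span B" and y: "y \<in> cball x0 R \<inter> span B" and c: "code x = code y"
    have "\<bar>(x - y) \<bullet> e\<bar> \<le> h" if e: "e \<in> E" for e
    proof -
      have "\<lfloor>((x - x0) \<bullet> e) / h\<rfloor> = \<lfloor>((y - x0) \<bullet> e) / h\<rfloor>" using fun_cong[OF c, of e] e by (simp add: code_def)
      then have "\<bar>((x - x0) \<bullet> e) / h - ((y - x0) \<bullet> e) / h\<bar> \<le> 1" by linarith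
      moreover have "((x - x0) \<bullet> e) / h - ((y - x0) \<bullet> e) / h = ((x - y) \<bullet> e) / h"
        by (simp add: diff_divide_distrib[symmetric] inner_diff_left)
      ultimately show ?thesis using h by simp
    qed
    note close = this
    have "x - y \<in> span B" using x y by (simp add: span_diff)
    from ex[OF this] have "dist x y = norm (\<Sum>e\<in>E. ((x - y) \<bullet> e) *\<^sub>R e)" by (simp add: dist_norm)
    also have "\<dots> \<le> (\<Sum>e\<in>E. h)" by (rule sum_norm_le) (use close n1 in auto)
    also have "\<dots> = real (card E) * h" by simp
    also have "\<dots> \<le> real d * h" using E(2) d h by (intro mult_right_mono) auto
    also have "\<dots> = \<epsilon>" using d by (simp add: h_def)
    finally show "dist x y \<le> \<epsilon>" .
  qed
  moreover have "card ?K \<le> (2 * nat k + 2) ^ d" unfolding cK using E(2) d by (intro power_increasing) auto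
  ultimately show ?thesis using covered_mono unfolding k_def by blast
qed

lemma cscale_decompose: "l2_cscale c f = Re c *\<^sub>R f + Im c *\<^sub>R l2_cscale \<i> f"
proof -
  have "c = complex_of_real (Re c) + complex_of_real (Im c) * \<i>" by (simp add: complex_eq_iff)
  then have "l2_cscale c f = l2_cscale (complex_of_real (Re c) + complex_of_real (Im c) * \<i>) f" by simp
  also have "\<dots> = l2_cscale (complex_of_real (Re c)) f + l2_cscale (complex_of_real (Im c)) (l2_cscale \<i> f)"
    by (simp only: l2.scale_left_distrib l2.scale_scale)
  finally show ?thesis by (simp add: scaleR_l2_def)
qed

text \<open>Quantisation works over the reals; a complex span of \<open>n\<close> elements is
  treated as part of a real span of \<open>2 * n\<close>.\<close>

lemma complex_span_subset:
  assumes "finite A"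
  shows "l2.span A \<subseteq> span (A \<union> l2_cscale \<i> ` A)"
proof
  fix f assume "f \<in> l2.span A"
  then obtain u where "f = (\<Sum>a\<in>A. l2_cscale (u a) a)" using l2.span_finite[OF assms] by auto
  moreover have "l2_cscale (u a) a \<in> span (A \<union> l2_cscale \<i> ` A)" if "a \<in> A" for a
    unfolding cscale_decompose[of "u a"] by (intro span_add span_scale span_base) (use that in auto)
  ultimately show "f \<in> span (A \<union> l2_cscale \<i> ` A)" by (simp add: span_sum)
qed

text \<open>Centres must lie in the covered set, so old centres are used only as codes; passing to a
  subset costs the factor 2 in the radius.\<close>

lemma covered_subset:
  assumes "covered S \<epsilon> m" "S' \<subseteq> S"
  shows "covered S' (2 * \<epsilon>) m"
proof -
  obtain T where T: "finite T" "S \<subseteq> (\<Union>x\<in>T. cball x \<epsilon>)" "card T \<le> m" using assms(1) unfolding covered_def by auto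
  have "\<forall>x\<in>S. \<exists>t. t \<in> T \<and> dist t x \<le> \<epsilon>" using T(2) by fastforce
  from bchoice[OF this] obtain c where c: "\<forall>x\<in>S. c x \<in> T \<and> dist (c x) x \<le> \<epsilon>" by (elim exE)
  have "covered S' (2 * \<epsilon>) (card T)"
  proof (rule covered_code[OF T(1), of c])
    show "c ` S' \<subseteq> T" using c assms(2) by blast
    fix x y assume xy: "x \<in> S'" "y \<in> S'" "c x = c y"
    have "dist (c x) x \<le> \<epsilon>" "dist (c y) y \<le> \<epsilon>" using c assms(2) xy(1,2) by blast+
    then have "dist (c x) x \<le> \<epsilon>" "dist (c x) y \<le> \<epsilon>" using xy(3) by simp_all
    then show "dist x y \<le> 2 * \<epsilon>" using dist_triangle3[of x y "c x"] by linarith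
  qed
  then show ?thesis using T(3) covered_mono by blast
qed

lemma poly_abs_le:
  fixes P :: "real poly"
  assumes "1 \<le> x"
  shows "\<bar>poly P x\<bar> \<le> (\<Sum>i\<le>degree P. \<bar>coeff P i\<bar>) * x ^ degree P"
proof -
  have "\<bar>poly P x\<bar> \<le> (\<Sum>i\<le>degree P. \<bar>coeff P i * x ^ i\<bar>)" unfolding poly_altdef by (rule sum_abs)
  also have "\<dots> \<le> (\<Sum>i\<le>degree P. \<bar>coeff P i\<bar> * x ^ degree P)"
    unfolding abs_mult using assms by (intro sum_mono mult_left_mono) (auto intro: power_increasing)
  finally show ?thesis by (simp add: sum_distrib_right)
qed

text \<open>A subset of \<open>{1..p}\<close> with at most \<open>n\<close> elements is listed as a
  word of length \<open>n\<close> over \<open>{0..p}\<close>, with 0 as padding.\<close>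

lemma card_small_subsets:
  "finite {I. I \<subseteq> {1..p} \<and> card I \<le> n}" "card {I. I \<subseteq> {1..p::nat} \<and> card I \<le> n} \<le> (p + 1) ^ n"
proof -
  let ?F = "PiE {..<n} (\<lambda>_. {0..p})"
  have sub: "{I. I \<subseteq> {1..p} \<and> card I \<le> n} \<subseteq> (\<lambda>f. f ` {..<n} - {0}) ` ?F"
  proof
    fix I assume "I \<in> {I. I \<subseteq> {1..p} \<and> card I \<le> n}"
    then have I: "I \<subseteq> {1..p}" "card I \<le> n" by auto
    have finI: "finite I" using I finite_subset by blast
    obtain h where h: "bij_betw h {0..<card I} I" using ex_bij_betw_nat_finite[OF finI] by blast
    define f where "f = (\<lambda>i\<in>{..<n}. if i < card I then h i else 0)"
    have hI: "h i \<in> I" if "i < card I" for i using h that by (auto simp: bij_betw_def)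
    have "f \<in> ?F" unfolding f_def using hI I by (force simp: restrict_PiE_iff)
    moreover have "I = f ` {..<n} - {0}"
    proof
      show "I \<subseteq> f ` {..<n} - {0}"
      proof
        fix x assume x: "x \<in> I"
        then have "x \<in> h ` {0..<card I}" using h by (simp add: bij_betw_def)
        then obtain i where i: "i < card I" "x = h i" by auto
        then have "x = f i" "i < n" using I by (auto simp: f_def)
        moreover have "x \<noteq> 0" using x I by auto
        ultimately show "x \<in> f ` {..<n} - {0}" by blast
      qed
      show "f ` {..<n} - {0} \<subseteq> I" using hI by (auto simp: f_def)
    qed
    ultimately show "I \<in> (\<lambda>f. f ` {..<n} - {0}) ` ?F" by blast
  qed
  have finF: "finite ?F" by (intro finite_PiE) auto
  show "finite {I. I \<subseteq> {1..p} \<and> card I \<le> n}" using finite_subset[OF sub] finF by blast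
  have "card {I. I \<subseteq> {1..p} \<and> card I \<le> n} \<le> card ((\<lambda>f. f ` {..<n} - {0}) ` ?F)" using finF by (intro card_mono sub) auto
  also have "\<dots> \<le> card ?F" by (rule card_image_le[OF finF])
  also have "\<dots> = (p + 1) ^ n" by (simp add: card_PiE)
  finally show "card {I. I \<subseteq> {1..p} \<and> card I \<le> n} \<le> (p + 1) ^ n" .
qed

lemma zero_in_nonlinear: "0 \<in> nonlinear_approx g P n"
  unfolding nonlinear_approx_def by (intro UN_I[of "{}"]) auto

lemma covered_nonlinear:
  fixes P :: "real poly" and n :: nat and g :: "nat \<Rightarrow> l2"
  assumes n: "1 \<le> n" and \<epsilon>: "0 < \<epsilon>" and R: "0 \<le> R"
  defines "p \<equiv> nat \<lfloor>poly P (real n)\<rfloor>"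
  shows "covered (cball x R \<inter> nonlinear_approx g P n) (2 * \<epsilon>) ((p + 1) ^ n * (2 * nat \<lceil>R * real (2 * n) / \<epsilon>\<rceil> + 2) ^ (2 * n))"
proof -
  define \<I> where "\<I> = {I. I \<subseteq> {1..p} \<and> card I \<le> n}"
  have eq: "{I. I \<subseteq> {k. 1 \<le> k \<and> real k \<le> poly P (real n)} \<and> card I \<le> n} = \<I>"
  proof -
    have "{k. 1 \<le> k \<and> real k \<le> poly P (real n)} = {1..p}"
    proof (intro set_eqI iffI)
      have k: "real k \<le> poly P (real n) \<longleftrightarrow> k \<le> p" if "1 \<le> k" for k
      proof -
        have "real k \<le> poly P (real n) \<longleftrightarrow> int k \<le> \<lfloor>poly P (real n)\<rfloor>" by (simp add: le_floor_iff)
        then show ?thesis unfolding p_def using that by linarith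
      qed
      fix k
      show "k \<in> {1..p}" if "k \<in> {k. 1 \<le> k \<and> real k \<le> poly P (real n)}" using that k by auto
      show "k \<in> {k. 1 \<le> k \<and> real k \<le> poly P (real n)}" if "k \<in> {1..p}" using that k by auto
    qed
    then show ?thesis by (simp add: \<I>_def)
  qed
  define d where "d = (2 * nat \<lceil>R * real (2 * n) / \<epsilon>\<rceil> + 2) ^ (2 * n)"
  have fin: "finite \<I>" "card \<I> \<le> (p + 1) ^ n" unfolding \<I>_def using card_small_subsets by blast+
  have cov: "covered (cball x R \<inter> span (g ` I \<union> l2_cscale \<i> ` g ` I)) \<epsilon> d" if I: "I \<in> \<I>" for I
    unfolding d_def
  proof (rule covered_span_ball[OF _ _ _ \<epsilon> R])
    have finI: "finite I" "card I \<le> n" using I unfolding \<I>_def by (auto intro: finite_subset)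
    then show "finite (g ` I \<union> l2_cscale \<i> ` g ` I)" by simp
    have "card (g ` I \<union> l2_cscale \<i> ` g ` I) \<le> card (g ` I) + card (l2_cscale \<i> ` g ` I)" by (rule card_Un_le)
    also have "\<dots> \<le> card I + card I"
      using card_image_le[OF finI(1), of g] card_image_le[OF finite_imageI[OF finI(1)], of "l2_cscale \<i>" g] by linarith
    finally show "card (g ` I \<union> l2_cscale \<i> ` g ` I) \<le> 2 * n" using finI by linarith
  qed (use n in auto)
  have "covered (\<Union>I\<in>\<I>. cball x R \<inter> span (g ` I \<union> l2_cscale \<i> ` g ` I)) \<epsilon> (card \<I> * d)"
    by (rule covered_UN[OF fin(1) cov])
  then have "covered (\<Union>I\<in>\<I>. cball x R \<inter> span (g ` I \<union> l2_cscale \<i> ` g ` I)) \<epsilon> ((p + 1) ^ n * d)"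
    by (rule covered_mono) (use fin in simp)
  moreover have "cball x R \<inter> nonlinear_approx g P n \<subseteq> (\<Union>I\<in>\<I>. cball x R \<inter> span (g ` I \<union> l2_cscale \<i> ` g ` I))"
    unfolding nonlinear_approx_def eq
  proof safe
    fix f I assume f: "f \<in> cball x R" "I \<in> \<I>" "f \<in> l2.span (g ` I)"
    have "finite (g ` I)" using f(2) unfolding \<I>_def by (auto intro: finite_subset)
    then have "f \<in> span (g ` I \<union> l2_cscale \<i> ` g ` I)" using complex_span_subset f(3) by blast
    then show "f \<in> (\<Union>I\<in>\<I>. cball x R \<inter> span (g ` I \<union> l2_cscale \<i> ` g ` I))" using f by blast
  qed
  ultimately show ?thesis unfolding d_def by (rule covered_subset)
qed

lemma controlled_complexity_nonlinear: "controlled_complexity (nonlinear_approx g P)"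
  unfolding controlled_complexity_def
proof (intro conjI allI impI)
  show "nonlinear_approx g P n \<noteq> {}" for n using zero_in_nonlinear by blast
  fix a :: real and x :: l2 and R :: real assume "0 < a \<and> 0 < R"
  then have a: "0 < a" and R: "0 < R" by auto
  define A where "A = (\<Sum>i\<le>degree P. \<bar>coeff P i\<bar>) + 1"
  define D where "D = real (degree P)"
  define A' where "A' = 8 * R + 4"
  have A: "1 \<le> A" "1 \<le> A'" using R by (auto simp: A_def A'_def sum_nonneg)
  \<comment> \<open>The logarithm of the covering bound: the choice of the index set contributes
    \<open>D * ln n\<close> per element, and each of the \<open>2 * n\<close> real coordinates has
    of order \<open>n powr (a + 1)\<close> values. The total is of order
    \<open>n * ln n\<close>.\<close>
  define \<eta> where "\<eta> n = (if n = 0 then 0 else real n * (ln A + D * ln (real n) + 2 * (ln A' + (a + 1) * ln (real n))))" for n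
  show "\<exists>n\<^sub>0\<ge>1. \<exists>\<eta>::nat \<Rightarrow> real. (\<forall>n. 0 \<le> \<eta> n) \<and> (\<forall>\<delta>>0. bdd_above ((\<lambda>n. \<eta> n / real n powr (1 + \<delta>)) ` {1..})) \<and>
     (\<forall>n\<ge>n\<^sub>0. ereal_of_enat (covering_number (cball x R \<inter> nonlinear_approx g P n) (real n powr - a)) \<le> ereal (exp (\<eta> n)))"
  proof (rule exI[of _ 1], intro conjI, simp, rule exI[of _ \<eta>], intro conjI allI impI)
    show "0 \<le> \<eta> n" for n using A a by (auto simp: \<eta>_def D_def intro!: mult_nonneg_nonneg add_nonneg_nonneg)
    fix \<delta> :: real assume \<delta>: "0 < \<delta>"
    define c where "c = D + 2 * (a + 1)"
    have c: "0 \<le> c" using a by (simp add: c_def D_def)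
    define b where "b = ln A + 2 * ln A'"
    have b: "0 \<le> b" using A by (simp add: b_def)
    show "bdd_above ((\<lambda>n. \<eta> n / real n powr (1 + \<delta>)) ` {1..})"
    proof (rule bdd_aboveI2)
      fix n :: nat assume "n \<in> {1..}"
      then have n: "1 \<le> n" by simp
      have e: "\<eta> n = real n * (b + c * ln (real n))" using n by (simp add: \<eta>_def b_def c_def algebra_simps)
      have ln: "ln (real n) \<le> real n powr \<delta> / \<delta>" using n \<delta> by (intro ln_powr_bound) auto
      have p1: "1 \<le> real n powr \<delta>" using n \<delta> by (simp add: ge_one_powr_ge_zero)
      have "b + c * ln (real n) \<le> b * real n powr \<delta> + c * (real n powr \<delta> / \<delta>)"
        using b c p1 ln by (intro add_mono mult_left_mono) (auto simp: mult_le_cancel_left1)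
      also have "\<dots> = (b + c / \<delta>) * real n powr \<delta>" by (simp add: algebra_simps)
      finally have "\<eta> n \<le> real n * ((b + c / \<delta>) * real n powr \<delta>)" unfolding e by (intro mult_left_mono) auto
      also have "\<dots> = (b + c / \<delta>) * real n powr (1 + \<delta>)" using n by (simp add: powr_add)
      finally show "\<eta> n / real n powr (1 + \<delta>) \<le> b + c / \<delta>" using n by (simp add: divide_le_eq)
    qed
  next
    fix n :: nat assume n: "1 \<le> n"
    \<comment> \<open>Halved because \<open>covered_nonlinear\<close> yields the radius
      \<open>2 * \<epsilon>\<close>.\<close>
    define \<epsilon> where "\<epsilon> = real n powr - a / 2"
    have \<epsilon>: "0 < \<epsilon>" using n by (simp add: \<epsilon>_def)
    define p where "p = nat \<lfloor>poly P (real n)\<rfloor>"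
    define k where "k = nat \<lceil>R * real (2 * n) / \<epsilon>\<rceil>"
    have "covering_number (cball x R \<inter> nonlinear_approx g P n) (2 * \<epsilon>) \<le> enat ((p + 1) ^ n * (2 * k + 2) ^ (2 * n))"
      unfolding p_def k_def by (intro covering_number_le covered_nonlinear n \<epsilon>) (use R in simp)
    then have 1: "ereal_of_enat (covering_number (cball x R \<inter> nonlinear_approx g P n) (real n powr - a))
       \<le> ereal_of_enat (enat ((p + 1) ^ n * (2 * k + 2) ^ (2 * n)))"
      by (simp only: ereal_of_enat_le_iff \<epsilon>_def) simp
    have n1: "1 \<le> real n" using n by simp
    have "real p \<le> \<bar>poly P (real n)\<bar>" unfolding p_def by linarith
    also have "\<dots> \<le> (A - 1) * real n ^ degree P" using poly_abs_le[OF n1, of P] by (simp add: A_def)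
    finally have "real (p + 1) \<le> (A - 1) * real n ^ degree P + 1" by simp
    also have "\<dots> \<le> A * real n ^ degree P" using one_le_power[OF n1, of "degree P"] by (simp add: algebra_simps)
    also have "\<dots> = A * real n powr D" using n by (simp add: D_def powr_realpow)
    finally have p: "real (p + 1) \<le> A * real n powr D" .
    have na: "1 \<le> real n powr (a + 1)" using n a by (simp add: ge_one_powr_ge_zero)
    have "R * real (2 * n) / \<epsilon> = 4 * R * real n powr (a + 1)"
      using n by (simp add: \<epsilon>_def powr_minus powr_add field_simps)
    then have "real k \<le> 4 * R * real n powr (a + 1) + 1" unfolding k_def using R n
      by (simp add: of_nat_nat)
    then have "real (2 * k + 2) \<le> 8 * R * real n powr (a + 1) + 4" by simp
    also have "\<dots> \<le> A' * real n powr (a + 1)" using na by (simp add: A'_def algebra_simps)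
    finally have k: "real (2 * k + 2) \<le> A' * real n powr (a + 1)" .
    have "real ((p + 1) ^ n * (2 * k + 2) ^ (2 * n)) = real (p + 1) ^ n * real (2 * k + 2) ^ (2 * n)"
      by (simp only: of_nat_mult of_nat_power)
    also have "\<dots> \<le> (A * real n powr D) ^ n * (A' * real n powr (a + 1)) ^ (2 * n)"
      using p k by (intro mult_mono power_mono) auto
    also have "\<dots> = exp (\<eta> n)"
    proof -
      have e1: "A * real n powr D = exp (ln A + D * ln (real n))" using A n by (simp add: exp_add powr_def)
      have e2: "A' * real n powr (a + 1) = exp (ln A' + (a + 1) * ln (real n))" using A n by (simp add: exp_add powr_def)
      show ?thesis unfolding e1 e2 exp_of_nat_mult[symmetric] exp_add[symmetric] using n
        by (simp add: \<eta>_def algebra_simps)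
    qed
    finally have "ereal_of_enat (enat ((p + 1) ^ n * (2 * k + 2) ^ (2 * n))) \<le> ereal (exp (\<eta> n))" by simp
    then show "ereal_of_enat (covering_number (cball x R \<inter> nonlinear_approx g P n) (real n powr - a)) \<le> ereal (exp (\<eta> n))"
      using 1 by (rule order_trans[rotated])
  qed
qed

section \<open>Enumeration of the shearlet system\<close>

text \<open>Values of \<open>f\<close> may repeat. Keeping only first occurrences can only lower
  positions, so \<open>f n\<close> still appears at an index of at most \<open>n + 1\<close>; the 1
  is the shift to positive indices.\<close>

lemma enumerate_range:
  fixes f :: "nat \<Rightarrow> 'a"
  assumes inf: "infinite (range f)"
  shows "\<exists>g. bij_betw g {1..} (range f) \<and> (\<forall>n. \<exists>k. 1 \<le> k \<and> k \<le> n + 1 \<and> g k = f n)"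
proof -
  define h where "h x = (LEAST n. f n = x)" for x
  have fh: "f (h x) = x" if "x \<in> range f" for x
    using that unfolding h_def by (auto intro: LeastI)
  have h_le: "h (f n) \<le> n" for n unfolding h_def by (rule Least_le) simp
  define H where "H = h ` range f"
  have inj: "inj_on h (range f)" by (rule inj_on_inverseI[of _ f]) (rule fh)
  have infH: "infinite H" unfolding H_def using inf finite_image_iff[OF inj] by blast
  have fH: "bij_betw f H (range f)" unfolding bij_betw_def
  proof
    show "inj_on f H" unfolding H_def by (rule inj_on_inverseI[of _ h]) (use fh in auto)
    have "f ` H = (\<lambda>x. x) ` range f" unfolding H_def image_image by (rule image_cong[OF refl], rule fh, rule rangeI)
    then show "f ` H = range f" by simp
  qed
  have sh: "bij_betw (\<lambda>k::nat. k - 1) {1..} UNIV"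
    by (rule bij_betw_byWitness[of _ Suc]) auto
  have "bij_betw (f \<circ> (enumerate H \<circ> (\<lambda>k. k - 1))) {1..} (range f)"
    by (intro bij_betw_trans[OF bij_betw_trans[OF sh bij_enumerate[OF infH]] fH])
  moreover have "\<exists>k. 1 \<le> k \<and> k \<le> n + 1 \<and> (f \<circ> (enumerate H \<circ> (\<lambda>k. k - 1))) k = f n" for n
  proof -
    have "h (f n) \<in> H" by (auto simp: H_def)
    then have "h (f n) \<in> range (enumerate H)" using bij_enumerate[OF infH] by (simp add: bij_betw_def)
    then obtain k where k: "enumerate H k = h (f n)" by auto
    have "k \<le> n" using le_enumerate[OF infH, of k] h_le[of n] k by linarith
    then show ?thesis using k fh by (intro exI[of _ "k + 1"]) auto
  qed
  ultimately show ?thesis by blast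
qed

text \<open>Every number decodes to an element of the system: a shear out of range or an invalid
  cone label falls back to a translate of the generator, so that the range is exactly the system.
  The tag \<open>t\<close> is 0 for shearlets.\<close>

definition lab :: "nat \<Rightarrow> l2" where
  "lab n = (let (t, n1) = prod_decode n; (j, n2) = prod_decode n1; (m, n3) = prod_decode n2;
       (i, n4) = prod_decode n3; (k1, k2) = prod_decode n4;
       k = vector [int_decode k1, int_decode k2] in
     if t = 0 \<and> \<bar>int_decode m\<bar> \<le> \<lceil>2 powr (real j / 2)\<rceil> \<and> i \<in> {0, 1}
     then l2_of (shearlet gen_wave 1 j (int_decode m) i k)
     else l2_of (\<lambda>x. gen_wave (x - 1 *\<^sub>R int_vec k)))"

definition enc :: "nat \<Rightarrow> nat \<Rightarrow> int \<Rightarrow> nat \<Rightarrow> int \<Rightarrow> int \<Rightarrow> nat" where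
  "enc t j m i k1 k2 = prod_encode (t, prod_encode (j, prod_encode (int_encode m,
     prod_encode (i, prod_encode (int_encode k1, int_encode k2)))))"

lemma lab_enc:
  "lab (enc t j m i k1 k2) = (if t = 0 \<and> \<bar>m\<bar> \<le> \<lceil>2 powr (real j / 2)\<rceil> \<and> i \<in> {0, 1}
     then l2_of (shearlet gen_wave 1 j m i (vector [k1, k2]))
     else l2_of (\<lambda>x. gen_wave (x - 1 *\<^sub>R int_vec (vector [k1, k2]))))"
  unfolding lab_def enc_def by (auto simp: Let_def)

lemma range_lab: "range lab = shearlet_system gen_wave gen_wave 1"
proof
  show "range lab \<subseteq> shearlet_system gen_wave gen_wave 1"
  proof (rule image_subsetI)
    fix n :: nat
    obtain t n1 where 1: "prod_decode n = (t, n1)" by (metis surj_pair)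
    obtain j n2 where 2: "prod_decode n1 = (j, n2)" by (metis surj_pair)
    obtain m n3 where 3: "prod_decode n2 = (m, n3)" by (metis surj_pair)
    obtain i n4 where 4: "prod_decode n3 = (i, n4)" by (metis surj_pair)
    obtain k1 k2 where 5: "prod_decode n4 = (k1, k2)" by (metis surj_pair)
    let ?k = "vector [int_decode k1, int_decode k2] :: int^2"
    have l: "lab n = (if t = 0 \<and> \<bar>int_decode m\<bar> \<le> \<lceil>2 powr (real j / 2)\<rceil> \<and> i \<in> {0, 1}
     then l2_of (shearlet gen_wave 1 j (int_decode m) i ?k) else l2_of (\<lambda>x. gen_wave (x - 1 *\<^sub>R int_vec ?k)))"
      unfolding lab_def Let_def 1 2 3 4 5 prod.case by (rule refl)
    show "lab n \<in> shearlet_system gen_wave gen_wave 1"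
    proof (cases "t = 0 \<and> \<bar>int_decode m\<bar> \<le> \<lceil>2 powr (real j / 2)\<rceil> \<and> i \<in> {0, 1}")
      case True
      show ?thesis unfolding l if_P[OF True] shearlet_system_def by (rule UnI2) (use True in blast)
    next
      case False
      show ?thesis unfolding l if_not_P[OF False] shearlet_system_def by (rule UnI1) blast
    qed
  qed
  have vec: "k = vector [k $ 1, k $ 2]" for k :: "int^2" by (simp add: vec_eq_iff forall_2 vector_2)
  show "shearlet_system gen_wave gen_wave 1 \<subseteq> range lab"
  proof
    fix f assume "f \<in> shearlet_system gen_wave gen_wave 1"
    then consider k where "f = l2_of (\<lambda>x. gen_wave (x - 1 *\<^sub>R int_vec k))"
      | j m i k where "f = l2_of (shearlet gen_wave 1 j m i k)" "\<bar>m\<bar> \<le> \<lceil>2 powr (real j / 2)\<rceil>" "i \<in> {0, 1}"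
      unfolding shearlet_system_def by blast
    then show "f \<in> range lab"
    proof cases
      case 1
      have "f = lab (enc 1 0 0 0 (k $ 1) (k $ 2))" unfolding 1 lab_enc vec[of k, symmetric] by simp
      then show ?thesis by blast
    next
      case 2
      have "f = lab (enc 0 j m i (k $ 1) (k $ 2))" unfolding 2(1) lab_enc vec[of k, symmetric] using 2(2,3) by auto
      then show ?thesis by blast
    qed
  qed
qed

text \<open>The factor 4 makes the estimate iterable: each pairing squares the bound on four times
  the code.\<close>

lemma prod_encode_le: "a \<le> Y \<Longrightarrow> b \<le> Y \<Longrightarrow> 1 \<le> Y \<Longrightarrow> 4 * prod_encode (a, b) \<le> (4 * Y)\<^sup>2"
proof -
  assume a: "a \<le> Y" and b: "b \<le> Y" and Y: "1 \<le> Y"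
  have "triangle (a + b) \<le> (a + b) * Suc (a + b) div 2" by (simp add: triangle_def)
  also have "\<dots> \<le> (2 * Y) * (2 * Y + 1) div 2" using a b by (intro div_le_mono mult_le_mono) auto
  also have "\<dots> = Y * (2 * Y + 1)" by simp
  finally have "prod_encode (a, b) \<le> Y * (2 * Y + 1) + Y" using a by (simp add: prod_encode_def)
  moreover have "Y \<le> Y * Y" using Y by simp
  moreover have "Y * (2 * Y + 1) + Y = 2 * (Y * Y) + 2 * Y" "(4 * Y)\<^sup>2 = 16 * (Y * Y)"
    by (simp_all add: power2_eq_square algebra_simps)
  ultimately show ?thesis by linarith
qed

lemma int_encode_le: "real (int_encode k) \<le> 2 * \<bar>real_of_int k\<bar> + 1"
  by (auto simp: int_encode_def sum_encode_def)

text \<open>Five nested pairings, each squaring the bound, give the exponent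
  \<open>2 ^ 5\<close>.\<close>

lemma enc_le:
  assumes X: "1 \<le> X" and b: "t \<le> X" "j \<le> X" "int_encode m \<le> X" "i \<le> X" "int_encode k1 \<le> X" "int_encode k2 \<le> X"
  shows "enc t j m i k1 k2 \<le> (4 * X) ^ 32"
proof -
  have step: "4 * prod_encode (a, b) \<le> (4 * X) ^ (2 * p)" if "a \<le> X" "4 * b \<le> (4 * X) ^ p" "1 \<le> p" for a b p
  proof -
    define Y where "Y = max a b"
    have "4 * X \<le> (4 * X) ^ p" using that X by (intro self_le_power) auto
    then have Y: "4 * max Y 1 \<le> (4 * X) ^ p" using that X by (auto simp: Y_def max_def)
    have "4 * prod_encode (a, b) \<le> (4 * max Y 1)\<^sup>2" by (rule prod_encode_le) (auto simp: Y_def)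
    also have "\<dots> \<le> ((4 * X) ^ p)\<^sup>2" using Y by (intro power_mono) auto
    finally show ?thesis by (simp only: power_mult[symmetric] mult.commute[of p])
  qed
  define n4 where "n4 = prod_encode (int_encode k1, int_encode k2)"
  define n3 where "n3 = prod_encode (i, n4)"
  define n2 where "n2 = prod_encode (int_encode m, n3)"
  define n1 where "n1 = prod_encode (j, n2)"
  have "4 * n4 \<le> (4 * X) ^ (2 * 1)" unfolding n4_def using b by (intro step) auto
  then have "4 * n3 \<le> (4 * X) ^ (2 * 2)" unfolding n3_def using b by (intro step) auto
  then have "4 * n2 \<le> (4 * X) ^ (2 * 4)" unfolding n2_def using b by (intro step) auto
  then have "4 * n1 \<le> (4 * X) ^ (2 * 8)" unfolding n1_def using b by (intro step) auto
  then have "4 * prod_encode (t, n1) \<le> (4 * X) ^ (2 * 16)" using b by (intro step) auto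
  then show ?thesis unfolding enc_def n4_def[symmetric] n3_def[symmetric] n2_def[symmetric] n1_def[symmetric] by simp
qed

lemma translate_elem:
  "(\<lambda>x. gen_wave (x - 1 *\<^sub>R int_vec (vector [k1, k2]))) = (\<lambda>z. complex_of_real (elem 1 0 0 (k1, k2) (z $ 1) (z $ 2)))"
  by (simp add: fun_eq_iff gen_wave_def elem_def int_vec_def vector_2)

text \<open>An infinite system is what permits a bijection with the positive integers. The kernel is
  supported in an interval of length 3, so translates by multiples of 4 differ on a nonempty open
  set.\<close>

lemma infinite_system: "infinite (shearlet_system gen_wave gen_wave 1)"
proof -
  define e where "e p = (\<lambda>z::real^2. complex_of_real (elem 1 0 0 (4 * int p, 0) (z $ 1) (z $ 2)))" for p :: nat
  have sq: "square_integrable (e p)" for p unfolding e_def by (rule elem_l2) simp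
  have pos: "kernel u \<noteq> 0" if "-1 < u" "u < 1" for u :: real
  proof -
    have "u^2 < 1" if "u < 0" using that \<open>-1 < u\<close> by (simp add: abs_square_less_1)
    then show ?thesis using that by (auto simp: kernel_def)
  qed
  have "inj (\<lambda>p. l2_of (e p))"
  proof (rule injI, rule ccontr)
    fix p p' :: nat assume eq: "l2_of (e p) = l2_of (e p')" and ne: "p \<noteq> p'"
    define U where "U = {z::real^2. real (4 * p) - 1 < z $ 1 \<and> z $ 1 < real (4 * p) + 1 \<and> -1 < z $ 2 \<and> z $ 2 < 1}"
    have "l2_rel (e p) (e p')" using eq sq Quotient_rel[OF Quotient_l2] l2_rel_refl by metis
    then have AE: "AE z in lborel. e p z = e p' z" by (simp add: l2_rel_def)
    have d: "e p z \<noteq> e p' z" if z: "z \<in> U" for z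
    proof -
      have "kernel (z $ 1 - real (4 * p)) \<noteq> 0" "kernel (z $ 2) \<noteq> 0"
        using pos[of "z $ 1 - real (4 * p)"] pos[of "z $ 2"] z by (auto simp: U_def)
      then have "e p z \<noteq> 0" by (simp add: e_def elem_def)
      moreover have "kernel (z $ 1 - real (4 * p')) = 0"
      proof (cases "p < p'")
        case True
        then have "real (4 * p) + 4 \<le> real (4 * p')" by linarith
        then show ?thesis using z by (auto simp: U_def kernel_def)
      next
        case False
        then have "real (4 * p') + 4 \<le> real (4 * p)" using ne by linarith
        then show ?thesis using z by (auto simp: U_def kernel_def)
      qed
      then have "e p' z = 0" by (simp add: e_def elem_def)
      ultimately show ?thesis by simp
    qed
    have op: "open U" unfolding U_def by (intro open_Collect_conj open_Collect_less continuous_intros)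
    have "(vector [real (4 * p), 0] :: real^2) \<in> U" by (simp add: U_def vector_2)
    then have neU: "U \<noteq> {}" by blast
    have "AE z in lborel. z \<notin> U" using AE by eventually_elim (use d in blast)
    then have "U \<in> null_sets lborel" using op AE_iff_null[of lborel "\<lambda>z. z \<notin> U"] by (simp add: borel_open)
    then have "negligible U" by (simp only: negligible_iff_null_sets null_sets_completionI)
    with open_not_negligible[OF op neU] show False by blast
  qed
  then have "infinite (range (\<lambda>p. l2_of (e p)))" by (rule range_inj_infinite)
  moreover have "range (\<lambda>p. l2_of (e p)) \<subseteq> shearlet_system gen_wave gen_wave 1"
    unfolding e_def translate_elem[symmetric] shearlet_system_def by blast
  ultimately show ?thesis using finite_subset by blast
qed

section \<open>The approximation rate\<close>

lemma nonlinear_rate_dyadic: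
  assumes par: "1 \<le> \<nu>" "0 < \<rho>\<^sub>0" "\<rho>\<^sub>1 < 1"
  shows "\<exists>g P C. bij_betw g {1..} (shearlet_system gen_wave gen_wave 1) \<and> 1 \<le> C \<and>
    (\<forall>f\<in>star_indicators \<nu> \<rho>\<^sub>0 \<rho>\<^sub>1. \<forall>n I. C * (real (I + 1) * 2 ^ I) \<le> real n \<longrightarrow>
       infdist f (nonlinear_approx g P n) \<le> C * (real (I + 1) / 2 ^ I))"
proof -
  obtain C where C: "1 \<le> C" and app: "\<And>S I. S\<in>STAR \<nu> \<rho>\<^sub>0 \<rho>\<^sub>1 \<Longrightarrow> \<exists>J f. finite J \<and> J \<subseteq> shear_index \<and>
     real (card J) \<le> C * (real (I + 1) * 2 ^ I) \<and>
     (\<forall>(L, m, i, k1, k2)\<in>J. L \<le> I \<and> \<bar>of_int k1\<bar> \<le> C * 4 ^ I \<and> \<bar>of_int k2\<bar> \<le> C * 4 ^ I) \<and>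
     f \<in> l2.span (welem ` J) \<and> norm (l2_of (indicator S) - f) \<le> C * (real (I + 1) / 2 ^ I)"
  proof -
    obtain C where *: "1 \<le> C \<and> (\<forall>S\<in>STAR \<nu> \<rho>\<^sub>0 \<rho>\<^sub>1. \<forall>I::nat. \<exists>J f. finite J \<and> J \<subseteq> shear_index \<and>
     real (card J) \<le> C * (real (I + 1) * 2 ^ I) \<and>
     (\<forall>(L, m, i, k1, k2)\<in>J. L \<le> I \<and> \<bar>of_int k1\<bar> \<le> C * 4 ^ I \<and> \<bar>of_int k2\<bar> \<le> C * 4 ^ I) \<and>
     f \<in> l2.span (welem ` J) \<and> norm (l2_of (indicator S) - f) \<le> C * (real (I + 1) / 2 ^ I))"
      using star_approximation[OF par] by (elim exE)
    show ?thesis by (rule that[OF *[THEN conjunct1] *[THEN conjunct2, rule_format]])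
  qed
  obtain g where g: "bij_betw g {1..} (shearlet_system gen_wave gen_wave 1)"
    and gi: "\<And>n. \<exists>k. 1 \<le> k \<and> k \<le> n + 1 \<and> g k = lab n"
    using enumerate_range[of lab] infinite_system unfolding range_lab by blast
  define c where "c = nat \<lceil>2 * C + 3\<rceil>"
  have c: "2 * C + 3 \<le> real c" unfolding c_def using C by linarith
  \<comment> \<open>The entries of a code are of order \<open>4 ^ I \<le> n^2\<close>; raised to the
    power 32 they give degree 64. The summand 1 is the shift in
    \<open>enumerate_range\<close>.\<close>
  define P :: "real poly" where "P = [:1:] + monom (real ((4 * c) ^ 32)) 64"
  have Pn: "poly P (real n) = 1 + real ((4 * c) ^ 32) * real n ^ 64" for n by (simp add: P_def poly_monom)
  show ?thesis
  proof (rule exI[of _ g], rule exI[of _ P], rule exI[of _ C], intro conjI g C ballI allI impI)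
    fix F n I assume "F \<in> star_indicators \<nu> \<rho>\<^sub>0 \<rho>\<^sub>1" and n: "C * (real (I + 1) * 2 ^ I) \<le> real n"
    then obtain S where S: "S \<in> STAR \<nu> \<rho>\<^sub>0 \<rho>\<^sub>1" "F = l2_of (indicator S)" unfolding star_indicators_def by blast
    obtain J f where J: "finite J" "J \<subseteq> shear_index" "real (card J) \<le> C * (real (I + 1) * 2 ^ I)"
      and Jb': "\<forall>(L, m, i, k1, k2)\<in>J. L \<le> I \<and> \<bar>of_int k1\<bar> \<le> C * 4 ^ I \<and> \<bar>of_int k2\<bar> \<le> C * 4 ^ I"
      and f: "f \<in> l2.span (welem ` J)" "norm (l2_of (indicator S) - f) \<le> C * (real (I + 1) / 2 ^ I)"
      using app[OF S(1), of I] by (elim exE conjE)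
    have Jb: "L \<le> I \<and> \<bar>of_int k1\<bar> \<le> C * 4 ^ I \<and> \<bar>of_int k2\<bar> \<le> C * 4 ^ I" if "(L, m, i, k1, k2) \<in> J" for L m i k1 k2
      using bspec[OF Jb' that] by simp
    have "1 * (1 * 2 ^ I) \<le> C * (real (I + 1) * 2 ^ I)" using C by (intro mult_mono) auto
    then have I: "2 ^ I \<le> real n" using n by linarith
    have ex: "\<exists>k. 1 \<le> k \<and> real k \<le> poly P (real n) \<and> g k = welem d" if d: "d \<in> J" for d
    proof -
      obtain L m i k1 k2 where deq: "d = (L, m, i, k1, k2)" by (metis surj_pair)
      have mem: "i \<in> {0, 1}" "\<bar>of_int m\<bar> \<le> (2::real) ^ L" using J(2) d unfolding deq shear_index_def by auto
      note b = Jb[OF d[unfolded deq]]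
      have pw: "2 powr (real (2 * L) / 2) = (2::real) ^ L" by (simp add: powr_realpow)
      have "\<bar>m\<bar> \<le> \<lceil>2 powr (real (2 * L) / 2)\<rceil>" unfolding pw using mem(2) by linarith
      then have we: "lab (enc 0 (2 * L) m i k1 k2) = welem d" unfolding lab_enc deq welem_def using mem(1) by simp
      define X where "X = c * 4 ^ I"
      have I4: "1 \<le> (4::real) ^ I" "(2::real) ^ I \<le> 4 ^ I" by (auto intro: power_mono)
      have cX: "(2 * C + 3) * 4 ^ I \<le> real X" unfolding X_def using c by (simp add: mult_right_mono)
      have c5: "5 * 4 ^ I \<le> real X"
      proof -
        have "5 * (4::real) ^ I \<le> (2 * C + 3) * 4 ^ I" using C by (intro mult_right_mono) auto
        then show ?thesis using cX by linarith
      qed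
      have X1: "1 \<le> X" using c5 I4 by linarith
      have "enc 0 (2 * L) m i k1 k2 \<le> (4 * X) ^ 32"
      proof (rule enc_le)
        show "1 \<le> X" by (rule X1)
        show "0 \<le> X" by simp
        have "real I < 2 ^ I" by (rule of_nat_less_two_power)
        then have "real (2 * L) \<le> 2 * 4 ^ I" using b I4 by linarith
        then show "2 * L \<le> X" using c5 by linarith
        have "(2::real) ^ L \<le> 2 ^ I" using b by (intro power_increasing) auto
        then have "real (int_encode m) \<le> 2 * 4 ^ I + 1" using int_encode_le[of m] mem(2) I4 by linarith
        then show "int_encode m \<le> X" using c5 I4 by linarith
        show "i \<le> X" using mem(1) X1 by auto
        have k: "int_encode k \<le> X" if "\<bar>of_int k\<bar> \<le> C * 4 ^ I" for k
        proof -
          have "real (int_encode k) \<le> 2 * (C * 4 ^ I) + 1" using int_encode_le[of k] that by linarith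
          moreover have "(2 * C + 3) * 4 ^ I = 2 * (C * 4 ^ I) + 3 * 4 ^ I" by (simp add: algebra_simps)
          ultimately show ?thesis using cX I4 by linarith
        qed
        show "int_encode k1 \<le> X" "int_encode k2 \<le> X" using b by (auto intro: k)
      qed
      also have "\<dots> \<le> (4 * c) ^ 32 * n ^ 64"
      proof -
        have nI: "2 ^ I \<le> n" using I by (metis of_nat_le_iff of_nat_numeral of_nat_power)
        have "(4::nat) ^ I = (2 ^ I)\<^sup>2" by (simp add: power_mult[symmetric] mult.commute[of I 2]) (simp add: power_mult)
        also have "\<dots> \<le> n\<^sup>2" using nI by (rule power_mono) simp
        finally have "4 * X \<le> 4 * c * n\<^sup>2" unfolding X_def by simp
        then have "(4 * X) ^ 32 \<le> (4 * c * n\<^sup>2) ^ 32" by (rule power_mono) simp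
        then show ?thesis by (simp add: power_mult_distrib power_mult[symmetric])
      qed
      finally have e: "enc 0 (2 * L) m i k1 k2 \<le> (4 * c) ^ 32 * n ^ 64" .
      obtain k where k: "1 \<le> k" "k \<le> enc 0 (2 * L) m i k1 k2 + 1" "g k = lab (enc 0 (2 * L) m i k1 k2)" using gi by blast
      have "k \<le> (4 * c) ^ 32 * n ^ 64 + 1" using k e by linarith
      then have "real k \<le> real ((4 * c) ^ 32 * n ^ 64 + 1)" by (simp only: of_nat_le_iff)
      then have "real k \<le> poly P (real n)" unfolding Pn by simp
      then show ?thesis using k we by metis
    qed
    then have "\<forall>d\<in>J. \<exists>k. 1 \<le> k \<and> real k \<le> poly P (real n) \<and> g k = welem d" by blast
    from bchoice[OF this] obtain idx where idx: "\<forall>d\<in>J. 1 \<le> idx d \<and> real (idx d) \<le> poly P (real n) \<and> g (idx d) = welem d" by (elim exE)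
    have "card (idx ` J) \<le> card J" by (rule card_image_le[OF J(1)])
    then have "real (card (idx ` J)) \<le> real n" using J(3) n by linarith
    then have cn: "card (idx ` J) \<le> n" by simp
    have "g ` idx ` J = welem ` J" using idx by (force simp: image_image)
    then have "f \<in> l2.span (g ` idx ` J)" using f(1) by simp
    then have "f \<in> nonlinear_approx g P n" unfolding nonlinear_approx_def using cn idx
      by (intro UN_I[of "idx ` J"]) auto
    then have "infdist F (nonlinear_approx g P n) \<le> dist F f" by (rule infdist_le)
    then show "infdist F (nonlinear_approx g P n) \<le> C * (real (I + 1) / 2 ^ I)" using f(2) S(2) by (simp add: dist_norm)
  qed
qed

lemma square_le_exp:
  fixes x c :: real
  assumes "0 < c" "0 \<le> x"
  shows "x^2 \<le> exp (2 * c * x) / c^2"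
proof -
  have "c * x \<le> exp (c * x)" using exp_ge_add_one_self[of "c * x"] by linarith
  then have "(c * x)^2 \<le> exp (c * x)^2" using assms by (intro power_mono) auto
  then have "c^2 * x^2 \<le> exp (2 * c * x)" by (simp add: power_mult_distrib exp_double[symmetric] mult.assoc)
  then show ?thesis using assms by (simp add: field_simps)
qed

lemma norm_star_indicator:
  assumes "f \<in> star_indicators \<nu> \<rho>\<^sub>0 \<rho>\<^sub>1"
  shows "norm f \<le> 1"
proof -
  obtain S where S: "S \<in> STAR \<nu> \<rho>\<^sub>0 \<rho>\<^sub>1" "f = l2_of (indicator S)" using assms unfolding star_indicators_def by blast
  have Sm: "S \<in> sets borel" by (rule STAR_borel[OF S(1)])
  have Ssub: "S \<subseteq> cbox (vector [0, 0]) (vector [1, 1])"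
  proof -
    have "S \<subseteq> {x. \<forall>i. 0 \<le> x $ i \<and> x $ i \<le> 1}" using S(1) unfolding STAR_def by blast
    also have "\<dots> \<subseteq> cbox (vector [0, 0]) (vector [1, 1])" by (auto simp: mem_box_cart forall_2 vector_2)
    finally show ?thesis .
  qed
  have "emeasure lborel S \<le> ennreal (((vector [1, 1] :: real^2) $ 1 - (vector [0, 0] :: real^2) $ 1)
      * ((vector [1, 1] :: real^2) $ 2 - (vector [0, 0] :: real^2) $ 2))"
  proof (rule shear_box_measure[OF linear_id])
    show "\<bar>det (matrix (id :: real^2 \<Rightarrow> real^2))\<bar> = 1" by (simp add: matrix_id)
    show "(vector [0, 0] :: real^2) $ i \<le> (vector [1, 1] :: real^2) $ i" for i
      using exhaust_2[of i] by (auto simp: vector_2)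
  qed (use Sm Ssub in auto)
  then have em: "emeasure lborel S \<le> ennreal 1" by (simp add: vector_2)
  have "l2_le (indicat_real S) (1 * sqrt (1 * real (card {()}) * 1))"
    by (rule l2_le_overlap[where R = "\<lambda>_. S"])
       (use Sm em in \<open>auto simp: indicator_def\<close>)
  moreover have "(\<lambda>z. complex_of_real (indicat_real S z)) = indicator S" by (auto simp: indicator_def)
  ultimately show ?thesis unfolding l2_le_def S(2) by simp
qed

text \<open>The largest admissible \<open>I\<close> satisfies
  \<open>2 ^ -I \<le> 2 * C * (I + 2) / n\<close>, so the error is of order \<open>I^2 / n\<close>,
  and \<open>I^2\<close> is absorbed by \<open>n powr (1 - t)\<close>. Since \<open>K\<close> is
  chosen before \<open>D\<close>, the rate is uniform over the class.\<close>

lemma rate_of_dyadic_rate: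
  assumes C: "1 \<le> C" and t: "0 \<le> t" "t < 1"
  shows "\<exists>K>0. \<forall>D::nat \<Rightarrow> real. (\<forall>n I. C * (real (I + 1) * 2 ^ I) \<le> real n \<longrightarrow> D n \<le> C * (real (I + 1) / 2 ^ I)) \<longrightarrow>
     (\<forall>n. D n \<le> 1) \<longrightarrow> (\<forall>n\<ge>1. D n \<le> K * real n powr - t)"
proof -
  \<comment> \<open>Chosen so that \<open>exp (2 * c * x)\<close> equals
    \<open>2 powr (x * (1 - t))\<close>.\<close>
  define c where "c = (1 - t) * ln 2 / 2"
  have c: "0 < c" using t by (simp add: c_def)
  define K where "K = max C (2 * C^2 * (4 / c^2))"
  show ?thesis
  proof (rule exI[of _ K], intro conjI allI impI)
    show "0 < K" using C by (simp add: K_def)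
    fix D :: "nat \<Rightarrow> real" and n :: nat
    assume rate: "\<forall>n I. C * (real (I + 1) * 2 ^ I) \<le> real n \<longrightarrow> D n \<le> C * (real (I + 1) / 2 ^ I)"
      and triv: "\<forall>n. D n \<le> 1" and n: "1 \<le> n"
    have n1: "1 \<le> real n" using n by simp
    show "D n \<le> K * real n powr - t"
    proof (cases "C \<le> real n")
      case False
      have "1 = C * (1 / C)" using C by simp
      also have "\<dots> \<le> C * (1 / real n)" using False C n1 by (intro mult_left_mono divide_left_mono) auto
      also have "1 / real n = real n powr - 1" using n1 by (simp add: powr_minus_divide)
      also have "C * (real n powr - 1) \<le> K * real n powr - t" using t n1 C
        by (intro mult_mono powr_mono) (auto simp: K_def)
      finally show ?thesis using triv[rule_format, of n] by linarith
    next
      case True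
      define A where "A = {I. C * (real (I + 1) * 2 ^ I) \<le> real n}"
      have pow: "2 ^ I \<le> real n" if "I \<in> A" for I
      proof -
        have "1 * (1 * 2 ^ I) \<le> C * (real (I + 1) * 2 ^ I)" using C by (intro mult_mono) auto
        then show ?thesis using that unfolding A_def mem_Collect_eq by linarith
      qed
      have "A \<subseteq> {..n}"
      proof
        fix I assume "I \<in> A"
        then have "real I < real n" using pow[OF \<open>I \<in> A\<close>] of_nat_less_two_power[of I, where ?'a = real] by linarith
        then show "I \<in> {..n}" by simp
      qed
      then have fin: "finite A" using finite_subset by blast
      have ne: "A \<noteq> {}" using True by (auto simp: A_def intro!: exI[of _ 0])
      define I where "I = Max A"
      have IA: "I \<in> A" unfolding I_def by (rule Max_in[OF fin ne])
      have "Suc I \<notin> A" using Max_ge[OF fin, of "Suc I"] unfolding I_def by auto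
      then have up: "real n < C * (real (I + 2) * 2 ^ Suc I)" by (simp add: A_def)
      have "D n \<le> C * (real (I + 1) / 2 ^ I)" using rate IA by (simp add: A_def)
      also have "\<dots> \<le> C * (real (I + 2) / 2 ^ I)" using C by (intro mult_left_mono divide_right_mono) auto
      also have "\<dots> \<le> C * (real (I + 2) * (2 * C * real (I + 2) / real n))"
      proof -
        have "1 / 2 ^ I \<le> 2 * C * real (I + 2) / real n"
          using up n1 by (simp add: field_simps)
        then have "real (I + 2) * (1 / 2 ^ I) \<le> real (I + 2) * (2 * C * real (I + 2) / real n)" by (rule mult_left_mono) simp
        then show ?thesis using C by (intro mult_left_mono) auto
      qed
      also have "\<dots> = 2 * C^2 * (real (I + 2))^2 / real n" by (simp add: power2_eq_square)
      also have "\<dots> \<le> 2 * C^2 * (4 * real n powr (1 - t) / c^2) / real n"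
      proof -
        have "ln ((2::real) ^ (I + 2)) = real (I + 2) * ln 2" by (rule ln_realpow)
        then have "exp (2 * c * real (I + 2)) = (2 ^ (I + 2)) powr (1 - t)"
          unfolding powr_def c_def by (simp add: mult.commute mult.left_commute del: power_Suc power_add)
        also have "\<dots> \<le> (4 * real n) powr (1 - t)" using pow[OF IA] t by (intro powr_mono2) (auto simp: power_add)
        also have "\<dots> = 4 powr (1 - t) * real n powr (1 - t)" using n1 by (simp add: powr_mult)
        also have "\<dots> \<le> 4 powr 1 * real n powr (1 - t)" using t by (intro mult_right_mono powr_mono) auto
        finally have "(real (I + 2))^2 \<le> 4 * real n powr (1 - t) / c^2"
          using square_le_exp[OF c, of "real (I + 2)"] c by (simp add: order_trans divide_right_mono)
        then show ?thesis using n1 by (intro divide_right_mono mult_left_mono) auto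
      qed
      also have "\<dots> = 2 * C^2 * (4 / c^2) * (real n powr (1 - t) / real n)" by simp
      also have "real n powr (1 - t) / real n = real n powr - t"
        using n1 by (simp add: powr_diff powr_minus_divide)
      also have "2 * C^2 * (4 / c^2) * real n powr - t \<le> K * real n powr - t" by (intro mult_right_mono) (auto simp: K_def)
      finally show ?thesis .
    qed
  qed
qed

lemma nonlinear_rate:
  assumes par: "1 \<le> \<nu>" "0 < \<rho>\<^sub>0" "\<rho>\<^sub>1 < 1"
  shows "\<exists>g P. bij_betw g {1..} (shearlet_system gen_wave gen_wave 1) \<and>
    (\<forall>t. 0 \<le> t \<and> t < 1 \<longrightarrow> (\<exists>K>0. \<forall>n\<ge>1. \<forall>f\<in>star_indicators \<nu> \<rho>\<^sub>0 \<rho>\<^sub>1.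
       infdist f (nonlinear_approx g P n) \<le> K * real n powr - t))"
proof -
  obtain g P C where g: "bij_betw g {1..} (shearlet_system gen_wave gen_wave 1)" and C: "1 \<le> C"
    and rate: "\<forall>f\<in>star_indicators \<nu> \<rho>\<^sub>0 \<rho>\<^sub>1. \<forall>n I. C * (real (I + 1) * 2 ^ I) \<le> real n \<longrightarrow>
       infdist f (nonlinear_approx g P n) \<le> C * (real (I + 1) / 2 ^ I)"
    using nonlinear_rate_dyadic[OF par] by (elim exE conjE)
  have triv: "infdist f (nonlinear_approx g P n) \<le> 1" if "f \<in> star_indicators \<nu> \<rho>\<^sub>0 \<rho>\<^sub>1" for f n
    using infdist_le[OF zero_in_nonlinear, of f g P n] norm_star_indicator[OF that] by simp
  show ?thesis
  proof (rule exI[of _ g], rule exI[of _ P], intro conjI g allI impI)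
    fix t :: real assume t: "0 \<le> t \<and> t < 1"
    obtain K where K: "0 < K" and r: "\<And>D::nat \<Rightarrow> real. (\<forall>n I. C * (real (I + 1) * 2 ^ I) \<le> real n \<longrightarrow> D n \<le> C * (real (I + 1) / 2 ^ I)) \<Longrightarrow>
     (\<forall>n. D n \<le> 1) \<Longrightarrow> (\<forall>n\<ge>1. D n \<le> K * real n powr - t)"
      using rate_of_dyadic_rate[OF C, of t] t by blast
    show "\<exists>K>0. \<forall>n\<ge>1. \<forall>f\<in>star_indicators \<nu> \<rho>\<^sub>0 \<rho>\<^sub>1. infdist f (nonlinear_approx g P n) \<le> K * real n powr - t"
    proof (rule exI[of _ K], intro conjI K allI impI ballI)
      fix n :: nat and f assume n: "1 \<le> n" and f: "f \<in> star_indicators \<nu> \<rho>\<^sub>0 \<rho>\<^sub>1"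
      show "infdist f (nonlinear_approx g P n) \<le> K * real n powr - t"
        using r[of "\<lambda>n. infdist f (nonlinear_approx g P n)"] rate f triv[OF f] n by blast
    qed
  qed
qed

section \<open>Dimension bounds\<close>

lemma infdist_obtain:
  assumes "A \<noteq> {}" "infdist x A < r"
  obtains a where "a \<in> A" "dist x a < r"
proof -
  have "(INF a\<in>A. dist x a) < r" using assms by (simp add: infdist_notempty)
  then obtain a where "a \<in> A" "dist x a < r"
    using assms(1) by (subst (asm) cINF_less_iff) (auto intro: bdd_belowI2[of _ 0])
  then show ?thesis by (rule that)
qed

text \<open>The comparison in the extended reals with a finite bound also shows that the covering
  number is finite, so actual coverings exist.\<close>

lemma controlled_coverings:
  assumes A: "controlled_complexity A" and pos: "0 < (a::real)" "0 < R" "0 < (\<delta>::real)"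
  shows "\<exists>n0\<ge>1. \<exists>B\<ge>0. \<forall>n\<ge>n0. \<exists>k. covered (cball x R \<inter> A n) (real n powr - a) k \<and> real k \<le> exp (B * real n powr (1 + \<delta>))"
proof -
  obtain n0 and \<eta> :: "nat \<Rightarrow> real" where n0: "1 \<le> n0" and \<eta>: "\<forall>\<delta>>0. bdd_above ((\<lambda>n. \<eta> n / real n powr (1 + \<delta>)) ` {1..})"
    and c: "\<forall>n\<ge>n0. ereal_of_enat (covering_number (cball x R \<inter> A n) (real n powr - a)) \<le> ereal (exp (\<eta> n))"
    using conjunct2[OF A[unfolded controlled_complexity_def], rule_format, OF conjI[OF pos(1,2)], of x] by (elim exE conjE)
  obtain B0 where B0: "\<And>n. 1 \<le> n \<Longrightarrow> \<eta> n / real n powr (1 + \<delta>) \<le> B0"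
    using \<eta>[rule_format, OF pos(3)] unfolding bdd_above_def by auto
  show ?thesis
  proof (rule exI[of _ n0], intro conjI n0, rule exI[of _ "max B0 0"], intro conjI allI impI)
    fix n assume n: "n0 \<le> n"
    then have n1: "1 \<le> real n" using n0 by simp
    have "\<eta> n \<le> B0 * real n powr (1 + \<delta>)" using B0[of n] n n0 n1 by (simp add: divide_le_eq)
    also have "\<dots> \<le> max B0 0 * real n powr (1 + \<delta>)" by (intro mult_right_mono) auto
    finally have e: "exp (\<eta> n) \<le> exp (max B0 0 * real n powr (1 + \<delta>))" by simp
    obtain k where k: "covering_number (cball x R \<inter> A n) (real n powr - a) = enat k"
      using c[rule_format, OF n] by (cases "covering_number (cball x R \<inter> A n) (real n powr - a)") auto
    then have "real k \<le> exp (\<eta> n)" using c[rule_format, OF n] by simp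
    then have "real k \<le> exp (max B0 0 * real n powr (1 + \<delta>))" using e by (rule order_trans)
    then show "\<exists>k. covered (cball x R \<inter> A n) (real n powr - a) k \<and> real k \<le> exp (max B0 0 * real n powr (1 + \<delta>))"
      using covered_of_covering_number[OF k] by (intro exI[of _ k] conjI)
  qed simp
qed

text \<open>\<open>t < 1\<close> and \<open>\<delta>\<close> are chosen with
  \<open>(1 + \<delta>) / t = 1 + d\<close>, and \<open>n\<close> is of order
  \<open>(1 / \<epsilon>) powr (1 / t)\<close>. The centres of a covering of the bounded part of
  \<open>A n\<close> do not lie in \<open>C\<close>; they serve only as codes, within
  \<open>3 * \<epsilon> / 8\<close> of the coded points.\<close>

lemma entropy_upper:
  fixes C :: "l2 set"
  assumes A: "controlled_complexity A" and bd: "\<And>f. f \<in> C \<Longrightarrow> norm f \<le> 1"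
    and rate: "\<And>t::real. 0 \<le> t \<and> t < 1 \<Longrightarrow> \<exists>K>0. \<forall>n\<ge>1. \<forall>f\<in>C. infdist f (A n) \<le> K * real n powr - t"
    and d: "0 < (d::real)"
  shows "\<exists>B>0. \<exists>e>0. \<forall>\<epsilon>. 0 < \<epsilon> \<and> \<epsilon> < e \<longrightarrow> (\<exists>k. covered C \<epsilon> k \<and> real k \<le> exp (B * (1 / \<epsilon>) powr (1 + d)))"
proof -
  define \<delta> where "\<delta> = d / 4"
  define t where "t = (1 + d / 4) / (1 + d)"
  have t: "0 < t" "t < 1" "(1 + \<delta>) / t = 1 + d" using d by (auto simp: t_def \<delta>_def field_simps)
  have \<delta>: "0 < \<delta>" using d by (simp add: \<delta>_def)
  obtain K where K: "0 < K" and r: "\<forall>n\<ge>1. \<forall>f\<in>C. infdist f (A n) \<le> K * real n powr - t" using rate[of t] t by auto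
  obtain n0 B where n0: "1 \<le> n0" and B: "0 \<le> B"
    and cov: "\<forall>n\<ge>n0. \<exists>k. covered (cball 0 2 \<inter> A n) (real n powr - 1) k \<and> real k \<le> exp (B * real n powr (1 + \<delta>))"
    using controlled_coverings[OF A _ _ \<delta>, of 1 2 0] by auto
  \<comment> \<open>Makes both \<open>n powr - t\<close> and \<open>K * n powr - t\<close> at most
    \<open>\<epsilon> / 8\<close>.\<close>
  define c where "c = 8 * (K + 1)"
  have c: "8 \<le> c" using K by (simp add: c_def)
  define e where "e = min 1 (c / real n0 powr t)"
  have e: "0 < e" "e \<le> 1" using c n0 by (auto simp: e_def)
  define B' where "B' = B * (2 powr (1 + \<delta>) * c powr (1 + d)) + 1"
  show ?thesis
  proof (rule exI[of _ B'], intro conjI, use B in \<open>simp add: B'_def add_nonneg_pos\<close>, rule exI[of _ e], intro conjI e allI impI)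
    fix \<epsilon> :: real assume eps: "0 < \<epsilon> \<and> \<epsilon> < e"
    define y where "y = (c / \<epsilon>) powr (1 / t)"
    have ce: "8 \<le> c / \<epsilon>" using c eps e by (simp add: le_divide_eq)
    have y1: "1 \<le> y" unfolding y_def using ce t by (intro ge_one_powr_ge_zero) auto
    have yn0: "real n0 \<le> y"
    proof -
      have "\<epsilon> \<le> c / real n0 powr t" using eps by (simp add: e_def)
      then have "real n0 powr t \<le> c / \<epsilon>" using eps n0 by (simp add: field_simps)
      then have "(real n0 powr t) powr (1 / t) \<le> y" unfolding y_def using t by (intro powr_mono2) auto
      then show ?thesis using t n0 by (simp add: powr_powr)
    qed
    define n where "n = nat \<lceil>y\<rceil>"
    have n: "y \<le> real n" "real n \<le> 2 * y" using y1 unfolding n_def by linarith+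
    have nn0: "n0 \<le> n" using n yn0 by linarith
    have n1: "1 \<le> real n" using n y1 by linarith
    have yt: "y powr t = c / \<epsilon>" unfolding y_def using t c eps by (simp add: powr_powr)
    have nt: "real n powr - t \<le> \<epsilon> / c"
    proof -
      have "c / \<epsilon> \<le> real n powr t" unfolding yt[symmetric] using n y1 t by (intro powr_mono2) auto
      moreover have "0 < c / \<epsilon>" using ce by linarith
      ultimately have "1 / real n powr t \<le> 1 / (c / \<epsilon>)" by (intro frac_le) linarith+
      then show ?thesis by (simp add: powr_minus_divide)
    qed
    have cK: "\<epsilon> / c \<le> \<epsilon> / 8" "K * (\<epsilon> / c) \<le> \<epsilon> / 8"
      using c eps K by (auto simp: c_def field_simps)
    have Kn: "K * real n powr - t \<le> \<epsilon> / 8" using mult_left_mono[OF nt, of K] K cK by linarith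
    have "real n powr - 1 \<le> real n powr - t" using n1 t by (intro powr_mono) auto
    then have n8: "real n powr - 1 \<le> \<epsilon> / 8" using nt cK by linarith
    have An: "A n \<noteq> {}" using A n0 nn0 unfolding controlled_complexity_def by auto
    obtain k where k: "covered (cball 0 2 \<inter> A n) (real n powr - 1) k" "real k \<le> exp (B * real n powr (1 + \<delta>))"
      using cov nn0 by blast
    obtain T where T: "finite T" "cball 0 2 \<inter> A n \<subseteq> (\<Union>x\<in>T. cball x (real n powr - 1))" "card T \<le> k"
      using k(1) unfolding covered_def by auto
    have "\<forall>f\<in>C. \<exists>x. x \<in> T \<and> dist x f \<le> 3 * \<epsilon> / 8"
    proof
      fix f assume f: "f \<in> C"
      have "infdist f (A n) < \<epsilon> / 4" using r[rule_format, of n f] f Kn eps n0 nn0 by auto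
      then obtain a where a: "a \<in> A n" "dist f a < \<epsilon> / 4" using infdist_obtain[OF An] by blast
      have "norm a \<le> norm f + dist f a" by (metis add.commute dist_commute dist_norm norm_triangle_sub)
      then have "a \<in> cball 0 2 \<inter> A n" using bd[OF f] a eps e by auto
      then obtain x where x: "x \<in> T" "dist x a \<le> real n powr - 1" using T(2) by auto
      have "dist x f \<le> dist x a + dist f a" by (rule dist_triangle2)
      then show "\<exists>x. x \<in> T \<and> dist x f \<le> 3 * \<epsilon> / 8" using x a n8 by (intro exI[of _ x]) auto
    qed
    from bchoice[OF this] obtain code where code: "\<forall>f\<in>C. code f \<in> T \<and> dist (code f) f \<le> 3 * \<epsilon> / 8" by (elim exE)
    have "covered C \<epsilon> (card T)"
    proof (rule covered_code[OF T(1), of code])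
      show "code ` C \<subseteq> T" using code by auto
      fix f f' assume ff: "f \<in> C" "f' \<in> C" "code f = code f'"
      then have "dist (code f) f \<le> 3 * \<epsilon> / 8" "dist (code f') f' \<le> 3 * \<epsilon> / 8" using code by auto
      then show "dist f f' \<le> \<epsilon>" using dist_triangle3[of f f' "code f"] ff(3) eps by simp
    qed
    moreover have "real (card T) \<le> exp (B' * (1 / \<epsilon>) powr (1 + d))"
    proof -
      have "real n powr (1 + \<delta>) \<le> (2 * y) powr (1 + \<delta>)" using n y1 \<delta> by (intro powr_mono2) auto
      also have "\<dots> = 2 powr (1 + \<delta>) * y powr (1 + \<delta>)" using y1 by (simp add: powr_mult)
      also have "y powr (1 + \<delta>) = (c / \<epsilon>) powr ((1 + \<delta>) / t)" unfolding y_def by (simp add: powr_powr)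
      also have "\<dots> = (c * (1 / \<epsilon>)) powr (1 + d)" unfolding t(3) by simp
      also have "\<dots> = c powr (1 + d) * (1 / \<epsilon>) powr (1 + d)" using c eps by (subst powr_mult) auto
      finally have "B * real n powr (1 + \<delta>) \<le> B * (2 powr (1 + \<delta>) * (c powr (1 + d) * (1 / \<epsilon>) powr (1 + d)))" using B by (rule mult_left_mono)
      also have "\<dots> \<le> B' * (1 / \<epsilon>) powr (1 + d)" by (simp add: B'_def algebra_simps)
      finally have "exp (B * real n powr (1 + \<delta>)) \<le> exp (B' * (1 / \<epsilon>) powr (1 + d))" by simp
      then show ?thesis using k(2) T(3) by linarith
    qed
    ultimately show "\<exists>k. covered C \<epsilon> k \<and> real k \<le> exp (B' * (1 / \<epsilon>) powr (1 + d))" by blast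
  qed
qed

lemma totally_bounded_of_covered:
  assumes e: "0 < e" and c: "\<And>\<epsilon>. 0 < \<epsilon> \<Longrightarrow> \<epsilon> < e \<Longrightarrow> \<exists>k. covered C \<epsilon> k"
  shows "totally_bounded C"
  unfolding totally_bounded_metric
proof (intro allI impI)
  fix r :: real assume r: "0 < r"
  define \<epsilon> where "\<epsilon> = min r e / 2"
  have "0 < \<epsilon>" "\<epsilon> < e" "\<epsilon> < r" using r e by (auto simp: \<epsilon>_def min_def)
  then obtain k where "covered C \<epsilon> k" using c by blast
  then obtain T where T: "finite T" "C \<subseteq> (\<Union>x\<in>T. cball x \<epsilon>)" unfolding covered_def by auto
  show "\<exists>k. finite k \<and> C \<subseteq> (\<Union>x\<in>k. {y. dist x y < r})"
    using T \<open>\<epsilon> < r\<close> by (intro exI[of _ T]) force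
qed

lemma covering_number_finite:
  assumes "covered C \<epsilon> k"
  shows "\<exists>k'\<le>k. covering_number C \<epsilon> = enat k'"
  using covering_number_le[OF assms] by (cases "covering_number C \<epsilon>") auto

lemma log2_exp_le: "real k \<le> exp x \<Longrightarrow> 0 \<le> x \<Longrightarrow> log 2 (real k) \<le> 2 * x"
proof -
  assume k: "real k \<le> exp x" and x: "0 \<le> x"
  show "log 2 (real k) \<le> 2 * x"
  proof (cases "k = 0")
    case True
    then show ?thesis using x by (simp add: log_def)
  next
    case False
    then have "ln (real k) \<le> x" using k by (metis ln_exp ln_le_cancel_iff exp_gt_zero of_nat_0_less_iff neq0_conv)
    moreover have "1/2 \<le> ln (2::real)" using exp_half_le2 by (subst ln_ge_iff) auto
    ultimately have "ln (real k) \<le> 2 * x * ln 2" using x mult_left_mono[of "1/2" "ln 2" "2 * x"] by simp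
    then show ?thesis by (simp add: log_def divide_le_eq)
  qed
qed

lemma loglog_le:
  assumes "log 2 (real k) \<le> A" "1 \<le> A"
  shows "log 2 (log 2 (real k)) \<le> log 2 A"
proof (cases "k \<le> 1")
  case True
  then have "k = 0 \<or> k = 1" by auto
  \<comment> \<open>Default values: \<open>ln 0 = 0\<close>, so the double logarithm is 0 for
    \<open>k = 0\<close> and for \<open>k = 1\<close>.\<close>
  then have "log 2 (log 2 (real k)) = 0" by (auto simp: log_def)
  then show ?thesis using assms(2) by simp
next
  case False
  then have "0 < log 2 (real k)" by simp
  then show ?thesis using assms by simp
qed

text \<open>After two logarithms the constant contributes only \<open>log 2 B'\<close>, which is at
  most \<open>d * log 2 (1 / \<epsilon>)\<close> for small \<open>\<epsilon>\<close>. Half of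
  \<open>d2\<close> pays for the exponent and half for the constant.\<close>

lemma upper_pe_dim_le_1:
  assumes H: "\<And>d::real. 0 < d \<Longrightarrow> \<exists>B>0. \<exists>e>0. \<forall>\<epsilon>. 0 < \<epsilon> \<and> \<epsilon> < e \<longrightarrow> (\<exists>k. covered C \<epsilon> k \<and> real k \<le> exp (B * (1 / \<epsilon>) powr (1 + d)))"
  shows "totally_bounded C" "upper_pe_dim C \<le> 1"
proof -
  obtain B e where "0 < (e::real)" and "\<forall>\<epsilon>. 0 < \<epsilon> \<and> \<epsilon> < e \<longrightarrow> (\<exists>k. covered C \<epsilon> k \<and> real k \<le> exp (B * (1 / \<epsilon>) powr (1 + 1)))"
    using H[of 1] by auto
  then show tb: "totally_bounded C" by (intro totally_bounded_of_covered[of e]) auto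
  have "Limsup (at_right 0) (pe_quotient C) \<le> 1 + ereal d2" if d2: "0 < d2" for d2
  proof (rule Limsup_bounded)
    define d where "d = d2 / 2"
    have d: "0 < d" using d2 by (simp add: d_def)
    obtain B e where B: "0 < B" and e: "0 < e" and cov: "\<forall>\<epsilon>. 0 < \<epsilon> \<and> \<epsilon> < e \<longrightarrow> (\<exists>k. covered C \<epsilon> k \<and> real k \<le> exp (B * (1 / \<epsilon>) powr (1 + d)))"
      using H[OF d] by auto
    define B' where "B' = 2 * B + 1"
    define e' where "e' = min (min e (1/2)) (2 powr - (log 2 B' / d))"
    have e': "0 < e'" using e by (simp add: e'_def)
    have "pe_quotient C \<epsilon> \<le> 1 + ereal d2" if eps: "0 < \<epsilon>" "\<epsilon> < e'" for \<epsilon>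
    proof -
      obtain k where k: "covered C \<epsilon> k" "real k \<le> exp (B * (1 / \<epsilon>) powr (1 + d))" using cov eps by (auto simp: e'_def)
      obtain k' where k': "k' \<le> k" "covering_number C \<epsilon> = enat k'" using covering_number_finite[OF k(1)] by auto
      define L where "L = log 2 (1 / \<epsilon>)"
      have e2: "2 \<le> 1 / \<epsilon>" using eps by (simp add: e'_def field_simps)
      have L1: "1 \<le> L" unfolding L_def using e2 eps by (simp add: le_log_iff)
      have LB: "log 2 B' \<le> d * L"
      proof -
        have "\<epsilon> \<le> 2 powr - (log 2 B' / d)" using eps by (simp add: e'_def)
        then have "log 2 \<epsilon> \<le> - (log 2 B' / d)" using eps by (simp add: log_le_iff)
        then have "log 2 B' / d \<le> L" unfolding L_def using eps by (simp add: log_divide)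
        then show ?thesis using d by (simp add: field_simps)
      qed
      have p1: "1 \<le> (1 / \<epsilon>) powr (1 + d)" using e2 d by (intro ge_one_powr_ge_zero) auto
      have "real k' \<le> exp (B * (1 / \<epsilon>) powr (1 + d))" using k k' by linarith
      then have "log 2 (real k') \<le> 2 * (B * (1 / \<epsilon>) powr (1 + d))" using B by (intro log2_exp_le) auto
      also have "\<dots> \<le> B' * (1 / \<epsilon>) powr (1 + d)" by (simp add: B'_def algebra_simps)
      finally have 1: "log 2 (real k') \<le> B' * (1 / \<epsilon>) powr (1 + d)" .
      have "1 * 1 \<le> B' * (1 / \<epsilon>) powr (1 + d)" using B p1 by (intro mult_mono) (auto simp: B'_def)
      then have "log 2 (log 2 (real k')) \<le> log 2 (B' * (1 / \<epsilon>) powr (1 + d))" using loglog_le[OF 1] by simp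
      also have "\<dots> = log 2 B' + (1 + d) * L"
      proof -
        have "log 2 (B' * (1 / \<epsilon>) powr (1 + d)) = log 2 B' + log 2 ((1 / \<epsilon>) powr (1 + d))"
          using B eps by (subst log_mult_pos) (auto simp: B'_def)
        then show ?thesis using eps unfolding L_def by (simp add: log_powr)
      qed
      also have "\<dots> \<le> (1 + d2) * L" using LB by (simp add: d_def algebra_simps)
      finally have "log 2 (log 2 (real k')) / L \<le> 1 + d2" using L1 by (simp add: divide_le_eq)
      then show ?thesis unfolding pe_quotient_def k' L_def by (simp add: one_ereal_def)
    qed
    then show "\<forall>\<^sub>F \<epsilon> in at_right 0. pe_quotient C \<epsilon> \<le> 1 + ereal d2"
      unfolding eventually_at_right_field using e' by blast
  qed
  then have "Limsup (at_right 0) (pe_quotient C) \<le> 1" by (rule ereal_le_epsilon2[rule_format])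
  then show "upper_pe_dim C \<le> 1" using tb by (simp add: upper_pe_dim_def)
qed

section \<open>Mass distribution: ball estimates against coverings\<close>

lemma outer_measure_le_sum:
  fixes M :: "'a::metric_space measure"
  assumes M: "sets M = sets borel" and T: "finite T" "C \<subseteq> (\<Union>x\<in>T. cball x r)"
    and b: "\<And>x. outer_measure_of M (cball x r) \<le> ennreal b" "0 \<le> b"
  shows "outer_measure_of M C \<le> ennreal (real (card T) * b)"
proof -
  have s: "cball x r \<in> sets M" for x :: 'a unfolding M by simp
  have "outer_measure_of M C \<le> outer_measure_of M (\<Union>x\<in>T. cball x r)" by (rule outer_measure_of_mono[OF T(2)])
  also have "\<dots> = emeasure M (\<Union>x\<in>T. cball x r)" using T(1) s by (intro outer_measure_of_eq) auto
  also have "\<dots> \<le> (\<Sum>x\<in>T. emeasure M (cball x r))" using T(1) s by (intro emeasure_subadditive_finite) auto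
  also have "\<dots> \<le> (\<Sum>x\<in>T. ennreal b)" using b s by (intro sum_mono) auto
  also have "\<dots> = ennreal (real (card T) * b)" using b(2) by (simp add: ennreal_mult ennreal_of_nat_eq_real_of_nat)
  finally show ?thesis .
qed

text \<open>Mass distribution principle: a covering by \<open>k'\<close> balls of radius
  \<open>\<epsilon>\<close> forces \<open>m \<le> k' * exp (- c * (1 / \<epsilon>) powr s)\<close>
  for the positive mass \<open>m\<close>, so the logarithm of \<open>k'\<close> is at least of order
  \<open>(1 / \<epsilon>) powr s\<close>, for every \<open>s < 1\<close>.\<close>

lemma lower_pe_dim_ge_1:
  fixes M :: "l2 measure"
  assumes P: "borel_prob_measure M" and pos: "outer_measure_of M C > 0"
    and small: "\<And>s. 0 < s \<Longrightarrow> s < 1 \<Longrightarrow> \<exists>c>0. \<exists>r0>0. \<forall>x. \<forall>\<rho>::real. 0 < \<rho> \<and> \<rho> < r0 \<longrightarrow>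
           outer_measure_of M (cball x \<rho>) \<le> ennreal (exp (- c * (1 / \<rho>) powr s))"
    and cov: "\<exists>e>0. \<forall>\<epsilon>. 0 < \<epsilon> \<and> \<epsilon> < e \<longrightarrow> (\<exists>k. covered C \<epsilon> k)"
  shows "1 \<le> lower_pe_dim C"
proof -
  obtain e where e: "0 < e" and cov: "\<forall>\<epsilon>. 0 < \<epsilon> \<and> \<epsilon> < e \<longrightarrow> (\<exists>k. covered C \<epsilon> k)" using cov by auto
  have M: "sets M = sets borel" "prob_space M" using P by (auto simp: borel_prob_measure_def)
  interpret prob_space M by (rule M)
  have sp: "space M = UNIV" using sets_eq_imp_space_eq[OF M(1)] by simp
  have "outer_measure_of M C \<le> outer_measure_of M (space M)" by (rule outer_measure_of_mono) (simp add: sp)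
  also have "\<dots> = 1" by (simp add: emeasure_space_1)
  finally have le1: "outer_measure_of M C \<le> 1" .
  then obtain m where m: "outer_measure_of M C = ennreal m" "0 \<le> m" by (cases "outer_measure_of M C") (auto simp: top_unique)
  have m0: "0 < m" using pos m by (simp add: less_le)
  have "1 \<le> Liminf (at_right 0) (pe_quotient C) + ereal d" if d: "0 < d" for d
  proof (cases "d \<ge> 1")
    case True
    have "0 \<le> Liminf (at_right 0) (pe_quotient C)"
    proof (rule Liminf_bounded)
      have "0 \<le> pe_quotient C \<epsilon>" if eps: "0 < \<epsilon>" "\<epsilon> < min e 1" for \<epsilon>
      proof -
        obtain k where k: "covered C \<epsilon> k" using cov eps by auto
        obtain k' where k': "covering_number C \<epsilon> = enat k'" using covering_number_finite[OF k] by auto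
        have "0 \<le> log 2 (log 2 (real k'))"
        proof (cases "k' \<le> 1")
          case True
          then have "k' = 0 \<or> k' = 1" by auto
          then show ?thesis by (auto simp: log_def)
        next
          case False
          then have "1 \<le> log 2 (real k')" by (simp add: le_log_iff)
          then show ?thesis by simp
        qed
        moreover have "0 \<le> log 2 (1 / \<epsilon>)" using eps by simp
        ultimately show ?thesis unfolding pe_quotient_def k' by simp
      qed
      then show "\<forall>\<^sub>F \<epsilon> in at_right 0. 0 \<le> pe_quotient C \<epsilon>"
        unfolding eventually_at_right_field using e by (intro exI[of _ "min e 1"]) auto
    qed
    moreover have "1 \<le> ereal d" using True by (simp add: one_ereal_def)
    ultimately show ?thesis by (metis add.left_neutral add_mono)
  next
    case False
    \<comment> \<open>Half of \<open>d\<close> is spent on the exponent and half on the factor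
      \<open>c / 2\<close>. As \<open>d < 1\<close> here, \<open>s\<close> lies strictly between 0
      and 1; for larger \<open>d\<close> nonnegativity of the quotient was enough.\<close>
    define s where "s = 1 - d / 2"
    have s: "0 < s" "s < 1" using d False by (auto simp: s_def)
    obtain c r0 where c: "0 < c" and r0: "0 < r0" and sm: "\<forall>x. \<forall>\<rho>::real. 0 < \<rho> \<and> \<rho> < r0 \<longrightarrow>
           outer_measure_of M (cball x \<rho>) \<le> ennreal (exp (- c * (1 / \<rho>) powr s))" using small[OF s] by auto
    define Y where "Y = max 1 (2 * \<bar>ln m\<bar> / c)"
    define Z where "Z = \<bar>log 2 (c / 2)\<bar> * (2 / d) + 1"
    have Z: "1 \<le> Z" using d by (simp add: Z_def)
    define e' where "e' = min (min (min e r0) (1 / Y powr (1 / s))) (2 powr - Z)"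
    have Y: "1 \<le> Y" by (simp add: Y_def)
    have e': "0 < e'" using e r0 Y by (simp add: e'_def)
    have "ereal (1 - d) \<le> Liminf (at_right 0) (pe_quotient C)"
    proof (rule Liminf_bounded)
      have "ereal (1 - d) \<le> pe_quotient C \<epsilon>" if eps: "0 < \<epsilon>" "\<epsilon> < e'" for \<epsilon>
      proof -
        obtain k where k: "covered C \<epsilon> k" using cov eps by (auto simp: e'_def)
        obtain k' where k': "covering_number C \<epsilon> = enat k'" using covering_number_finite[OF k] by auto
        obtain T where T: "finite T" "C \<subseteq> (\<Union>x\<in>T. cball x \<epsilon>)" "card T \<le> k'"
          using covered_of_covering_number[OF k'] unfolding covered_def by auto
        define w where "w = (1 / \<epsilon>) powr s"
        have "outer_measure_of M (cball x \<epsilon>) \<le> ennreal (exp (- c * w))" for x using sm eps unfolding w_def by (simp add: e'_def)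
        then have "outer_measure_of M C \<le> ennreal (real (card T) * exp (- c * w))"
          by (intro outer_measure_le_sum[OF M(1) T(1,2)]) auto
        then have "m \<le> real (card T) * exp (- c * w)" unfolding m(1) by simp
        also have "\<dots> \<le> real k' * exp (- c * w)" using T(3) by (intro mult_right_mono) auto
        finally have mk: "m * exp (c * w) \<le> real k'" by (simp add: exp_minus field_simps)
        have "0 < m * exp (c * w)" using m0 by simp
        then have k0: "0 < real k'" using mk by linarith
        have "ln (m * exp (c * w)) \<le> ln (real k')" using mk m0 k0 by simp
        then have lnk: "ln m + c * w \<le> ln (real k')" using m0 by (simp add: ln_mult)
        have wY: "Y \<le> w"
        proof -
          have "\<epsilon> \<le> 1 / Y powr (1 / s)" using eps by (simp add: e'_def)
          then have "Y powr (1 / s) \<le> 1 / \<epsilon>" using eps Y by (simp add: field_simps)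
          then have "(Y powr (1 / s)) powr s \<le> w" unfolding w_def using s by (intro powr_mono2) auto
          then show ?thesis using s Y by (simp add: powr_powr)
        qed
        have "2 * \<bar>ln m\<bar> / c \<le> w" using wY by (simp add: Y_def)
        then have "\<bar>ln m\<bar> \<le> c / 2 * w" using c by (simp add: field_simps)
        then have h: "c / 2 * w \<le> ln (real k')" using lnk by (simp add: field_simps)
        have cw: "0 < c / 2 * w" using c wY Y by simp
        have "ln (real k') \<le> log 2 (real k')"
        proof -
          have "ln (2::real) \<le> 1" using ln_le_minus_one[of "2::real"] by simp
          moreover have "0 \<le> ln (real k')" using h cw by linarith
          ultimately show ?thesis unfolding log_def using mult_left_mono[of "ln 2" 1 "ln (real k')"]
            by (simp add: le_divide_eq)
        qed
        then have "c / 2 * w \<le> log 2 (real k')" using h by linarith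
        then have "log 2 (c / 2 * w) \<le> log 2 (log 2 (real k'))" using cw by simp
        moreover have "log 2 (c / 2 * w) = log 2 (c / 2) + log 2 w"
          using c wY Y by (intro log_mult_pos) auto
        moreover have "log 2 w = s * log 2 (1 / \<epsilon>)" unfolding w_def using eps by (simp add: log_powr)
        moreover define L where "L = log 2 (1 / \<epsilon>)"
        ultimately have ll: "log 2 (c / 2) + s * L \<le> log 2 (log 2 (real k'))" by simp
        have "\<epsilon> \<le> 2 powr - Z" using eps by (simp add: e'_def)
        then have "log 2 \<epsilon> \<le> - Z" using eps by (simp add: log_le_iff)
        then have LZ: "Z \<le> L" unfolding L_def using eps by (simp add: log_divide)
        have "\<bar>log 2 (c / 2)\<bar> * (2 / d) \<le> L" using LZ by (simp add: Z_def)
        then have "\<bar>log 2 (c / 2)\<bar> \<le> d / 2 * L" using d by (simp add: field_simps)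
        then have "(1 - d) * L \<le> log 2 (log 2 (real k'))" using ll by (simp add: s_def algebra_simps)
        then have "1 - d \<le> log 2 (log 2 (real k')) / L" using LZ Z by (simp add: le_divide_eq)
        then show ?thesis unfolding pe_quotient_def k' L_def by simp
      qed
      then show "\<forall>\<^sub>F \<epsilon> in at_right 0. ereal (1 - d) \<le> pe_quotient C \<epsilon>"
        unfolding eventually_at_right_field using e' by blast
    qed
    then have "ereal (1 - d) + ereal d \<le> Liminf (at_right 0) (pe_quotient C) + ereal d" by (rule add_right_mono)
    then show ?thesis by (simp add: one_ereal_def)
  qed
  then have "1 \<le> Liminf (at_right 0) (pe_quotient C)" by (rule ereal_le_epsilon2[rule_format])
  then show ?thesis by (simp add: lower_pe_dim_def)
qed

text \<open>Each outer null set has a measurable null hull, and a countable union of hulls is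
  null.\<close>

lemma outer_null_UN:
  assumes sp: "space M = UNIV" and "countable I" and z: "\<And>i. i \<in> I \<Longrightarrow> outer_measure_of M (S i) = 0" and sub: "D \<subseteq> (\<Union>i\<in>I. S i)"
  shows "outer_measure_of M D = 0"
proof -
  have "\<forall>i\<in>I. \<exists>E. E \<in> null_sets M \<and> S i \<subseteq> E"
  proof
    fix i assume i: "i \<in> I"
    obtain E where "E \<in> sets M" "S i \<subseteq> E" "outer_measure_of M (S i) = emeasure M E"
      using outer_measure_of_attain[of "S i" M] sp by auto
    then show "\<exists>E. E \<in> null_sets M \<and> S i \<subseteq> E" using z[OF i] by (intro exI[of _ E]) auto
  qed
  from bchoice[OF this] obtain E where E: "\<forall>i\<in>I. E i \<in> null_sets M \<and> S i \<subseteq> E i" by (elim exE)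
  have n: "(\<Union>i\<in>I. E i) \<in> null_sets M" using assms(2) E by (intro null_sets_UN') auto
  have "outer_measure_of M D \<le> outer_measure_of M (\<Union>i\<in>I. E i)"
    using sub E by (intro outer_measure_of_mono) blast
  also have "\<dots> = 0" using n by (subst outer_measure_of_eq) auto
  finally show ?thesis by simp
qed

text \<open>With \<open>t * s = 1 + 2 * \<delta>\<close> the set is covered by
  \<open>exp (B * n powr (1 + \<delta>))\<close> balls of measure at most
  \<open>exp (- c' * n powr (1 + 2 * \<delta>))\<close>. A single sufficiently large
  \<open>n\<close> already contradicts a positive outer measure.\<close>

lemma fast_approximation_null:
  fixes M :: "l2 measure"
  assumes P: "borel_prob_measure M"
    and small: "\<And>s. 0 < s \<Longrightarrow> s < 1 \<Longrightarrow> \<exists>c>0. \<exists>r0>0. \<forall>x. \<forall>\<rho>::real. 0 < \<rho> \<and> \<rho> < r0 \<longrightarrow>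
           outer_measure_of M (cball x \<rho>) \<le> ennreal (exp (- c * (1 / \<rho>) powr s))"
    and bd: "\<And>f. f \<in> C \<Longrightarrow> norm f \<le> 1" and A: "controlled_complexity A" and t: "1 < (t::real)" and K: "0 \<le> K"
  shows "outer_measure_of M {f \<in> C. \<forall>n\<ge>1. real n powr t * infdist f (A n) \<le> K} = 0"
proof (rule ccontr)
  define S where "S = {f \<in> C. \<forall>n\<ge>1. real n powr t * infdist f (A n) \<le> K}"
  assume "outer_measure_of M {f \<in> C. \<forall>n\<ge>1. real n powr t * infdist f (A n) \<le> K} \<noteq> 0"
  then have ne: "outer_measure_of M S \<noteq> 0" by (simp only: S_def simp_thms)
  have M: "sets M = sets borel" "prob_space M" using P by (auto simp: borel_prob_measure_def)
  interpret prob_space M by (rule M)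
  have sp: "space M = UNIV" using sets_eq_imp_space_eq[OF M(1)] by simp
  have "outer_measure_of M S \<le> outer_measure_of M (space M)" by (rule outer_measure_of_mono) (simp add: sp)
  also have "\<dots> = 1" by (simp add: emeasure_space_1)
  finally have le1: "outer_measure_of M S \<le> 1" .
  then obtain m where m: "outer_measure_of M S = ennreal m" "0 \<le> m" by (cases "outer_measure_of M S") (auto simp: top_unique)
  have m0: "0 < m" using ne m by (simp add: less_le)
  define \<delta> where "\<delta> = (t - 1) / 4"
  define s where "s = (1 + t) / (2 * t)"
  have \<delta>: "0 < \<delta>" using t by (simp add: \<delta>_def)
  have s: "0 < s" "s < 1" "t * s = 1 + \<delta> + \<delta>" using t by (auto simp: s_def \<delta>_def field_simps)
  obtain c r0 where c: "0 < c" and r0: "0 < r0" and sm: "\<forall>x. \<forall>\<rho>::real. 0 < \<rho> \<and> \<rho> < r0 \<longrightarrow>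
           outer_measure_of M (cball x \<rho>) \<le> ennreal (exp (- c * (1 / \<rho>) powr s))" using small[OF s(1,2)] by auto
  obtain n0 B where n0: "1 \<le> n0" and B: "0 \<le> B"
    and cov: "\<forall>n\<ge>n0. \<exists>k. covered (cball 0 (K + 2) \<inter> A n) (real n powr - t) k \<and> real k \<le> exp (B * real n powr (1 + \<delta>))"
    using controlled_coverings[OF A _ _ \<delta>, of t "K + 2" 0] t K by auto
  define c' where "c' = c / (K + 2) powr s"
  have c': "0 < c'" using c K by (simp add: c'_def)
  \<comment> \<open>The thresholds in order: the coverings are available, the ball term beats the
    entropy term by at least \<open>n\<close>, the radius is below \<open>r0\<close>, and
    \<open>exp (- n)\<close> is below the mass \<open>m\<close>.\<close>
  define X where "X = Max {real n0, ((B + 1) / c') powr (1 / \<delta>), ((K + 2) / r0) powr (1 / t) + 1, \<bar>ln m\<bar> + 1, 1}"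
  have X: "real n0 \<le> X" "((B + 1) / c') powr (1 / \<delta>) \<le> X" "((K + 2) / r0) powr (1 / t) + 1 \<le> X" "\<bar>ln m\<bar> + 1 \<le> X" "1 \<le> X"
    unfolding X_def by (intro Max_ge, simp, simp)+
  define n where "n = nat \<lceil>X\<rceil>"
  have n: "X \<le> real n" unfolding n_def using X(5) by linarith
  have n0n: "n0 \<le> n" "1 \<le> n" using n X n0 by linarith+
  have n1: "1 \<le> real n" using n0n by simp
  define \<rho> where "\<rho> = (K + 2) * real n powr - t"
  have \<rho>: "0 < \<rho>" "\<rho> < r0"
  proof -
    show "0 < \<rho>" using K n1 by (simp add: \<rho>_def)
    have "((K + 2) / r0) powr (1 / t) < real n" using X(3) n by linarith
    then have "(((K + 2) / r0) powr (1 / t)) powr t < real n powr t" using t by (intro powr_less_mono2) auto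
    moreover have "(((K + 2) / r0) powr (1 / t)) powr t = (K + 2) / r0" using t K r0 by (simp add: powr_powr)
    ultimately have "(K + 2) / r0 < real n powr t" by simp
    then have "K + 2 < r0 * real n powr t" using r0 by (simp add: field_simps)
    then show "\<rho> < r0" unfolding \<rho>_def using n1 by (simp add: powr_minus_divide divide_less_eq)
  qed
  have An: "A n \<noteq> {}" using A n0n unfolding controlled_complexity_def by auto
  obtain k where k: "covered (cball 0 (K + 2) \<inter> A n) (real n powr - t) k" "real k \<le> exp (B * real n powr (1 + \<delta>))"
    using cov n0n by blast
  obtain T where T: "finite T" "cball 0 (K + 2) \<inter> A n \<subseteq> (\<Union>x\<in>T. cball x (real n powr - t))" "card T \<le> k"
    using k(1) unfolding covered_def by auto
  have pn: "0 < real n powr - t" "real n powr - t \<le> 1" using n1 t powr_mono[of "- t" 0 "real n"] by auto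
  have "S \<subseteq> (\<Union>x\<in>T. cball x \<rho>)"
  proof
    fix f assume f: "f \<in> S"
    then have "real n powr t * infdist f (A n) \<le> K" using n0n by (auto simp: S_def)
    then have "infdist f (A n) \<le> K * real n powr - t" using n1 by (simp add: powr_minus_divide field_simps)
    also have "\<dots> < (K + 1) * real n powr - t" using pn by (intro mult_strict_right_mono) auto
    finally obtain a where a: "a \<in> A n" "dist f a < (K + 1) * real n powr - t" using infdist_obtain[OF An] by blast
    have "(K + 1) * real n powr - t \<le> K + 1" using mult_left_mono[OF pn(2), of "K + 1"] K by simp
    moreover have "norm a \<le> norm f + dist f a" by (metis add.commute dist_commute dist_norm norm_triangle_sub)
    moreover have "norm f \<le> 1" using f bd by (auto simp: S_def)
    ultimately have "norm a \<le> K + 2" using a(2) by linarith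
    then have "a \<in> cball 0 (K + 2) \<inter> A n" using a by auto
    then obtain x where x: "x \<in> T" "dist x a \<le> real n powr - t" using T(2) by auto
    have "dist x f \<le> dist x a + dist f a" by (rule dist_triangle2)
    also have "\<dots> \<le> \<rho>" using x(2) a(2) unfolding \<rho>_def by (simp add: algebra_simps)
    finally show "f \<in> (\<Union>x\<in>T. cball x \<rho>)" using x(1) by auto
  qed
  then have "outer_measure_of M S \<le> ennreal (real (card T) * exp (- c * (1 / \<rho>) powr s))"
    using sm \<rho> by (intro outer_measure_le_sum[OF M(1) T(1)]) auto
  then have "m \<le> real (card T) * exp (- c * (1 / \<rho>) powr s)" unfolding m(1) by simp
  also have "\<dots> \<le> exp (B * real n powr (1 + \<delta>)) * exp (- c * (1 / \<rho>) powr s)"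
    using T(3) k(2) by (intro mult_right_mono) auto
  also have "\<dots> = exp (B * real n powr (1 + \<delta>) - c * (1 / \<rho>) powr s)" by (simp add: exp_diff exp_minus field_simps)
  finally have mle: "m \<le> exp (B * real n powr (1 + \<delta>) - c * (1 / \<rho>) powr s)" .
  have 1: "c * (1 / \<rho>) powr s = c' * real n powr (1 + \<delta> + \<delta>)"
  proof -
    have "1 / \<rho> = real n powr t / (K + 2)" using n1 K unfolding \<rho>_def by (simp add: powr_minus_divide)
    then have "(1 / \<rho>) powr s = (real n powr t) powr s / (K + 2) powr s" using K by (simp add: powr_divide)
    then show ?thesis unfolding c'_def s(3)[symmetric] by (simp add: powr_powr)
  qed
  have 2: "real n powr (1 + \<delta> + \<delta>) = real n powr (1 + \<delta>) * real n powr \<delta>" by (rule powr_add)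
  have "B * real n powr (1 + \<delta>) - c * (1 / \<rho>) powr s \<le> - real n"
  proof -
    have "(((B + 1) / c') powr (1 / \<delta>)) powr \<delta> \<le> real n powr \<delta>" using X(2) n \<delta> by (intro powr_mono2) auto
    moreover have "(((B + 1) / c') powr (1 / \<delta>)) powr \<delta> = (B + 1) / c'" using B c' \<delta> by (simp add: powr_powr)
    ultimately have "B + 1 \<le> c' * real n powr \<delta>" using c' by (simp add: field_simps)
    then have "real n powr (1 + \<delta>) * (B - c' * real n powr \<delta>) \<le> real n powr (1 + \<delta>) * (- 1)" by (intro mult_left_mono) auto
    moreover have "real n powr 1 \<le> real n powr (1 + \<delta>)" using n1 \<delta> by (intro powr_mono) auto
    moreover have "real n powr 1 = real n" by simp
    ultimately show ?thesis unfolding 1 2 by (simp add: algebra_simps)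
  qed
  then have "m \<le> exp (- real n)" using mle by (meson exp_le_cancel_iff order_trans)
  then have "ln m \<le> ln (exp (- real n))" using m0 by (subst ln_le_cancel_iff) auto
  then show False using X(4) n by simp
qed

text \<open>The uncountable union becomes countable: the condition for \<open>t\<close> implies the
  one for any smaller exponent \<open>1 + 1 / (j + 1)\<close>, and the bound is rounded up to a
  natural number.\<close>

lemma fast_approximation_union_null:
  fixes M :: "l2 measure"
  assumes P: "borel_prob_measure M"
    and small: "\<And>s. 0 < s \<Longrightarrow> s < 1 \<Longrightarrow> \<exists>c>0. \<exists>r0>0. \<forall>x. \<forall>\<rho>::real. 0 < \<rho> \<and> \<rho> < r0 \<longrightarrow>
           outer_measure_of M (cball x \<rho>) \<le> ennreal (exp (- c * (1 / \<rho>) powr s))"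
    and bd: "\<And>f. f \<in> C \<Longrightarrow> norm f \<le> 1" and A: "controlled_complexity A"
  shows "outer_measure_of M (\<Union>t\<in>{1<..}. {f\<in>C. bdd_above ((\<lambda>n. real n powr t * infdist f (A n)) ` {1..})}) = 0"
proof (rule outer_null_UN)
  let ?S = "\<lambda>(j, K). {f \<in> C. \<forall>n\<ge>1. real n powr (1 + inverse (real (Suc j))) * infdist f (A n) \<le> real K}"
  show "space M = UNIV" using P sets_eq_imp_space_eq[of M borel] by (auto simp: borel_prob_measure_def)
  show "countable (UNIV :: (nat \<times> nat) set)" by simp
  show "outer_measure_of M (?S p) = 0" for p
  proof (cases p)
    case (Pair j K)
    show ?thesis unfolding Pair prod.case by (rule fast_approximation_null[OF P small bd A]) auto
  qed
  show "(\<Union>t\<in>{1<..}. {f\<in>C. bdd_above ((\<lambda>n. real n powr t * infdist f (A n)) ` {1..})}) \<subseteq> (\<Union>p\<in>UNIV. ?S p)"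
  proof
    fix f assume "f \<in> (\<Union>t\<in>{1<..}. {f\<in>C. bdd_above ((\<lambda>n. real n powr t * infdist f (A n)) ` {1..})})"
    then obtain t where t: "1 < t" "f \<in> C" "bdd_above ((\<lambda>n. real n powr t * infdist f (A n)) ` {1..})" by auto
    then obtain b where b: "\<And>n. 1 \<le> n \<Longrightarrow> real n powr t * infdist f (A n) \<le> b" unfolding bdd_above_def by auto
    obtain j where j: "inverse (real (Suc j)) < t - 1" using reals_Archimedean[of "t - 1"] t by auto
    obtain K where K: "b \<le> real K" using real_arch_simple by blast
    have "real n powr (1 + inverse (real (Suc j))) * infdist f (A n) \<le> real K" if n: "1 \<le> n" for n
    proof -
      have "real n powr (1 + inverse (real (Suc j))) * infdist f (A n) \<le> real n powr t * infdist f (A n)"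
        using j n by (intro mult_right_mono powr_mono infdist_nonneg) auto
      then show ?thesis using b[OF n] K by linarith
    qed
    then have "f \<in> ?S (j, K)" using t(2) by simp
    then show "f \<in> (\<Union>p\<in>UNIV. ?S p)" by blast
  qed
qed

section \<open>Random radius functions\<close>

text \<open>The coefficient jumps only where \<open>N * x / (2 * pi)\<close> is an integer. These
  points are zeros of \<open>sin (N * x / 2)\<close>, where \<open>F\<close> tends to 0, so that the
  jump is invisible in the product.\<close>

lemma floor_step_tendsto:
  fixes F :: "real \<Rightarrow> real" and \<beta> :: "int \<Rightarrow> real"
  assumes \<beta>: "\<And>k. \<bar>\<beta> k\<bar> \<le> 1" and F: "(F \<longlongrightarrow> l) (at x)" and zero: "sin (N * x / 2) = 0 \<Longrightarrow> l = 0"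
  shows "((\<lambda>y. \<beta> \<lfloor>N * y / (2 * pi)\<rfloor> * F y) \<longlongrightarrow> \<beta> \<lfloor>N * x / (2 * pi)\<rfloor> * l) (at x)"
proof (cases "N * x / (2 * pi) \<in> \<int>")
  case True
  then obtain k where "N * x / (2 * pi) = of_int k" by (elim Ints_cases)
  then have "N * x / 2 = of_int k * pi" by (simp add: field_simps)
  then have l: "l = 0" using zero by (simp add: sin_zero_iff_int2)
  have "((\<lambda>y. \<beta> \<lfloor>N * y / (2 * pi)\<rfloor> * F y) \<longlongrightarrow> 0) (at x)"
  proof (rule Lim_null_comparison)
    show "\<forall>\<^sub>F y in at x. norm (\<beta> \<lfloor>N * y / (2 * pi)\<rfloor> * F y) \<le> \<bar>F y\<bar>"
      using mult_right_mono[OF \<beta> abs_ge_zero] by (auto simp: abs_mult)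
    show "((\<lambda>y. \<bar>F y\<bar>) \<longlongrightarrow> 0) (at x)" using F l tendsto_rabs_zero by blast
  qed
  then show ?thesis using l by simp
next
  case False
  have "((\<lambda>y. N * y / (2 * pi)) \<longlongrightarrow> N * x / (2 * pi)) (at x)" by (intro tendsto_intros) auto
  from eventually_floor_eq[OF this False]
  have "\<forall>\<^sub>F y in at x. \<beta> \<lfloor>N * x / (2 * pi)\<rfloor> * F y = \<beta> \<lfloor>N * y / (2 * pi)\<rfloor> * F y"
    by (rule eventually_mono) simp
  then show ?thesis by (rule Lim_transform_eventually[rotated]) (intro tendsto_intros F)
qed

lemma floor_step_deriv:
  fixes F D :: "real \<Rightarrow> real" and \<beta> :: "int \<Rightarrow> real"
  assumes \<beta>: "\<And>k. \<bar>\<beta> k\<bar> \<le> 1" and F: "(F has_real_derivative D x) (at x)"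
    and zero: "sin (N * x / 2) = 0 \<Longrightarrow> F x = 0 \<and> D x = 0"
  shows "((\<lambda>y. \<beta> \<lfloor>N * y / (2 * pi)\<rfloor> * F y) has_real_derivative \<beta> \<lfloor>N * x / (2 * pi)\<rfloor> * D x) (at x)"
proof -
  have "((\<lambda>y. \<beta> \<lfloor>N * y / (2 * pi)\<rfloor> * ((F y - F x) / (y - x))) \<longlongrightarrow> \<beta> \<lfloor>N * x / (2 * pi)\<rfloor> * D x) (at x)"
    using F zero by (intro floor_step_tendsto \<beta>) (auto simp: has_field_derivative_iff)
  moreover have "\<forall>\<^sub>F y in at x. \<beta> \<lfloor>N * y / (2 * pi)\<rfloor> * ((F y - F x) / (y - x))
      = (\<beta> \<lfloor>N * y / (2 * pi)\<rfloor> * F y - \<beta> \<lfloor>N * x / (2 * pi)\<rfloor> * F x) / (y - x)"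
  proof (cases "N * x / (2 * pi) \<in> \<int>")
    case True
    then obtain k where "N * x / (2 * pi) = of_int k" by (elim Ints_cases)
    then have "N * x / 2 = of_int k * pi" by (simp add: field_simps)
    then have "F x = 0" using zero by (simp add: sin_zero_iff_int2)
    then show ?thesis by simp
  next
    case False
    have "((\<lambda>y. N * y / (2 * pi)) \<longlongrightarrow> N * x / (2 * pi)) (at x)" by (intro tendsto_intros) auto
    from eventually_floor_eq[OF this False] show ?thesis
      by (rule eventually_mono) (simp add: algebra_simps diff_divide_distrib)
  qed
  ultimately show ?thesis unfolding has_field_derivative_iff by (rule Lim_transform_eventually)
qed

text \<open>Telescoping, with total sum 1 and tails \<open>1 / (n + 1)\<close>: the total will bound
  the second derivative of the radius, and the tail is explicit.\<close>

definition weight :: "nat \<Rightarrow> real" where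
  "weight i = 1 / (real i + 1) - 1 / (real i + 2)"

lemma weight_eq: "weight i = 1 / ((real i + 1) * (real i + 2))"
  by (simp add: weight_def field_simps)

lemma weight_pos: "0 < weight i"
  by (simp add: weight_eq)

lemma sums_weight: "(\<lambda>i. weight (i + n)) sums (1 / (real n + 1))"
proof -
  have "(\<lambda>i. 1 / (real (i + n) + 1)) \<longlonglongrightarrow> 0"
    using LIMSEQ_ignore_initial_segment[OF LIMSEQ_inverse_real_of_nat, of n] by (simp add: inverse_eq_divide add.commute)
  from telescope_sums'[OF this] show ?thesis by (simp add: weight_def add_ac)
qed

text \<open>\<open>4 ^ i\<close> compensates two derivatives of a wave of frequency of order
  \<open>2 ^ i\<close>. The further 4 absorbs the bound 3 in \<open>ripple2_bound\<close> and keeps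
  the radius between 1/4 and 1/2.\<close>

definition amplitude :: "nat \<Rightarrow> real" where
  "amplitude i = weight i / (4 * 4 ^ i)"

definition cell :: "nat \<Rightarrow> nat set \<Rightarrow> int \<Rightarrow> real" where
  "cell i A k = (if nat (k mod 2 ^ i) \<in> A then 1 else 0)"

text \<open>The fourth power and its first two derivatives vanish at the ends of the sectors, where
  the bits may jump; this glues the sectors to a twice continuously differentiable function.\<close>

definition ripple :: "nat \<Rightarrow> nat set \<Rightarrow> real \<Rightarrow> real" where
  "ripple i A \<phi> = amplitude i * (cell i A \<lfloor>2 ^ i * \<phi> / (2 * pi)\<rfloor> * sin (2 ^ i * \<phi> / 2) ^ 4)"

definition ripple1 :: "nat \<Rightarrow> nat set \<Rightarrow> real \<Rightarrow> real" where
  "ripple1 i A \<phi> = amplitude i * (cell i A \<lfloor>2 ^ i * \<phi> / (2 * pi)\<rfloor> *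
     (2 ^ i * (2 * sin (2 ^ i * \<phi> / 2) ^ 3 * cos (2 ^ i * \<phi> / 2))))"

definition ripple2 :: "nat \<Rightarrow> nat set \<Rightarrow> real \<Rightarrow> real" where
  "ripple2 i A \<phi> = amplitude i * (cell i A \<lfloor>2 ^ i * \<phi> / (2 * pi)\<rfloor> *
     (4 ^ i * (3 * sin (2 ^ i * \<phi> / 2) ^ 2 * cos (2 ^ i * \<phi> / 2) ^ 2 - sin (2 ^ i * \<phi> / 2) ^ 4)))"

lemma cell_bound: "\<bar>cell i A k\<bar> \<le> 1" "0 \<le> cell i A k" "cell i A k \<le> 1"
  by (auto simp: cell_def)

lemma amplitude_pos: "0 < amplitude i"
  by (simp add: amplitude_def weight_pos)

lemma ripple_deriv: "(ripple i A has_real_derivative ripple1 i A \<phi>) (at \<phi>)"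
  unfolding ripple_def[abs_def] ripple1_def
proof (intro DERIV_cmult floor_step_deriv cell_bound)
  show "((\<lambda>\<phi>. sin (2 ^ i * \<phi> / 2) ^ 4) has_real_derivative
      2 ^ i * (2 * sin (2 ^ i * \<phi> / 2) ^ 3 * cos (2 ^ i * \<phi> / 2))) (at \<phi>)"
    by (auto intro!: derivative_eq_intros)
qed auto

lemma ripple1_deriv: "(ripple1 i A has_real_derivative ripple2 i A \<phi>) (at \<phi>)"
  unfolding ripple1_def[abs_def] ripple2_def
proof (intro DERIV_cmult floor_step_deriv cell_bound)
  have "(4::real) ^ i = 2 ^ i * 2 ^ i" by (simp flip: power_mult_distrib)
  then show "((\<lambda>\<phi>. 2 ^ i * (2 * sin (2 ^ i * \<phi> / 2) ^ 3 * cos (2 ^ i * \<phi> / 2))) has_real_derivative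
      4 ^ i * (3 * sin (2 ^ i * \<phi> / 2) ^ 2 * cos (2 ^ i * \<phi> / 2) ^ 2 - sin (2 ^ i * \<phi> / 2) ^ 4)) (at \<phi>)"
    by (auto intro!: derivative_eq_intros simp: power_numeral_reduce algebra_simps)
qed auto

lemma ripple2_cont: "isCont (ripple2 i A) \<phi>"
  unfolding isCont_def ripple2_def
  by (intro tendsto_mult[OF tendsto_const] floor_step_tendsto cell_bound) (auto intro!: tendsto_intros)

lemma ripple_bound: "0 \<le> ripple i A \<phi>" "ripple i A \<phi> \<le> weight i / 4"
proof -
  have s: "sin (2 ^ i * \<phi> / 2) ^ 4 \<le> 1"
    using power_mono[of "\<bar>sin (2 ^ i * \<phi> / 2)\<bar>" 1 4] by (simp add: power_even_abs)
  show "0 \<le> ripple i A \<phi>" unfolding ripple_def using amplitude_pos[of i] cell_bound by (intro mult_nonneg_nonneg) auto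
  have "cell i A \<lfloor>2 ^ i * \<phi> / (2 * pi)\<rfloor> * sin (2 ^ i * \<phi> / 2) ^ 4 \<le> 1 * 1"
    using s by (intro mult_mono cell_bound) auto
  then have "ripple i A \<phi> \<le> amplitude i" unfolding ripple_def using amplitude_pos[of i] by (simp add: mult_left_le)
  also have "\<dots> \<le> weight i / 4" unfolding amplitude_def using weight_pos[of i] by (intro divide_left_mono) auto
  finally show "ripple i A \<phi> \<le> weight i / 4" .
qed

lemma ripple1_bound: "\<bar>ripple1 i A \<phi>\<bar> \<le> weight i"
proof -
  have a: "amplitude i * 2 ^ i \<le> weight i / 4"
  proof -
    have "weight i * 2 ^ i \<le> weight i * 4 ^ i" using weight_pos[of i] by (intro mult_left_mono power_mono) auto
    then show ?thesis unfolding amplitude_def by (simp add: field_simps)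
  qed
  have "\<bar>cell i A \<lfloor>2 ^ i * \<phi> / (2 * pi)\<rfloor> * (sin (2 ^ i * \<phi> / 2) ^ 3 * cos (2 ^ i * \<phi> / 2))\<bar> \<le> 1 * (1 ^ 3 * 1)"
    unfolding abs_mult power_abs by (intro mult_mono power_mono cell_bound) auto
  then have "amplitude i * 2 ^ i * \<bar>2 * (cell i A \<lfloor>2 ^ i * \<phi> / (2 * pi)\<rfloor> * (sin (2 ^ i * \<phi> / 2) ^ 3 * cos (2 ^ i * \<phi> / 2)))\<bar>
      \<le> weight i / 4 * 2"
    using a amplitude_pos[of i] weight_pos[of i] by (intro mult_mono) auto
  also have "amplitude i * 2 ^ i * \<bar>2 * (cell i A \<lfloor>2 ^ i * \<phi> / (2 * pi)\<rfloor> * (sin (2 ^ i * \<phi> / 2) ^ 3 * cos (2 ^ i * \<phi> / 2)))\<bar> = \<bar>ripple1 i A \<phi>\<bar>"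
    unfolding ripple1_def using amplitude_pos[of i] by (simp add: abs_mult mult_ac)
  finally show ?thesis using weight_pos[of i] by simp
qed

lemma ripple2_bound: "\<bar>ripple2 i A \<phi>\<bar> \<le> weight i"
proof -
  define x where "x = 2 ^ i * \<phi> / 2"
  define y where "y = sin x ^ 2"
  have "3 * sin x ^ 2 * cos x ^ 2 - sin x ^ 4 = y * (3 - 4 * y)"
    unfolding cos_squared_eq y_def by (simp add: power_numeral_reduce algebra_simps)
  moreover have y: "0 \<le> y" "y \<le> 1" by (auto simp: abs_square_le_1 y_def)
  moreover have "\<bar>y * (3 - 4 * y)\<bar> \<le> 1 * 3"
    unfolding abs_mult using y by (intro mult_mono) auto
  ultimately have v: "\<bar>3 * sin x ^ 2 * cos x ^ 2 - sin x ^ 4\<bar> \<le> 3" by simp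
  have "\<bar>cell i A \<lfloor>2 ^ i * \<phi> / (2 * pi)\<rfloor>\<bar> * \<bar>3 * sin x ^ 2 * cos x ^ 2 - sin x ^ 4\<bar> \<le> 1 * 3"
    by (intro mult_mono cell_bound v) auto
  then have "weight i / 4 * (\<bar>cell i A \<lfloor>2 ^ i * \<phi> / (2 * pi)\<rfloor>\<bar> * \<bar>3 * sin x ^ 2 * cos x ^ 2 - sin x ^ 4\<bar>) \<le> weight i / 4 * (1 * 3)"
    using weight_pos[of i] by (intro mult_left_mono) auto
  moreover have "weight i / 4 * (\<bar>cell i A \<lfloor>2 ^ i * \<phi> / (2 * pi)\<rfloor>\<bar> * \<bar>3 * sin x ^ 2 * cos x ^ 2 - sin x ^ 4\<bar>) = \<bar>ripple2 i A \<phi>\<bar>"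
    unfolding ripple2_def amplitude_def x_def[symmetric] using weight_pos[of i] by (simp add: abs_mult)
  ultimately show ?thesis using weight_pos[of i] by linarith
qed

lemma ripple_periodic: "ripple i A (\<phi> + 2 * pi) = ripple i A \<phi>"
proof -
  have "2 ^ i * (\<phi> + 2 * pi) / (2 * pi) = 2 ^ i * \<phi> / (2 * pi) + of_int (2 ^ i)" by (simp add: field_simps)
  then have f: "\<lfloor>2 ^ i * (\<phi> + 2 * pi) / (2 * pi)\<rfloor> = \<lfloor>2 ^ i * \<phi> / (2 * pi)\<rfloor> + 2 ^ i" by (simp only: floor_add_int)
  have c: "cell i A (k + 2 ^ i) = cell i A k" for k by (simp add: cell_def)
  have "2 ^ i * (\<phi> + 2 * pi) / 2 = 2 ^ i * \<phi> / 2 + real (2 ^ i) * pi" by (simp add: field_simps)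
  then have "sin (2 ^ i * (\<phi> + 2 * pi) / 2) = sin (2 ^ i * \<phi> / 2 + real (2 ^ i) * pi)" by (simp only:)
  also have "\<dots> = sin (2 ^ i * \<phi> / 2) * cos (real (2 ^ i) * pi)" unfolding sin_add sin_npi by simp
  also have "cos (real (2 ^ i) * pi) = (- 1) ^ (2 ^ i)" by (rule cos_npi)
  finally have "sin (2 ^ i * (\<phi> + 2 * pi) / 2) ^ 4 = sin (2 ^ i * \<phi> / 2) ^ 4"
    by (simp add: power_mult_distrib flip: power_mult)
  then show ?thesis unfolding ripple_def f c by simp
qed

definition radius :: "(nat \<Rightarrow> nat set) \<Rightarrow> real \<Rightarrow> real" where
  "radius \<omega> \<phi> = 1/4 + (\<Sum>i. ripple i (\<omega> i) \<phi>)"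

text \<open>The constant \<open>1 / (n + 1)\<close> dominates the remainder of the series, so that the truncated
  profiles bound the full one from above.\<close>

definition radius_upto :: "nat \<Rightarrow> (nat \<Rightarrow> nat set) \<Rightarrow> real \<Rightarrow> real" where
  "radius_upto n \<omega> \<phi> = 1/4 + (\<Sum>i<n. ripple i (\<omega> i) \<phi>) + 1 / (real n + 1)"

lemma summable_weight: "summable weight"
  using sums_weight[of 0] by (auto simp: sums_iff)

lemma summable_ripple: "summable (\<lambda>i. ripple i (\<omega> i) \<phi>)"
  by (rule summable_comparison_test'[OF summable_divide[OF summable_weight, of 4], of 0]) (use ripple_bound in auto)

lemma radius_bounds: "1/4 \<le> radius \<omega> \<phi>" "radius \<omega> \<phi> \<le> 1/2"
proof -
  show "1/4 \<le> radius \<omega> \<phi>" unfolding radius_def using suminf_nonneg[OF summable_ripple ripple_bound(1)] by simp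
  have "(\<Sum>i. ripple i (\<omega> i) \<phi>) \<le> (\<Sum>i. weight i / 4)"
    by (intro suminf_le ripple_bound summable_ripple summable_divide summable_weight)
  also have "\<dots> = 1/4" using sums_divide[OF sums_weight[of 0], of 4] by (simp add: sums_iff)
  finally show "radius \<omega> \<phi> \<le> 1/2" unfolding radius_def by simp
qed

lemma radius_le_upto: "radius \<omega> \<phi> \<le> radius_upto n \<omega> \<phi>"
proof -
  have "(\<Sum>i. ripple (i + n) (\<omega> (i + n)) \<phi>) \<le> (\<Sum>i. weight (i + n) / 4)"
  proof (rule suminf_le)
    show "summable (\<lambda>i. ripple (i + n) (\<omega> (i + n)) \<phi>)" using summable_ignore_initial_segment[OF summable_ripple] .
    show "summable (\<lambda>i. weight (i + n) / 4)" using summable_divide[OF summable_ignore_initial_segment[OF summable_weight]] .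
  qed (rule ripple_bound)
  also have "\<dots> = 1 / (real n + 1) / 4" using sums_divide[OF sums_weight[of n], of 4] by (simp add: sums_iff)
  also have "\<dots> \<le> 1 / (real n + 1)" by (simp add: field_simps)
  finally show ?thesis unfolding radius_def radius_upto_def
    using suminf_split_initial_segment[OF summable_ripple, of \<omega> \<phi> n] by simp
qed

lemma radius_upto_tendsto: "(\<lambda>n. radius_upto n \<omega> \<phi>) \<longlonglongrightarrow> radius \<omega> \<phi>"
proof -
  have "(\<lambda>n. 1 / (real n + 1)) \<longlonglongrightarrow> 0"
    using LIMSEQ_inverse_real_of_nat by (simp add: inverse_eq_divide add.commute)
  then have "(\<lambda>n. radius_upto n \<omega> \<phi>) \<longlonglongrightarrow> 1/4 + (\<Sum>i. ripple i (\<omega> i) \<phi>) + 0"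
    unfolding radius_upto_def by (intro tendsto_intros summable_LIMSEQ summable_ripple)
  then show ?thesis by (simp add: radius_def)
qed

lemma radius_periodic: "radius \<omega> (\<phi> + 2 * pi) = radius \<omega> \<phi>" "radius_upto n \<omega> (\<phi> + 2 * pi) = radius_upto n \<omega> \<phi>"
  by (simp_all add: radius_def radius_upto_def ripple_periodic)

lemma radius_deriv: "(radius \<omega> has_real_derivative (\<Sum>i. ripple1 i (\<omega> i) \<phi>)) (at \<phi>)"
proof -
  have "((\<lambda>\<phi>. \<Sum>i. ripple i (\<omega> i) \<phi>) has_real_derivative (\<Sum>i. ripple1 i (\<omega> i) \<phi>)) (at \<phi>)"
    by (rule has_field_derivative_series'[OF convex_UNIV DERIV_subset[OF ripple_deriv]
          Weierstrass_m_test'[OF _ summable_weight] UNIV_I summable_ripple])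
       (use ripple1_bound in auto)
  from DERIV_add[OF DERIV_const[of "1/4"] this] show ?thesis by (simp add: radius_def[abs_def])
qed

lemma summable_ripple1: "summable (\<lambda>i. ripple1 i (\<omega> i) \<phi>)"
  by (rule summable_comparison_test'[OF summable_weight, of 0]) (use ripple1_bound in auto)

lemma summable_ripple2: "summable (\<lambda>i. \<bar>ripple2 i (\<omega> i) \<phi>\<bar>)"
  by (rule summable_comparison_test'[OF summable_weight, of 0]) (use ripple2_bound in auto)

lemma radius_deriv2: "((\<lambda>\<phi>. \<Sum>i. ripple1 i (\<omega> i) \<phi>) has_real_derivative (\<Sum>i. ripple2 i (\<omega> i) \<phi>)) (at \<phi>)"
  by (rule has_field_derivative_series'[OF convex_UNIV DERIV_subset[OF ripple1_deriv]
        Weierstrass_m_test'[OF _ summable_weight] UNIV_I summable_ripple1])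
     (use ripple2_bound in auto)

lemma radius_deriv2_cont: "continuous_on UNIV (\<lambda>\<phi>. \<Sum>i. ripple2 i (\<omega> i) \<phi>)"
proof (rule uniform_limit_theorem[OF _ Weierstrass_m_test[OF _ summable_weight]])
  show "\<forall>\<^sub>F n in sequentially. continuous_on UNIV (\<lambda>\<phi>. \<Sum>i<n. ripple2 i (\<omega> i) \<phi>)"
    using ripple2_cont by (auto intro!: always_eventually continuous_on_sum simp: continuous_on_eq_continuous_at)
qed (use ripple2_bound in auto)

text \<open>Termwise differentiation under the summable \<open>weight\<close>; since the weights sum
  to 1, the second derivative stays within the room left by \<open>\<nu> \<ge> 1\<close>.\<close>

lemma radius_C2: "radius \<omega> \<in> C2_2pi" "\<bar>deriv (deriv (radius \<omega>)) \<phi>\<bar> \<le> 1"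
proof -
  have 1: "deriv (radius \<omega>) = (\<lambda>\<phi>. \<Sum>i. ripple1 i (\<omega> i) \<phi>)" by (rule ext) (rule DERIV_imp_deriv[OF radius_deriv])
  have 2: "deriv (\<lambda>\<phi>. \<Sum>i. ripple1 i (\<omega> i) \<phi>) = (\<lambda>\<phi>. \<Sum>i. ripple2 i (\<omega> i) \<phi>)"
    by (rule ext) (rule DERIV_imp_deriv[OF radius_deriv2])
  have "continuous_on UNIV (\<lambda>\<phi>. \<Sum>i. ripple1 i (\<omega> i) \<phi>)"
    using radius_deriv2 by (meson DERIV_isCont continuous_at_imp_continuous_on)
  then show "radius \<omega> \<in> C2_2pi"
    unfolding C2_2pi_def C1_differentiable_on_def has_real_derivative_iff_has_vector_derivative[symmetric]
    using radius_periodic(1) radius_deriv[of \<omega>] radius_deriv2[of \<omega>] radius_deriv2_cont[of \<omega>]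
    by (intro CollectI conjI allI exI[of _ "\<lambda>\<phi>. \<Sum>i. ripple1 i (\<omega> i) \<phi>"] exI[of _ "\<lambda>\<phi>. \<Sum>i. ripple2 i (\<omega> i) \<phi>"]) (simp_all add: 1)
  have "\<bar>\<Sum>i. ripple2 i (\<omega> i) \<phi>\<bar> \<le> (\<Sum>i. \<bar>ripple2 i (\<omega> i) \<phi>\<bar>)" by (rule summable_rabs[OF summable_ripple2])
  also have "\<dots> \<le> (\<Sum>i. weight i)" by (intro suminf_le ripple2_bound summable_ripple2 summable_weight)
  also have "\<dots> = 1" using sums_weight[of 0] by (simp add: sums_iff)
  finally show "\<bar>deriv (deriv (radius \<omega>)) \<phi>\<bar> \<le> 1" unfolding 1 2 .
qed

text \<open>Isolates one level: with its bits emptied, the remaining radius is a reference curve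
  shared by all stars that differ in that level only.\<close>

lemma radius_split: "radius \<omega> \<phi> = radius (fun_upd \<omega> i {}) \<phi> + ripple i (\<omega> i) \<phi>"
proof -
  have r0: "ripple i {} \<phi> = 0" by (simp add: ripple_def cell_def)
  have "(\<lambda>j. if j = i then ripple i (\<omega> i) \<phi> else 0) sums ripple i (\<omega> i) \<phi>" by (rule sums_single)
  moreover have "(\<lambda>j. ripple j ((fun_upd \<omega> i {}) j) \<phi>) sums (\<Sum>j. ripple j ((fun_upd \<omega> i {}) j) \<phi>)"
    by (rule summable_sums[OF summable_ripple])
  ultimately have "(\<lambda>j. ripple j ((fun_upd \<omega> i {}) j) \<phi> + (if j = i then ripple i (\<omega> i) \<phi> else 0)) sums
      ((\<Sum>j. ripple j ((fun_upd \<omega> i {}) j) \<phi>) + ripple i (\<omega> i) \<phi>)" by (intro sums_add)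
  moreover have "(\<lambda>j. ripple j ((fun_upd \<omega> i {}) j) \<phi> + (if j = i then ripple i (\<omega> i) \<phi> else 0)) = (\<lambda>j. ripple j (\<omega> j) \<phi>)"
    using r0 by auto
  ultimately show ?thesis unfolding radius_def by (simp add: sums_iff)
qed

section \<open>Random stars in polar charts and the areas between them\<close>

lemma star_region_polar:
  assumes per: "\<And>\<phi>. \<rho> (\<phi> + 2 * pi) = \<rho> \<phi>" and pos: "\<And>\<phi>. 0 \<le> \<rho> \<phi>" and r: "0 \<le> r"
  shows "r *\<^sub>R vector [cos \<phi>, sin \<phi>] \<in> star_region \<rho> \<longleftrightarrow> r \<le> \<rho> \<phi>"
proof
  assume "r *\<^sub>R vector [cos \<phi>, sin \<phi>] \<in> star_region \<rho>"
  then obtain r' \<phi>' where h: "r *\<^sub>R vector [cos \<phi>, sin \<phi>] = (r' *\<^sub>R vector [cos \<phi>', sin \<phi>'] :: real^2)" "0 \<le> r'" "r' \<le> \<rho> \<phi>'"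
    unfolding star_region_def by blast
  have e: "r * cos \<phi> = r' * cos \<phi>'" "r * sin \<phi> = r' * sin \<phi>'"
    using arg_cong[OF h(1), of "\<lambda>v. v $ 1"] arg_cong[OF h(1), of "\<lambda>v. v $ 2"] by (simp_all add: vector_2)
  have sq: "(s * cos t)^2 + (s * sin t)^2 = s^2" for s t :: real
    by (simp add: power_mult_distrib flip: distrib_left)
  have "r^2 = r'^2" using sq[of r \<phi>] sq[of r' \<phi>'] e by simp
  then have rr: "r = r'" using r h(2) by (simp add: power2_eq_iff_nonneg)
  show "r \<le> \<rho> \<phi>"
  proof (cases "r = 0")
    case False
    then have "sin \<phi> = sin \<phi>' \<and> cos \<phi> = cos \<phi>'" using e rr by simp
    then obtain n :: int where "\<phi> = \<phi>' + 2 * pi * n" unfolding sin_cos_eq_iff by auto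
    then have "\<rho> \<phi> = \<rho> \<phi>'" using periodic_int[of \<rho> \<phi>' n] per by (simp add: mult_ac)
    then show ?thesis using h(3) rr by simp
  qed (use pos in simp)
next
  assume r1: "r \<le> \<rho> \<phi>"
  obtain t where t: "0 \<le> t" "t < 2 * pi" "cos \<phi> = cos t" "sin \<phi> = sin t"
    using sincos_total_2pi[of "cos \<phi>" "sin \<phi>"] by auto
  then obtain n :: int where "\<phi> = t + 2 * pi * n" using sin_cos_eq_iff[of \<phi> t] by auto
  then have "\<rho> \<phi> = \<rho> t" using periodic_int[of \<rho> t n] per by (simp add: mult_ac)
  then show "r *\<^sub>R vector [cos \<phi>, sin \<phi>] \<in> star_region \<rho>"
    unfolding star_region_def using r r1 t by (intro CollectI exI[of _ r] exI[of _ t]) simp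
qed

definition random_star :: "(nat \<Rightarrow> nat set) \<Rightarrow> (real^2) set" where
  "random_star \<omega> = (+) (vector [1/2, 1/2]) ` star_region (radius \<omega>)"

lemma random_star_STAR:
  assumes "1 \<le> \<nu>" "\<rho>\<^sub>0 \<le> 1/4" "1/2 \<le> \<rho>\<^sub>1"
  shows "random_star \<omega> \<in> STAR \<nu> \<rho>\<^sub>0 \<rho>\<^sub>1"
  unfolding STAR_def random_star_def
proof (rule CollectI, rule exI[of _ "vector [1/2, 1/2]"], rule exI[of _ "radius \<omega>"], intro conjI allI)
  show "AE \<phi> in lborel. \<bar>deriv (deriv (radius \<omega>)) \<phi>\<bar> \<le> \<nu>" using radius_C2(2) assms(1) by (intro AE_I2) (meson order_trans)
  show "0 \<le> radius \<omega> \<phi>" "\<rho>\<^sub>0 \<le> radius \<omega> \<phi>" "radius \<omega> \<phi> \<le> \<rho>\<^sub>1" for \<phi> using radius_bounds[of \<omega> \<phi>] assms by linarith+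
  show "(+) (vector [1/2, 1/2]) ` star_region (radius \<omega>) \<subseteq> {x. \<forall>i. 0 \<le> x $ i \<and> x $ i \<le> 1}"
  proof
    fix x :: "real^2" assume "x \<in> (+) (vector [1/2, 1/2]) ` star_region (radius \<omega>)"
    then obtain r \<phi> where x: "x = vector [1/2, 1/2] + r *\<^sub>R vector [cos \<phi>, sin \<phi>]" "0 \<le> r" "r \<le> radius \<omega> \<phi>"
      unfolding star_region_def by blast
    have r: "r \<le> 1/2" using x(3) radius_bounds(2)[of \<omega> \<phi>] by linarith
    have "\<bar>r * cos \<phi>\<bar> \<le> 1/2 * 1" "\<bar>r * sin \<phi>\<bar> \<le> 1/2 * 1"
      unfolding abs_mult using r x(2) by (intro mult_mono; simp)+
    then have "- (1/2) \<le> r * cos \<phi>" "r * cos \<phi> \<le> 1/2" "- (1/2) \<le> r * sin \<phi>" "r * sin \<phi> \<le> 1/2" by linarith+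
    then show "x \<in> {x. \<forall>i. 0 \<le> x $ i \<and> x $ i \<le> 1}" unfolding x(1) by (simp add: forall_2 vector_2)
  qed
qed (rule refl radius_C2)+

text \<open>Polar coordinates with \<open>z $ 1\<close> the height above the curve of radius
  \<open>\<rho>\<close> and \<open>z $ 2\<close> the angle. Over a reference curve, membership in a
  star compares the height with one ripple. The Jacobian is the full radius
  \<open>z $ 1 + \<rho> (z $ 2)\<close>.\<close>

definition chart :: "(real \<Rightarrow> real) \<Rightarrow> real^2 \<Rightarrow> real^2" where
  "chart \<rho> z = vector [1/2, 1/2] + (z $ 1 + \<rho> (z $ 2)) *\<^sub>R vector [cos (z $ 2), sin (z $ 2)]"

lemma chart_deriv:
  assumes \<rho>: "\<And>t. (\<rho> has_real_derivative R t) (at t)"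
  shows "(chart \<rho> has_derivative (\<lambda>h. vector [(h $ 1 + h $ 2 * R (z $ 2)) * cos (z $ 2) - (z $ 1 + \<rho> (z $ 2)) * (h $ 2 * sin (z $ 2)),
     (h $ 1 + h $ 2 * R (z $ 2)) * sin (z $ 2) + (z $ 1 + \<rho> (z $ 2)) * (h $ 2 * cos (z $ 2))])) (at z within S)"
proof -
  have nth: "((\<lambda>z::real^2. z $ i) has_derivative (\<lambda>h. h $ i)) (at z within S)" for i
    by (rule bounded_linear_imp_has_derivative[OF bounded_linear_vec_nth])
  have r: "((\<lambda>z::real^2. z $ 1 + \<rho> (z $ 2)) has_derivative (\<lambda>h. h $ 1 + h $ 2 * R (z $ 2))) (at z within S)"
    by (intro has_derivative_add nth DERIV_compose_FDERIV[OF \<rho>])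
  have c: "((\<lambda>z::real^2. cos (z $ 2)) has_derivative (\<lambda>h. h $ 2 * - sin (z $ 2))) (at z within S)"
    by (rule DERIV_compose_FDERIV[OF DERIV_cos nth])
  have s: "((\<lambda>z::real^2. sin (z $ 2)) has_derivative (\<lambda>h. h $ 2 * cos (z $ 2))) (at z within S)"
    by (rule DERIV_compose_FDERIV[OF DERIV_sin nth])
  have e: "chart \<rho> = (\<lambda>z. vector [1/2, 1/2] + (((z $ 1 + \<rho> (z $ 2)) * cos (z $ 2)) *\<^sub>R axis 1 1
      + ((z $ 1 + \<rho> (z $ 2)) * sin (z $ 2)) *\<^sub>R axis 2 1))"
    by (auto simp: fun_eq_iff chart_def vec_eq_iff forall_2 vector_2 axis_def)
  have "(chart \<rho> has_derivative (\<lambda>h. 0 + (((z $ 1 + \<rho> (z $ 2)) * (h $ 2 * - sin (z $ 2)) + (h $ 1 + h $ 2 * R (z $ 2)) * cos (z $ 2)) *\<^sub>R axis 1 1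
      + ((z $ 1 + \<rho> (z $ 2)) * (h $ 2 * cos (z $ 2)) + (h $ 1 + h $ 2 * R (z $ 2)) * sin (z $ 2)) *\<^sub>R axis 2 1))) (at z within S)"
    unfolding e
    by (intro has_derivative_add has_derivative_const has_derivative_scaleR_left has_derivative_mult r c s)
  then show ?thesis
    by (rule has_derivative_eq_rhs) (auto simp: fun_eq_iff vec_eq_iff forall_2 vector_2 axis_def algebra_simps)
qed

lemma chart_inj:
  assumes "\<And>t. 0 \<le> \<rho> t"
  shows "inj_on (chart \<rho>) {z. 0 < z $ 1 \<and> 0 < z $ 2 \<and> z $ 2 < 2 * pi}"
proof (rule inj_onI, clarsimp)
  fix z w :: "real^2"
  assume z: "0 < z $ 1" "0 < z $ 2" "z $ 2 < 2 * pi" and w: "0 < w $ 1" "0 < w $ 2" "w $ 2 < 2 * pi"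
    and eq: "chart \<rho> z = chart \<rho> w"
  define r where "r = z $ 1 + \<rho> (z $ 2)"
  define s where "s = w $ 1 + \<rho> (w $ 2)"
  have pos: "0 < r" "0 < s" unfolding r_def s_def by (intro add_pos_nonneg assms z w)+
  have e: "r * cos (z $ 2) = s * cos (w $ 2)" "r * sin (z $ 2) = s * sin (w $ 2)"
    using arg_cong[OF eq, of "\<lambda>v. v $ 1"] arg_cong[OF eq, of "\<lambda>v. v $ 2"] by (simp_all add: chart_def vector_2 r_def s_def)
  have sq: "(u * cos t)^2 + (u * sin t)^2 = u^2" for u t :: real
    by (simp add: power_mult_distrib flip: distrib_left)
  have "r^2 = s^2" using sq[of r "z $ 2"] sq[of s "w $ 2"] e by simp
  then have rs: "r = s" using pos by (simp add: power2_eq_iff_nonneg)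
  then have "sin (z $ 2) = sin (w $ 2) \<and> cos (z $ 2) = cos (w $ 2)" using e pos by simp
  then obtain n :: int where n: "z $ 2 = w $ 2 + 2 * pi * n" unfolding sin_cos_eq_iff by auto
  have "2 * pi * n < 2 * pi * 1" "2 * pi * (- 1) < 2 * pi * n" using n z w by linarith+
  then have "real_of_int n < 1" "- 1 < real_of_int n" by (simp_all only: mult_less_cancel_left_pos[of "2 * pi"] pi_gt_zero zero_less_mult_iff zero_less_numeral simp_thms)
  then have "n = 0" by linarith
  then have z2: "z $ 2 = w $ 2" using n by simp
  then have "z $ 1 = w $ 1" using rs by (simp add: r_def s_def)
  then show "z = w" using z2 by (simp add: vec_eq_iff forall_2)
qed

lemma chart_area:
  assumes \<rho>: "\<And>t. (\<rho> has_real_derivative R t) (at t)" "\<And>t. 1/4 \<le> \<rho> t"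
    and ab: "0 < a" "a \<le> b" and st: "0 < s" "s \<le> t" "t < 2 * pi"
  defines "Q \<equiv> cbox (vector [a, s]) (vector [b, t]) :: (real^2) set"
  shows "compact (chart \<rho> ` Q)" "(b - a) * (t - s) / 4 \<le> measure lborel (chart \<rho> ` Q)"
proof -
  let ?f' = "\<lambda>z h. vector [(h $ 1 + h $ 2 * R (z $ 2)) * cos (z $ 2) - (z $ 1 + \<rho> (z $ 2)) * (h $ 2 * sin (z $ 2)),
     (h $ 1 + h $ 2 * R (z $ 2)) * sin (z $ 2) + (z $ 1 + \<rho> (z $ 2)) * (h $ 2 * cos (z $ 2))] :: real^2"
  note d = chart_deriv[OF \<rho>(1)]
  have Q: "z \<in> Q \<longleftrightarrow> a \<le> z $ 1 \<and> z $ 1 \<le> b \<and> s \<le> z $ 2 \<and> z $ 2 \<le> t" for z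
    unfolding Q_def by (auto simp: mem_box_cart forall_2 vector_2)
  have "continuous_on Q (chart \<rho>)" by (rule has_derivative_continuous_on) (rule d)
  then show c: "compact (chart \<rho> ` Q)" unfolding Q_def by (intro compact_continuous_image compact_cbox)
  have \<rho>0: "0 \<le> \<rho> t" for t using \<rho>(2)[of t] by linarith
  have det: "\<bar>det (matrix (?f' z))\<bar> = z $ 1 + \<rho> (z $ 2)" if "z \<in> Q" for z
  proof -
    have alg: "c * (R * s' + r * c) - (R * c - r * s') * s' = r * (s'^2 + c^2)" for c s' R r :: real
      by (simp add: power2_eq_square algebra_simps)
    have "det (matrix (?f' z)) = z $ 1 + \<rho> (z $ 2)"
      unfolding det_2 matrix_def using alg[of "cos (z $ 2)" "R (z $ 2)" "sin (z $ 2)" "z $ 1 + \<rho> (z $ 2)"]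
      by (simp add: vector_2 axis_def)
    moreover have "0 \<le> z $ 1 + \<rho> (z $ 2)" using that ab \<rho>0[of "z $ 2"] unfolding Q by linarith
    ultimately show ?thesis by simp
  qed
  have "continuous_on UNIV \<rho>" using \<rho>(1) by (meson DERIV_isCont continuous_at_imp_continuous_on)
  moreover have nth: "continuous_on Q (\<lambda>z. z $ j)" for j by (intro continuous_intros)
  ultimately have "continuous_on Q (\<lambda>z. \<rho> (z $ 2))" by (intro continuous_on_compose2[of UNIV \<rho> Q "\<lambda>z. z $ 2"]) simp_all
  with nth have "continuous_on Q (\<lambda>z. z $ 1 + \<rho> (z $ 2))" by (intro continuous_on_add)
  then have int0: "(\<lambda>z. z $ 1 + \<rho> (z $ 2)) integrable_on Q" unfolding Q_def by (rule integrable_continuous)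
  then have int: "(\<lambda>z. \<bar>det (matrix (?f' z))\<bar>) integrable_on Q"
    by (rule integrable_eq) (use det in simp)
  have inj: "inj_on (chart \<rho>) Q"
    using ab st by (intro inj_on_subset[OF chart_inj[OF \<rho>0]]) (auto simp: Q)
  have "measure lebesgue (chart \<rho> ` Q) = integral Q (\<lambda>z. \<bar>det (matrix (?f' z))\<bar>)"
    by (rule measure_differentiable_image_eq[OF _ d inj int]) (simp add: Q_def)
  also have "\<dots> = integral Q (\<lambda>z. z $ 1 + \<rho> (z $ 2))" by (rule integral_cong) (rule det)
  also have "\<dots> \<ge> integral Q (\<lambda>z. 1/4)"
  proof (rule integral_le[OF _ int0])
    show "(\<lambda>z. 1/4 :: real) integrable_on Q" unfolding Q_def by (rule integrable_const)
    fix z assume "z \<in> Q"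
    then show "1/4 \<le> z $ 1 + \<rho> (z $ 2)" using \<rho>(2)[of "z $ 2"] ab unfolding Q by linarith
  qed
  also have "integral Q (\<lambda>z. 1/4) = (b - a) * (t - s) / 4"
  proof -
    have ne: "cbox (vector [a, s]) (vector [b, t]) \<noteq> ({} :: (real^2) set)"
      using ab st by (simp add: interval_ne_empty_cart forall_2 vector_2)
    show ?thesis unfolding Q_def using content_cbox_cart[OF ne] by (simp add: UNIV_2 vector_2)
  qed
  also have "measure lebesgue (chart \<rho> ` Q) = measure lborel (chart \<rho> ` Q)"
    using c by (intro measure_completion) (simp add: borel_compact)
  finally show "(b - a) * (t - s) / 4 \<le> measure lborel (chart \<rho> ` Q)" .
qed

lemma square_integrable_indicator:
  assumes "S \<in> sets borel" "bounded S"
  shows "square_integrable (indicator S)"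
proof -
  obtain r where r: "\<And>z. z \<in> S \<Longrightarrow> norm z \<le> r" using assms(2) unfolding bounded_iff by auto
  have "square_integrable (\<lambda>z. complex_of_real (indicat_real S z))"
    by (rule square_integrable_bounded_support[where B = 1 and r = r]) (use assms(1) r in \<open>auto simp: indicator_def split: if_splits\<close>)
  moreover have "(\<lambda>z. complex_of_real (indicat_real S z)) = indicator S" by (auto simp: indicator_def)
  ultimately show ?thesis by simp
qed

lemma dist_indicator:
  fixes S S' :: "(real^2) set"
  assumes S: "S \<in> sets borel" "bounded S" and S': "S' \<in> sets borel" "bounded S'"
  shows "(dist (l2_of (indicator S)) (l2_of (indicator S')))^2 = measure lborel ((S - S') \<union> (S' - S))"
proof -
  note si = square_integrable_indicator[OF S] square_integrable_indicator[OF S']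
  let ?f = "\<lambda>z. indicator S z - indicator S' z :: complex"
  have "dist (l2_of (indicator S)) (l2_of (indicator S')) = norm (l2_of ?f)"
    unfolding dist_norm l2_of_diff[OF si] ..
  also have "\<dots> = sqrt (LINT z|lborel. (norm (?f z))^2)" by (rule norm_l2_of[OF square_integrable_sub[OF si]])
  also have "(\<lambda>z. (norm (?f z))^2) = indicat_real ((S - S') \<union> (S' - S))" by (auto simp: indicator_def fun_eq_iff)
  also have "(LINT z|lborel. indicat_real ((S - S') \<union> (S' - S)) z) = measure lborel ((S - S') \<union> (S' - S))" by simp
  finally show ?thesis by simp
qed

lemma random_star_compact: "compact (random_star \<omega>)"
proof -
  have "continuous_on UNIV (radius \<omega>)" using radius_deriv by (meson DERIV_isCont continuous_at_imp_continuous_on)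
  then show ?thesis unfolding random_star_def by (intro compact_translation star_region_compact)
qed

lemma chart_mem_random_star:
  assumes "0 \<le> z $ 1"
  shows "chart (radius \<omega>\<^sub>0) z \<in> random_star \<omega> \<longleftrightarrow> z $ 1 + radius \<omega>\<^sub>0 (z $ 2) \<le> radius \<omega> (z $ 2)"
proof -
  have p: "0 \<le> radius \<omega> t" for \<omega> t using radius_bounds(1)[of \<omega> t] by linarith
  have "chart (radius \<omega>\<^sub>0) z \<in> random_star \<omega> \<longleftrightarrow>
     (z $ 1 + radius \<omega>\<^sub>0 (z $ 2)) *\<^sub>R vector [cos (z $ 2), sin (z $ 2)] \<in> star_region (radius \<omega>)"
    unfolding random_star_def chart_def by (auto simp: image_iff)
  also have "\<dots> \<longleftrightarrow> z $ 1 + radius \<omega>\<^sub>0 (z $ 2) \<le> radius \<omega> (z $ 2)"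
    using assms p by (intro star_region_polar radius_periodic) auto
  finally show ?thesis .
qed

text \<open>In the middle half of a sector \<open>2 ^ i * \<phi>\<close> is within
  \<open>pi / 2\<close> of an odd multiple of \<open>pi\<close>. Its cosine is nonpositive, so the
  squared sine of the half angle is at least 1/2 and the ripple reaches a quarter of its
  amplitude.\<close>

lemma mid_cell:
  fixes k i :: nat
  assumes k: "k < 2 ^ i" and \<phi>: "2 * pi * (real k + 1/4) / 2 ^ i \<le> \<phi>" "\<phi> \<le> 2 * pi * (real k + 3/4) / 2 ^ i"
  shows "\<lfloor>2 ^ i * \<phi> / (2 * pi)\<rfloor> = int k" "ripple i A \<phi> \<ge> (if k \<in> A then amplitude i / 4 else 0)"
    "k \<notin> A \<Longrightarrow> ripple i A \<phi> = 0" "0 < \<phi>" "\<phi> < 2 * pi"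
proof -
  have b: "2 * pi * (real k + 1/4) \<le> 2 ^ i * \<phi>" "2 ^ i * \<phi> \<le> 2 * pi * (real k + 3/4)"
    using \<phi> by (simp_all add: field_simps)
  have b2: "real k + 1/4 \<le> 2 ^ i * \<phi> / (2 * pi)" "2 ^ i * \<phi> / (2 * pi) \<le> real k + 3/4"
    using b by (simp_all add: field_simps)
  show fl: "\<lfloor>2 ^ i * \<phi> / (2 * pi)\<rfloor> = int k" using b2 by (intro floor_unique) auto
  have cell: "cell i A (int k) = (if k \<in> A then 1 else 0)" using k unfolding cell_def by (simp add: nat_mod_distrib flip: of_nat_power)
  show "k \<notin> A \<Longrightarrow> ripple i A \<phi> = 0" unfolding ripple_def fl cell by simp
  have "0 < 2 * pi * (real k + 1/4) / 2 ^ i" by simp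
  then show "0 < \<phi>" using \<phi>(1) by linarith
  have "real k + 1 \<le> 2 ^ i" using k by (metis Suc_eq_plus1 Suc_leI of_nat_1 of_nat_add of_nat_le_iff of_nat_numeral of_nat_power)
  then have "real k + 3/4 < 2 ^ i" by linarith
  then have "2 * pi * (real k + 3/4) / 2 ^ i < 2 * pi * 2 ^ i / 2 ^ i" by (intro divide_strict_right_mono mult_strict_left_mono) auto
  then have "2 * pi * (real k + 3/4) / 2 ^ i < 2 * pi" by simp
  then show "\<phi> < 2 * pi" using \<phi>(2) by linarith
  have "cos (2 ^ i * \<phi>) \<le> 0"
  proof -
    have "0 \<le> cos (2 ^ i * \<phi> - 2 * real k * pi - pi)" using b by (intro cos_ge_zero) (simp_all add: algebra_simps)
    also have "\<dots> = - cos (2 ^ i * \<phi> - 2 * real k * pi)" by simp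
    also have "cos (2 ^ i * \<phi> - 2 * real k * pi) = cos (2 ^ i * \<phi>)" unfolding cos_diff by (simp only: cos_2npi sin_2npi)
    finally show ?thesis by simp
  qed
  moreover have "cos (2 * (2 ^ i * \<phi> / 2)) = 1 - 2 * sin (2 ^ i * \<phi> / 2) ^ 2" by (rule cos_double_sin)
  ultimately have "1/2 \<le> sin (2 ^ i * \<phi> / 2) ^ 2" by simp
  then have "(1/2)^2 \<le> (sin (2 ^ i * \<phi> / 2) ^ 2)^2" by (intro power_mono) auto
  moreover have "(sin (2 ^ i * \<phi> / 2) ^ 2)^2 = sin (2 ^ i * \<phi> / 2) ^ 4" by (simp flip: power_mult)
  moreover have "(1/2)^2 = (1/4 :: real)" by (simp add: power2_eq_square)
  ultimately have "1/4 \<le> sin (2 ^ i * \<phi> / 2) ^ 4" by (simp only:)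
  then show "ripple i A \<phi> \<ge> (if k \<in> A then amplitude i / 4 else 0)"
    unfolding ripple_def fl cell using amplitude_pos[of i] by simp
qed

text \<open>Over the middle half of a sector with differing bits, the heights from an eighth to a
  quarter of the amplitude belong to exactly one of the stars. These boxes are disjoint, each of
  area at least \<open>amplitude i / 8\<close> times \<open>pi / 2 ^ i\<close> times the Jacobian
  bound 1/4, and \<open>pi \<ge> 2\<close>.\<close>

lemma random_star_separated:
  assumes agree: "fun_upd \<omega> i {} = fun_upd \<omega>' i {}"
    and D: "D \<subseteq> {..<2 ^ i}" "D \<subseteq> (\<omega> i - \<omega>' i) \<union> (\<omega>' i - \<omega> i)"
  shows "real (card D) * (amplitude i / (16 * 2 ^ i)) \<le> (dist (l2_of (indicator (random_star \<omega>))) (l2_of (indicator (random_star \<omega>'))))^2"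
proof -
  define \<rho> where "\<rho> = radius (fun_upd \<omega> i {})"
  define Q where "Q k = (cbox (vector [amplitude i / 8, 2 * pi * (real k + 1/4) / 2 ^ i])
     (vector [amplitude i / 4, 2 * pi * (real k + 3/4) / 2 ^ i]) :: (real^2) set)" for k :: nat
  have Qm: "z \<in> Q k \<longleftrightarrow> amplitude i / 8 \<le> z $ 1 \<and> z $ 1 \<le> amplitude i / 4 \<and>
     2 * pi * (real k + 1/4) / 2 ^ i \<le> z $ 2 \<and> z $ 2 \<le> 2 * pi * (real k + 3/4) / 2 ^ i" for z k
    unfolding Q_def by (auto simp: mem_box_cart forall_2 vector_2)
  note a = amplitude_pos[of i]
  have fin: "finite D" using D(1) by (rule finite_subset) simp
  have \<rho>1: "(\<rho> has_real_derivative (\<Sum>j. ripple1 j ((fun_upd \<omega> i {}) j) t)) (at t)" for t unfolding \<rho>_def by (rule radius_deriv)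
  have \<rho>4: "1/4 \<le> \<rho> t" for t unfolding \<rho>_def by (rule radius_bounds)
  have area: "compact (chart \<rho> ` Q k) \<and> amplitude i / (16 * 2 ^ i) \<le> measure lborel (chart \<rho> ` Q k)" if k: "k \<in> D" for k
  proof -
    have k2: "k < 2 ^ i" using k D by auto
    let ?s = "2 * pi * (real k + 1/4) / 2 ^ i" and ?t = "2 * pi * (real k + 3/4) / 2 ^ i"
    have le: "?s \<le> ?t" by (intro divide_right_mono mult_left_mono) auto
    note st = mid_cell(4)[OF k2 order_refl le] mid_cell(5)[OF k2 le order_refl]
    have "(amplitude i / 4 - amplitude i / 8) * (?t - ?s) / 4 \<le> measure lborel (chart \<rho> ` Q k)"
      unfolding Q_def by (rule chart_area(2)[OF \<rho>1 \<rho>4]) (use a st le in auto)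
    moreover have "amplitude i / (16 * 2 ^ i) \<le> (amplitude i / 4 - amplitude i / 8) * (?t - ?s) / 4"
    proof -
      have "(amplitude i / 4 - amplitude i / 8) * (?t - ?s) / 4 = amplitude i * (pi / 2) / (16 * 2 ^ i)" by (simp add: field_simps)
      moreover have "amplitude i * 1 / (16 * 2 ^ i) \<le> amplitude i * (pi / 2) / (16 * 2 ^ i)"
        using a pi_gt3 by (intro divide_right_mono mult_left_mono) auto
      ultimately show ?thesis by (simp only: mult_1_right)
    qed
    moreover have "compact (chart \<rho> ` Q k)" unfolding Q_def by (rule chart_area(1)[OF \<rho>1 \<rho>4]) (use a st le in auto)
    ultimately show ?thesis by auto
  qed
  have fl: "\<lfloor>2 ^ i * (z $ 2) / (2 * pi)\<rfloor> = int k \<and> 0 < z $ 1 \<and> 0 < z $ 2 \<and> z $ 2 < 2 * pi" if "z \<in> Q k" "k \<in> D" for z k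
    using mid_cell(1,4,5)[of k i "z $ 2"] that D a unfolding Qm by auto
  have disj: "disjoint_family_on (\<lambda>k. chart \<rho> ` Q k) D"
  proof (unfold disjoint_family_on_def, intro ballI impI, rule ccontr)
    fix k l assume kl: "k \<in> D" "l \<in> D" "k \<noteq> l" and ne: "chart \<rho> ` Q k \<inter> chart \<rho> ` Q l \<noteq> {}"
    then obtain z w where zw: "z \<in> Q k" "w \<in> Q l" "chart \<rho> z = chart \<rho> w" by blast
    have \<rho>0: "0 \<le> \<rho> t" for t using \<rho>4[of t] by linarith
    have "z = w" using fl[OF zw(1) kl(1)] fl[OF zw(2) kl(2)] by (intro inj_onD[OF chart_inj[of \<rho>, OF \<rho>0] zw(3)]) auto
    then show False using fl[OF zw(1) kl(1)] fl[OF zw(2) kl(2)] kl(3) by simp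
  qed
  let ?\<Delta> = "(random_star \<omega> - random_star \<omega>') \<union> (random_star \<omega>' - random_star \<omega>)"
  have cp: "compact (random_star \<omega>)" "compact (random_star \<omega>')" by (rule random_star_compact)+
  have \<Delta>: "?\<Delta> \<in> fmeasurable lborel"
  proof (rule fmeasurableI)
    show "?\<Delta> \<in> sets lborel" using borel_compact[OF cp(1)] borel_compact[OF cp(2)] by auto
    show "emeasure lborel ?\<Delta> < \<infinity>"
    proof (rule emeasure_bounded_finite, rule bounded_subset)
      show "bounded (random_star \<omega> \<union> random_star \<omega>')" using cp by (simp add: compact_imp_bounded)
    qed blast
  qed
  have sub: "(\<Union>k\<in>D. chart \<rho> ` Q k) \<subseteq> ?\<Delta>"
  proof
    fix y assume "y \<in> (\<Union>k\<in>D. chart \<rho> ` Q k)"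
    then obtain k z where k: "k \<in> D" and z: "z \<in> Q k" and y: "y = chart \<rho> z" by blast
    have k2: "k < 2 ^ i" using k D by auto
    note m = mid_cell(2,3)[OF k2, of "z $ 2"]
    have z1: "0 < z $ 1" "z $ 1 \<le> amplitude i / 4" using z a unfolding Qm by auto
    have z2: "2 * pi * (real k + 1/4) / 2 ^ i \<le> z $ 2" "z $ 2 \<le> 2 * pi * (real k + 3/4) / 2 ^ i" using z unfolding Qm by auto
    have r: "radius \<omega> (z $ 2) = \<rho> (z $ 2) + ripple i (\<omega> i) (z $ 2)" "radius \<omega>' (z $ 2) = \<rho> (z $ 2) + ripple i (\<omega>' i) (z $ 2)"
      using radius_split[of \<omega> "z $ 2" i] radius_split[of \<omega>' "z $ 2" i] agree by (simp_all add: \<rho>_def)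
    have mem: "chart \<rho> z \<in> random_star \<omega> \<longleftrightarrow> z $ 1 \<le> ripple i (\<omega> i) (z $ 2)"
        "chart \<rho> z \<in> random_star \<omega>' \<longleftrightarrow> z $ 1 \<le> ripple i (\<omega>' i) (z $ 2)"
      using chart_mem_random_star[of z "fun_upd \<omega> i {}"] z1 r unfolding \<rho>_def by simp_all
    have one: "z $ 1 \<le> ripple i A (z $ 2) \<longleftrightarrow> k \<in> A" for A
      using m(1)[OF z2, of A] m(2)[OF z2, of A] z1 by (cases "k \<in> A") auto
    show "y \<in> ?\<Delta>" using k D(2) unfolding y Un_iff Diff_iff mem one by blast
  qed
  have "real (card D) * (amplitude i / (16 * 2 ^ i)) = (\<Sum>k\<in>D. amplitude i / (16 * 2 ^ i))" by simp
  also have "\<dots> \<le> (\<Sum>k\<in>D. measure lborel (chart \<rho> ` Q k))" using area by (intro sum_mono) auto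
  also have "\<dots> = measure lborel (\<Union>k\<in>D. chart \<rho> ` Q k)"
  proof (rule measure_finite_Union[symmetric, OF fin _ disj])
    show "(\<lambda>k. chart \<rho> ` Q k) ` D \<subseteq> sets lborel" using area by (auto intro: borel_compact)
    show "emeasure lborel (chart \<rho> ` Q k) \<noteq> \<infinity>" if "k \<in> D" for k
      using area[OF that] emeasure_bounded_finite[of "chart \<rho> ` Q k"] by (auto simp: compact_imp_bounded)
  qed
  also have "\<dots> \<le> measure lborel ?\<Delta>"
    using area fin by (intro measure_mono_fmeasurable[OF sub _ \<Delta>]) (auto intro!: sets.finite_UN borel_compact)
  also have "\<dots> = (dist (l2_of (indicator (random_star \<omega>))) (l2_of (indicator (random_star \<omega>'))))^2"
    using cp by (intro dist_indicator[symmetric]) (auto intro: borel_compact compact_imp_bounded)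
  finally show ?thesis .
qed

section \<open>The random star\<close>

definition bits :: "nat \<Rightarrow> nat set pmf" where
  "bits i = pmf_of_set (Pow {..<2 ^ i})"

definition bit_space :: "(nat \<Rightarrow> nat set) measure" where
  "bit_space = PiM UNIV (\<lambda>i. measure_pmf (bits i))"

definition shape :: "(nat \<Rightarrow> nat set) \<Rightarrow> l2" where
  "shape \<omega> = l2_of (indicator (random_star \<omega>))"

definition star_upto :: "nat \<Rightarrow> (nat \<Rightarrow> nat set) \<Rightarrow> (real^2) set" where
  "star_upto n \<omega> = (+) (vector [1/2, 1/2]) ` star_region (radius_upto n \<omega>)"

text \<open>The product space also contains sets reaching beyond \<open>{..<2 ^ i}\<close>. The
  radius sees only the restriction, so a truncated star takes finitely many values.\<close>

lemma cell_restrict: "cell i (A \<inter> {..<2 ^ i}) = cell i A"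
proof
  fix k :: int
  have "nat (k mod 2 ^ i) < 2 ^ i" by (simp add: nat_less_iff)
  then show "cell i (A \<inter> {..<2 ^ i}) k = cell i A k" by (simp add: cell_def)
qed

lemma star_upto_cong:
  assumes "\<forall>i<n. \<omega> i \<inter> {..<2 ^ i} = \<omega>' i \<inter> {..<2 ^ i}"
  shows "star_upto n \<omega> = star_upto n \<omega>'"
proof -
  have "ripple i (\<omega> i) = ripple i (\<omega>' i)" if "i < n" for i
    using assms that cell_restrict[of i "\<omega> i"] cell_restrict[of i "\<omega>' i"] by (simp add: ripple_def[abs_def])
  then have "radius_upto n \<omega> = radius_upto n \<omega>'" by (simp add: radius_upto_def[abs_def])
  then show ?thesis by (simp add: star_upto_def)
qed

text \<open>A truncated star depends on finitely many bits, so every preimage is a finite union of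
  cylinder sets.\<close>

lemma star_upto_measurable: "(\<lambda>\<omega>. l2_of (indicator (star_upto n \<omega>))) \<in> borel_measurable bit_space"
proof (rule measurableI)
  fix V :: "l2 set" assume V: "V \<in> sets borel"
  define T where "T = {\<tau>\<in>PiE {..<n} (\<lambda>i. Pow {..<2 ^ i}). l2_of (indicator (star_upto n \<tau>)) \<in> V}"
  have fin: "finite T" unfolding T_def by (intro finite_Collect_conjI disjI1 finite_PiE[unfolded PiE_def]) (auto intro!: finite_PiE)
  have eq: "(\<lambda>\<omega>. l2_of (indicator (star_upto n \<omega>))) -` V \<inter> space bit_space
      = {\<omega>\<in>space bit_space. \<exists>\<tau>\<in>T. \<forall>i\<in>{..<n}. \<omega> i \<inter> {..<2 ^ i} = \<tau> i}"
  proof (intro set_eqI iffI)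
    fix \<omega> assume w: "\<omega> \<in> (\<lambda>\<omega>. l2_of (indicator (star_upto n \<omega>))) -` V \<inter> space bit_space"
    define \<tau> where "\<tau> = (\<lambda>i\<in>{..<n}. \<omega> i \<inter> {..<2 ^ i})"
    have "star_upto n \<tau> = star_upto n \<omega>" by (rule star_upto_cong) (auto simp: \<tau>_def)
    then have "\<tau> \<in> T" using w unfolding T_def by (auto simp: \<tau>_def)
    then show "\<omega> \<in> {\<omega>\<in>space bit_space. \<exists>\<tau>\<in>T. \<forall>i\<in>{..<n}. \<omega> i \<inter> {..<2 ^ i} = \<tau> i}"
      using w by (auto simp: \<tau>_def intro!: bexI[of _ \<tau>])
  next
    fix \<omega> assume w: "\<omega> \<in> {\<omega>\<in>space bit_space. \<exists>\<tau>\<in>T. \<forall>i\<in>{..<n}. \<omega> i \<inter> {..<2 ^ i} = \<tau> i}"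
    then obtain \<tau> where t: "\<tau> \<in> T" "\<forall>i\<in>{..<n}. \<omega> i \<inter> {..<2 ^ i} = \<tau> i" by blast
    have "star_upto n \<omega> = star_upto n \<tau>" by (rule star_upto_cong) (use t in auto)
    then show "\<omega> \<in> (\<lambda>\<omega>. l2_of (indicator (star_upto n \<omega>))) -` V \<inter> space bit_space" using t w unfolding T_def by simp
  qed
  have one: "{\<omega>\<in>space bit_space. \<omega> i \<inter> {..<2 ^ i} = B} \<in> sets bit_space" for i B
  proof -
    have "(\<lambda>\<omega>. \<omega> i) \<in> measurable bit_space (measure_pmf (bits i))" unfolding bit_space_def by (rule measurable_component_singleton) simp
    from measurable_sets[OF this, of "{A. A \<inter> {..<2 ^ i} = B}"] show ?thesis by (simp add: vimage_def Int_def conj_commute)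
  qed
  show "(\<lambda>\<omega>. l2_of (indicator (star_upto n \<omega>))) -` V \<inter> space bit_space \<in> sets bit_space"
    unfolding eq by (intro sets.sets_Collect_finite_Ex[OF _ fin] sets.sets_Collect_finite_All one) auto
qed simp

lemma polar_vec:
  fixes x :: "real^2"
  obtains r \<phi> where "0 \<le> r" "x = r *\<^sub>R vector [cos \<phi>, sin \<phi>]"
proof -
  obtain r \<phi> where h: "x $ 1 = r * cos \<phi>" "x $ 2 = r * sin \<phi>" using polar_Ex by metis
  show ?thesis
  proof (cases "0 \<le> r")
    case True
    then show ?thesis using h by (intro that[of r \<phi>]) (simp_all add: vec_eq_iff forall_2 vector_2)
  next
    case False
    then show ?thesis using h by (intro that[of "- r" "\<phi> + pi"]) (simp_all add: vec_eq_iff forall_2 vector_2)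
  qed
qed

lemma radius_upto_bounds: "0 \<le> radius_upto n \<omega> \<phi>" "radius_upto n \<omega> \<phi> \<le> 3/2"
proof -
  show "0 \<le> radius_upto n \<omega> \<phi>" using radius_le_upto[of \<omega> \<phi> n] radius_bounds(1)[of \<omega> \<phi>] by linarith
  have "(\<Sum>i<n. ripple i (\<omega> i) \<phi>) \<le> (\<Sum>i. ripple i (\<omega> i) \<phi>)"
    by (intro sum_le_suminf summable_ripple) (auto intro: ripple_bound)
  then have "1/4 + (\<Sum>i<n. ripple i (\<omega> i) \<phi>) \<le> 1/2" using radius_bounds(2)[of \<omega> \<phi>] unfolding radius_def by linarith
  moreover have "1 / (real n + 1) \<le> 1" by simp
  ultimately show "radius_upto n \<omega> \<phi> \<le> 3/2" unfolding radius_upto_def by linarith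
qed

lemma star_upto_compact: "compact (star_upto n \<omega>)"
proof -
  have "isCont (ripple i A) t" for i A t by (rule DERIV_isCont[OF ripple_deriv])
  then have "continuous_on UNIV (radius_upto n \<omega>)"
    unfolding radius_upto_def[abs_def] continuous_on_eq_continuous_at[OF open_UNIV] by (auto intro!: continuous_intros)
  then show ?thesis unfolding star_upto_def by (intro compact_translation star_region_compact)
qed

text \<open>As the truncated radii dominate the full one, points of the star belong to all truncated
  stars, and every other point leaves them eventually. The indicators thus converge everywhere,
  boundary included, and dominated convergence applies.\<close>

lemma star_upto_tendsto: "(\<lambda>n. l2_of (indicator (star_upto n \<omega>))) \<longlonglongrightarrow> shape \<omega>"
proof -
  let ?S = "random_star \<omega>"
  let ?D = "\<lambda>n. (star_upto n \<omega> - ?S) \<union> (?S - star_upto n \<omega>)"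
  let ?c = "vector [1/2, 1/2] :: real^2"
  have pos: "0 \<le> radius \<omega> t" for t using radius_bounds(1)[of \<omega> t] by linarith
  have mem: "?c + r *\<^sub>R vector [cos \<phi>, sin \<phi>] \<in> ?S \<longleftrightarrow> r \<le> radius \<omega> \<phi>"
    "?c + r *\<^sub>R vector [cos \<phi>, sin \<phi>] \<in> star_upto n \<omega> \<longleftrightarrow> r \<le> radius_upto n \<omega> \<phi>" if "0 \<le> r" for r \<phi> n
    using star_region_polar[of "radius \<omega>" r \<phi>, OF radius_periodic(1) pos that]
      star_region_polar[of "radius_upto n \<omega>" r \<phi>, OF radius_periodic(2) radius_upto_bounds(1) that]
    unfolding random_star_def star_upto_def by (auto simp: image_iff)
  have sets: "?D n \<in> sets borel" for n using borel_compact[OF star_upto_compact[of n \<omega>]] borel_compact[OF random_star_compact[of \<omega>]] by auto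
  have "(\<lambda>n. LINT z|lborel. indicat_real (?D n) z) \<longlonglongrightarrow> (LINT z::real^2|lborel. (0::real))"
  proof (rule integral_dominated_convergence[where w = "indicat_real (cball ?c (3/2))"])
    show "integrable lborel (indicat_real (cball ?c (3/2)))"
      by (intro integrable_real_indicator emeasure_bounded_finite) auto
    show "AE z in lborel. (\<lambda>n. indicat_real (?D n) z) \<longlonglongrightarrow> 0"
    proof (rule AE_I2)
      fix z :: "real^2"
      obtain r \<phi> where z: "0 \<le> r" "z - ?c = r *\<^sub>R vector [cos \<phi>, sin \<phi>]" by (rule polar_vec)
      then have z': "z = ?c + r *\<^sub>R vector [cos \<phi>, sin \<phi>]" by (simp add: algebra_simps)
      have "\<forall>\<^sub>F n in sequentially. z \<notin> ?D n"
      proof (cases "r \<le> radius \<omega> \<phi>")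
        case True
        then show ?thesis unfolding z' using mem[OF z(1)] order_trans[OF _ radius_le_upto] by simp
      next
        case False
        then have "\<forall>\<^sub>F n in sequentially. radius_upto n \<omega> \<phi> < r" by (intro order_tendstoD[OF radius_upto_tendsto]) simp
        then show ?thesis by (rule eventually_mono) (use False mem[OF z(1)] z' in auto)
      qed
      then have "\<forall>\<^sub>F n in sequentially. 0 = indicat_real (?D n) z" by (rule eventually_mono) simp
      then show "(\<lambda>n. indicat_real (?D n) z) \<longlonglongrightarrow> 0" by (rule Lim_transform_eventually[OF tendsto_const])
    qed
    show "AE z in lborel. norm (indicat_real (?D n) z) \<le> indicat_real (cball ?c (3/2)) z" for n
    proof (rule AE_I2)
      fix z :: "real^2"
      obtain r \<phi> where z: "0 \<le> r" "z - ?c = r *\<^sub>R vector [cos \<phi>, sin \<phi>]" by (rule polar_vec)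
      then have z': "z = ?c + r *\<^sub>R vector [cos \<phi>, sin \<phi>]" by (simp add: algebra_simps)
      have "norm (vector [cos \<phi>, sin \<phi>] :: real^2) = 1" by (simp add: norm_eq_1 inner_vec_def UNIV_2 vector_2 flip: power2_eq_square)
      then have d: "dist ?c z = r" unfolding dist_norm norm_minus_commute[of ?c] using z by simp
      have "r \<le> 3/2" if "z \<in> ?D n"
        using that mem(1)[OF z(1), of \<phi>] mem(2)[OF z(1), of \<phi> n] radius_upto_bounds(2)[of n \<omega> \<phi>] radius_bounds(2)[of \<omega> \<phi>] unfolding z' by auto
      then show "norm (indicat_real (?D n) z) \<le> indicat_real (cball ?c (3/2)) z" using d by (simp add: indicator_def)
    qed
  qed (use sets in auto)
  then have "(\<lambda>n. measure lborel (?D n)) \<longlonglongrightarrow> 0" by simp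
  moreover have "measure lborel (?D n) = (dist (l2_of (indicator (star_upto n \<omega>))) (shape \<omega>))^2" for n
    unfolding shape_def
    by (rule dist_indicator[symmetric, OF borel_compact compact_imp_bounded borel_compact compact_imp_bounded,
          OF star_upto_compact star_upto_compact random_star_compact random_star_compact])
  ultimately have "(\<lambda>n. (dist (l2_of (indicator (star_upto n \<omega>))) (shape \<omega>))^2) \<longlonglongrightarrow> 0" by simp
  from tendsto_real_sqrt[OF this] have "(\<lambda>n. dist (l2_of (indicator (star_upto n \<omega>))) (shape \<omega>)) \<longlonglongrightarrow> 0" by simp
  then show ?thesis by (rule tendsto_dist_iff[THEN iffD2])
qed

lemma shape_measurable: "shape \<in> borel_measurable bit_space"
  by (rule borel_measurable_LIMSEQ_metric[OF star_upto_measurable star_upto_tendsto])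

section \<open>Probability of small balls\<close>

lemma sum_Pow_power:
  fixes x :: real
  assumes "finite S"
  shows "(\<Sum>B\<in>Pow S. x ^ card B) = (1 + x) ^ card S"
  using assms
proof (induction S rule: finite_induct)
  case (insert a S)
  have fin: "finite B" if "B \<in> Pow S" for B using that insert(1) by (auto intro: finite_subset)
  have "(\<Sum>B\<in>Pow (insert a S). x ^ card B) = (\<Sum>B\<in>Pow S. x ^ card B) + (\<Sum>B\<in>insert a ` Pow S. x ^ card B)"
    unfolding Pow_insert using insert by (intro sum.union_disjoint) auto
  also have "(\<Sum>B\<in>insert a ` Pow S. x ^ card B) = (\<Sum>B\<in>Pow S. x ^ card (insert a B))"
    using insert by (subst sum.reindex) (auto simp: inj_on_def)
  also have "\<dots> = (\<Sum>B\<in>Pow S. x * x ^ card B)"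
  proof (rule sum.cong[OF refl])
    fix B assume B: "B \<in> Pow S"
    then have "a \<notin> B" using insert(2) by auto
    then show "x ^ card (insert a B) = x * x ^ card B" using fin[OF B] by simp
  qed
  also have "\<dots> = x * (\<Sum>B\<in>Pow S. x ^ card B)" by (rule sum_distrib_left[symmetric])
  finally show ?case using insert by (simp add: algebra_simps)
qed simp

text \<open>Exponential moment bound. After symmetric difference with one member of
  \<open>G\<close>, every set has at most \<open>k\<close> elements, hence weight
  \<open>(1/16) ^ card B\<close> at least \<open>(1/16) ^ k\<close>. The total weight over all
  subsets is \<open>(17/16) ^ card S\<close>, and
  \<open>16 * (17/32) ^ 16 \<le> exp (- 1)\<close>.\<close>

lemma hamming_ball_card:
  assumes S: "finite (S :: 'a set)" "card S = 16 * k"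
    and G: "G \<subseteq> Pow S" "\<And>A B. A \<in> G \<Longrightarrow> B \<in> G \<Longrightarrow> card ((A - B) \<union> (B - A)) \<le> k"
  shows "real (card G) / 2 ^ card S \<le> exp (- real k)"
proof (cases "G = {}")
  case False
  then obtain A0 where A0: "A0 \<in> G" by blast
  define f where "f B = (A0 - B) \<union> (B - A0)" for B
  have ff: "f (f B) = B" for B unfolding f_def by blast
  have inj: "inj_on f G" by (metis inj_onI ff)
  have sub: "f ` G \<subseteq> {B \<in> Pow S. card B \<le> k}" using G A0 unfolding f_def by blast
  have finP: "finite (Pow S)" using S by simp
  have "real (card G) * (1/16) ^ k = (\<Sum>B\<in>f ` G. (1/16) ^ k)" using card_image[OF inj] by simp
  also have "\<dots> \<le> (\<Sum>B\<in>f ` G. (1/16) ^ card B)" using sub by (intro sum_mono power_decreasing) auto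
  also have "\<dots> \<le> (\<Sum>B\<in>Pow S. (1/16) ^ card B)" using sub finP by (intro sum_mono2) auto
  also have "\<dots> = (1 + 1/16) ^ card S" by (rule sum_Pow_power[OF S(1)])
  finally have g: "real (card G) \<le> 16 ^ k * (17/16) ^ card S" by (simp add: power_one_over field_simps)
  have "real (card G) / 2 ^ card S \<le> 16 ^ k * (17/16) ^ card S / 2 ^ card S" by (intro divide_right_mono g) simp
  also have "\<dots> = 16 ^ k * (17/32) ^ card S" by (simp add: power_divide flip: power_mult_distrib)
  also have "\<dots> = (16 * (17/32) ^ 16) ^ k" unfolding S(2) power_mult power_mult_distrib ..
  also have "\<dots> \<le> exp (- 1) ^ k"
  proof (rule power_mono)
    have "16 * (17/32) ^ 16 \<le> (1/3 :: real)" by (simp add: power_divide)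
    also have "1/3 \<le> exp (- 1 :: real)" using exp_le by (simp add: exp_minus divide_simps)
    finally show "16 * (17/32) ^ 16 \<le> exp (- 1 :: real)" .
  qed simp
  also have "\<dots> = exp (- real k)" by (simp add: exp_of_nat_mult[symmetric])
  finally show ?thesis .
qed simp

text \<open>Two stars in the ball have distance at most \<open>2 * r\<close>. By
  \<open>random_star_separated\<close> and \<open>1024 * r^2 \<le> amplitude i\<close> their bits of
  level \<open>i\<close> differ in at most \<open>2 ^ i / 16 = k\<close> places. The factor
  \<open>i + 2\<close> in the hypothesis pays for the weight in the amplitude.\<close>

lemma conditional_ball_bound:
  assumes k: "2 ^ i = 16 * k" and r: "64 * r * 2 ^ i * (real i + 2) \<le> 1" "0 \<le> r"
  shows "emeasure (measure_pmf (bits i)) {A. shape (fun_upd \<omega> i A) \<in> cball x r} \<le> ennreal (exp (- real k))"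
proof -
  define G where "G = Pow {..<2 ^ i} \<inter> {A. shape (fun_upd \<omega> i A) \<in> cball x r}"
  have a: "1024 * r^2 \<le> amplitude i"
  proof -
    define v where "v = 2 ^ i * (real i + 2)"
    have "(64 * r * v)^2 \<le> 1^2" using r by (intro power_mono) (auto simp: v_def mult_ac)
    then have 1: "4096 * r^2 * v^2 \<le> 1" by (simp add: power_mult_distrib)
    have "(4::real) ^ i = 2 ^ i * 2 ^ i" by (simp flip: power_mult_distrib)
    then have am: "amplitude i = 1 / (4 * ((real i + 1) * (real i + 2) * (2 ^ i * 2 ^ i)))" by (simp add: amplitude_def weight_eq)
    have "(real i + 1) * (real i + 2) * (2 ^ i * 2 ^ i) \<le> (real i + 2) * (real i + 2) * (2 ^ i * 2 ^ i)" by (intro mult_right_mono) auto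
    also have "\<dots> = v^2" by (simp add: v_def power2_eq_square)
    finally have v: "4 * ((real i + 1) * (real i + 2) * (2 ^ i * 2 ^ i)) \<le> 4 * v^2" by simp
    have "0 < v" by (simp add: v_def)
    then have "1024 * r^2 \<le> 1 / (4 * v^2)" using 1 by (simp add: field_simps)
    also have "\<dots> \<le> amplitude i" unfolding am by (rule divide_left_mono[OF v]) (use \<open>0 < v\<close> in auto)
    finally show ?thesis .
  qed
  have "real (card G) / 2 ^ card {..<2 ^ i :: nat} \<le> exp (- real k)"
  proof (rule hamming_ball_card)
    show "card {..<2 ^ i :: nat} = 16 * k" using k by simp
    fix A B assume AB: "A \<in> G" "B \<in> G"
    let ?D = "(A - B) \<union> (B - A)"
    have "dist x (shape (fun_upd \<omega> i A)) \<le> r" "dist x (shape (fun_upd \<omega> i B)) \<le> r" using AB unfolding G_def by auto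
    then have d: "dist (shape (fun_upd \<omega> i A)) (shape (fun_upd \<omega> i B)) \<le> 2 * r"
      using dist_triangle3[of "shape (fun_upd \<omega> i A)" "shape (fun_upd \<omega> i B)" x] by linarith
    have "real (card ?D) * (amplitude i / (16 * 2 ^ i)) \<le> (dist (shape (fun_upd \<omega> i A)) (shape (fun_upd \<omega> i B)))^2"
      unfolding shape_def by (rule random_star_separated) (use AB in \<open>auto simp: G_def\<close>)
    also have "\<dots> \<le> (2 * r)^2" using d by (intro power_mono) auto
    also have "\<dots> \<le> amplitude i / 256" using a by (simp add: power_mult_distrib)
    finally have "real (card ?D) * (amplitude i / (16 * 2 ^ i)) \<le> amplitude i / 256" .
    then have "real (card ?D) \<le> 2 ^ i / 16" using amplitude_pos[of i] by (simp add: field_simps)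
    also have "\<dots> = real k" using arg_cong[OF k, of real] by simp
    finally show "card ?D \<le> k" by simp
  qed (auto simp: G_def)
  moreover have "emeasure (measure_pmf (bits i)) {A. shape (fun_upd \<omega> i A) \<in> cball x r} = ennreal (real (card G) / 2 ^ card {..<2 ^ i :: nat})"
  proof -
    have ne: "Pow {..<2 ^ i :: nat} \<noteq> {}" "finite (Pow {..<2 ^ i :: nat})" by auto
    show ?thesis unfolding bits_def emeasure_pmf_of_set[OF ne] G_def by (simp add: card_Pow)
  qed
  ultimately show ?thesis by (simp add: ennreal_leI)
qed

text \<open>Fubini with the coordinate \<open>i\<close> split off: the conditional bound is uniform
  in the bits of all other levels.\<close>

lemma shape_ball_bound:
  assumes k: "2 ^ i = 16 * k" and r: "64 * r * 2 ^ i * (real i + 2) \<le> 1" "0 \<le> r"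
  shows "emeasure bit_space (shape -` cball x r \<inter> space bit_space) \<le> ennreal (exp (- real k))"
proof -
  let ?M = "\<lambda>i. measure_pmf (bits i)"
  let ?N = "PiM (UNIV - {i}) ?M"
  let ?u = "\<lambda>(A, \<omega>). fun_upd \<omega> i A"
  let ?V = "shape -` cball x r \<inter> space bit_space"
  have P: "prob_space (?M j)" for j by (rule measure_pmf.prob_space_axioms)
  interpret N: prob_space ?N by (intro prob_space_PiM P)
  interpret pair_sigma_finite "?M i" ?N ..
  have eq: "distr (?M i \<Otimes>\<^sub>M ?N) bit_space ?u = bit_space"
    using distr_pair_PiM_eq_PiM[of "UNIV - {i}" ?M i] P by (simp add: bit_space_def)
  have u: "?u \<in> measurable (?M i \<Otimes>\<^sub>M ?N) bit_space"
    unfolding bit_space_def case_prod_beta by (rule measurable_fun_upd[where J = "UNIV - {i}"]) auto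
  have V: "?V \<in> sets bit_space" by (rule measurable_sets[OF shape_measurable]) simp
  have W: "?u -` ?V \<inter> space (?M i \<Otimes>\<^sub>M ?N) \<in> sets (?M i \<Otimes>\<^sub>M ?N)" by (rule measurable_sets[OF u V])
  have "emeasure bit_space ?V = emeasure (distr (?M i \<Otimes>\<^sub>M ?N) bit_space ?u) ?V" by (simp add: eq)
  also have "\<dots> = emeasure (?M i \<Otimes>\<^sub>M ?N) (?u -` ?V \<inter> space (?M i \<Otimes>\<^sub>M ?N))" by (rule emeasure_distr[OF u V])
  also have "\<dots> = (\<integral>\<^sup>+\<omega>. emeasure (?M i) ((\<lambda>A. (A, \<omega>)) -` (?u -` ?V \<inter> space (?M i \<Otimes>\<^sub>M ?N))) \<partial>?N)"
    by (rule emeasure_pair_measure_alt2[OF W])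
  also have "\<dots> \<le> (\<integral>\<^sup>+\<omega>. ennreal (exp (- real k)) \<partial>?N)"
  proof (rule nn_integral_mono)
    fix \<omega>
    have "emeasure (?M i) ((\<lambda>A. (A, \<omega>)) -` (?u -` ?V \<inter> space (?M i \<Otimes>\<^sub>M ?N))) \<le> emeasure (?M i) {A. shape (fun_upd \<omega> i A) \<in> cball x r}"
      by (rule emeasure_mono) auto
    also have "\<dots> \<le> ennreal (exp (- real k))" by (rule conditional_ball_bound[OF k r])
    finally show "emeasure (?M i) ((\<lambda>A. (A, \<omega>)) -` (?u -` ?V \<inter> space (?M i \<Otimes>\<^sub>M ?N))) \<le> ennreal (exp (- real k))" .
  qed
  also have "\<dots> = ennreal (exp (- real k))" by (simp add: N.emeasure_space_1)
  finally show ?thesis .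
qed

definition star_measure :: "l2 measure" where
  "star_measure = distr bit_space borel shape"

lemma star_measure_prob: "borel_prob_measure star_measure"
proof -
  interpret prob_space bit_space unfolding bit_space_def by (intro prob_space_PiM measure_pmf.prob_space_axioms)
  show ?thesis unfolding borel_prob_measure_def star_measure_def using prob_space_distr[OF shape_measurable] by simp
qed

text \<open>Measurability of \<open>C\<close> is not asserted; every Borel set containing
  \<open>C\<close> has full preimage under \<open>shape\<close> and thus measure 1.\<close>

lemma star_measure_outer:
  assumes "range shape \<subseteq> C"
  shows "outer_measure_of star_measure C > 0"
proof -
  interpret prob_space bit_space unfolding bit_space_def by (intro prob_space_PiM measure_pmf.prob_space_axioms)
  have "outer_measure_of star_measure C \<ge> 1"
  proof (unfold outer_measure_of_def, rule INF_greatest)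
    fix B assume B: "B \<in> {B \<in> sets star_measure. C \<subseteq> B}"
    then have "shape -` B \<inter> space bit_space = space bit_space" using assms by auto
    moreover have "B \<in> sets borel" using B by (simp add: star_measure_def)
    ultimately have "emeasure star_measure B = emeasure bit_space (space bit_space)"
      unfolding star_measure_def by (simp add: emeasure_distr[OF shape_measurable])
    then show "1 \<le> emeasure star_measure B" by (simp add: emeasure_space_1)
  qed
  moreover have "(0::ennreal) < 1" by simp
  ultimately show ?thesis by (rule less_le_trans[rotated])
qed

text \<open>For the largest admissible level, \<open>2 ^ i\<close> is of order \<open>1 / r\<close>
  up to a factor of order \<open>i\<close>. This factor is absorbed by raising the exponent from 1
  to \<open>1 + \<eta>\<close>, where \<open>(1 + \<eta>) * s = 1\<close>.\<close>

lemma star_measure_ball: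
  assumes s: "0 < s" "s < (1::real)"
  shows "\<exists>c>0. \<exists>r0>0. \<forall>x. \<forall>\<rho>::real. 0 < \<rho> \<and> \<rho> < r0 \<longrightarrow>
     outer_measure_of star_measure (cball x \<rho>) \<le> ennreal (exp (- c * (1 / \<rho>) powr s))"
proof -
  define \<eta> where "\<eta> = (1 - s) / s"
  have \<eta>: "0 < \<eta>" "(1 + \<eta>) * s = 1" using s by (auto simp: \<eta>_def field_simps)
  define C where "C = 3 + 1 / (\<eta> * ln 2)"
  have l: "0 < \<eta> * ln 2" using \<eta> by simp
  have C: "3 \<le> C" using l by (simp add: C_def less_imp_le)
  have grow: "real i + 3 \<le> C * 2 powr (real i * \<eta>)" for i
  proof -
    have "1 + real i * \<eta> * ln 2 \<le> 2 powr (real i * \<eta>)" unfolding powr_def using exp_ge_add_one_self[of "real i * \<eta> * ln 2"] by simp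
    then have "C * (1 + real i * \<eta> * ln 2) \<le> C * 2 powr (real i * \<eta>)" using C by (intro mult_left_mono) auto
    moreover have "C * (1 + real i * \<eta> * ln 2) = C + C * (real i * (\<eta> * ln 2))" by (simp add: algebra_simps)
    moreover have "real i \<le> C * (real i * (\<eta> * ln 2))"
    proof -
      have "1 / (\<eta> * ln 2) * (real i * (\<eta> * ln 2)) \<le> C * (real i * (\<eta> * ln 2))"
        using l by (intro mult_right_mono) (auto simp: C_def)
      moreover have "1 / (\<eta> * ln 2) * (real i * (\<eta> * ln 2)) = real i" using \<eta> by (simp add: field_simps)
      ultimately show ?thesis by linarith
    qed
    ultimately show ?thesis using C by linarith
  qed
  define c where "c = (1 / (128 * C)) powr s / 16"
  have c: "0 < c" using C by (simp add: c_def)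
  show ?thesis
  proof (rule exI[of _ c], intro conjI c, rule exI[of _ "1 / 6144"], intro conjI allI impI)
    fix x :: l2 and r :: real assume r: "0 < r \<and> r < 1 / 6144"
    define ok where "ok i \<longleftrightarrow> 64 * r * 2 ^ i * (real i + 2) \<le> 1" for i :: nat
    \<comment> \<open>\<open>6144 = 64 * 2 ^ 4 * 6\<close> makes level 4 admissible, so that the
      largest admissible \<open>i\<close> is at least 4 and \<open>2 ^ i\<close> is divisible by
      16.\<close>
    have ok4: "ok 4" using r by (simp add: ok_def)
    have bd: "i \<le> nat \<lceil>1 / (64 * r)\<rceil>" if "ok i" for i
    proof -
      have "64 * r * (1 * real i) \<le> 64 * r * (2 ^ i * (real i + 2))" using r by (intro mult_left_mono mult_mono) auto
      then have "64 * r * real i \<le> 1" using that by (simp add: ok_def mult_ac)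
      then have "real i \<le> 1 / (64 * r)" using r by (simp add: field_simps)
      then show ?thesis by linarith
    qed
    obtain i where i: "ok i" "\<And>j. ok j \<Longrightarrow> j \<le> i"
      using Nat.ex_has_greatest_nat[of ok 4, OF ok4] bd by metis
    have i4: "4 \<le> i" using i(2)[OF ok4] .
    define k where "k = (2::nat) ^ (i - 4)"
    have k: "2 ^ i = 16 * k"
    proof -
      have "(2::nat) ^ i = 2 ^ (4 + (i - 4))" using i4 by simp
      also have "\<dots> = 16 * k" unfolding k_def power_add by simp
      finally show ?thesis .
    qed
    have "\<not> ok (i + 1)" using i(2)[of "i + 1"] by auto
    then have "1 < 128 * r * 2 ^ i * (real i + 3)" by (simp add: ok_def algebra_simps)
    also have "\<dots> \<le> 128 * r * 2 ^ i * (C * 2 powr (real i * \<eta>))" using grow[of i] r by (intro mult_left_mono) auto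
    also have "\<dots> = 128 * C * r * 2 powr (real i * (1 + \<eta>))" by (simp add: powr_add powr_realpow distrib_left mult_ac)
    finally have "1 / (128 * C) * (1 / r) \<le> 2 powr (real i * (1 + \<eta>))" using C r by (simp add: field_simps)
    then have "(1 / (128 * C) * (1 / r)) powr s \<le> (2 powr (real i * (1 + \<eta>))) powr s" using s C r by (intro powr_mono2) auto
    also have "\<dots> = 2 powr (real i * ((1 + \<eta>) * s))" by (simp add: powr_powr mult_ac)
    also have "\<dots> = 2 ^ i" unfolding \<eta>(2) by (simp add: powr_realpow)
    also have "(2::real) ^ i = 16 * real k" using arg_cong[OF k, of real] by simp
    also have "(1 / (128 * C) * (1 / r)) powr s = (1 / (128 * C)) powr s * (1 / r) powr s" by (rule powr_mult)
    finally have ck: "c * (1 / r) powr s \<le> real k" by (simp add: c_def)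
    have "outer_measure_of star_measure (cball x r) = emeasure star_measure (cball x r)"
      by (rule outer_measure_of_eq) (simp add: star_measure_def)
    also have "\<dots> = emeasure bit_space (shape -` cball x r \<inter> space bit_space)"
      unfolding star_measure_def by (rule emeasure_distr[OF shape_measurable]) simp
    also have "\<dots> \<le> ennreal (exp (- real k))" using i(1) r unfolding ok_def by (intro shape_ball_bound[OF k]) auto
    also have "\<dots> \<le> ennreal (exp (- c * (1 / r) powr s))" using ck by (intro ennreal_leI) simp
    finally show "outer_measure_of star_measure (cball x r) \<le> ennreal (exp (- c * (1 / r) powr s))" .
  qed simp
qed

theorem proposition1p20:
  fixes \<nu> \<rho>\<^sub>0 \<rho>\<^sub>1 :: real and C :: "l2 set"
  assumes "\<nu> \<ge> 1"
    and "0 < \<rho>\<^sub>0" and "\<rho>\<^sub>0 \<le> 1/4" and "1/2 \<le> \<rho>\<^sub>1" and "\<rho>\<^sub>1 < 1"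
    and C_eq: "C = star_indicators \<nu> \<rho>\<^sub>0 \<rho>\<^sub>1"
  shows
    "has_pe_dim C 1 \<and>
     (\<exists>\<mu>. borel_prob_measure \<mu> \<and> critical_measure \<mu> C) \<and>
     (\<exists>\<phi> \<psi> (\<delta>::real) g P.
        square_integrable \<phi> \<and> square_integrable \<psi> \<and> \<delta> > 0 \<and>
        bij_betw g {1..} (shearlet_system \<phi> \<psi> \<delta>) \<and>
        optimal_controlled (nonlinear_approx g P) C \<and>
        (\<forall>t::real. 0 \<le> t \<and> t < 1 \<longrightarrow>
           (\<exists>K>0. \<forall>n\<ge>1. \<forall>f\<in>C. infdist f (nonlinear_approx g P n) \<le> K * real n powr - t))) \<and>
     (\<forall>\<mu> B. borel_prob_measure \<mu> \<longrightarrow> critical_measure \<mu> C \<longrightarrow> controlled_complexity B \<longrightarrow>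
        outer_measure_of \<mu>
          (\<Union>t\<in>{1<..}. {f\<in>C. bdd_above ((\<lambda>n. real n powr t * infdist f (B n)) ` {1..})}) = 0)"
proof -
  have par: "1 \<le> \<nu>" "0 < \<rho>\<^sub>0" "\<rho>\<^sub>1 < 1" using assms by auto
  have bd: "norm f \<le> 1" if "f \<in> C" for f using that norm_star_indicator unfolding C_eq by blast
  obtain g P where g: "bij_betw g {1..} (shearlet_system gen_wave gen_wave 1)"
    and rate: "\<forall>t. 0 \<le> t \<and> t < 1 \<longrightarrow> (\<exists>K>0. \<forall>n\<ge>1. \<forall>f\<in>C. infdist f (nonlinear_approx g P n) \<le> K * real n powr - t)"
    using nonlinear_rate[OF par] unfolding C_eq by (elim exE conjE)
  have ctl: "controlled_complexity (nonlinear_approx g P)" by (rule controlled_complexity_nonlinear)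
  have shapes: "range shape \<subseteq> C"
    unfolding C_eq star_indicators_def shape_def using random_star_STAR[of \<nu> \<rho>\<^sub>0 \<rho>\<^sub>1] assms by blast
  have ent: "\<exists>B>0. \<exists>e>0. \<forall>\<epsilon>. 0 < \<epsilon> \<and> \<epsilon> < e \<longrightarrow> (\<exists>k. covered C \<epsilon> k \<and> real k \<le> exp (B * (1 / \<epsilon>) powr (1 + d)))"
    if "0 < d" for d
    by (rule entropy_upper[OF ctl bd rate[rule_format] that])
  have tb: "totally_bounded C" by (rule upper_pe_dim_le_1(1)[OF ent])
  have up: "upper_pe_dim C \<le> 1" by (rule upper_pe_dim_le_1(2)[OF ent])
  have cov: "\<exists>e>0. \<forall>\<epsilon>. 0 < \<epsilon> \<and> \<epsilon> < e \<longrightarrow> (\<exists>k. covered C \<epsilon> k)"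
    using ent[of 1] by (meson zero_less_one)
  have low: "1 \<le> lower_pe_dim C"
    by (rule lower_pe_dim_ge_1[OF star_measure_prob star_measure_outer[OF shapes] star_measure_ball cov])
  have "lower_pe_dim C \<le> upper_pe_dim C"
    unfolding lower_pe_dim_def upper_pe_dim_def using tb by (simp add: Liminf_le_Limsup)
  then have dim: "lower_pe_dim C = 1" "upper_pe_dim C = 1" using up low by auto
  \<comment> \<open>Criticality refers to the dimension. The ball estimate for all
    \<open>s < 1\<close> was used to find the dimension and, now that it is 1, is exactly the
    estimate that criticality demands.\<close>
  have crit: "critical_measure star_measure C"
    unfolding critical_measure_def dim using star_measure_outer[OF shapes] star_measure_ball by auto
  have sq: "square_integrable gen_wave"
    using elem_l2[of 1 0 0 "(0, 0)"] by (simp add: gen_wave_def[abs_def] elem_def)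
  have opt: "optimal_controlled (nonlinear_approx g P) C"
    unfolding optimal_controlled_def dim
  proof (intro conjI ctl allI impI)
    show "bounded C" using bd by (auto simp: bounded_iff)
    show "C \<noteq> {}" using shapes by blast
    fix t :: real assume "0 \<le> t \<and> ereal t < inverse 1"
    then have "0 \<le> t \<and> t < 1" by (simp add: one_ereal_def)
    then show "\<exists>K>0. \<forall>n\<ge>1. \<forall>x\<in>C. infdist x (nonlinear_approx g P n) \<le> K * real n powr - t" using rate by blast
  qed
  have conv: "outer_measure_of \<mu> (\<Union>t\<in>{1<..}. {f\<in>C. bdd_above ((\<lambda>n. real n powr t * infdist f (B n)) ` {1..})}) = 0"
    if "borel_prob_measure \<mu>" "critical_measure \<mu> C" "controlled_complexity B" for \<mu> B
  proof (rule fast_approximation_union_null[OF that(1) _ bd that(3)])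
    fix s :: real assume "0 < s" "s < 1"
    then show "\<exists>c>0. \<exists>r0>0. \<forall>x. \<forall>\<rho>::real. 0 < \<rho> \<and> \<rho> < r0 \<longrightarrow>
        outer_measure_of \<mu> (cball x \<rho>) \<le> ennreal (exp (- c * (1 / \<rho>) powr s))"
      using that(2) unfolding critical_measure_def dim by (simp add: one_ereal_def)
  qed
  show ?thesis
  proof (intro conjI)
    show "has_pe_dim C 1" unfolding has_pe_dim_def using dim by simp
    show "\<exists>\<mu>. borel_prob_measure \<mu> \<and> critical_measure \<mu> C" using star_measure_prob crit by blast
    show "\<exists>\<phi> \<psi> (\<delta>::real) g P. square_integrable \<phi> \<and> square_integrable \<psi> \<and> \<delta> > 0 \<and>
        bij_betw g {1..} (shearlet_system \<phi> \<psi> \<delta>) \<and> optimal_controlled (nonlinear_approx g P) C \<and>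
        (\<forall>t::real. 0 \<le> t \<and> t < 1 \<longrightarrow>
           (\<exists>K>0. \<forall>n\<ge>1. \<forall>f\<in>C. infdist f (nonlinear_approx g P n) \<le> K * real n powr - t))"
      by (rule exI[of _ gen_wave], rule exI[of _ gen_wave], rule exI[of _ 1], rule exI[of _ g], rule exI[of _ P])
         (intro conjI sq g opt rate zero_less_one)
  qed (use conv in blast)
qed

end
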